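(* Let $\mathfrak B_\times$ be a scaled bounded geometry structure on $M$ with operator Lie algebra $\mathcal V$ and scaling weight $\rho$. Let $m\in\mathbb N_0$ and $P\in\mathrm{Diff}_{\mathcal V}^m(M)$. For $\alpha\in\mathscr A$ write $(\phi_\alpha)_*P=\sum_{|\gamma|\le m}p_{\alpha\gamma}(x)(\rho_\alpha D)^\gamma$, set $p_\alpha(x,\xi)=\sum_{|\gamma|\le m}p_{\alpha\gamma}(x)\xi^\gamma$, and put $p=\sum_\alpha\chi_\alpha\phi_\alpha^*p_\alpha\in\mathcal C^\infty({}^{\mathcal V}T^*M)$, where for a fixed nonnegative $\chi\in\mathcal C^\infty_c((-2,2)^n)$ equal to $1$ on $[-1,1]^n$ we set $\chi_\alpha=\phi_\alpha^*\chi/\sum_\beta\phi_\beta^*\chi$. Then the equivalence class $$\sigma_{\mathcal V}^m(P):=[p]\in P^m({}^{\mathcal V}T^*M)/\rho P^{m-1}({}^{\mathcal V}T^*M)$$ is well-defined, in the sense that it does not depend on the choice of $\chi$, and it does not change when computed with respect to a compatible scaled bounded geometry structure. It fits into the short exact sequence $$0\to\rho\,\mathrm{Diff}_{\mathcal V}^{m-1}(M)\hookrightarrow\mathrm{Diff}_{\mathcal V}^m(M)\xrightarrow{\sigma_{\mathcal V}^m}P^m({}^{\mathcal V}T^*M)/\rho P^{m-1}({}^{\mathcal V}T^*M)\to0.$$ Furthermore, for a weight $w$ on $M$ and $P\in w\,\mathrm{Diff}_{\mathcal V}^m(M)$, the principal symbol $\sigma_{\mathcal V}^{m,w}(P):=w\,\sigma_{\mathcal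 V}^m(w^{-1}P)\in wP^m({}^{\mathcal V}T^*M)/w\rho P^{m-1}({}^{\mathcal V}T^*M)$ is well-defined (it does not change when an equivalent weight is used instead of $w$) and fits into the analogous short exact sequence. Finally, for weights $w_1,w_2$ and $P_j\in w_j\mathrm{Diff}_{\mathcal V}^{m_j}(M)$, $j=1,2$, we have $i[P_1,P_2]\in w_1w_2\rho\,\mathrm{Diff}_{\mathcal V}^{m_1+m_2-1}(M)$, with principal symbol given by the Poisson bracket $$\sigma_{\mathcal V}^{m_1+m_2-1,w_1w_2\rho}(i[P_1,P_2])=\{\sigma_{\mathcal V}^{m_1,w_1}(P_1),\sigma_{\mathcal V}^{m_2,w_2}(P_2)\}.$$
   Context: **B.g. structures.** A bounded geometry (b.g.) structure on a smooth $n$-manifold $M$ (without boundary) is a family $\mathfrak B=\{(U_\alpha,\phi_\alpha):\alpha\in\mathscr A\}$, $\mathscr A$ countable, $U_\alpha\subset M$ open, $\phi_\alpha\colon U_\alpha\to(-2,2)^n$ a diffeomorphism, such that (i) there is $A_0\in\mathbb N$ so that any $A_0+1$ of the $U_\alpha$ with pairwise distinct indices have empty intersection; (ii) $M=\bigcup_\alpha\phi_\alpha^{-1}((-1,1)^n)$; (iii) the transition functions $\tau_{\beta\alpha}=\phi_\beta\circ\phi_\alpha^{-1}\colon\phi_\alpha(U_\alpha\cap U_\beta)\to\phi_\beta(U_\alpha\cap U_\beta)$ have, for each $k$, $\mathcal C^k$-norms bounded uniformly in $\alpha,\beta$. $\mathcal C^\infty_{\rm uni}(M)$ is the space of smooth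 $f$ with $\mathcal C^k((-2,2)^n)$-norms of $f\circ\phi_\alpha^{-1}$ bounded uniformly in $\alpha$ for each $k$; $\mathcal C^\infty_{\rm uni}(M;TM)$ is defined likewise via the coefficients of $(\phi_\alpha)_*V$. **Scaled b.g. structures.** A scaled b.g. structure is $\mathfrak B_\times=\{(U_\alpha,\phi_\alpha,\rho_\alpha)\}$ where $\{(U_\alpha,\phi_\alpha)\}$ is a b.g. structure, $\rho_\alpha\in(0,1]^n$, and for each $\gamma\in\mathbb N_0^n$ there is $C_\gamma$ with $|\partial^\gamma(\rho_{\alpha,i}\partial_i\tau_{\beta\alpha}^j)|\le C_\gamma\rho_{\beta,j}$ on $\phi_\alpha(U_\alpha\cap U_\beta)$ for all $\alpha,\beta,i,j$. $\mathcal W=\mathcal C^\infty_{\rm uni}(M;TM)$. Operator Lie algebra $\mathcal V$: vector fields $V$ with $(\phi_\alpha)_*V=\sum_iV_\alpha^i\rho_{\alpha,i}\partial_i$, $V_\alpha^i$ bounded with all derivatives, uniformly in $\alpha$. **Compatibility.** Let $U'_\alpha=\phi_\alpha^{-1}((-\frac32,\frac32)^n)$. Two scaled b.g. structures $\{(U_\alpha,\phi_\alpha,\rho_\alpha)\}$, $\{(\tilde U_{\tilde\alpha},\tilde\phi_{\tilde\alpha},\tilde\rho_{\tilde\alpha})\}$ are compatible if the maps $\tau_{\alpha\tilde\alpha}=\phi_\alpha\circ\tilde\phi_{\tilde\alpha}^{-1}$ on $\tilde\phi_{\tilde\alpha}(U'_\alpha\cap\tilde U'_{\tilde\alpha})$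 and $\tau_{\tilde\alpha\alpha}=\tilde\phi_{\tilde\alpha}\circ\phi_\alpha^{-1}$ on $\phi_\alpha(U'_\alpha\cap\tilde U'_{\tilde\alpha})$ are bounded with all derivatives uniformly in $\alpha,\tilde\alpha$, and there satisfy $|\partial^\gamma\tilde\rho_{\tilde\alpha,i}\partial_i\tau^j_{\alpha\tilde\alpha}|\le C_\gamma\rho_{\alpha,j}$, $|\partial^\gamma\rho_{\alpha,i}\partial_i\tau^j_{\tilde\alpha\alpha}|\le C_\gamma\tilde\rho_{\tilde\alpha,j}$ for all $i,j,\gamma$. **Weights.** A weight on $M$ is $0<w\in\mathcal C^\infty(M)$ with $(Ww)/w\in\mathcal C^\infty_{\rm uni}(M)$ for all $W\in\mathcal W$; weights $w,w'$ are equivalent if $w/w',w'/w\in\mathcal C^\infty_{\rm uni}(M)$. A scaling weight $\rho$ is a weight with $C^{-1}\bar\rho_\alpha\le\rho\le C\bar\rho_\alpha$ on $U'_\alpha$ for all $\alpha$, where $\bar\rho_\alpha=\max_i\rho_{\alpha,i}$. **Symbols.** ${}^{\mathcal V}T^*M$ is $T^*M$ with fibre coordinates $\xi\in\mathbb R^n$ over $U_\alpha$ corresponding to the covector $\sum_i\xi_i\,dx^i/\rho_{\alpha,i}$, $x^i=\phi_\alpha^i$; $(\phi_\alpha)_*a$ denotes $a$ in the coordinates $(x,\xi)\in(-2,2)^n\times\mathbb R^n$, and $\phi_\alpha^*$ the inverse operation. $S^m({}^{\mathcal V}T^*M)$: smooth $a$ with $|\partial_x^\beta\partial_\xi^\gamma(\phi_\alpha)_*a|\le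 C_{\beta\gamma}\langle\xi\rangle^{m-|\gamma|}$ uniformly in $\alpha$. $P^m\subset S^m$: fibrewise polynomials of degree $\le m$ ($P^{-1}=0$); $wP^m=\{wa\}$. Poisson bracket in coordinates over $U_\alpha$: $\{p_1,p_2\}=\sum_i(\partial_{\xi_i}p_1\,\rho_{\alpha,i}\partial_{x^i}p_2-\rho_{\alpha,i}\partial_{x^i}p_1\,\partial_{\xi_i}p_2)$. **Differential operators.** $\mathrm{Diff}^m_{\mathcal V}(M)$: finite sums of at most $m$-fold compositions of elements of $\mathcal V$ (0-fold: multiplication by elements of $\mathcal C^\infty_{\rm uni}(M)$; complex coefficients allowed); equivalently, $m$-th order differential operators $P$ with $(\phi_\alpha)_*P=\sum_{|\gamma|\le m}p_{\alpha\gamma}(x)(\rho_\alpha D)^\gamma$, $(\rho_\alpha D)^\gamma=\prod_j(\rho_{\alpha,j}i^{-1}\partial_j)^{\gamma_j}$, with $p_{\alpha\gamma}$ bounded with all derivatives uniformly in $\alpha$. $\mathrm{Diff}^{-1}_{\mathcal V}=0$, $w\mathrm{Diff}^m_{\mathcal V}(M)=\{wP:P\in\mathrm{Diff}^m_{\mathcal V}(M)\}$. *)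

theory Defs
  imports
    "HOL-Analysis.Analysis"
    "HOL-Algebra.Elementary_Groups"
    "HOL-Library.Function_Algebras"
begin

section \<open>Smooth functions and partial derivatives on Euclidean space\<close>

fun iter_deriv ::
  "'e list \<Rightarrow> ('e::real_normed_vector \<Rightarrow> 'b::real_normed_vector) \<Rightarrow> 'e \<Rightarrow> 'b" where
  "iter_deriv [] f = f"
| "iter_deriv (v # vs) f = (\<lambda>x. frechet_derivative (iter_deriv vs f) (at x) v)"

text \<open>Only used for open \<open>S\<close>; then only the values of \<open>f\<close> on \<open>S\<close> matter.\<close>

definition smooth_on ::
  "'e::real_normed_vector set \<Rightarrow> ('e \<Rightarrow> 'b::real_normed_vector) \<Rightarrow> bool" where
  "smooth_on S f \<longleftrightarrow> (\<forall>vs. \<forall>x\<in>S. iter_deriv vs f differentiable (at x))"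

definition pd ::
  "'n::finite \<Rightarrow> (real^'n \<Rightarrow> 'b::real_normed_vector) \<Rightarrow> real^'n \<Rightarrow> 'b" where
  "pd i f x = frechet_derivative f (at x) (axis i 1)"

text \<open>
  Multi-indices are functions \<open>'n \<Rightarrow> nat\<close>. The mixed partial derivative is taken in the order of
  some fixed enumeration of the index type; for smooth functions the order is immaterial.
\<close>

definition index_list :: "'n::finite list" where
  "index_list = (SOME is. distinct is \<and> set is = UNIV)"

definition mpd ::
  "('n::finite \<Rightarrow> nat) \<Rightarrow> (real^'n \<Rightarrow> 'b::real_normed_vector) \<Rightarrow> real^'n \<Rightarrow> 'b" where
  "mpd \<gamma> f = iter_deriv (concat (map (\<lambda>i. replicate (\<gamma> i) (axis i 1)) index_list)) f"

definition mlen :: "('n::finite \<Rightarrow> nat) \<Rightarrow> nat" where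
  "mlen \<gamma> = (\<Sum>i\<in>UNIV. \<gamma> i)"

definition mmonom :: "('n::finite \<Rightarrow> nat) \<Rightarrow> real^'n \<Rightarrow> complex" where
  "mmonom \<gamma> \<xi> = (\<Prod>i\<in>UNIV. complex_of_real (\<xi> $ i) ^ \<gamma> i)"

text \<open>The cube \<open>(-r,r)\<^sup>n\<close>.\<close>

definition cube :: "real \<Rightarrow> (real^'n::finite) set" where
  "cube r = {x. \<forall>i. \<bar>x $ i\<bar> < r}"

definition unif_bounded_derivs ::
  "'k set \<Rightarrow> ('k \<Rightarrow> (real^'n::finite) set) \<Rightarrow> ('k \<Rightarrow> real^'n \<Rightarrow> 'b::real_normed_vector) \<Rightarrow> bool" where
  "unif_bounded_derivs I D f \<longleftrightarrow>
     (\<forall>k. \<exists>C. \<forall>i\<in>I. \<forall>x\<in>D i. \<forall>\<gamma>. mlen \<gamma> \<le> k \<longrightarrow> norm (mpd \<gamma> (f i) x) \<le> C)"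


section \<open>Smooth manifolds\<close>

text \<open>
  The manifold is a Hausdorff, second countable type with a smooth atlas \<open>M\<close> that covers it. The
  atlas need not be maximal.
\<close>

type_synonym ('a, 'n) atlas = "('a set \<times> ('a \<Rightarrow> real^'n)) set"

definition smooth_atlas :: "('a::topological_space, 'n::finite) atlas \<Rightarrow> bool" where
  "smooth_atlas M \<longleftrightarrow>
     (\<Union>(U, \<psi>)\<in>M. U) = UNIV \<and>
     (\<forall>(U, \<psi>)\<in>M. open U \<and> open (\<psi> ` U) \<and> homeomorphism U (\<psi> ` U) \<psi> (inv_into U \<psi>)) \<and>
     (\<forall>(U, \<psi>)\<in>M. \<forall>(V, \<theta>)\<in>M. smooth_on (\<psi> ` (U \<inter> V)) (\<theta> \<circ> inv_into U \<psi>))"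

definition smooth_fun :: "('a, 'n::finite) atlas \<Rightarrow> ('a \<Rightarrow> 'b::real_normed_vector) \<Rightarrow> bool" where
  "smooth_fun M f \<longleftrightarrow> (\<forall>(U, \<psi>)\<in>M. smooth_on (\<psi> ` U) (f \<circ> inv_into U \<psi>))"

definition diffeo_onto ::
  "('a::topological_space, 'n::finite) atlas \<Rightarrow> 'a set \<Rightarrow> ('a \<Rightarrow> real^'n) \<Rightarrow> (real^'n) set \<Rightarrow> bool" where
  "diffeo_onto M U \<phi> S \<longleftrightarrow>
     homeomorphism U S \<phi> (inv_into U \<phi>) \<and>
     (\<forall>(V, \<psi>)\<in>M. smooth_on (\<psi> ` (U \<inter> V)) (\<phi> \<circ> inv_into V \<psi>) \<and>
                   smooth_on (\<phi> ` (U \<inter> V)) (\<psi> \<circ> inv_into U \<phi>))"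


section \<open>Bounded geometry structures\<close>

record ('i, 'a, 'n) bg_data =
  indices :: "'i set"
  nbhd :: "'i \<Rightarrow> 'a set"
  coord :: "'i \<Rightarrow> 'a \<Rightarrow> real^'n::finite"

record ('i, 'a, 'n) scaled_bg_data = "('i, 'a, 'n::finite) bg_data" +
  scl :: "'i \<Rightarrow> real^'n::finite"

text \<open>\<open>param B \<alpha>\<close> is \<open>\<phi>\<^sub>\<alpha>\<close> inverse, and \<open>transition B B' \<alpha> \<beta>\<close> is
  \<open>\<phi>'\<^sub>\<beta>\<close> after \<open>\<phi>\<^sub>\<alpha>\<close> inverse.\<close>

definition param :: "('i, 'a, 'n::finite, 'z) bg_data_scheme \<Rightarrow> 'i \<Rightarrow> real^'n \<Rightarrow> 'a" where
  "param B \<alpha> = inv_into (nbhd B \<alpha>) (coord B \<alpha>)"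

definition transition ::
  "('i, 'a, 'n::finite, 'y) bg_data_scheme \<Rightarrow> ('j, 'a, 'n, 'z) bg_data_scheme \<Rightarrow>
   'i \<Rightarrow> 'j \<Rightarrow> real^'n \<Rightarrow> real^'n" where
  "transition B B' \<alpha> \<beta> = coord B' \<beta> \<circ> param B \<alpha>"

text \<open>\<open>inner B \<alpha>\<close> is \<open>U'\<^sub>\<alpha>\<close>.\<close>

definition inner :: "('i, 'a, 'n::finite, 'z) bg_data_scheme \<Rightarrow> 'i \<Rightarrow> 'a set" where
  "inner B \<alpha> = {q \<in> nbhd B \<alpha>. coord B \<alpha> q \<in> cube (3/2)}"

definition bg_structure ::
  "('a::topological_space, 'n::finite) atlas \<Rightarrow> ('i, 'a, 'n, 'z) bg_data_scheme \<Rightarrow> bool" where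
  "bg_structure M B \<longleftrightarrow>
     countable (indices B) \<and>
     (\<forall>\<alpha>\<in>indices B. open (nbhd B \<alpha>) \<and> diffeo_onto M (nbhd B \<alpha>) (coord B \<alpha>) (cube 2)) \<and>
     (\<exists>A0::nat. \<forall>J\<subseteq>indices B. finite J \<and> card J = A0 + 1 \<longrightarrow> (\<Inter>\<alpha>\<in>J. nbhd B \<alpha>) = {}) \<and>
     (\<Union>\<alpha>\<in>indices B. {q \<in> nbhd B \<alpha>. coord B \<alpha> q \<in> cube 1}) = UNIV \<and>
     unif_bounded_derivs (indices B \<times> indices B)
       (\<lambda>(\<alpha>, \<beta>). coord B \<alpha> ` (nbhd B \<alpha> \<inter> nbhd B \<beta>)) (\<lambda>(\<alpha>, \<beta>). transition B B \<alpha> \<beta>)"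

text \<open>\<open>C\<^sup>\<infinity>\<^sub>u\<^sub>n\<^sub>i(M)\<close>\<close>

definition C_uni ::
  "('a, 'n::finite) atlas \<Rightarrow> ('i, 'a, 'n, 'z) bg_data_scheme \<Rightarrow> ('a \<Rightarrow> 'b::real_normed_vector) set" where
  "C_uni M B = {f. smooth_fun M f \<and>
     unif_bounded_derivs (indices B) (\<lambda>_. cube 2) (\<lambda>\<alpha>. f \<circ> param B \<alpha>)}"

text \<open>
  \<open>scale_bounds B B' D\<close>: for each \<open>\<gamma>\<close> there is \<open>C\<^sub>\<gamma>\<close> with
  \<open>\<bar>\<partial>\<^sup>\<gamma>(\<rho>\<^sub>\<alpha>\<^sub>,\<^sub>i \<partial>\<^sub>i \<tau>\<^sup>j)\<bar> \<le> C\<^sub>\<gamma> \<rho>'\<^sub>\<beta>\<^sub>,\<^sub>j\<close> on \<open>\<phi>\<^sub>\<alpha>(D \<alpha> \<beta>)\<close>,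
  where \<open>\<tau>\<close> is the transition from chart \<open>\<alpha>\<close> of \<open>B\<close> to chart \<open>\<beta>\<close> of \<open>B'\<close>.
\<close>

definition scale_bounds ::
  "('i, 'a, 'n::finite) scaled_bg_data \<Rightarrow> ('j, 'a, 'n) scaled_bg_data \<Rightarrow> ('i \<Rightarrow> 'j \<Rightarrow> 'a set) \<Rightarrow> bool" where
  "scale_bounds B B' D \<longleftrightarrow>
     (\<forall>\<gamma>. \<exists>C. \<forall>\<alpha>\<in>indices B. \<forall>\<beta>\<in>indices B'. \<forall>x\<in>coord B \<alpha> ` D \<alpha> \<beta>. \<forall>i j.
        \<bar>mpd \<gamma> (\<lambda>y. scl B \<alpha> $ i * pd i (\<lambda>z. transition B B' \<alpha> \<beta> z $ j) y) x\<bar> \<le> C * scl B' \<beta> $ j)"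

definition scaled_bg_structure ::
  "('a::topological_space, 'n::finite) atlas \<Rightarrow> ('i, 'a, 'n) scaled_bg_data \<Rightarrow> bool" where
  "scaled_bg_structure M B \<longleftrightarrow>
     bg_structure M B \<and>
     (\<forall>\<alpha>\<in>indices B. \<forall>i. 0 < scl B \<alpha> $ i \<and> scl B \<alpha> $ i \<le> 1) \<and>
     scale_bounds B B (\<lambda>\<alpha> \<beta>. nbhd B \<alpha> \<inter> nbhd B \<beta>)"

definition compatible ::
  "('i, 'a, 'n::finite) scaled_bg_data \<Rightarrow> ('j, 'a, 'n) scaled_bg_data \<Rightarrow> bool" where
  "compatible B B' \<longleftrightarrow>
     unif_bounded_derivs (indices B' \<times> indices B)
       (\<lambda>(\<beta>, \<alpha>). coord B' \<beta> ` (inner B \<alpha> \<inter> inner B' \<beta>)) (\<lambda>(\<beta>, \<alpha>). transition B' B \<beta> \<alpha>) \<and>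
     unif_bounded_derivs (indices B \<times> indices B')
       (\<lambda>(\<alpha>, \<beta>). coord B \<alpha> ` (inner B \<alpha> \<inter> inner B' \<beta>)) (\<lambda>(\<alpha>, \<beta>). transition B B' \<alpha> \<beta>) \<and>
     scale_bounds B' B (\<lambda>\<beta> \<alpha>. inner B \<alpha> \<inter> inner B' \<beta>) \<and>
     scale_bounds B B' (\<lambda>\<alpha> \<beta>. inner B \<alpha> \<inter> inner B' \<beta>)"


section \<open>Vector fields and differential operators\<close>

text \<open>
  Operators act on \<open>C\<^sup>\<infinity>(M; \<complex>)\<close>. As all functions of type \<open>'a \<Rightarrow> complex\<close> are possible arguments,
  operators are required to return \<open>0\<close> on non-smooth arguments, so that equality of operators
  is equality on smooth functions. A real vector field is identified with the derivation it
  defines on \<open>C\<^sup>\<infinity>(M; \<complex>)\<close>; \<open>bg_vector_fields M B r\<close> consists of those \<open>V\<close> with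
  \<open>(\<phi>\<^sub>\<alpha>)\<^sub>* V = \<Sum>\<^sub>i v\<^sub>\<alpha>\<^sup>i r\<^sub>\<alpha>\<^sub>,\<^sub>i \<partial>\<^sub>i\<close> and \<open>v\<^sub>\<alpha>\<close> bounded with all derivatives,
  uniformly in \<open>\<alpha>\<close>.
\<close>

type_synonym 'a operator = "('a \<Rightarrow> complex) \<Rightarrow> 'a \<Rightarrow> complex"

definition bg_vector_fields ::
  "('a, 'n::finite) atlas \<Rightarrow> ('i, 'a, 'n, 'z) bg_data_scheme \<Rightarrow> ('i \<Rightarrow> real^'n) \<Rightarrow> 'a operator set" where
  "bg_vector_fields M B r = {V.
     (\<forall>u. \<not> smooth_fun M u \<longrightarrow> V u = (\<lambda>q. 0)) \<and>
     (\<exists>v :: 'i \<Rightarrow> real^'n \<Rightarrow> real^'n.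
        (\<forall>\<alpha>\<in>indices B. smooth_on (cube 2) (v \<alpha>)) \<and>
        unif_bounded_derivs (indices B) (\<lambda>_. cube 2) v \<and>
        (\<forall>u. smooth_fun M u \<longrightarrow> (\<forall>\<alpha>\<in>indices B. \<forall>x\<in>cube 2.
           V u (param B \<alpha> x) =
             (\<Sum>i\<in>UNIV. complex_of_real (v \<alpha> x $ i * r \<alpha> $ i) * pd i (u \<circ> param B \<alpha>) x))))}"

definition uni_vector_fields ::
  "('a, 'n::finite) atlas \<Rightarrow> ('i, 'a, 'n, 'z) bg_data_scheme \<Rightarrow> 'a operator set" where
  "uni_vector_fields M B = bg_vector_fields M B (\<lambda>_. \<chi> i. 1)"

definition op_lie_algebra ::
  "('a, 'n::finite) atlas \<Rightarrow> ('i, 'a, 'n) scaled_bg_data \<Rightarrow> 'a operator set" where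
  "op_lie_algebra M B = bg_vector_fields M B (scl B)"

definition smooth_id :: "('a, 'n::finite) atlas \<Rightarrow> 'a operator" where
  "smooth_id M u = (if smooth_fun M u then u else (\<lambda>q. 0))"

text \<open>
  Finite sums of compositions of at most \<open>m\<close> elements of the operator Lie algebra; complex
  coefficients are accommodated by a complex-valued factor in \<open>C\<^sup>\<infinity>\<^sub>u\<^sub>n\<^sub>i(M)\<close> in front of each
  composition, which for the empty composition gives the multiplication operators. For negative
  \<open>m\<close> only the zero operator remains.
\<close>

inductive_set Diff ::
  "('a, 'n::finite) atlas \<Rightarrow> ('i, 'a, 'n) scaled_bg_data \<Rightarrow> int \<Rightarrow> 'a operator set"
  for M :: "('a, 'n::finite) atlas" and B :: "('i, 'a, 'n) scaled_bg_data" and m :: int where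
  zero: "(\<lambda>u q. 0) \<in> Diff M B m"
| comp: "f \<in> C_uni M B \<Longrightarrow> set Vs \<subseteq> op_lie_algebra M B \<Longrightarrow> int (length Vs) \<le> m \<Longrightarrow>
    (\<lambda>u q. f q * foldr (\<circ>) Vs (smooth_id M) u q) \<in> Diff M B m"
| add: "P \<in> Diff M B m \<Longrightarrow> Q \<in> Diff M B m \<Longrightarrow> (\<lambda>u q. P u q + Q u q) \<in> Diff M B m"

definition wDiff ::
  "('a, 'n::finite) atlas \<Rightarrow> ('i, 'a, 'n) scaled_bg_data \<Rightarrow> ('a \<Rightarrow> real) \<Rightarrow> int \<Rightarrow> 'a operator set" where
  "wDiff M B w m = (\<lambda>P u q. complex_of_real (w q) * P u q) ` Diff M B m"

text \<open>The operator \<open>i[P,Q]\<close>.\<close>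

definition i_commutator :: "'a operator \<Rightarrow> 'a operator \<Rightarrow> 'a operator" where
  "i_commutator P Q = (\<lambda>u q. \<i> * (P (Q u) q - Q (P u) q))"


section \<open>Weights\<close>

definition weight ::
  "('a, 'n::finite) atlas \<Rightarrow> ('i, 'a, 'n, 'z) bg_data_scheme \<Rightarrow> ('a \<Rightarrow> real) \<Rightarrow> bool" where
  "weight M B w \<longleftrightarrow>
     (\<forall>q. 0 < w q) \<and> smooth_fun M w \<and>
     (\<forall>W\<in>uni_vector_fields M B.
        (\<lambda>q. W (\<lambda>q'. complex_of_real (w q')) q / complex_of_real (w q)) \<in> C_uni M B)"

definition equivalent_weights ::
  "('a, 'n::finite) atlas \<Rightarrow> ('i, 'a, 'n, 'z) bg_data_scheme \<Rightarrow> ('a \<Rightarrow> real) \<Rightarrow> ('a \<Rightarrow> real) \<Rightarrow> bool" where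
  "equivalent_weights M B w w' \<longleftrightarrow>
     (\<lambda>q. w q / w' q) \<in> C_uni M B \<and> (\<lambda>q. w' q / w q) \<in> C_uni M B"

definition scaling_weight ::
  "('a, 'n::finite) atlas \<Rightarrow> ('i, 'a, 'n) scaled_bg_data \<Rightarrow> ('a \<Rightarrow> real) \<Rightarrow> bool" where
  "scaling_weight M B \<rho> \<longleftrightarrow>
     weight M B \<rho> \<and>
     (\<exists>C>0. \<forall>\<alpha>\<in>indices B. \<forall>q\<in>inner B \<alpha>.
        Max (range (\<lambda>i. scl B \<alpha> $ i)) / C \<le> \<rho> q \<and> \<rho> q \<le> C * Max (range (\<lambda>i. scl B \<alpha> $ i)))"


section \<open>The cotangent bundle and symbols\<close>

text \<open>
  A covector at \<open>q\<close> is the differential at \<open>q\<close> of a smooth real function, represented by the set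
  of all smooth functions with the same differential at \<open>q\<close>.
\<close>

definition differential :: "('a, 'n::finite) atlas \<Rightarrow> 'a \<Rightarrow> ('a \<Rightarrow> real) \<Rightarrow> ('a \<Rightarrow> real) set" where
  "differential M q f = {g. smooth_fun M g \<and>
     (\<forall>(U, \<psi>)\<in>M. q \<in> U \<longrightarrow>
        (\<forall>i. pd i (g \<circ> inv_into U \<psi>) (\<psi> q) = pd i (f \<circ> inv_into U \<psi>) (\<psi> q)))}"

definition cotangent_bundle :: "('a, 'n::finite) atlas \<Rightarrow> ('a \<times> ('a \<Rightarrow> real) set) set" where
  "cotangent_bundle M = {(q, differential M q f) | q f. smooth_fun M f}"

text \<open>
  The local trivialization: \<open>(x, \<xi>)\<close> is sent to the covector \<open>\<Sum>\<^sub>i \<xi>\<^sub>i dx\<^sup>i / \<rho>\<^sub>\<alpha>\<^sub>,\<^sub>i\<close>,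
  that is, to the functions \<open>g\<close> with \<open>\<partial>g/\<partial>x\<^sup>i = \<xi>\<^sub>i / \<rho>\<^sub>\<alpha>\<^sub>,\<^sub>i\<close> at the base point.
\<close>

definition cot_param ::
  "('a, 'n::finite) atlas \<Rightarrow> ('i, 'a, 'n) scaled_bg_data \<Rightarrow> 'i \<Rightarrow>
   (real^'n) \<times> (real^'n) \<Rightarrow> 'a \<times> ('a \<Rightarrow> real) set" where
  "cot_param M B \<alpha> = (\<lambda>(x, \<xi>). (param B \<alpha> x,
     {g. smooth_fun M g \<and> (\<forall>i. pd i (g \<circ> param B \<alpha>) x = \<xi> $ i / scl B \<alpha> $ i)}))"

text \<open>
  Symbols are complex functions on the cotangent bundle, by convention \<open>0\<close> off the cotangent
  bundle. \<open>push\<close> and \<open>pull\<close> are \<open>(\<phi>\<^sub>\<alpha>)\<^sub>*\<close> and \<open>\<phi>\<^sub>\<alpha>\<^sup>*\<close>, the latter extended by \<open>0\<close>.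
\<close>

type_synonym 'a symbol = "'a \<times> ('a \<Rightarrow> real) set \<Rightarrow> complex"

definition push ::
  "('a, 'n::finite) atlas \<Rightarrow> ('i, 'a, 'n) scaled_bg_data \<Rightarrow> 'i \<Rightarrow> 'a symbol \<Rightarrow>
   real^'n \<Rightarrow> real^'n \<Rightarrow> complex" where
  "push M B \<alpha> a x \<xi> = a (cot_param M B \<alpha> (x, \<xi>))"

definition pull ::
  "('a, 'n::finite) atlas \<Rightarrow> ('i, 'a, 'n) scaled_bg_data \<Rightarrow> 'i \<Rightarrow>
   (real^'n \<Rightarrow> real^'n \<Rightarrow> complex) \<Rightarrow> 'a symbol" where
  "pull M B \<alpha> b z =
     (if z \<in> cot_param M B \<alpha> ` (cube 2 \<times> UNIV)
      then (case inv_into (cube 2 \<times> UNIV) (cot_param M B \<alpha>) z of (x, \<xi>) \<Rightarrow> b x \<xi>) else 0)"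

definition symbols ::
  "('a, 'n::finite) atlas \<Rightarrow> ('i, 'a, 'n) scaled_bg_data \<Rightarrow> real \<Rightarrow> 'a symbol set" where
  "symbols M B m = {a.
     (\<forall>z. z \<notin> cotangent_bundle M \<longrightarrow> a z = 0) \<and>
     (\<forall>\<alpha>\<in>indices B. smooth_on (cube 2 \<times> UNIV) (\<lambda>(x, \<xi>). push M B \<alpha> a x \<xi>)) \<and>
     (\<forall>\<beta> \<gamma>. \<exists>C. \<forall>\<alpha>\<in>indices B. \<forall>x\<in>cube 2. \<forall>\<xi>.
        norm (mpd \<beta> (\<lambda>y. mpd \<gamma> (push M B \<alpha> a y) \<xi>) x)
          \<le> C * sqrt (1 + (norm \<xi>)\<^sup>2) powr (m - real (mlen \<gamma>)))}"

text \<open>For negative \<open>m\<close> the sum is empty and only the zero symbol remains.\<close>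

definition poly_symbols ::
  "('a, 'n::finite) atlas \<Rightarrow> ('i, 'a, 'n) scaled_bg_data \<Rightarrow> int \<Rightarrow> 'a symbol set" where
  "poly_symbols M B m = {a \<in> symbols M B (of_int m).
     \<forall>\<alpha>\<in>indices B. \<forall>x\<in>cube 2. \<exists>c. \<forall>\<xi>.
       push M B \<alpha> a x \<xi> = (\<Sum>\<gamma> | int (mlen \<gamma>) \<le> m. c \<gamma> * mmonom \<gamma> \<xi>)}"

definition weight_times :: "('a \<Rightarrow> real) \<Rightarrow> 'a symbol set \<Rightarrow> 'a symbol set" where
  "weight_times w S = (\<lambda>a z. complex_of_real (w (fst z)) * a z) ` S"

definition wpoly_symbols ::
  "('a, 'n::finite) atlas \<Rightarrow> ('i, 'a, 'n) scaled_bg_data \<Rightarrow> ('a \<Rightarrow> real) \<Rightarrow> int \<Rightarrow> 'a symbol set" where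
  "wpoly_symbols M B w m = weight_times w (poly_symbols M B m)"

definition local_poisson ::
  "real^'n::finite \<Rightarrow> (real^'n \<Rightarrow> real^'n \<Rightarrow> complex) \<Rightarrow> (real^'n \<Rightarrow> real^'n \<Rightarrow> complex) \<Rightarrow>
   real^'n \<Rightarrow> real^'n \<Rightarrow> complex" where
  "local_poisson r a b x \<xi> = (\<Sum>i\<in>UNIV.
       pd i (\<lambda>\<eta>. a x \<eta>) \<xi> * (complex_of_real (r $ i) * pd i (\<lambda>y. b y \<xi>) x)
     - complex_of_real (r $ i) * pd i (\<lambda>y. a y \<xi>) x * pd i (\<lambda>\<eta>. b x \<eta>) \<xi>)"

definition poisson ::
  "('a, 'n::finite) atlas \<Rightarrow> ('i, 'a, 'n) scaled_bg_data \<Rightarrow> 'a symbol \<Rightarrow> 'a symbol \<Rightarrow> 'a symbol" where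
  "poisson M B a b = (THE c.
     (\<forall>z. z \<notin> cotangent_bundle M \<longrightarrow> c z = 0) \<and>
     (\<forall>\<alpha>\<in>indices B. \<forall>x\<in>cube 2. \<forall>\<xi>.
        push M B \<alpha> c x \<xi> = local_poisson (scl B \<alpha>) (push M B \<alpha> a) (push M B \<alpha> b) x \<xi>))"


section \<open>The principal symbol\<close>

definition cutoff :: "(real^'n::finite \<Rightarrow> real) \<Rightarrow> bool" where
  "cutoff \<kappa> \<longleftrightarrow>
     smooth_on UNIV \<kappa> \<and>
     compact (closure {x. \<kappa> x \<noteq> 0}) \<and> closure {x. \<kappa> x \<noteq> 0} \<subseteq> cube 2 \<and>
     (\<forall>x. 0 \<le> \<kappa> x) \<and> (\<forall>x. (\<forall>i. \<bar>x $ i\<bar> \<le> 1) \<longrightarrow> \<kappa> x = 1)"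

definition pull_cutoff ::
  "('i, 'a, 'n::finite, 'z) bg_data_scheme \<Rightarrow> (real^'n \<Rightarrow> real) \<Rightarrow> 'i \<Rightarrow> 'a \<Rightarrow> real" where
  "pull_cutoff B \<kappa> \<alpha> q = (if q \<in> nbhd B \<alpha> then \<kappa> (coord B \<alpha> q) else 0)"

text \<open>
  The sums over all charts are written as sums over the finitely many charts containing the given
  point; the other summands vanish.
\<close>

definition chart_partition ::
  "('i, 'a, 'n::finite, 'z) bg_data_scheme \<Rightarrow> (real^'n \<Rightarrow> real) \<Rightarrow> 'i \<Rightarrow> 'a \<Rightarrow> real" where
  "chart_partition B \<kappa> \<alpha> q =
     pull_cutoff B \<kappa> \<alpha> q / (\<Sum>\<beta> | \<beta> \<in> indices B \<and> q \<in> nbhd B \<beta>. pull_cutoff B \<kappa> \<beta> q)"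

text \<open>\<open>(\<rho>\<^sub>\<alpha> D)\<^sup>\<gamma> u\<close> with \<open>D\<^sub>j = -i \<partial>\<^sub>j\<close>.\<close>

definition scaled_D ::
  "real^'n::finite \<Rightarrow> ('n \<Rightarrow> nat) \<Rightarrow> (real^'n \<Rightarrow> complex) \<Rightarrow> real^'n \<Rightarrow> complex" where
  "scaled_D r \<gamma> u x = (\<Prod>j\<in>UNIV. (complex_of_real (r $ j) * inverse \<i>) ^ \<gamma> j) * mpd \<gamma> u x"

text \<open>\<open>c\<close> is the coefficient family of \<open>(\<phi>\<^sub>\<alpha>)\<^sub>* P\<close>.\<close>

definition local_coeffs ::
  "('a, 'n::finite) atlas \<Rightarrow> ('i, 'a, 'n) scaled_bg_data \<Rightarrow> int \<Rightarrow> 'a operator \<Rightarrow> 'i \<Rightarrow>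
   (('n \<Rightarrow> nat) \<Rightarrow> real^'n \<Rightarrow> complex) \<Rightarrow> bool" where
  "local_coeffs M B m P \<alpha> c \<longleftrightarrow>
     (\<forall>u. smooth_fun M u \<longrightarrow> (\<forall>x\<in>cube 2.
        P u (param B \<alpha> x) =
          (\<Sum>\<gamma> | int (mlen \<gamma>) \<le> m. c \<gamma> x * scaled_D (scl B \<alpha>) \<gamma> (u \<circ> param B \<alpha>) x)))"

text \<open>
  \<open>p\<^sub>\<alpha>(x, \<xi>)\<close>. The coefficients are determined by \<open>P\<close> for \<open>|\<gamma>| \<le> m\<close> and \<open>x\<close> in the
  cube, and no other values are used, so the choice operator is harmless.
\<close>

definition local_symbol ::
  "('a, 'n::finite) atlas \<Rightarrow> ('i, 'a, 'n) scaled_bg_data \<Rightarrow> int \<Rightarrow> 'a operator \<Rightarrow> 'i \<Rightarrow>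
   real^'n \<Rightarrow> real^'n \<Rightarrow> complex" where
  "local_symbol M B m P \<alpha> x \<xi> =
     (\<Sum>\<gamma> | int (mlen \<gamma>) \<le> m. (SOME c. local_coeffs M B m P \<alpha> c) \<gamma> x * mmonom \<gamma> \<xi>)"

definition full_symbol ::
  "('a, 'n::finite) atlas \<Rightarrow> ('i, 'a, 'n) scaled_bg_data \<Rightarrow> (real^'n \<Rightarrow> real) \<Rightarrow> int \<Rightarrow>
   'a operator \<Rightarrow> 'a symbol" where
  "full_symbol M B \<kappa> m P z =
     (\<Sum>\<alpha> | \<alpha> \<in> indices B \<and> fst z \<in> nbhd B \<alpha>.
        complex_of_real (chart_partition B \<kappa> \<alpha> (fst z)) * pull M B \<alpha> (local_symbol M B m P \<alpha>) z)"

definition additive_group :: "'g::ab_group_add set \<Rightarrow> 'g monoid" where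
  "additive_group X = \<lparr>carrier = X, mult = (+), one = 0\<rparr>"

text \<open>The class of \<open>p\<close> in the quotient of \<open>w P\<^sup>m\<close> by \<open>w \<rho> P\<^sup>m\<^sup>-\<^sup>1\<close>.\<close>

definition symbol_class ::
  "('a, 'n::finite) atlas \<Rightarrow> ('i, 'a, 'n) scaled_bg_data \<Rightarrow> ('a \<Rightarrow> real) \<Rightarrow> ('a \<Rightarrow> real) \<Rightarrow> int \<Rightarrow>
   'a symbol \<Rightarrow> 'a symbol set" where
  "symbol_class M B \<rho> w m p =
     wpoly_symbols M B (\<lambda>q. w q * \<rho> q) (m - 1) #>\<^bsub>additive_group (wpoly_symbols M B w m)\<^esub> p"

definition principal_symbol ::
  "('a, 'n::finite) atlas \<Rightarrow> ('i, 'a, 'n) scaled_bg_data \<Rightarrow> (real^'n \<Rightarrow> real) \<Rightarrow> ('a \<Rightarrow> real) \<Rightarrow> int \<Rightarrow>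
   'a operator \<Rightarrow> 'a symbol set" where
  "principal_symbol M B \<kappa> \<rho> m P = symbol_class M B \<rho> (\<lambda>q. 1) m (full_symbol M B \<kappa> m P)"

definition weighted_principal_symbol ::
  "('a, 'n::finite) atlas \<Rightarrow> ('i, 'a, 'n) scaled_bg_data \<Rightarrow> (real^'n \<Rightarrow> real) \<Rightarrow> ('a \<Rightarrow> real) \<Rightarrow>
   ('a \<Rightarrow> real) \<Rightarrow> int \<Rightarrow> 'a operator \<Rightarrow> 'a symbol set" where
  "weighted_principal_symbol M B \<kappa> \<rho> w m P =
     weight_times w (principal_symbol M B \<kappa> \<rho> m (\<lambda>u q. inverse (complex_of_real (w q)) * P u q))"

text \<open>
  \<open>0 \<rightarrow> K \<hookrightarrow> D \<rightarrow> S/N \<rightarrow> 0\<close> is a short exact sequence of complex vector spaces with second map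
  \<open>\<sigma>\<close>, where \<open>K\<close> and \<open>D\<close> consist of operators and \<open>S\<close> and \<open>N\<close> of symbols. (The library's
  \<open>short_exact_sequence\<close> requires all groups to live on one type.)
\<close>

definition symbol_short_exact ::
  "'a operator set \<Rightarrow> 'a operator set \<Rightarrow> ('a operator \<Rightarrow> 'a symbol set) \<Rightarrow>
   'a symbol set \<Rightarrow> 'a symbol set \<Rightarrow> bool" where
  "symbol_short_exact K D \<sigma> S N \<longleftrightarrow>
     group (additive_group D) \<and> subgroup K (additive_group D) \<and>
     group (additive_group S) \<and> subgroup N (additive_group S) \<and>
     (\<forall>c. \<forall>P\<in>K. (\<lambda>u q. c * P u q) \<in> K) \<and> (\<forall>c. \<forall>P\<in>D. (\<lambda>u q. c * P u q) \<in> D) \<and>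
     (\<forall>c. \<forall>a\<in>S. (\<lambda>z. c * a z) \<in> S) \<and> (\<forall>c. \<forall>a\<in>N. (\<lambda>z. c * a z) \<in> N) \<and>
     \<sigma> \<in> epi (additive_group D) (additive_group S Mod N) \<and>
     (\<forall>c. \<forall>P\<in>D. \<forall>p\<in>\<sigma> P. (\<lambda>z. c * p z) \<in> \<sigma> (\<lambda>u q. c * P u q)) \<and>
     kernel (additive_group D) (additive_group S Mod N) \<sigma> = K"

end

(*
  Every operator is a finite sum of words in vector fields, weights and functions, and such a word
  carries a global symbol, the product of the symbols of its letters. In a chart the coefficients of
  the word agree with those of this symbol up to a factor \<rho>, since differentiating a coefficient
  along a vector field of the operator Lie algebra costs the scaling of the chart, which is bounded
  by \<rho>; so the globally defined symbol represents the class of the glued local symbols. Conversely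
  local coefficients are realised by an operator: the charts are coloured with finitely many colours
  such that the shrunken charts of one colour are disjoint, and then the coordinate fields, cut off
  and summed over the charts of one colour, are global fields of the operator Lie algebra. The
  commutator formula reduces by the Leibniz rule on both sides to pairs of letters.
*)
theory Submission
  imports Defs
begin

text \<open>A principal symbol is only a class, so it cannot be carried through an induction over
  operators. The relation \<open>gen\<close> therefore generates pairs of an operator and one
  definite symbol, and three facts settle most claims: the operators of such pairs are exactly
  \<open>wDiff\<close> (\<open>wDiff_iff\<close>), their symbols are exactly
  \<open>wpoly_symbols\<close> (\<open>wpoly_iff\<close>), and the class of the second component is
  the principal symbol of the first (\<open>principal_symbol_eq\<close>). Moreover
  \<open>gen\<close> sees the structure only through its uniform functions, weights and fields, so
  invariance under a compatible structure means that these three sets do not change. The obstacle to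
  colouring is that bounded geometry limits the number of charts through one point, whereas finitely
  many colours require a limit on the number of shrunken charts meeting a given one. A uniform
  Lipschitz bound on the transition maps and a finite net bridge this gap.\<close>

abbreviation cor :: "real => complex" where "cor \<equiv> complex_of_real"

abbreviation midxs :: "int => ('n::finite => nat) set" where "midxs m \<equiv> {\<gamma>. int (mlen \<gamma>) \<le> m}"

section \<open>Directional derivatives, their iteration and their locality\<close>

definition dird :: "'e::real_normed_vector => ('e => 'b::real_normed_vector) => 'e => 'b" where
  "dird v f x = frechet_derivative f (at x) v"

lemma pd_dird: "pd i f = dird (axis i 1) f"
  by (simp add: fun_eq_iff pd_def dird_def)

lemma iter_deriv_Cons: "iter_deriv (v # vs) f = dird v (iter_deriv vs f)"
  by (simp add: fun_eq_iff dird_def)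

declare iter_deriv.simps(2) [simp del]
declare iter_deriv_Cons [simp]

lemma iter_deriv_append: "iter_deriv (us @ vs) f = iter_deriv us (iter_deriv vs f)"
  by (induction us) simp_all

lemma dird_eqI: "(f has_derivative f') (at x) ==> dird v f x = f' v"
  unfolding dird_def using frechet_derivative_at by metis

lemma has_derivative_dird: "f differentiable (at x) ==> (f has_derivative (\<lambda>v. dird v f x)) (at x)"
  unfolding dird_def using frechet_derivative_works by blast

lemma has_derivative_local_cong:
  assumes "open S" "x \<in> S" "\<And>y. y \<in> S ==> f y = g y"
  shows "(f has_derivative f') (at x) \<longleftrightarrow> (g has_derivative f') (at x)"
  using has_derivative_transform_within_open[OF _ assms(1,2)] assms(3) by metis

text \<open>\<open>frechet_derivative\<close> is a choice among the maps that are a derivative at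
  \<open>x\<close>. Both functions have the same such maps, so the values agree even where neither
  is differentiable; hence the local congruences carry no smoothness hypothesis.\<close>

lemma dird_local_cong:
  assumes "open S" "x \<in> S" "\<And>y. y \<in> S ==> f y = g y"
  shows "dird v f x = dird v g x"
  unfolding dird_def frechet_derivative_def using has_derivative_local_cong[OF assms] by simp

lemma differentiable_local_cong:
  assumes "open S" "x \<in> S" "\<And>y. y \<in> S ==> f y = g y"
  shows "f differentiable (at x) \<longleftrightarrow> g differentiable (at x)"
  unfolding differentiable_def using has_derivative_local_cong[OF assms] by simp

lemma iter_deriv_local_cong:
  assumes "open S" "\<And>y. y \<in> S ==> f y = g y" "x \<in> S"
  shows "iter_deriv vs f x = iter_deriv vs g x"
  using assms(3)
proof (induction vs arbitrary: x)
  case (Cons v vs)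
  show ?case using dird_local_cong[OF assms(1) Cons.prems Cons.IH] by simp
qed (use assms in simp)

lemma smooth_on_cong:
  assumes "open S" "\<And>y. y \<in> S ==> f y = g y"
  shows "smooth_on S f \<longleftrightarrow> smooth_on S g"
proof -
  have "iter_deriv vs f differentiable (at x) \<longleftrightarrow> iter_deriv vs g differentiable (at x)"
    if "x \<in> S" for vs x
    by (rule differentiable_local_cong[OF assms(1) that iter_deriv_local_cong[OF assms]])
  then show ?thesis unfolding smooth_on_def by blast
qed

lemma smooth_on_subset: "smooth_on S f ==> T \<subseteq> S ==> smooth_on T f"
  unfolding smooth_on_def by blast

lemma smooth_on_differentiable: "smooth_on S f ==> x \<in> S ==> f differentiable (at x)"
  unfolding smooth_on_def by (metis iter_deriv.simps(1))

lemma smooth_on_continuous_on: "smooth_on S f ==> continuous_on S f"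
  by (simp add: continuous_at_imp_continuous_on differentiable_imp_continuous_within smooth_on_differentiable)

section \<open>Families of functions with uniformly bounded derivatives\<close>

text \<open>
  The flag decides whether only differentiability is required or also bounds that are uniform in the
  index. In this way a single calculus covers smoothness and uniform boundedness of all derivatives.
\<close>

definition cn_fam ::
  "bool => nat => 'k set => ('k => 'e::euclidean_space set) => ('k => 'e => 'b::real_normed_vector) => bool" where
  "cn_fam b n I D F \<longleftrightarrow>
     (\<forall>vs. length vs \<le> n \<and> set vs \<subseteq> Basis \<longrightarrow>
        (\<forall>k\<in>I. \<forall>x\<in>D k. iter_deriv vs (F k) differentiable (at x)) \<and>
        (b \<longrightarrow> (\<exists>C. \<forall>k\<in>I. \<forall>x\<in>D k. norm (iter_deriv vs (F k) x) \<le> C)))"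

definition c_fam ::
  "bool => 'k set => ('k => 'e::euclidean_space set) => ('k => 'e => 'b::real_normed_vector) => bool" where
  "c_fam b I D F \<longleftrightarrow> (\<forall>n. cn_fam b n I D F)"

lemma cn_fam_0:
  "cn_fam b 0 I D F \<longleftrightarrow>
     (\<forall>k\<in>I. \<forall>x\<in>D k. F k differentiable (at x)) \<and> (b \<longrightarrow> (\<exists>C. \<forall>k\<in>I. \<forall>x\<in>D k. norm (F k x) \<le> C))"
  unfolding cn_fam_def by simp

lemma cn_fam_mono: "cn_fam b n I D F ==> n' \<le> n ==> cn_fam b n' I D F"
  unfolding cn_fam_def by (meson le_trans)

text \<open>The head of the list in \<open>iter_deriv\<close> is applied last, so the innermost
  derivative sits at the end. Splitting it off there turns order \<open>Suc n\<close> of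
  \<open>F\<close> into order \<open>n\<close> of its first derivatives, the form in which product
  and chain rule can be used inductively.\<close>

lemma cn_fam_Suc:
  "cn_fam b (Suc n) I D F \<longleftrightarrow> cn_fam b 0 I D F \<and> (\<forall>v\<in>Basis. cn_fam b n I D (\<lambda>k. dird v (F k)))"
proof (intro iffI conjI ballI)
  assume *: "cn_fam b (Suc n) I D F"
  then show "cn_fam b 0 I D F" by (rule cn_fam_mono) simp
  fix v :: 'b assume v: "v \<in> Basis"
  show "cn_fam b n I D (\<lambda>k. dird v (F k))"
    unfolding cn_fam_def
  proof (intro allI impI)
    fix vs :: "'b list" assume vs: "length vs \<le> n \<and> set vs \<subseteq> Basis"
    have "length (vs @ [v]) \<le> Suc n \<and> set (vs @ [v]) \<subseteq> Basis" using vs v by simp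
    from *[unfolded cn_fam_def, rule_format, OF this]
    show "(\<forall>k\<in>I. \<forall>x\<in>D k. iter_deriv vs (dird v (F k)) differentiable at x) \<and>
         (b \<longrightarrow> (\<exists>C. \<forall>k\<in>I. \<forall>x\<in>D k. norm (iter_deriv vs (dird v (F k)) x) \<le> C))"
      by (simp add: iter_deriv_append)
  qed
next
  assume *: "cn_fam b 0 I D F \<and> (\<forall>v\<in>Basis. cn_fam b n I D (\<lambda>k. dird v (F k)))"
  show "cn_fam b (Suc n) I D F"
    unfolding cn_fam_def
  proof (intro allI impI)
    fix vs :: "'b list" assume vs: "length vs \<le> Suc n \<and> set vs \<subseteq> Basis"
    show "(\<forall>k\<in>I. \<forall>x\<in>D k. iter_deriv vs (F k) differentiable at x) \<and>
         (b \<longrightarrow> (\<exists>C. \<forall>k\<in>I. \<forall>x\<in>D k. norm (iter_deriv vs (F k) x) \<le> C))"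
    proof (cases vs rule: rev_cases)
      case Nil
      then show ?thesis using * by (simp add: cn_fam_0)
    next
      case (snoc us v)
      then have "cn_fam b n I D (\<lambda>k. dird v (F k))" "length us \<le> n \<and> set us \<subseteq> Basis"
        using * vs by auto
      then show ?thesis unfolding cn_fam_def snoc by (simp add: iter_deriv_append)
    qed
  qed
qed

lemma cn_fam_cong:
  assumes "\<And>k. k \<in> I ==> open (D k)" "\<And>k x. k \<in> I ==> x \<in> D k ==> F k x = G k x" "cn_fam b n I D F"
  shows "cn_fam b n I D G"
proof -
  have 1: "iter_deriv vs (F k) x = iter_deriv vs (G k) x" if "k \<in> I" "x \<in> D k" for k x vs
    by (rule iter_deriv_local_cong[OF assms(1)[OF that(1)] assms(2)[OF that(1)] that(2)])
  have 2: "iter_deriv vs (F k) differentiable (at x) \<longleftrightarrow> iter_deriv vs (G k) differentiable (at x)"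
    if "k \<in> I" "x \<in> D k" for k x vs
    by (rule differentiable_local_cong[OF assms(1)[OF that(1)] that(2) 1[OF that(1)]])
  show ?thesis using assms(3) unfolding cn_fam_def by (simp add: 1 2)
qed

text \<open>Product, chain and quotient rule describe \<open>dird v (F k)\<close> only on
  \<open>D k\<close>, where \<open>F k\<close> is differentiable. Openness lets such a formula
  \<open>G v k\<close> replace the derivative in all higher derivatives.\<close>

lemma cn_fam_SucI:
  assumes "\<And>k. k \<in> I ==> open (D k)" "cn_fam b 0 I D F"
    and "\<And>v. v \<in> Basis ==> cn_fam b n I D (G v)"
    and "\<And>v k x. v \<in> Basis ==> k \<in> I ==> x \<in> D k ==> G v k x = dird v (F k) x"
  shows "cn_fam b (Suc n) I D F"
  unfolding cn_fam_Suc using assms(2) cn_fam_cong[OF assms(1) assms(4) assms(3)] by blast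

lemma cn_fam_differentiable: "cn_fam b n I D F ==> k \<in> I ==> x \<in> D k ==> F k differentiable (at x)"
  using cn_fam_mono[of b n I D F 0] by (simp add: cn_fam_0)

lemma cn_fam_bound:
  assumes "cn_fam b n I D F" b
  obtains C where "C > 0" "\<And>k x. k \<in> I ==> x \<in> D k ==> norm (F k x) \<le> C"
proof -
  obtain C where C: "\<And>k x. k \<in> I ==> x \<in> D k ==> norm (F k x) \<le> C"
    using cn_fam_mono[OF assms(1), of 0] assms(2) unfolding cn_fam_0 by blast
  have "norm (F k x) \<le> max C 1" if "k \<in> I" "x \<in> D k" for k x
    using C[OF that] by simp
  then show ?thesis using that[of "max C 1"] by simp
qed

lemma cn_fam_0I:
  assumes "\<And>k x. k \<in> I ==> x \<in> D k ==> F k differentiable (at x)"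
    and "b ==> \<exists>C. \<forall>k\<in>I. \<forall>x\<in>D k. norm (F k x) \<le> C"
  shows "cn_fam b 0 I D F"
  unfolding cn_fam_0 using assms by blast

lemma dird_const [simp]: "dird v (\<lambda>x. c) = (\<lambda>x. 0)"
  by (rule ext, rule dird_eqI[of _ "\<lambda>_. 0"]) simp

lemma cn_fam_const:
  fixes c :: "'k => 'b::real_normed_vector" and D :: "'k => 'e::euclidean_space set"
  assumes "b ==> \<exists>C. \<forall>k\<in>I. norm (c k) \<le> C"
  shows "cn_fam b n I D (\<lambda>k x. c k)"
  using assms
proof (induction n arbitrary: c)
  case 0
  then show ?case by (auto simp: cn_fam_0)
next
  case (Suc n)
  have "\<exists>C. \<forall>k\<in>I. norm ((\<lambda>_. 0::'b) k) \<le> C" by (intro exI[of _ 0]) simp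
  then have "cn_fam b n I D (\<lambda>k x. 0::'b)" by (rule Suc.IH)
  then show ?case using Suc.prems by (auto simp: cn_fam_Suc cn_fam_0)
qed

lemma cn_fam_linear:
  assumes h: "bounded_linear h" and op: "\<And>k. k \<in> I ==> open (D k)" and "cn_fam b n I D F"
  shows "cn_fam b n I D (\<lambda>k x. h (F k x))"
  using assms(3)
proof (induction n arbitrary: F)
  have der: "((\<lambda>x. h (F k x)) has_derivative (\<lambda>v. h (dird v (F k) x))) (at x)"
    if "cn_fam b n I D F" "k \<in> I" "x \<in> D k" for n F k x
    using bounded_linear.has_derivative[OF h has_derivative_dird[OF cn_fam_differentiable[OF that]]] .
  have zero: "cn_fam b 0 I D (\<lambda>k x. h (F k x))" if F: "cn_fam b n I D F" for n F
  proof (rule cn_fam_0I)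
    show "(\<lambda>x. h (F k x)) differentiable (at x)" if "k \<in> I" "x \<in> D k" for k x
      using der[OF F that] by (rule differentiableI)
    assume b
    then obtain C where C: "C > 0" "\<And>k x. k \<in> I ==> x \<in> D k ==> norm (F k x) \<le> C"
      using cn_fam_bound[OF F] by blast
    obtain K where K: "\<And>x. norm (h x) \<le> norm x * K" and "K > 0"
      using h bounded_linear.pos_bounded by blast
    have "norm (h (F k x)) \<le> C * K" if "k \<in> I" "x \<in> D k" for k x
      using K[of "F k x"] mult_right_mono[OF C(2)[OF that], of K] \<open>K > 0\<close> by linarith
    then show "\<exists>C. \<forall>k\<in>I. \<forall>x\<in>D k. norm (h (F k x)) \<le> C" by blast
  qed
  {
    case 0
    then show ?case by (rule zero)
  next
    case (Suc n)
    show ?case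
    proof (rule cn_fam_SucI[OF op zero[OF Suc.prems], where G = "\<lambda>v k x. h (dird v (F k) x)"])
      show "cn_fam b n I D (\<lambda>k x. h (dird v (F k) x))" if "v \<in> Basis" for v
        using Suc that by (auto simp: cn_fam_Suc)
      show "h (dird v (F k) x) = dird v (\<lambda>x. h (F k x)) x" if "k \<in> I" "x \<in> D k" for v k x
        using der[OF Suc.prems that] by (simp add: dird_eqI)
    qed
  }
qed

lemma cn_fam_bilinear_0:
  assumes h: "bounded_bilinear h" and F: "cn_fam b n I D F" and G: "cn_fam b n I D G"
  shows "cn_fam b 0 I D (\<lambda>k x. h (F k x) (G k x))"
proof (rule cn_fam_0I)
  show "(\<lambda>x. h (F k x) (G k x)) differentiable (at x)" if "k \<in> I" "x \<in> D k" for k x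
    using bounded_bilinear.FDERIV[OF h has_derivative_dird[OF cn_fam_differentiable[OF F that]]
         has_derivative_dird[OF cn_fam_differentiable[OF G that]]] by (rule differentiableI)
  assume b
  then obtain C where C: "C > 0" "\<And>k x. k \<in> I ==> x \<in> D k ==> norm (F k x) \<le> C"
    using cn_fam_bound[OF F] by blast
  obtain C' where C': "C' > 0" "\<And>k x. k \<in> I ==> x \<in> D k ==> norm (G k x) \<le> C'"
    using cn_fam_bound[OF G] \<open>b\<close> by blast
  obtain K where K: "\<And>x y. norm (h x y) \<le> norm x * norm y * K" and "K > 0"
    using h bounded_bilinear.pos_bounded by blast
  have "norm (h (F k x) (G k x)) \<le> C * C' * K" if "k \<in> I" "x \<in> D k" for k x
  proof -
    have "norm (F k x) * norm (G k x) \<le> C * C'"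
      using C C' that by (intro mult_mono) auto
    then show ?thesis using K[of "F k x" "G k x"] \<open>K > 0\<close> by (smt (verit) mult_right_mono)
  qed
  then show "\<exists>C. \<forall>k\<in>I. \<forall>x\<in>D k. norm (h (F k x) (G k x)) \<le> C" by blast
qed

lemma cn_fam_add:
  assumes op: "\<And>k. k \<in> I ==> open (D k)" and "cn_fam b n I D F" "cn_fam b n I D G"
  shows "cn_fam b n I D (\<lambda>k x. F k x + G k x)"
  using assms(2,3)
proof (induction n arbitrary: F G)
  have der: "((\<lambda>x. F k x + G k x) has_derivative (\<lambda>v. dird v (F k) x + dird v (G k) x)) (at x)"
    if "cn_fam b n I D F" "cn_fam b n I D G" "k \<in> I" "x \<in> D k" for n F G k x
    by (intro has_derivative_add has_derivative_dird cn_fam_differentiable[OF that(1,3,4)] cn_fam_differentiable[OF that(2,3,4)])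
  have zero: "cn_fam b 0 I D (\<lambda>k x. F k x + G k x)" if F: "cn_fam b n I D F" and G: "cn_fam b n I D G" for n F G
  proof (rule cn_fam_0I)
    show "(\<lambda>x. F k x + G k x) differentiable (at x)" if "k \<in> I" "x \<in> D k" for k x
      using der[OF F G that] by (rule differentiableI)
    assume b
    then obtain C where C: "C > 0" "\<And>k x. k \<in> I ==> x \<in> D k ==> norm (F k x) \<le> C"
      using cn_fam_bound[OF F] by blast
    obtain C' where C': "C' > 0" "\<And>k x. k \<in> I ==> x \<in> D k ==> norm (G k x) \<le> C'"
      using cn_fam_bound[OF G] \<open>b\<close> by blast
    have "norm (F k x + G k x) \<le> C + C'" if "k \<in> I" "x \<in> D k" for k x
      using C(2)[OF that] C'(2)[OF that] norm_triangle_ineq[of "F k x" "G k x"] by linarith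
    then show "\<exists>C. \<forall>k\<in>I. \<forall>x\<in>D k. norm (F k x + G k x) \<le> C" by blast
  qed
  {
    case 0
    then show ?case by (rule zero)
  next
    case (Suc n)
    show ?case
    proof (rule cn_fam_SucI[OF op zero[OF Suc.prems], where G = "\<lambda>v k x. dird v (F k) x + dird v (G k) x"])
      show "cn_fam b n I D (\<lambda>k x. dird v (F k) x + dird v (G k) x)" if "v \<in> Basis" for v
        using Suc that by (auto simp: cn_fam_Suc)
      show "dird v (F k) x + dird v (G k) x = dird v (\<lambda>x. F k x + G k x) x" if "k \<in> I" "x \<in> D k" for v k x
        using der[OF Suc.prems that] by (simp add: dird_eqI)
    qed
  }
qed

lemma cn_fam_sum:
  assumes op: "\<And>k. k \<in> I ==> open (D k)" and "\<And>a. a \<in> A ==> cn_fam b n I D (F a)"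
  shows "cn_fam b n I D (\<lambda>k x. \<Sum>a\<in>A. F a k x)"
proof -
  have z: "cn_fam b n I D (\<lambda>k x. 0)" using cn_fam_const[of b I "\<lambda>_. 0"] by fastforce
  show ?thesis
  proof (cases "finite A")
    case True
    then show ?thesis using assms(2)
      by induction (auto intro!: z cn_fam_add[OF op])
  next
    case False
    then show ?thesis using z by simp
  qed
qed

text \<open>The product rule gives two products of the same kind, each with one factor
  differentiated, so the induction lets \<open>F\<close> and \<open>G\<close> vary. A general
  bounded bilinear map covers multiplication and scaling at once.\<close>

lemma cn_fam_bilinear:
  assumes h: "bounded_bilinear h" and op: "\<And>k. k \<in> I ==> open (D k)"
    and "cn_fam b n I D F" "cn_fam b n I D G"
  shows "cn_fam b n I D (\<lambda>k x. h (F k x) (G k x))"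
  using assms(3,4)
proof (induction n arbitrary: F G)
  case 0
  then show ?case by (rule cn_fam_bilinear_0[OF h])
next
  case (Suc n)
  show ?case
  proof (rule cn_fam_SucI[OF op cn_fam_bilinear_0[OF h Suc.prems],
        where G = "\<lambda>v k x. h (F k x) (dird v (G k) x) + h (dird v (F k) x) (G k x)"])
    have FG: "cn_fam b n I D F" "cn_fam b n I D G" using Suc.prems cn_fam_mono le_SucI order_refl by metis+
    show "cn_fam b n I D (\<lambda>k x. h (F k x) (dird v (G k) x) + h (dird v (F k) x) (G k x))" if "v \<in> Basis" for v
    proof (rule cn_fam_add[OF op])
      show "cn_fam b n I D (\<lambda>k x. h (F k x) (dird v (G k) x))" "cn_fam b n I D (\<lambda>k x. h (dird v (F k) x) (G k x))"
        using Suc.prems that by (auto intro!: Suc.IH FG simp: cn_fam_Suc)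
    qed
    show "h (F k x) (dird v (G k) x) + h (dird v (F k) x) (G k x) = dird v (\<lambda>x. h (F k x) (G k x)) x"
      if "k \<in> I" "x \<in> D k" for v k x
      using bounded_bilinear.FDERIV[OF h has_derivative_dird[OF cn_fam_differentiable[OF Suc.prems(1) that]]
         has_derivative_dird[OF cn_fam_differentiable[OF Suc.prems(2) that]]]
      by (simp add: dird_eqI)
  qed
qed

text \<open>The chain rule is expanded in the basis because \<open>cn_fam\<close> records
  derivatives in fixed basis directions, while \<open>dird v g x\<close> is a direction that moves
  with \<open>x\<close>.\<close>

lemma dird_compose:
  fixes g :: "'e::real_normed_vector => 'e2::euclidean_space"
  assumes "f differentiable (at (g x))" "g differentiable (at x)"
  shows "dird v (\<lambda>x. f (g x)) x = (\<Sum>b\<in>Basis. (dird v g x \<bullet> b) *\<^sub>R dird b f (g x))"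
proof -
  have lin: "linear (\<lambda>v. dird v f (g x))"
    using has_derivative_dird[OF assms(1)] has_derivative_linear by blast
  have "dird v (\<lambda>x. f (g x)) x = dird (dird v g x) f (g x)"
    using has_derivative_compose[OF has_derivative_dird[OF assms(2)] has_derivative_dird[OF assms(1)]]
    by (simp add: dird_eqI)
  also have "\<dots> = dird (\<Sum>b\<in>Basis. (dird v g x \<bullet> b) *\<^sub>R b) f (g x)" by (simp add: euclidean_representation)
  also have "\<dots> = (\<Sum>b\<in>Basis. (dird v g x \<bullet> b) *\<^sub>R dird b f (g x))"
    using linear_sum[OF lin, of "\<lambda>b. (dird v g x \<bullet> b) *\<^sub>R b"] linear_scale[OF lin] by simp
  finally show ?thesis .
qed

text \<open>\<open>F\<close> varies in the induction, since the chain rule produces its partial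
  derivatives composed with the same \<open>G\<close>. The index map \<open>s\<close> lets the outer
  function belong to another index set, such as the target charts of transition maps.\<close>

lemma cn_fam_compose:
  fixes G :: "'k => 'e::euclidean_space => 'e2::euclidean_space"
  assumes op: "\<And>k. k \<in> I ==> open (D k)"
    and s: "\<And>k. k \<in> I ==> s k \<in> J" "\<And>k x. k \<in> I ==> x \<in> D k ==> G k x \<in> E (s k)"
    and "cn_fam b n I D G" "cn_fam b n J E F"
  shows "cn_fam b n I D (\<lambda>k x. F (s k) (G k x))"
  using assms(4,5)
proof (induction n arbitrary: F)
  have zero: "cn_fam b 0 I D (\<lambda>k x. F (s k) (G k x))" if G: "cn_fam b n I D G" and F: "cn_fam b n J E F" for n F
  proof (rule cn_fam_0I)
    show "(\<lambda>x. F (s k) (G k x)) differentiable (at x)" if "k \<in> I" "x \<in> D k" for k x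
      using differentiable_chain_at[OF cn_fam_differentiable[OF G that] cn_fam_differentiable[OF F s(1)[OF that(1)] s(2)[OF that]]]
      by (simp add: o_def)
    assume b
    then obtain C where C: "C > 0" "\<And>k x. k \<in> J ==> x \<in> E k ==> norm (F k x) \<le> C"
      using cn_fam_bound[OF F] by blast
    then show "\<exists>C. \<forall>k\<in>I. \<forall>x\<in>D k. norm (F (s k) (G k x)) \<le> C" using s by blast
  qed
  {
    case 0
    then show ?case by (rule zero)
  next
    case (Suc n)
    have dF: "F (s k) differentiable (at (G k x))" and dG: "G k differentiable (at x)" if "k \<in> I" "x \<in> D k" for k x
      using that cn_fam_differentiable[OF Suc.prems(2) s(1)[OF that(1)] s(2)[OF that]]
        cn_fam_differentiable[OF Suc.prems(1) that] by auto
    show ?case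
    proof (rule cn_fam_SucI[OF op zero[OF Suc.prems], where G = "\<lambda>v k x. \<Sum>b\<in>Basis. (dird v (G k) x \<bullet> b) *\<^sub>R dird b (F (s k)) (G k x)"])
      show "cn_fam b n I D (\<lambda>k x. \<Sum>b\<in>Basis. (dird v (G k) x \<bullet> b) *\<^sub>R dird b (F (s k)) (G k x))" if "v \<in> Basis" for v
      proof (intro cn_fam_sum[OF op] cn_fam_bilinear[OF bounded_bilinear_scaleR op])
        fix u :: 'e2 assume u: "u \<in> Basis"
        have "cn_fam b n I D (\<lambda>k. dird v (G k))" using Suc.prems(1) that by (simp add: cn_fam_Suc)
        then show "cn_fam b n I D (\<lambda>k x. dird v (G k) x \<bullet> u)"
          by (intro cn_fam_linear[where h = "\<lambda>z. z \<bullet> u", OF bounded_linear_inner_left op])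
        have "cn_fam b n I D G" using Suc.prems(1) cn_fam_mono le_SucI order_refl by metis
        moreover have "cn_fam b n J E (\<lambda>j. dird u (F j))" using Suc.prems u by (simp add: cn_fam_Suc)
        ultimately show "cn_fam b n I D (\<lambda>k x. dird u (F (s k)) (G k x))" by (rule Suc.IH)
      qed
      show "(\<Sum>b\<in>Basis. (dird v (G k) x \<bullet> b) *\<^sub>R dird b (F (s k)) (G k x)) = dird v (\<lambda>x. F (s k) (G k x)) x"
        if "k \<in> I" "x \<in> D k" for v k x
        using dird_compose[OF dF[OF that] dG[OF that]] by simp
    qed
  }
qed

text \<open>The derivative of the reciprocal contains only the reciprocal itself and a derivative of
  \<open>F\<close>, so the induction closes on the same function. The lower bound enters at order
  zero.\<close>

lemma cn_fam_inverse:
  fixes F :: "'k => 'e::euclidean_space => 'b::real_normed_field"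
  assumes op: "\<And>k. k \<in> I ==> open (D k)"
    and nz: "\<And>k x. k \<in> I ==> x \<in> D k ==> F k x \<noteq> 0"
    and lb: "b ==> \<exists>c>0. \<forall>k\<in>I. \<forall>x\<in>D k. c \<le> norm (F k x)"
    and "cn_fam b n I D F"
  shows "cn_fam b n I D (\<lambda>k x. inverse (F k x))"
  using assms(4)
proof (induction n)
  have zero: "cn_fam b 0 I D (\<lambda>k x. inverse (F k x))" if F: "cn_fam b n I D F" for n
  proof (rule cn_fam_0I)
    show "(\<lambda>x. inverse (F k x)) differentiable (at x)" if "k \<in> I" "x \<in> D k" for k x
      using Deriv.has_derivative_inverse[OF nz[OF that] has_derivative_dird[OF cn_fam_differentiable[OF F that]]]
      by (rule differentiableI)
    assume b
    then obtain c where c: "c > 0" "\<forall>k\<in>I. \<forall>x\<in>D k. c \<le> norm (F k x)" using lb by blast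
    have "norm (inverse (F k x)) \<le> inverse c" if "k \<in> I" "x \<in> D k" for k x
      using c that by (simp add: norm_inverse le_imp_inverse_le)
    then show "\<exists>C. \<forall>k\<in>I. \<forall>x\<in>D k. norm (inverse (F k x)) \<le> C" by blast
  qed
  {
    case 0
    then show ?case by (rule zero)
  next
    case (Suc n)
    show ?case
    proof (rule cn_fam_SucI[OF op zero[OF Suc.prems], where G = "\<lambda>v k x. - (inverse (F k x) * dird v (F k) x * inverse (F k x))"])
      have *: "cn_fam b n I D (\<lambda>k x. inverse (F k x))" using Suc cn_fam_mono by (metis le_SucI order_refl)
      show "cn_fam b n I D (\<lambda>k x. - (inverse (F k x) * dird v (F k) x * inverse (F k x)))" if "v \<in> Basis" for v
      proof -
        have "cn_fam b n I D (\<lambda>k. dird v (F k))" using Suc.prems that by (simp add: cn_fam_Suc)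
        then show ?thesis
          by (intro cn_fam_linear[OF bounded_linear_minus[OF bounded_linear_ident] op] *
              cn_fam_bilinear[OF bounded_bilinear_mult op])
      qed
      show "- (inverse (F k x) * dird v (F k) x * inverse (F k x)) = dird v (\<lambda>x. inverse (F k x)) x"
        if "k \<in> I" "x \<in> D k" for v k x
        using Deriv.has_derivative_inverse[OF nz[OF that] has_derivative_dird[OF cn_fam_differentiable[OF Suc.prems that]]]
        by (simp add: dird_eqI)
    qed
  }
qed

section \<open>Symmetry of second derivatives\<close>

lemma dird_scaleR: "f differentiable (at x) ==> dird (c *\<^sub>R v) f x = c *\<^sub>R dird v f x"
  using linear_scale[OF has_derivative_linear[OF has_derivative_dird]] by blast

lemma dird_line:
  fixes f :: "'e::real_normed_vector => real"
  assumes "f differentiable (at (y + t *\<^sub>R v))"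
  shows "((\<lambda>t. f (y + t *\<^sub>R v)) has_real_derivative dird v f (y + t *\<^sub>R v)) (at t)"
proof -
  have 1: "((\<lambda>t. y + t *\<^sub>R v) has_derivative (\<lambda>s. s *\<^sub>R v)) (at t)"
    by (auto intro!: derivative_eq_intros)
  have "((\<lambda>t. f (y + t *\<^sub>R v)) has_derivative (\<lambda>s. dird (s *\<^sub>R v) f (y + t *\<^sub>R v))) (at t)"
    by (rule has_derivative_compose[OF 1 has_derivative_dird[OF assms]])
  then show ?thesis
    by (simp add: has_field_derivative_def dird_scaleR[OF assms] mult.commute[of _ "dird v f (y + t *\<^sub>R v)"])
qed

text \<open>The mean value theorem twice: along \<open>v\<close> for the difference \<open>g\<close>
  of \<open>f\<close> on two parallel lines, then along \<open>w\<close> for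
  \<open>dird v f\<close>. The mixed derivative appears at an interior point of the small
  parallelogram.\<close>

lemma second_difference:
  fixes f :: "'e::real_normed_vector => real"
  assumes h: "h > 0"
    and S: "\<And>s t. 0 \<le> s ==> s \<le> h ==> 0 \<le> t ==> t \<le> h ==> x + s *\<^sub>R v + t *\<^sub>R w \<in> S"
    and f: "\<And>y. y \<in> S ==> f differentiable (at y)" "\<And>y. y \<in> S ==> dird v f differentiable (at y)"
  shows "\<exists>s t. 0 < s \<and> s < h \<and> 0 < t \<and> t < h \<and>
     f (x + h *\<^sub>R v + h *\<^sub>R w) - f (x + h *\<^sub>R v) - f (x + h *\<^sub>R w) + f x
       = h * h * dird w (dird v f) (x + s *\<^sub>R v + t *\<^sub>R w)"
proof -
  define g where "g = (\<lambda>s. f (x + h *\<^sub>R w + s *\<^sub>R v) - f (x + s *\<^sub>R v))"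
  have S': "x + t *\<^sub>R w + s *\<^sub>R v \<in> S" "x + s *\<^sub>R v \<in> S" if "0 \<le> s" "s \<le> h" "0 \<le> t" "t \<le> h" for s t
    using S[OF that] S[OF that(1,2), of 0] h by (simp_all add: algebra_simps)
  have "\<exists>s>0. s < h \<and> g h - g 0 = (h - 0) * (dird v f (x + h *\<^sub>R w + s *\<^sub>R v) - dird v f (x + s *\<^sub>R v))"
    unfolding g_def using h
    by (intro MVT2 DERIV_diff dird_line f S') auto
  then obtain s where s: "0 < s" "s < h"
    "g h - g 0 = h * (dird v f (x + h *\<^sub>R w + s *\<^sub>R v) - dird v f (x + s *\<^sub>R v))" by auto
  have "\<exists>t>0. t < h \<and> dird v f (x + s *\<^sub>R v + h *\<^sub>R w) - dird v f (x + s *\<^sub>R v + 0 *\<^sub>R w)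
     = (h - 0) * dird w (dird v f) (x + s *\<^sub>R v + t *\<^sub>R w)"
    using h s by (intro MVT2 dird_line f S) auto
  then obtain t where t: "0 < t" "t < h" "dird v f (x + s *\<^sub>R v + h *\<^sub>R w) - dird v f (x + s *\<^sub>R v)
     = h * dird w (dird v f) (x + s *\<^sub>R v + t *\<^sub>R w)" by auto
  have "g h - g 0 = h * h * dird w (dird v f) (x + s *\<^sub>R v + t *\<^sub>R w)"
    using s t by (simp add: algebra_simps)
  then show ?thesis using s t by (intro exI[of _ s] exI[of _ t]) (simp add: g_def algebra_simps)
qed

text \<open>The second difference is symmetric in \<open>v\<close> and \<open>w\<close>, so the two
  mixed derivatives take a common value at two points near \<open>x\<close>. By continuity their
  values at \<open>x\<close> then differ by less than \<open>2 * e\<close>, which is their assumed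
  distance itself.\<close>

lemma dird_commute_real:
  fixes f :: "'e::real_normed_vector => real"
  assumes "open S" "x \<in> S" and f: "smooth_on S f"
  shows "dird v (dird w f) x = dird w (dird v f) x"
proof (rule ccontr)
  assume ne: "dird v (dird w f) x \<noteq> dird w (dird v f) x"
  define e where "e = \<bar>dird v (dird w f) x - dird w (dird v f) x\<bar> / 2"
  have e: "e > 0" using ne by (simp add: e_def)
  have sm: "iter_deriv vs f differentiable (at y)" if "y \<in> S" for vs y
    using f that unfolding smooth_on_def by blast
  have c: "continuous (at x) (dird v (dird w f))" "continuous (at x) (dird w (dird v f))"
    using sm[OF assms(2), of "[v, w]"] sm[OF assms(2), of "[w, v]"]
    by (auto intro: differentiable_imp_continuous_within)
  obtain d1 where d1: "d1 > 0" "\<And>y. dist y x < d1 ==> dist (dird v (dird w f) y) (dird v (dird w f) x) < e"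
    using c(1) e unfolding continuous_at_eps_delta by blast
  obtain d2 where d2: "d2 > 0" "\<And>y. dist y x < d2 ==> dist (dird w (dird v f) y) (dird w (dird v f) x) < e"
    using c(2) e unfolding continuous_at_eps_delta by blast
  obtain d3 where d3: "d3 > 0" "ball x d3 \<subseteq> S" using assms(1,2) open_contains_ball by blast
  define d where "d = min d1 (min d2 d3)"
  have d: "d > 0" "d \<le> d1" "d \<le> d2" "d \<le> d3" using d1 d2 d3 by (auto simp: d_def)
  \<comment> \<open>The summand 1 keeps \<open>K\<close> positive when both directions vanish. With
    \<open>h = d / (2 * K)\<close> every point of the parallelogram has distance at most
    \<open>d / 2\<close> from \<open>x\<close>.\<close>
  define K where "K = norm v + norm w + 1"
  have K: "K > 0" unfolding K_def by (smt (verit) norm_ge_zero)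
  define h where "h = d / (2 * K)"
  have h: "h > 0" using d K by (simp add: h_def)
  have near: "dist (x + s *\<^sub>R v + t *\<^sub>R w) x < d" if "0 \<le> s" "s \<le> h" "0 \<le> t" "t \<le> h" for s t
  proof -
    have "dist (x + s *\<^sub>R v + t *\<^sub>R w) x = norm (s *\<^sub>R v + t *\<^sub>R w)" by (simp add: dist_norm add.assoc)
    also have "\<dots> \<le> s * norm v + t * norm w" using norm_triangle_ineq[of "s *\<^sub>R v" "t *\<^sub>R w"] that by simp
    also have "\<dots> \<le> h * norm v + h * norm w" using that by (intro add_mono mult_right_mono) auto
    also have "\<dots> \<le> h * K" using h by (simp add: K_def algebra_simps)
    also have "\<dots> = d / 2" using K by (simp add: h_def)
    also have "\<dots> < d" using d by simp
    finally show ?thesis .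
  qed
  have inS: "x + s *\<^sub>R v + t *\<^sub>R w \<in> S" if "0 \<le> s" "s \<le> h" "0 \<le> t" "t \<le> h" for s t
  proof -
    have "dist x (x + s *\<^sub>R v + t *\<^sub>R w) < d3" using near[OF that] d(4) by (simp only: dist_commute)
    then show ?thesis using d3(2) by (auto simp: mem_ball)
  qed
  have inS': "x + s *\<^sub>R w + t *\<^sub>R v \<in> S" if "0 \<le> s" "s \<le> h" "0 \<le> t" "t \<le> h" for s t
    using inS[of t s] that by (simp add: algebra_simps)
  have df: "f differentiable (at y)" "dird u f differentiable (at y)" if "y \<in> S" for u y
    using sm[OF that, of "[]"] sm[OF that, of "[u]"] by auto
  obtain s t where st: "0 < s" "s < h" "0 < t" "t < h"
    "f (x + h *\<^sub>R v + h *\<^sub>R w) - f (x + h *\<^sub>R v) - f (x + h *\<^sub>R w) + f x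
       = h * h * dird w (dird v f) (x + s *\<^sub>R v + t *\<^sub>R w)"
    using second_difference[OF h inS df(1) df(2)] by blast
  obtain s' t' where st': "0 < s'" "s' < h" "0 < t'" "t' < h"
    "f (x + h *\<^sub>R w + h *\<^sub>R v) - f (x + h *\<^sub>R w) - f (x + h *\<^sub>R v) + f x
       = h * h * dird v (dird w f) (x + s' *\<^sub>R w + t' *\<^sub>R v)"
    using second_difference[OF h inS' df(1) df(2)] by blast
  have sw: "x + h *\<^sub>R w + h *\<^sub>R v = x + h *\<^sub>R v + h *\<^sub>R w" "x + s' *\<^sub>R w + t' *\<^sub>R v = x + t' *\<^sub>R v + s' *\<^sub>R w" by simp_all
  have "h * h * dird w (dird v f) (x + s *\<^sub>R v + t *\<^sub>R w) = h * h * dird v (dird w f) (x + t' *\<^sub>R v + s' *\<^sub>R w)"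
    using st(5) st'(5) unfolding sw by linarith
  then have eq: "dird w (dird v f) (x + s *\<^sub>R v + t *\<^sub>R w) = dird v (dird w f) (x + t' *\<^sub>R v + s' *\<^sub>R w)"
    using h by simp
  have "dist (x + s *\<^sub>R v + t *\<^sub>R w) x < d2" "dist (x + t' *\<^sub>R v + s' *\<^sub>R w) x < d1"
    using near[of s t] near[of t' s'] st st' d by auto
  then have "\<bar>dird w (dird v f) (x + s *\<^sub>R v + t *\<^sub>R w) - dird w (dird v f) x\<bar> < e"
    "\<bar>dird v (dird w f) (x + t' *\<^sub>R v + s' *\<^sub>R w) - dird v (dird w f) x\<bar> < e"
    using d1(2) d2(2) unfolding dist_real_def by blast+
  then have "\<bar>dird v (dird w f) x - dird w (dird v f) x\<bar> < 2 * e" using eq by linarith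
  then show False by (simp add: e_def)
qed

lemma smooth_on_dird: "smooth_on S f ==> smooth_on S (dird v f)"
  unfolding smooth_on_def
proof (intro allI ballI)
  fix vs x assume "\<forall>vs. \<forall>x\<in>S. iter_deriv vs f differentiable at x" "x \<in> S"
  then have "iter_deriv (vs @ [v]) f differentiable (at x)" by blast
  then show "iter_deriv vs (dird v f) differentiable (at x)" by (simp add: iter_deriv_append)
qed

lemma smooth_on_iter_deriv: "smooth_on S f ==> smooth_on S (iter_deriv vs f)"
  by (induction vs) (simp_all add: smooth_on_dird)

lemma dird_linear:
  assumes "bounded_linear h" "f differentiable (at x)"
  shows "dird v (\<lambda>x. h (f x)) x = h (dird v f x)"
  using dird_eqI[OF bounded_linear.has_derivative[OF assms(1) has_derivative_dird[OF assms(2)]]] .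

lemma iter_deriv_linear:
  assumes "bounded_linear h" "smooth_on S f" "open S" "x \<in> S"
  shows "iter_deriv vs (\<lambda>x. h (f x)) x = h (iter_deriv vs f x)"
  using assms(4)
proof (induction vs arbitrary: x)
  case (Cons v vs)
  have "dird v (iter_deriv vs (\<lambda>x. h (f x))) x = dird v (\<lambda>x. h (iter_deriv vs f x)) x"
    by (rule dird_local_cong[OF assms(3) Cons.prems Cons.IH])
  then show ?case using dird_linear[OF assms(1) smooth_on_differentiable[OF smooth_on_iter_deriv[OF assms(2)] Cons.prems]]
    by simp
qed simp

lemma smooth_on_linear:
  assumes "bounded_linear h" "smooth_on S f" "open S"
  shows "smooth_on S (\<lambda>x. h (f x))"
  unfolding smooth_on_def
proof (intro allI ballI)
  fix vs x assume x: "x \<in> S"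
  have "(\<lambda>x. h (iter_deriv vs f x)) differentiable (at x)"
    using bounded_linear.has_derivative[OF assms(1) has_derivative_dird[OF smooth_on_differentiable[OF smooth_on_iter_deriv[OF assms(2)] x]]]
    by (rule differentiableI)
  moreover have "iter_deriv vs (\<lambda>x. h (f x)) differentiable (at x) \<longleftrightarrow> (\<lambda>x. h (iter_deriv vs f x)) differentiable (at x)"
    by (rule differentiable_local_cong[OF assms(3) x]) (rule iter_deriv_linear[OF assms])
  ultimately show "iter_deriv vs (\<lambda>x. h (f x)) differentiable (at x)" by simp
qed

lemma dird_commute:
  fixes f :: "'e::real_normed_vector => 'b::euclidean_space"
  assumes "open S" "x \<in> S" and f: "smooth_on S f"
  shows "dird v (dird w f) x = dird w (dird v f) x"
proof (rule euclidean_eqI)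
  fix b :: 'b assume "b \<in> Basis"
  have "iter_deriv vs f x \<bullet> b = iter_deriv vs (\<lambda>x. f x \<bullet> b) x" for vs
    using iter_deriv_linear[OF bounded_linear_inner_left f assms(1,2)] by simp
  from this[of "[v, w]"] this[of "[w, v]"]
  show "dird v (dird w f) x \<bullet> b = dird w (dird v f) x \<bullet> b"
    using dird_commute_real[OF assms(1,2) smooth_on_linear[OF bounded_linear_inner_left f assms(1)]] by simp
qed

lemma iter_deriv_move:
  fixes f :: "'e::real_normed_vector => 'b::euclidean_space"
  assumes "open S" "smooth_on S f" "x \<in> S"
  shows "iter_deriv (us @ v # vs) f x = iter_deriv (v # us @ vs) f x"
  using assms(3)
proof (induction us arbitrary: x)
  case (Cons u us)
  have "iter_deriv ((u # us) @ v # vs) f x = dird u (iter_deriv (v # us @ vs) f) x"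
    using dird_local_cong[OF assms(1) Cons.prems Cons.IH] by simp
  also have "\<dots> = dird v (dird u (iter_deriv (us @ vs) f)) x"
    using dird_commute[OF assms(1) Cons.prems smooth_on_iter_deriv[OF assms(2)]] by simp
  finally show ?case by simp
qed simp

text \<open>\<open>mpd\<close> fixes one order of differentiation, while iterated fields and
  \<open>cn_fam_Suc\<close> produce arbitrary orders; symmetry of second derivatives sorts
  them.\<close>

lemma iter_deriv_perm:
  fixes f :: "'e::real_normed_vector => 'b::euclidean_space"
  assumes "open S" "smooth_on S f" "x \<in> S" "mset us = mset vs"
  shows "iter_deriv us f x = iter_deriv vs f x"
  using assms(3,4)
proof (induction us arbitrary: vs x)
  case (Cons u us)
  then have "u \<in> set vs" by (metis list.set_intros(1) set_mset_mset)
  then obtain as bs where vs: "vs = as @ u # bs" by (meson split_list)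
  then have m: "mset us = mset (as @ bs)" using Cons.prems by simp
  have "iter_deriv (u # us) f x = dird u (iter_deriv (as @ bs) f) x"
    using dird_local_cong[OF assms(1) Cons.prems(1) Cons.IH[OF _ m]] by simp
  also have "\<dots> = iter_deriv vs f x" using iter_deriv_move[OF assms(1,2) Cons.prems(1)] by (simp add: vs)
  finally show ?case .
qed simp

section \<open>Families with all derivatives\<close>

lemma c_fam_D: "c_fam b I D F ==> cn_fam b n I D F"
  unfolding c_fam_def by blast

lemma c_fam_cong:
  assumes "\<And>k. k \<in> I ==> open (D k)" "\<And>k x. k \<in> I ==> x \<in> D k ==> F k x = G k x" "c_fam b I D F"
  shows "c_fam b I D G"
  unfolding c_fam_def
proof
  fix n
  from assms(1,2) c_fam_D[OF assms(3), of n] show "cn_fam b n I D G" by (rule cn_fam_cong)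
qed

lemma c_fam_const:
  assumes "b ==> \<exists>C. \<forall>k\<in>I. norm (c k) \<le> C"
  shows "c_fam b I D (\<lambda>k x. c k)"
  unfolding c_fam_def by (intro allI cn_fam_const assms)

lemma c_fam_const' [intro, simp]: "c_fam b I D (\<lambda>k x. c)"
  by (rule c_fam_const[of _ _ "\<lambda>_. c"]) blast

lemma c_fam_linear:
  assumes "bounded_linear h" "\<And>k. k \<in> I ==> open (D k)" "c_fam b I D F"
  shows "c_fam b I D (\<lambda>k x. h (F k x))"
  unfolding c_fam_def by (intro allI cn_fam_linear[where h = h] assms c_fam_D[OF assms(3)])

lemma c_fam_add:
  assumes "\<And>k. k \<in> I ==> open (D k)" "c_fam b I D F" "c_fam b I D G"
  shows "c_fam b I D (\<lambda>k x. F k x + G k x)"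
  unfolding c_fam_def by (intro allI cn_fam_add assms c_fam_D[OF assms(2)] c_fam_D[OF assms(3)])

lemma c_fam_sum:
  assumes "\<And>k. k \<in> I ==> open (D k)" "\<And>a. a \<in> A ==> c_fam b I D (F a)"
  shows "c_fam b I D (\<lambda>k x. \<Sum>a\<in>A. F a k x)"
  unfolding c_fam_def by (intro allI cn_fam_sum assms c_fam_D[OF assms(2)])

lemma c_fam_bilinear:
  assumes "bounded_bilinear h" "\<And>k. k \<in> I ==> open (D k)" "c_fam b I D F" "c_fam b I D G"
  shows "c_fam b I D (\<lambda>k x. h (F k x) (G k x))"
  unfolding c_fam_def by (intro allI cn_fam_bilinear[where h = h] assms c_fam_D[OF assms(3)] c_fam_D[OF assms(4)])

lemma c_fam_mult:
  fixes F G :: "'k => 'e::euclidean_space => 'b::real_normed_algebra"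
  assumes "\<And>k. k \<in> I ==> open (D k)" "c_fam b I D F" "c_fam b I D G"
  shows "c_fam b I D (\<lambda>k x. F k x * G k x)"
  by (rule c_fam_bilinear[OF bounded_bilinear_mult assms])

lemma c_fam_minus:
  assumes "\<And>k. k \<in> I ==> open (D k)" "c_fam b I D F"
  shows "c_fam b I D (\<lambda>k x. - F k x)"
  by (rule c_fam_linear[OF bounded_linear_minus[OF bounded_linear_ident] assms])

lemma c_fam_diff:
  assumes "\<And>k. k \<in> I ==> open (D k)" "c_fam b I D F" "c_fam b I D G"
  shows "c_fam b I D (\<lambda>k x. F k x - G k x)"
  using c_fam_add[OF assms(1,2) c_fam_minus[OF assms(1,3)]] by simp

lemma c_fam_of_real:
  fixes F :: "'k => 'e::euclidean_space => real"
  assumes "\<And>k. k \<in> I ==> open (D k)" "c_fam b I D F"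
  shows "c_fam b I D (\<lambda>k x. of_real (F k x) :: 'b::{real_normed_algebra_1,real_normed_vector})"
  by (rule c_fam_linear[OF bounded_linear_of_real assms])

lemma c_fam_prod:
  fixes F :: "'a => 'k => 'e::euclidean_space => 'b::real_normed_field"
  assumes "\<And>k. k \<in> I ==> open (D k)" "\<And>a. a \<in> A ==> c_fam b I D (F a)"
  shows "c_fam b I D (\<lambda>k x. \<Prod>a\<in>A. F a k x)"
proof (cases "finite A")
  case True
  then show ?thesis using assms(2)
    by induction (auto intro!: c_fam_mult[OF assms(1)])
qed simp

lemma c_fam_power:
  fixes F :: "'k => 'e::euclidean_space => 'b::real_normed_field"
  assumes "\<And>k. k \<in> I ==> open (D k)" "c_fam b I D F"
  shows "c_fam b I D (\<lambda>k x. F k x ^ n)"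
  by (induction n) (auto intro!: c_fam_mult[OF assms(1)] assms(2))

lemma c_fam_compose:
  fixes G :: "'k => 'e::euclidean_space => 'e2::euclidean_space"
  assumes "\<And>k. k \<in> I ==> open (D k)"
    and "\<And>k. k \<in> I ==> s k \<in> J" "\<And>k x. k \<in> I ==> x \<in> D k ==> G k x \<in> E (s k)"
    and "c_fam b I D G" "c_fam b J E F"
  shows "c_fam b I D (\<lambda>k x. F (s k) (G k x))"
  unfolding c_fam_def
  by (intro allI cn_fam_compose[where F = F and G = G and J = J and E = E and s = s]
      assms c_fam_D[OF assms(4)] c_fam_D[OF assms(5)])

lemma c_fam_reindex:
  fixes F :: "'j => 'e::euclidean_space => 'b::real_normed_vector"
  assumes "\<And>k. k \<in> I ==> s k \<in> J" "\<And>k x. k \<in> I ==> x \<in> D k ==> x \<in> E (s k)" "c_fam b J E F"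
  shows "c_fam b I D (\<lambda>k. F (s k))"
  unfolding c_fam_def cn_fam_def
proof (intro allI impI conjI)
  fix n and vs :: "'e list" assume vs: "length vs \<le> n \<and> set vs \<subseteq> Basis"
  have *: "(\<forall>k\<in>J. \<forall>x\<in>E k. iter_deriv vs (F k) differentiable (at x)) \<and>
        (b \<longrightarrow> (\<exists>C. \<forall>k\<in>J. \<forall>x\<in>E k. norm (iter_deriv vs (F k) x) \<le> C))"
    using c_fam_D[OF assms(3), of n] vs unfolding cn_fam_def by blast
  then show "\<forall>k\<in>I. \<forall>x\<in>D k. iter_deriv vs (F (s k)) differentiable (at x)" using assms(1,2) by blast
  show "\<exists>C. \<forall>k\<in>I. \<forall>x\<in>D k. norm (iter_deriv vs (F (s k)) x) \<le> C" if b
    using * that assms(1,2) by meson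
qed

lemma c_fam_inverse:
  fixes F :: "'k => 'e::euclidean_space => 'b::real_normed_field"
  assumes "\<And>k. k \<in> I ==> open (D k)"
    and "\<And>k x. k \<in> I ==> x \<in> D k ==> F k x \<noteq> 0"
    and "b ==> \<exists>c>0. \<forall>k\<in>I. \<forall>x\<in>D k. c \<le> norm (F k x)"
    and "c_fam b I D F"
  shows "c_fam b I D (\<lambda>k x. inverse (F k x))"
  unfolding c_fam_def by (intro allI cn_fam_inverse assms c_fam_D[OF assms(4)])

lemma c_fam_differentiable: "c_fam b I D F ==> k \<in> I ==> x \<in> D k ==> F k differentiable (at x)"
  using c_fam_D[of b I D F 0] by (rule cn_fam_differentiable)

lemma c_fam_dird_Basis: "c_fam b I D F ==> v \<in> Basis ==> c_fam b I D (\<lambda>k. dird v (F k))"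
  unfolding c_fam_def using cn_fam_Suc[of b _ I D F] by blast

text \<open>Only basis directions are controlled by definition; a fixed \<open>v\<close> is a
  combination of them with constant coefficients.\<close>

lemma c_fam_dird:
  fixes v :: "'e::euclidean_space"
  assumes op: "\<And>k. k \<in> I ==> open (D k)" and F: "c_fam b I D F"
  shows "c_fam b I D (\<lambda>k. dird v (F k))"
proof (rule c_fam_cong[OF op])
  show "c_fam b I D (\<lambda>k x. \<Sum>u\<in>Basis. (v \<bullet> u) *\<^sub>R dird u (F k) x)"
    by (intro c_fam_sum[OF op] c_fam_linear[OF bounded_linear_scaleR_right op] c_fam_dird_Basis[OF F])
  fix k x assume "k \<in> I" "x \<in> D k"
  then have lin: "linear (\<lambda>v. dird v (F k) x)"
    using has_derivative_linear[OF has_derivative_dird[OF c_fam_differentiable[OF F]]] by blast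
  have "dird v (F k) x = dird (\<Sum>u\<in>Basis. (v \<bullet> u) *\<^sub>R u) (F k) x" by (simp add: euclidean_representation)
  also have "\<dots> = (\<Sum>u\<in>Basis. (v \<bullet> u) *\<^sub>R dird u (F k) x)"
    using linear_sum[OF lin, of "\<lambda>u. (v \<bullet> u) *\<^sub>R u"] linear_scale[OF lin] by simp
  finally show "(\<Sum>u\<in>Basis. (v \<bullet> u) *\<^sub>R dird u (F k) x) = dird v (F k) x" by simp
qed

lemma c_fam_bound:
  assumes "c_fam True I D F"
  obtains C where "C > 0" "\<And>k x. k \<in> I ==> x \<in> D k ==> norm (F k x) \<le> C"
  using cn_fam_bound[OF c_fam_D[OF assms]] by blast

text \<open>Derivatives at a point do not depend on the domain, so a bound uniform over all pieces
  \<open>E (k, j)\<close> is a bound on \<open>D k\<close>. This allows an estimate to be proved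
  near each point in whichever auxiliary chart is convenient.\<close>

lemma c_fam_cover:
  fixes F :: "'k => 'e::euclidean_space => 'b::real_normed_vector"
  assumes "\<And>k x. k \<in> I ==> x \<in> D k ==> \<exists>j. (k, j) \<in> J \<and> x \<in> E (k, j)" "c_fam b J E (\<lambda>(k, j). F k)"
  shows "c_fam b I D F"
  unfolding c_fam_def cn_fam_def
proof (intro allI impI conjI)
  fix n and vs :: "'e list" assume vs: "length vs \<le> n \<and> set vs \<subseteq> Basis"
  have *: "(\<forall>k\<in>J. \<forall>x\<in>E k. iter_deriv vs (case k of (k, j) => F k) differentiable (at x)) \<and>
        (b \<longrightarrow> (\<exists>C. \<forall>k\<in>J. \<forall>x\<in>E k. norm (iter_deriv vs (case k of (k, j) => F k) x) \<le> C))"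
    using c_fam_D[OF assms(2), of n] vs unfolding cn_fam_def by blast
  then show "\<forall>k\<in>I. \<forall>x\<in>D k. iter_deriv vs (F k) differentiable (at x)" using assms(1) by fastforce
  show "\<exists>C. \<forall>k\<in>I. \<forall>x\<in>D k. norm (iter_deriv vs (F k) x) \<le> C" if b: b
  proof -
    obtain C where "\<forall>k\<in>J. \<forall>x\<in>E k. norm (iter_deriv vs (case k of (k, j) => F k) x) \<le> C" using * b by blast
    then have "\<forall>k\<in>I. \<forall>x\<in>D k. norm (iter_deriv vs (F k) x) \<le> C" using assms(1) by fastforce
    then show ?thesis by blast
  qed
qed

lemma c_fam_Un:
  fixes F :: "'k => 'e::euclidean_space => 'b::real_normed_vector"
  assumes "\<And>k x. k \<in> I ==> x \<in> D k ==> x \<in> D1 k \<or> x \<in> D2 k" "c_fam b I D1 F" "c_fam b I D2 F"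
  shows "c_fam b I D F"
  unfolding c_fam_def cn_fam_def
proof (intro allI impI conjI)
  fix n and vs :: "'e list" assume vs: "length vs \<le> n \<and> set vs \<subseteq> Basis"
  have *: "(\<forall>k\<in>I. \<forall>x\<in>D1 k. iter_deriv vs (F k) differentiable (at x)) \<and>
        (b \<longrightarrow> (\<exists>C. \<forall>k\<in>I. \<forall>x\<in>D1 k. norm (iter_deriv vs (F k) x) \<le> C))"
    "(\<forall>k\<in>I. \<forall>x\<in>D2 k. iter_deriv vs (F k) differentiable (at x)) \<and>
        (b \<longrightarrow> (\<exists>C. \<forall>k\<in>I. \<forall>x\<in>D2 k. norm (iter_deriv vs (F k) x) \<le> C))"
    using c_fam_D[OF assms(2), of n] c_fam_D[OF assms(3), of n] vs unfolding cn_fam_def by blast+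
  then show "\<forall>k\<in>I. \<forall>x\<in>D k. iter_deriv vs (F k) differentiable (at x)" using assms(1) by blast
  show "\<exists>C. \<forall>k\<in>I. \<forall>x\<in>D k. norm (iter_deriv vs (F k) x) \<le> C" if b: b
  proof -
    obtain C1 C2 where "\<forall>k\<in>I. \<forall>x\<in>D1 k. norm (iter_deriv vs (F k) x) \<le> C1"
       "\<forall>k\<in>I. \<forall>x\<in>D2 k. norm (iter_deriv vs (F k) x) \<le> C2"
      using * b by blast
    then have "\<forall>k\<in>I. \<forall>x\<in>D k. norm (iter_deriv vs (F k) x) \<le> max C1 C2" using assms(1)
      by (meson le_max_iff_disj)
    then show ?thesis by blast
  qed
qed

text \<open>Bootstrapping: each derivative of \<open>h\<close> is its logarithmic derivative times
  \<open>h\<close>, so order \<open>n\<close> gives order \<open>Suc n\<close>, and a bound on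
  \<open>h\<close> itself starts the induction. In this way weights of bounded size become uniform
  families.\<close>

lemma c_fam_log_derivative:
  fixes h :: "'k => 'e::euclidean_space => real"
  assumes op: "\<And>k. k \<in> I ==> open (D k)"
    and h: "c_fam False I D h" "\<And>k x. k \<in> I ==> x \<in> D k ==> h k x \<noteq> 0"
    and bd: "\<And>k x. k \<in> I ==> x \<in> D k ==> \<bar>h k x\<bar> \<le> C"
    and ld: "\<And>v. v \<in> Basis ==> c_fam b I D (\<lambda>k x. dird v (h k) x / h k x)"
  shows "c_fam b I D h"
  unfolding c_fam_def
proof
  have zero: "cn_fam b 0 I D h"
    using c_fam_differentiable[OF h(1)] bd by (intro cn_fam_0I) (auto intro!: exI[of _ C])
  fix n show "cn_fam b n I D h"
  proof (induction n)
    case (Suc n)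
    show ?case
    proof (rule cn_fam_SucI[OF op zero])
      show "cn_fam b n I D (\<lambda>k x. dird v (h k) x / h k x * h k x)" if "v \<in> Basis" for v
        by (intro cn_fam_bilinear[OF bounded_bilinear_mult op] Suc c_fam_D[OF ld[OF that]])
    qed (use h(2) in auto)
  qed (rule zero)
qed

text \<open>\<open>smooth_on\<close> asks for all directions, \<open>c_fam\<close> for basis
  directions only; \<open>c_fam_dird\<close> closes the gap, taking off the innermost direction each
  time.\<close>

lemma c_fam_False:
  fixes F :: "'k => 'e::euclidean_space => 'b::real_normed_vector"
  assumes op: "\<And>k. k \<in> I ==> open (D k)"
  shows "c_fam False I D F \<longleftrightarrow> (\<forall>k\<in>I. smooth_on (D k) (F k))"
proof
  assume F: "c_fam False I D F"
  have "iter_deriv vs (F k) differentiable (at x)" if "c_fam False I D F" "k \<in> I" "x \<in> D k" for vs F k x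
    using that
  proof (induction vs arbitrary: F rule: rev_induct)
    case Nil
    then show ?case using c_fam_differentiable[OF Nil(1)] by simp
  next
    case (snoc v vs)
    from snoc.IH[OF c_fam_dird[OF op snoc.prems(1)] snoc.prems(2,3)]
    show ?case by (simp add: iter_deriv_append)
  qed
  from this[OF F] show "\<forall>k\<in>I. smooth_on (D k) (F k)" unfolding smooth_on_def by blast
qed (simp add: c_fam_def cn_fam_def smooth_on_def)

lemma c_fam_smooth: "c_fam b I D F ==> c_fam False I D F"
  unfolding c_fam_def cn_fam_def by blast

lemma c_fam_exp:
  assumes op: "\<And>k. k \<in> I ==> open (D k)"
  shows "c_fam False I D (\<lambda>k. exp :: complex => complex)"
  unfolding c_fam_def
proof
  have der: "((exp :: complex => complex) has_derivative (\<lambda>v. exp z * v)) (at z)" for z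
    using DERIV_exp[of z] by (simp add: has_field_derivative_def)
  have zero: "cn_fam False 0 I D (\<lambda>k. exp :: complex => complex)"
    by (rule cn_fam_0I) (use der in \<open>auto simp: differentiable_def\<close>)
  fix n show "cn_fam False n I D (\<lambda>k. exp :: complex => complex)"
  proof (induction n)
    case (Suc n)
    show ?case
      by (rule cn_fam_SucI[OF op zero, where G = "\<lambda>v k z. exp z * v"])
        (auto intro!: cn_fam_linear[OF bounded_linear_mult_left op] Suc dird_eqI[OF der, symmetric])
  qed (rule zero)
qed

section \<open>Multi-indices\<close>

lemma index_list: "distinct (index_list :: 'n::finite list)" "set (index_list :: 'n list) = UNIV"
proof -
  have "\<exists>is::'n list. distinct is \<and> set is = UNIV"
    using finite_distinct_list[of "UNIV :: 'n set"] by auto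
  then have "distinct (index_list :: 'n list) \<and> set (index_list :: 'n list) = UNIV"
    unfolding index_list_def by (rule someI_ex)
  then show "distinct (index_list :: 'n list)" "set (index_list :: 'n list) = UNIV" by auto
qed

text \<open>Multi-indices are handled through lists of coordinates because \<open>iter_deriv\<close>
  works on lists: \<open>ilist\<close> writes a multi-index out in the order used by
  \<open>mpd\<close>, and \<open>midx\<close> forgets the order again.\<close>

definition ilist :: "('n::finite => nat) => 'n list" where
  "ilist \<gamma> = concat (map (\<lambda>i. replicate (\<gamma> i) i) index_list)"

definition midx :: "'n::finite list => 'n => nat" where
  "midx is i = count (mset is) i"

lemma prod_index_list: "(\<Prod>i\<leftarrow>index_list. g i) = (\<Prod>i\<in>(UNIV::'n::finite set). g i :: 'b::comm_monoid_mult)"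
  using prod.distinct_set_conv_list[OF index_list(1), of g] by (simp add: index_list(2))

lemma sum_index_list: "(\<Sum>i\<leftarrow>index_list. g i) = (\<Sum>i\<in>(UNIV::'n::finite set). g i :: 'b::comm_monoid_add)"
  using sum.distinct_set_conv_list[OF index_list(1), of g] by (simp add: index_list(2))

lemma prod_list_ilist: "(\<Prod>i\<leftarrow>ilist \<gamma>. g i) = (\<Prod>i\<in>UNIV. g i ^ \<gamma> i :: 'b::comm_monoid_mult)"
proof -
  have "(\<Prod>i\<leftarrow>concat (map (\<lambda>i. replicate (\<gamma> i) i) xs). g i) = (\<Prod>i\<leftarrow>xs. g i ^ \<gamma> i)" for xs
    by (induction xs) (simp_all add: map_replicate_const prod_list_replicate)
  then show ?thesis by (simp add: ilist_def prod_index_list)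
qed

lemma length_ilist: "length (ilist \<gamma>) = mlen \<gamma>"
  by (simp add: ilist_def length_concat o_def mlen_def sum_index_list)

lemma midx_ilist [simp]: "midx (ilist \<gamma>) = \<gamma>"
proof
  fix i
  have "count (mset (concat (map (\<lambda>i. replicate (\<gamma> i) i) xs))) i = (\<Sum>j\<leftarrow>xs. if j = i then \<gamma> i else 0)" for xs
    by (induction xs) auto
  then show "midx (ilist \<gamma>) i = \<gamma> i"
    by (simp add: midx_def ilist_def sum_index_list)
qed

lemma count_ilist [simp]: "count (mset (ilist \<gamma>)) i = \<gamma> i"
  using midx_ilist[of \<gamma>] unfolding midx_def fun_eq_iff by blast

lemma midx_eq_iff: "midx us = midx vs \<longleftrightarrow> mset us = mset vs"
  by (simp add: midx_def fun_eq_iff multiset_eq_iff)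

lemma mlen_midx [simp]: "mlen (midx us) = length us"
  using length_ilist[of "midx us"] midx_eq_iff[of "ilist (midx us)" us]
  by (metis midx_ilist mset_eq_length)

lemma mpd_ilist: "mpd \<gamma> f = iter_deriv (map (\<lambda>i. axis i 1) (ilist \<gamma>)) f"
  by (simp add: mpd_def ilist_def map_concat o_def)

text \<open>The given list is a permutation of \<open>ilist\<close> of its multi-index, so symmetry
  of derivatives applies.\<close>

lemma iter_deriv_mpd:
  fixes f :: "real^'n::finite => 'b::euclidean_space"
  assumes "open S" "smooth_on S f" "x \<in> S"
  shows "iter_deriv (map (\<lambda>i. axis i 1) is) f x = mpd (midx is) f x"
proof -
  have "mset is = mset (ilist (midx is))" by (simp flip: midx_eq_iff)
  then show ?thesis unfolding mpd_ilist
    by (intro iter_deriv_perm[OF assms]) simp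
qed

lemma mpd_0 [simp]: "mpd (\<lambda>_. 0) f = f"
proof -
  have "length (ilist (\<lambda>_::'a. 0)) = 0" by (simp only: length_ilist) (simp add: mlen_def)
  then show ?thesis by (simp add: mpd_ilist)
qed

lemma smooth_on_mpd: "smooth_on S f ==> smooth_on S (mpd \<gamma> f)"
  unfolding mpd_def by (rule smooth_on_iter_deriv)

lemma smooth_on_pd: "smooth_on S f ==> smooth_on S (pd i f)"
  unfolding pd_dird by (rule smooth_on_dird)

abbreviation raise :: "'n => ('n => nat) => 'n => nat" where
  "raise i \<gamma> \<equiv> \<gamma>(i := Suc (\<gamma> i))"

lemma pd_mpd:
  fixes f :: "real^'n::finite => 'b::euclidean_space"
  assumes "open S" "smooth_on S f" "x \<in> S"
  shows "pd i (mpd \<gamma> f) x = mpd (raise i \<gamma>) f x"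
proof -
  have "pd i (mpd \<gamma> f) x = iter_deriv (map (\<lambda>i. axis i 1) (i # ilist \<gamma>)) f x"
    by (simp add: pd_dird mpd_ilist)
  also have "\<dots> = mpd (midx (i # ilist \<gamma>)) f x" by (rule iter_deriv_mpd[OF assms])
  also have "midx (i # ilist \<gamma>) = raise i \<gamma>"
    by (auto simp: midx_def fun_eq_iff)
  finally show ?thesis .
qed

lemma mlen_raise [simp]: "mlen (raise i \<gamma>) = Suc (mlen \<gamma>)"
proof -
  have "mlen (raise i \<gamma>) = mlen (midx (i # ilist \<gamma>))"
    by (intro arg_cong[of _ _ mlen]) (auto simp: midx_def fun_eq_iff)
  then show ?thesis by (simp add: length_ilist)
qed

lemma finite_mlen [simp]: "finite {\<gamma> :: 'n::finite => nat. mlen \<gamma> \<le> k}"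
proof (rule finite_subset)
  show "{\<gamma> :: 'n => nat. mlen \<gamma> \<le> k} \<subseteq> PiE UNIV (\<lambda>_. {..k})"
  proof
    fix \<gamma> :: "'n => nat" assume "\<gamma> \<in> {\<gamma>. mlen \<gamma> \<le> k}"
    then have "\<gamma> i \<le> k" for i
      using member_le_sum[of i UNIV \<gamma>] by (simp add: mlen_def)
    then show "\<gamma> \<in> PiE UNIV (\<lambda>_. {..k})" by (auto simp: PiE_UNIV_domain)
  qed
  show "finite (PiE (UNIV :: 'n set) (\<lambda>_. {..k}))" by (rule finite_PiE) auto
qed

lemma finite_mlen_int [simp]: "finite {\<gamma> :: 'n::finite => nat. int (mlen \<gamma>) \<le> m}"
proof -
  have "{\<gamma> :: 'n => nat. int (mlen \<gamma>) \<le> m} \<subseteq> {\<gamma>. mlen \<gamma> \<le> nat m}" by auto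
  then show ?thesis using finite_subset finite_mlen by blast
qed

lemma Basis_vec_list:
  assumes "set vs \<subseteq> (Basis :: (real^'n::finite) set)"
  obtains us where "vs = map (\<lambda>i. axis i 1) us" "length us = length vs"
proof -
  have "\<exists>us. vs = map (\<lambda>i. axis i 1) us" using assms
  proof (induction vs)
    case (Cons v vs)
    then obtain us where "vs = map (\<lambda>i. axis i 1) us" by auto
    moreover obtain i where "v = axis i 1" using Cons.prems by (auto simp: Basis_vec_def)
    ultimately show ?case by (intro exI[of _ "i # us"]) simp
  qed simp
  then show ?thesis using that by force
qed

text \<open>The bridge between the internal calculus and the bounds in the definitions. From left to
  right, finitely many multi-indices of length at most \<open>n\<close> allow a maximum of
  constants; from right to left, derivatives along a list are first sorted into
  \<open>mpd\<close>.\<close>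

lemma c_fam_True:
  fixes F :: "'k => real^'n::finite => 'b::euclidean_space"
  assumes op: "\<And>k. k \<in> I ==> open (D k)"
  shows "c_fam True I D F \<longleftrightarrow> (\<forall>k\<in>I. smooth_on (D k) (F k)) \<and> unif_bounded_derivs I D F"
proof (intro iffI conjI)
  assume F: "c_fam True I D F"
  have "c_fam False I D F \<longleftrightarrow> (\<forall>k\<in>I. smooth_on (D k) (F k))" by (rule c_fam_False) (rule op)
  then show smF: "\<forall>k\<in>I. smooth_on (D k) (F k)" using c_fam_smooth[OF F] by simp
  have "\<exists>C. \<forall>k\<in>I. \<forall>x\<in>D k. norm (mpd \<gamma> (F k) x) \<le> C" for \<gamma>
  proof -
    have "set (map (\<lambda>i. axis i 1) (ilist \<gamma>)) \<subseteq> (Basis :: (real^'n) set)" by (auto simp: axis_in_Basis_iff)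
    then show ?thesis
      using c_fam_D[OF F, of "mlen \<gamma>", unfolded cn_fam_def, rule_format,
          of "map (\<lambda>i. axis i 1) (ilist \<gamma>)"]
      by (simp add: length_ilist mpd_ilist)
  qed
  then have "\<forall>\<gamma>. \<exists>C. \<forall>k\<in>I. \<forall>x\<in>D k. norm (mpd \<gamma> (F k) x) \<le> C" by blast
  from choice[OF this] obtain C where C: "\<And>\<gamma> k x. k \<in> I ==> x \<in> D k ==> norm (mpd \<gamma> (F k) x) \<le> C \<gamma>" by blast
  show "unif_bounded_derivs I D F"
    unfolding unif_bounded_derivs_def
  proof (intro allI exI ballI impI)
    fix n k x \<gamma> assume "k \<in> I" "x \<in> D k" "mlen (\<gamma> :: 'n => nat) \<le> n"
    then have "norm (mpd \<gamma> (F k) x) \<le> C \<gamma>" "C \<gamma> \<in> C ` {\<gamma>. mlen \<gamma> \<le> n}" by (auto intro: C)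
    then show "norm (mpd \<gamma> (F k) x) \<le> Max (C ` {\<gamma>. mlen \<gamma> \<le> n})"
      by (intro order_trans[OF _ Max_ge]) auto
  qed
next
  assume F: "(\<forall>k\<in>I. smooth_on (D k) (F k)) \<and> unif_bounded_derivs I D F"
  show "c_fam True I D F"
    unfolding c_fam_def cn_fam_def
  proof (intro allI impI conjI)
    fix n and vs :: "(real^'n) list" assume vs: "length vs \<le> n \<and> set vs \<subseteq> Basis"
    show "\<forall>k\<in>I. \<forall>x\<in>D k. iter_deriv vs (F k) differentiable at x"
      using F unfolding smooth_on_def by blast
    obtain us where us: "vs = map (\<lambda>i. axis i 1) us" "length us = length vs" using Basis_vec_list vs by blast
    obtain C where C: "\<forall>k\<in>I. \<forall>x\<in>D k. \<forall>\<gamma>. mlen \<gamma> \<le> n \<longrightarrow> norm (mpd \<gamma> (F k) x) \<le> C"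
      using F unfolding unif_bounded_derivs_def by blast
    have "norm (iter_deriv vs (F k) x) \<le> C" if "k \<in> I" "x \<in> D k" for k x
    proof -
      have "smooth_on (D k) (F k)" using F that by blast
      then have "iter_deriv vs (F k) x = mpd (midx us) (F k) x"
        unfolding us(1) by (rule iter_deriv_mpd[OF op[OF that(1)] _ that(2)])
      moreover have "mlen (midx us) \<le> n" using us vs by simp
      ultimately show ?thesis using C that by metis
    qed
    then show "\<exists>C. \<forall>k\<in>I. \<forall>x\<in>D k. norm (iter_deriv vs (F k) x) \<le> C" by blast
  qed
qed

lemma c_fam_pd:
  "(\<And>k. k \<in> I ==> open (D k)) ==> c_fam b I D F ==> c_fam b I D (\<lambda>k. pd i (F k))"
  unfolding pd_dird by (rule c_fam_dird)

lemma c_fam_component: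
  fixes F :: "'k => 'e::euclidean_space => real^'n::finite"
  assumes "\<And>k. k \<in> I ==> open (D k)" "c_fam b I D F"
  shows "c_fam b I D (\<lambda>k x. F k x $ i)"
  by (rule c_fam_linear[OF bounded_linear_vec_nth[of i] assms])

lemma c_fam_vec:
  fixes F :: "'k => 'e::euclidean_space => real^'n::finite"
  assumes op: "\<And>k. k \<in> I ==> open (D k)" and "\<And>i. c_fam b I D (\<lambda>k x. F k x $ i)"
  shows "c_fam b I D F"
proof (rule c_fam_cong[OF op])
  show "c_fam b I D (\<lambda>k x. \<Sum>i\<in>UNIV. (F k x $ i) *\<^sub>R axis i 1)"
    by (intro c_fam_sum[OF op] c_fam_linear[OF bounded_linear_scaleR_left op] assms)
  show "(\<Sum>i\<in>UNIV. (F k x $ i) *\<^sub>R axis i 1) = F k x" for k x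
    by (simp add: vec_eq_iff axis_def if_distrib cong: if_cong)
qed

lemma c_fam_id: "c_fam False I D (\<lambda>k x. x)"
  unfolding c_fam_def
proof
  fix n show "cn_fam False n I D (\<lambda>k x. x)"
  proof (cases n)
    case (Suc m)
    have "dird v (\<lambda>x. x) = (\<lambda>x. v)" for v :: 'b
      by (rule ext, rule dird_eqI[of _ "\<lambda>v. v"]) simp
    then show ?thesis unfolding Suc cn_fam_Suc
      using cn_fam_const[of False] by (auto simp: cn_fam_0)
  qed (simp add: cn_fam_0)
qed

lemma pd_compose:
  fixes g :: "real^'m::finite => real^'n::finite"
  assumes "f differentiable (at (g x))" "g differentiable (at x)"
  shows "pd i (\<lambda>x. f (g x)) x = (\<Sum>j\<in>UNIV. (pd i (\<lambda>x. g x $ j) x) *\<^sub>R pd j f (g x))"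
proof -
  have B: "(Basis :: (real^'n) set) = (\<lambda>j. axis j 1) ` UNIV" by (auto simp: Basis_vec_def)
  have "inj (\<lambda>j::'n. axis j (1::real))" by (auto simp: inj_def axis_eq_axis)
  then have "pd i (\<lambda>x. f (g x)) x = (\<Sum>j\<in>UNIV. (dird (axis i 1) g x \<bullet> axis j 1) *\<^sub>R dird (axis j 1) f (g x))"
    unfolding pd_dird dird_compose[OF assms] B by (subst sum.reindex) (auto simp: o_def)
  moreover have "dird (axis i 1) g x \<bullet> axis j 1 = pd i (\<lambda>x. g x $ j) x" for j
    unfolding pd_dird using dird_linear[OF bounded_linear_vec_nth[of j] assms(2)] by (simp add: inner_axis)
  ultimately show ?thesis by (simp add: pd_dird)
qed

lemma unif_bounded_derivsI:
  fixes F :: "'k => real^'n::finite => 'b::real_normed_vector"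
  assumes "\<And>\<gamma>. \<exists>C. \<forall>k\<in>I. \<forall>x\<in>D k. norm (mpd \<gamma> (F k) x) \<le> C"
  shows "unif_bounded_derivs I D F"
proof -
  have "\<forall>\<gamma>. \<exists>C. \<forall>k\<in>I. \<forall>x\<in>D k. norm (mpd \<gamma> (F k) x) \<le> C" using assms by blast
  from choice[OF this] obtain C where C: "\<And>\<gamma> k x. k \<in> I ==> x \<in> D k ==> norm (mpd \<gamma> (F k) x) \<le> C \<gamma>" by blast
  show ?thesis
    unfolding unif_bounded_derivs_def
  proof (intro allI exI ballI impI)
    fix n k x \<gamma> assume "k \<in> I" "x \<in> D k" "mlen (\<gamma> :: 'n => nat) \<le> n"
    then have "norm (mpd \<gamma> (F k) x) \<le> C \<gamma>" "C \<gamma> \<in> C ` {\<gamma>. mlen \<gamma> \<le> n}" by (auto intro: C)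
    then show "norm (mpd \<gamma> (F k) x) \<le> Max (C ` {\<gamma>. mlen \<gamma> \<le> n})"
      by (intro order_trans[OF _ Max_ge]) auto
  qed
qed

text \<open>The scales are constant on each chart, so division by them commutes with
  differentiation, and scale conditions become plain uniform boundedness of a quotient.\<close>

lemma c_fam_quotient:
  fixes F :: "'k => real^'n::finite => real"
  assumes op: "\<And>k. k \<in> I ==> open (D k)" and F: "c_fam b I D F" and s: "\<And>k. k \<in> I ==> 0 < s k"
    and bd: "\<And>\<gamma>. \<exists>C. \<forall>k\<in>I. \<forall>x\<in>D k. \<bar>mpd \<gamma> (F k) x\<bar> \<le> C * s k"
  shows "c_fam True I D (\<lambda>k x. F k x / s k)"
proof -
  have "c_fam False I D F \<longleftrightarrow> (\<forall>k\<in>I. smooth_on (D k) (F k))" by (rule c_fam_False) (rule op)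
  then have sm: "smooth_on (D k) (F k)" if "k \<in> I" for k using c_fam_smooth[OF F] that by simp
  have bl: "bounded_linear (\<lambda>y::real. y / c)" for c by (rule bounded_linear_divide)
  have eq: "mpd \<gamma> (\<lambda>x. F k x / s k) x = mpd \<gamma> (F k) x / s k" if "k \<in> I" "x \<in> D k" for \<gamma> k x
    unfolding mpd_def by (rule iter_deriv_linear[OF bl sm[OF that(1)] op[OF that(1)] that(2)])
  have "unif_bounded_derivs I D (\<lambda>k x. F k x / s k)"
  proof (rule unif_bounded_derivsI)
    fix \<gamma> :: "'n => nat"
    obtain C where C: "\<forall>k\<in>I. \<forall>x\<in>D k. \<bar>mpd \<gamma> (F k) x\<bar> \<le> C * s k" using bd by blast
    have "norm (mpd \<gamma> (\<lambda>x. F k x / s k) x) \<le> C" if "k \<in> I" "x \<in> D k" for k x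
      using C[rule_format, OF that] s[OF that(1)] by (simp add: eq[OF that] abs_divide abs_of_pos pos_divide_le_eq)
    then show "\<exists>C. \<forall>k\<in>I. \<forall>x\<in>D k. norm (mpd \<gamma> (\<lambda>x. F k x / s k) x) \<le> C" by blast
  qed
  moreover have "smooth_on (D k) (\<lambda>x. F k x / s k)" if "k \<in> I" for k
    by (rule smooth_on_linear[OF bl sm[OF that] op[OF that]])
  ultimately show ?thesis by (subst c_fam_True) (auto intro: op)
qed

section \<open>Cubes and cutoffs\<close>

definition ccube :: "real => (real^'n::finite) set" where
  "ccube r = {x. \<forall>i. \<bar>x $ i\<bar> \<le> r}"

lemma ccube_cbox: "(ccube r :: (real^'b::finite) set) = cbox (\<chi> i. - r) (\<chi> i. r)"
proof (rule Set.set_eqI)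
  show "x \<in> ccube r \<longleftrightarrow> x \<in> cbox (\<chi> i. - r) (\<chi> i. r)" for x :: "real^'b"
    unfolding ccube_def mem_box_cart mem_Collect_eq vec_lambda_beta by (rule iff_allI) linarith
qed

lemma compact_ccube: "compact (ccube r :: (real^'n::finite) set)"
  by (simp add: ccube_cbox compact_cbox)

lemma cube_box: "(cube r :: (real^'b::finite) set) = box (\<chi> i. - r) (\<chi> i. r)"
proof (rule Set.set_eqI)
  show "x \<in> cube r \<longleftrightarrow> x \<in> box (\<chi> i. - r) (\<chi> i. r)" for x :: "real^'b"
    unfolding cube_def mem_box_cart mem_Collect_eq vec_lambda_beta by (rule iff_allI) linarith
qed

lemma open_cube [simp, intro]: "open (cube r :: (real^'n::finite) set)"
  by (simp add: cube_box open_box)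

lemma cube_subset_ccube: "cube r \<subseteq> ccube r"
  by (auto simp: cube_def ccube_def less_imp_le)

lemma ccube_subset_cube: "r < s ==> ccube r \<subseteq> cube s"
  by (auto simp: cube_def ccube_def intro: le_less_trans)

lemma cube_mono: "r \<le> s ==> cube r \<subseteq> cube s"
  by (auto simp: cube_def intro: less_le_trans)

lemma ccube_mono: "r \<le> s ==> ccube r \<subseteq> ccube s"
  by (auto simp: ccube_def intro: order_trans)

lemma smooth_on_compose:
  fixes g :: "'e::euclidean_space => 'f::euclidean_space"
  assumes "open S" "open T" "smooth_on S g" "\<And>x. x \<in> S ==> g x \<in> T" "smooth_on T f"
  shows "smooth_on S (\<lambda>x. f (g x))"
proof -
  have g: "c_fam False {()} (\<lambda>_. S) (\<lambda>_. g)" using assms(3) by (subst c_fam_False) (auto simp: assms(1))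
  have f: "c_fam False {()} (\<lambda>_. T) (\<lambda>_. f)" using assms(5) by (subst c_fam_False) (auto simp: assms(2))
  have "c_fam False {()} (\<lambda>_. S) (\<lambda>_ x. f (g x))"
    by (rule c_fam_compose[where s = id and J = "{()}" and E = "\<lambda>_. T" and F = "\<lambda>_. f" and G = "\<lambda>_. g"])
      (use assms g f in auto)
  then show ?thesis by (subst (asm) c_fam_False) (auto simp: assms(1))
qed

lemma smooth_on_transfer: "open S ==> smooth_on S f ==> (\<And>y. y \<in> S ==> f y = g y) ==> smooth_on S g"
  by (subst smooth_on_cong[of S g f]) auto

lemma smooth_on_local: "(\<And>x. x \<in> S ==> \<exists>T. x \<in> T \<and> smooth_on T f) ==> smooth_on S f"
  unfolding smooth_on_def by blast

lemma c_fam_single: "open S ==> c_fam False I (\<lambda>_. S) (\<lambda>_. f) \<longleftrightarrow> (I = {} \<or> smooth_on S f)"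
  by (subst c_fam_False) auto

lemma c_fam_affine: "c_fam False I D (\<lambda>k x. c *\<^sub>R (x - y) :: 'e::euclidean_space)"
proof -
  have 1: "c_fam False I (\<lambda>_. UNIV) (\<lambda>k x :: 'e. x - y)"
    by (rule c_fam_diff) (auto intro: c_fam_id)
  have "c_fam False I (\<lambda>_. UNIV) (\<lambda>k x. c *\<^sub>R (x - y))"
    by (rule c_fam_linear[OF bounded_linear_scaleR_right _ 1]) auto
  then show ?thesis by (rule c_fam_reindex[where s = "\<lambda>k. k", rotated 2]) auto
qed

lemma cutoff_smooth: "cutoff \<kappa> ==> smooth_on UNIV \<kappa>"
  by (simp add: cutoff_def)

text \<open>The sup norm attains its maximum on the compact support, and the maximum is below 2
  because the support lies in the open cube. The margin leaves room for the nested cubes used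
  later.\<close>

lemma cutoff_support:
  fixes \<kappa> :: "real^'n::finite => real"
  assumes "cutoff \<kappa>"
  obtains s where "1 \<le> s" "s < 2" "\<And>x. \<kappa> x \<noteq> 0 ==> x \<in> ccube s"
proof -
  define K where "K = closure {x. \<kappa> x \<noteq> 0}"
  have K: "compact K" "K \<subseteq> cube 2" using assms by (auto simp: cutoff_def K_def)
  have sub: "{x. \<kappa> x \<noteq> 0} \<subseteq> K" unfolding K_def by (rule closure_subset)
  have "\<kappa> 0 = 1" using assms by (simp add: cutoff_def)
  then have "K \<noteq> {}" using sub by force
  have "continuous_on K infnorm" by (rule continuous_on_infnorm[OF continuous_on_id, simplified])
  then obtain y where y: "y \<in> K" "\<And>x. x \<in> K ==> infnorm x \<le> infnorm y"
    using continuous_attains_sup[OF K(1) \<open>K \<noteq> {}\<close>] by blast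
  have bd: "\<bar>x $ i\<bar> \<le> infnorm x" for x :: "real^'n" and i by (rule component_le_infnorm_cart)
  have lt: "infnorm y < 2"
  proof -
    define T where "T = range (\<lambda>i. \<bar>y $ i\<bar>)"
    have "{\<bar>y $ i\<bar> |i. i \<in> UNIV} = T" by (auto simp: T_def)
    then have "infnorm y = Sup T" by (simp add: infnorm_cart)
    also have "\<dots> = Max T" by (rule cSup_eq_Max) (auto simp: T_def)
    also have "\<dots> \<in> T" by (rule Max_in) (auto simp: T_def)
    finally show ?thesis using y(1) K(2) by (auto simp: cube_def T_def)
  qed
  show ?thesis
  proof (rule that[of "max 1 (infnorm y)"])
    fix x assume "\<kappa> x \<noteq> 0"
    then have "infnorm x \<le> infnorm y" using sub y(2) by blast
    then have "\<bar>x $ i\<bar> \<le> max 1 (infnorm y)" for i using bd[of x i] by simp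
    then show "x \<in> ccube (max 1 (infnorm y))" by (simp add: ccube_def)
  qed (use lt in auto)
qed

text \<open>Scaled translates of the given cutoff serve as bump functions.\<close>

lemma cutoff_between:
  fixes \<kappa> :: "real^'n::finite => real"
  assumes \<kappa>: "cutoff \<kappa>" and K: "compact K" and d: "d > 0"
  obtains \<kappa>' :: "real^'n => real" where "smooth_on UNIV \<kappa>'" "\<And>x. x \<in> K ==> \<kappa>' x = 1"
    "\<And>x. \<kappa>' x \<noteq> 0 ==> \<exists>y\<in>K. \<forall>i. \<bar>x $ i - y $ i\<bar> < d"
proof -
  \<comment> \<open>\<open>\<kappa>\<close> is supported where all coordinates are below 2 in
    absolute value and equals 1 where they are at most 1. After scaling by \<open>l\<close> the
    support around \<open>y\<close> has size \<open>d\<close>, and the value 1 is taken on the small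
    cube \<open>N y\<close>.\<close>
  define l where "l = 2 / d"
  have l: "l > 0" using d by (simp add: l_def)
  define N where "N = (\<lambda>y::real^'n. {x. x - y \<in> cube (1/l)})"
  have N: "open (N y)" "y \<in> N y" for y
  proof -
    have "N y = (\<lambda>x. x - y) -` cube (1/l)" by (auto simp: N_def)
    moreover have "continuous_on UNIV (\<lambda>x. x - y)" by (intro continuous_intros)
    ultimately show "open (N y)" by (simp add: open_vimage)
    show "y \<in> N y" using l by (simp add: N_def cube_def)
  qed
  obtain Y where Y: "Y \<subseteq> K" "finite Y" "K \<subseteq> (\<Union>y\<in>Y. N y)"
  proof (rule compactE_image[OF K, of K N])
    show "K \<subseteq> (\<Union>y\<in>K. N y)" using N(2) by blast
  qed (use N(1) in auto)
  \<comment> \<open>This combination is 1 as soon as one translate is 1, and 0 where all translates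
    vanish; no division by a sum is involved.\<close>
  define \<kappa>' where "\<kappa>' = (\<lambda>x. 1 - (\<Prod>y\<in>Y. 1 - \<kappa> (l *\<^sub>R (x - y))))"
  show ?thesis
  proof (rule that[of \<kappa>'])
    have "smooth_on UNIV (\<lambda>x. \<kappa> (l *\<^sub>R (x - y)))" for y
    proof (rule smooth_on_compose[OF open_UNIV open_UNIV _ _ cutoff_smooth[OF \<kappa>]])
      show "smooth_on UNIV (\<lambda>x. l *\<^sub>R (x - y))"
        using c_fam_affine[of "{()}" "\<lambda>_. UNIV" l y] by (simp add: c_fam_single)
    qed simp
    then have 1: "c_fam False {()} (\<lambda>_. UNIV) (\<lambda>_ x. \<kappa> (l *\<^sub>R (x - y)))" for y by (simp add: c_fam_single)
    have "c_fam False {()} (\<lambda>_. UNIV) (\<lambda>_ x. 1 - \<kappa> (l *\<^sub>R (x - y)))" for y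
      by (rule c_fam_diff[OF _ c_fam_const' 1]) simp
    then have "c_fam False {()} (\<lambda>_. UNIV) (\<lambda>_ x. \<Prod>y\<in>Y. 1 - \<kappa> (l *\<^sub>R (x - y)))"
      by (intro c_fam_prod) simp
    then have "c_fam False {()} (\<lambda>_. UNIV) (\<lambda>_ x. 1 - (\<Prod>y\<in>Y. 1 - \<kappa> (l *\<^sub>R (x - y))))"
      by (rule c_fam_diff[OF _ c_fam_const', rotated]) simp
    then have "c_fam False {()} (\<lambda>_. UNIV) (\<lambda>_. \<kappa>')"
      unfolding \<kappa>'_def .
    then show "smooth_on UNIV \<kappa>'" by (simp add: c_fam_single)
    show "\<kappa>' x = 1" if xK: "x \<in> K" for x
    proof -
      obtain y where y: "y \<in> Y" "x \<in> N y" using Y(3) xK by blast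
      have "\<bar>(l *\<^sub>R (x - y)) $ i\<bar> \<le> 1" for i
      proof -
        have "\<bar>x $ i - y $ i\<bar> < 1 / l" using y(2) by (simp add: N_def cube_def)
        then have "l * \<bar>x $ i - y $ i\<bar> \<le> 1" using l by (simp add: field_simps)
        moreover have "\<bar>(l *\<^sub>R (x - y)) $ i\<bar> = l * \<bar>x $ i - y $ i\<bar>" using l by (simp add: abs_mult)
        ultimately show ?thesis by simp
      qed
      then have "\<kappa> (l *\<^sub>R (x - y)) = 1" using \<kappa> unfolding cutoff_def by blast
      then have "(\<Prod>y\<in>Y. 1 - \<kappa> (l *\<^sub>R (x - y))) = 0" using y(1) Y(2) by (intro prod_zero) auto
      then show ?thesis by (simp add: \<kappa>'_def)
    qed
    show "\<exists>y\<in>K. \<forall>i. \<bar>x $ i - y $ i\<bar> < d" if nz: "\<kappa>' x \<noteq> 0" for x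
    proof -
      have "(\<Prod>y\<in>Y. 1 - \<kappa> (l *\<^sub>R (x - y))) \<noteq> 1" using nz by (simp add: \<kappa>'_def)
      then obtain y where y: "y \<in> Y" "\<kappa> (l *\<^sub>R (x - y)) \<noteq> 0" by (metis (mono_tags, lifting) diff_zero prod.neutral)
      have "l *\<^sub>R (x - y) \<in> closure {x. \<kappa> x \<noteq> 0}" by (rule subsetD[OF closure_subset]) (simp add: y(2))
      moreover have "closure {x. \<kappa> x \<noteq> 0} \<subseteq> cube 2" using \<kappa> by (simp add: cutoff_def)
      ultimately have l2: "l *\<^sub>R (x - y) \<in> cube 2" by blast
      have "\<bar>x $ i - y $ i\<bar> < d" for i
      proof -
        have "\<bar>(l *\<^sub>R (x - y)) $ i\<bar> = l * \<bar>x $ i - y $ i\<bar>" using l by (simp add: abs_mult)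
        moreover have "\<bar>(l *\<^sub>R (x - y)) $ i\<bar> < 2" using l2 unfolding cube_def by blast
        ultimately show ?thesis using d by (simp add: l_def field_simps)
      qed
      then show ?thesis using y(1) Y(1) by blast
    qed
  qed
qed

lemma cutoff_between_cubes:
  fixes \<kappa> :: "real^'n::finite => real"
  assumes \<kappa>: "cutoff \<kappa>" and "r < s"
  obtains \<kappa>' :: "real^'n => real" where "smooth_on UNIV \<kappa>'" "\<And>x. x \<in> ccube r ==> \<kappa>' x = 1"
    "\<And>x. \<kappa>' x \<noteq> 0 ==> x \<in> ccube s"
proof -
  obtain \<kappa>' :: "real^'n => real" where k: "smooth_on UNIV \<kappa>'" "\<And>x. x \<in> ccube r ==> \<kappa>' x = 1"
    "\<And>x. \<kappa>' x \<noteq> 0 ==> \<exists>y\<in>ccube r. \<forall>i. \<bar>x $ i - y $ i\<bar> < s - r"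
    using cutoff_between[OF \<kappa> compact_ccube, of "s - r" r] assms(2) by auto
  have "x \<in> ccube s" if x: "\<kappa>' x \<noteq> 0" for x
    unfolding ccube_def
  proof (intro CollectI allI)
    fix i
    obtain y where "y \<in> ccube r" "\<bar>x $ i - y $ i\<bar> < s - r" using k(3)[OF x] by blast
    moreover have "\<bar>y $ i\<bar> \<le> r" using \<open>y \<in> ccube r\<close> by (simp add: ccube_def)
    ultimately show "\<bar>x $ i\<bar> \<le> s" by linarith
  qed
  then show ?thesis using that k by blast
qed

section \<open>Charts of a scaled bounded geometry structure\<close>

locale scaled_bg =
  fixes M :: "('a::t2_space, 'n::finite) atlas" and B :: "('i, 'a, 'n) scaled_bg_data"
  assumes atlas: "smooth_atlas M" and sbg: "scaled_bg_structure M B"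
begin

abbreviation "I \<equiv> indices B"
abbreviation "U \<equiv> nbhd B"
abbreviation "\<phi> \<equiv> coord B"
abbreviation "\<psi> \<equiv> param B"
abbreviation "cfam \<equiv> c_fam True I (\<lambda>_. cube 2)"

definition ov :: "'i \<times> 'i => (real^'n) set" where
  "ov = (\<lambda>(\<alpha>, \<beta>). \<phi> \<alpha> ` (U \<alpha> \<inter> U \<beta>))"

definition trans :: "'i \<times> 'i => real^'n => real^'n" where
  "trans = (\<lambda>(\<alpha>, \<beta>). transition B B \<alpha> \<beta>)"

lemma bg: "bg_structure M B" using sbg by (simp add: scaled_bg_structure_def)

lemma open_U: "\<alpha> \<in> I ==> open (U \<alpha>)" using bg by (simp add: bg_structure_def)

lemma diffeo: "\<alpha> \<in> I ==> diffeo_onto M (U \<alpha>) (\<phi> \<alpha>) (cube 2)" using bg by (simp add: bg_structure_def)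

lemma homeo: "\<alpha> \<in> I ==> homeomorphism (U \<alpha>) (cube 2) (\<phi> \<alpha>) (\<psi> \<alpha>)"
  using diffeo by (simp add: diffeo_onto_def param_def)

lemma coord_in: "\<alpha> \<in> I ==> q \<in> U \<alpha> ==> \<phi> \<alpha> q \<in> cube 2"
  using homeo[of \<alpha>] unfolding homeomorphism_def by blast

lemma param_in: "\<alpha> \<in> I ==> x \<in> cube 2 ==> \<psi> \<alpha> x \<in> U \<alpha>"
  using homeo[of \<alpha>] unfolding homeomorphism_def by blast

lemma param_coord: "\<alpha> \<in> I ==> q \<in> U \<alpha> ==> \<psi> \<alpha> (\<phi> \<alpha> q) = q"
  using homeo[of \<alpha>] unfolding homeomorphism_def by blast

lemma coord_param: "\<alpha> \<in> I ==> x \<in> cube 2 ==> \<phi> \<alpha> (\<psi> \<alpha> x) = x"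
  using homeo[of \<alpha>] unfolding homeomorphism_def by blast

lemma continuous_coord: "\<alpha> \<in> I ==> continuous_on (U \<alpha>) (\<phi> \<alpha>)"
  using homeo[of \<alpha>] unfolding homeomorphism_def by blast

lemma continuous_param: "\<alpha> \<in> I ==> continuous_on (cube 2) (\<psi> \<alpha>)"
  using homeo[of \<alpha>] unfolding homeomorphism_def by blast

lemma coord_image: "\<alpha> \<in> I ==> \<phi> \<alpha> ` (U \<alpha> \<inter> V) = {x \<in> cube 2. \<psi> \<alpha> x \<in> V}"
  using coord_in param_in coord_param param_coord by (force simp: image_iff)

lemma param_image: "\<alpha> \<in> I ==> A \<subseteq> cube 2 ==> \<psi> \<alpha> ` A = {q \<in> U \<alpha>. \<phi> \<alpha> q \<in> A}"
  using coord_in param_in coord_param param_coord by (force simp: image_iff subset_iff)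

lemma open_coord_image:
  assumes "\<alpha> \<in> I" "open V"
  shows "open (\<phi> \<alpha> ` (U \<alpha> \<inter> V))"
proof -
  have "\<phi> \<alpha> ` (U \<alpha> \<inter> V) = cube 2 \<inter> \<psi> \<alpha> -` V" using coord_image[OF assms(1)] by auto
  then show ?thesis using continuous_open_preimage[OF continuous_param[OF assms(1)] open_cube assms(2)] by simp
qed

lemma open_param_image:
  assumes "\<alpha> \<in> I" "open A" "A \<subseteq> cube 2"
  shows "open (\<psi> \<alpha> ` A)"
proof -
  have "\<psi> \<alpha> ` A = U \<alpha> \<inter> \<phi> \<alpha> -` A" using param_image[OF assms(1,3)] by auto
  then show ?thesis using continuous_open_preimage[OF continuous_coord[OF assms(1)] open_U[OF assms(1)] assms(2)] by simp
qed

lemma closed_param_image: "\<alpha> \<in> I ==> compact A ==> A \<subseteq> cube 2 ==> closed (\<psi> \<alpha> ` A)"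
  by (intro compact_imp_closed compact_continuous_image continuous_on_subset[OF continuous_param]) auto

lemma open_ov: "k \<in> I \<times> I ==> open (ov k)"
  by (auto simp: ov_def intro!: open_coord_image open_U)

lemma ov_eq: "\<alpha> \<in> I ==> ov (\<alpha>, \<beta>) = {x \<in> cube 2. \<psi> \<alpha> x \<in> U \<beta>}"
  by (simp add: ov_def coord_image)

lemma trans_eq: "trans (\<alpha>, \<beta>) x = \<phi> \<beta> (\<psi> \<alpha> x)"
  by (simp add: trans_def transition_def)

lemma trans_in: "\<alpha> \<in> I ==> \<beta> \<in> I ==> x \<in> ov (\<alpha>, \<beta>) ==> trans (\<alpha>, \<beta>) x \<in> ov (\<beta>, \<alpha>)"
  by (simp add: ov_eq trans_eq coord_in param_coord param_in)

lemma trans_trans: "\<alpha> \<in> I ==> \<beta> \<in> I ==> x \<in> ov (\<alpha>, \<beta>) ==> trans (\<beta>, \<alpha>) (trans (\<alpha>, \<beta>) x) = x"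
  by (simp add: ov_eq trans_eq coord_param param_coord)

lemma param_trans: "\<beta> \<in> I ==> \<alpha> \<in> I ==> x \<in> ov (\<alpha>, \<beta>) ==> \<psi> \<beta> (trans (\<alpha>, \<beta>) x) = \<psi> \<alpha> x"
  by (simp add: ov_eq trans_eq param_coord)

lemma covered: obtains \<alpha> where "\<alpha> \<in> I" "q \<in> U \<alpha>" "\<phi> \<alpha> q \<in> cube 1"
proof -
  have "q \<in> (\<Union>\<alpha>\<in>I. {q \<in> U \<alpha>. \<phi> \<alpha> q \<in> cube 1})" using bg by (simp add: bg_structure_def)
  then show ?thesis using that by blast
qed

lemma scl_pos: "\<alpha> \<in> I ==> 0 < scl B \<alpha> $ i" and scl_le_1: "\<alpha> \<in> I ==> scl B \<alpha> $ i \<le> 1"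
  using sbg by (auto simp: scaled_bg_structure_def)

text \<open>\<open>diffeo_onto\<close> compares a chart only with charts of the atlas, so two such
  charts are compared through an atlas chart around each point.\<close>

lemma smooth_charts:
  assumes "diffeo_onto M V1 \<theta>1 S1" "diffeo_onto M V2 \<theta>2 S2" "open V1" "open V2" "open S1"
  shows "smooth_on (\<theta>1 ` (V1 \<inter> V2)) (\<theta>2 \<circ> inv_into V1 \<theta>1)"
proof (rule smooth_on_local)
  fix x assume "x \<in> \<theta>1 ` (V1 \<inter> V2)"
  then obtain q where q: "q \<in> V1" "q \<in> V2" "x = \<theta>1 q" by blast
  have "q \<in> (\<Union>(U, \<psi>)\<in>M. U)" using atlas by (simp add: smooth_atlas_def)
  then obtain W \<theta> where W: "(W, \<theta>) \<in> M" "q \<in> W" by blast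
  have hW: "open W" "open (\<theta> ` W)" "homeomorphism W (\<theta> ` W) \<theta> (inv_into W \<theta>)"
    using atlas W(1) unfolding smooth_atlas_def by blast+
  have h1: "homeomorphism V1 S1 \<theta>1 (inv_into V1 \<theta>1)" using assms(1) by (simp add: diffeo_onto_def)
  have op1: "open (\<theta>1 ` (V1 \<inter> A))" if "open A" for A
  proof -
    have "\<theta>1 ` (V1 \<inter> A) = S1 \<inter> inv_into V1 \<theta>1 -` A"
      using h1 unfolding homeomorphism_def by (force simp: image_iff)
    moreover have "continuous_on S1 (inv_into V1 \<theta>1)" using h1 by (simp add: homeomorphism_def)
    ultimately show ?thesis using continuous_open_preimage[OF _ assms(5) that] by simp
  qed
  have opW: "open (\<theta> ` (W \<inter> A))" if "open A" for A
  proof -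
    have "\<theta> ` (W \<inter> A) = \<theta> ` W \<inter> inv_into W \<theta> -` A"
      using hW(3) unfolding homeomorphism_def by (force simp: image_iff)
    moreover have "continuous_on (\<theta> ` W) (inv_into W \<theta>)" using hW by (simp add: homeomorphism_def)
    ultimately show ?thesis using continuous_open_preimage[OF _ hW(2) that] by simp
  qed
  have inv1: "inv_into V1 \<theta>1 (\<theta>1 p) = p" if "p \<in> V1" for p using h1 that by (simp add: homeomorphism_def)
  have invW: "inv_into W \<theta> (\<theta> p) = p" if "p \<in> W" for p using hW(3) that by (simp add: homeomorphism_def)
  define T where "T = \<theta>1 ` (V1 \<inter> (V2 \<inter> W))"
  have T: "open T" unfolding T_def by (intro op1 open_Int assms hW)
  have s1: "smooth_on T (\<theta> \<circ> inv_into V1 \<theta>1)"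
    using assms(1) W(1) unfolding diffeo_onto_def T_def by (blast intro: smooth_on_subset)
  have s2: "smooth_on (\<theta> ` (V2 \<inter> W)) (\<theta>2 \<circ> inv_into W \<theta>)"
    using assms(2) W(1) unfolding diffeo_onto_def by blast
  have o2: "open (\<theta> ` (V2 \<inter> W))" using opW[OF assms(4)] by (simp add: Int_commute)
  have "smooth_on T (\<lambda>x. (\<theta>2 \<circ> inv_into W \<theta>) ((\<theta> \<circ> inv_into V1 \<theta>1) x))"
    by (rule smooth_on_compose[OF T o2 s1 _ s2]) (auto simp: T_def inv1)
  moreover have "(\<theta>2 \<circ> inv_into W \<theta>) ((\<theta> \<circ> inv_into V1 \<theta>1) x) = (\<theta>2 \<circ> inv_into V1 \<theta>1) x" if "x \<in> T" for x
    using that by (auto simp: T_def inv1 invW)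
  ultimately have "smooth_on T (\<theta>2 \<circ> inv_into V1 \<theta>1)" by (rule smooth_on_transfer[OF T])
  moreover have "x \<in> T" using q W by (auto simp: T_def)
  ultimately show "\<exists>T. x \<in> T \<and> smooth_on T (\<theta>2 \<circ> inv_into V1 \<theta>1)" by blast
qed

lemma c_fam_trans: "c_fam True (I \<times> I) ov trans"
proof -
  have "smooth_on (ov k) (trans k)" if kI: "k \<in> I \<times> I" for k
  proof -
    obtain \<alpha> \<beta> where k: "k = (\<alpha>, \<beta>)" "\<alpha> \<in> I" "\<beta> \<in> I" using kI by blast
    show ?thesis
      using smooth_charts[OF diffeo diffeo open_U open_U open_cube, OF k(2,3,2,3)]
      by (simp add: k ov_def trans_def transition_def param_def)
  qed
  moreover have "unif_bounded_derivs (I \<times> I) ov trans"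
    using bg by (simp add: bg_structure_def ov_def trans_def)
  ultimately show ?thesis by (subst c_fam_True) (auto intro: open_ov)
qed

text \<open>This quotient is an entry of the Jacobian of the transition map with respect to the
  scaled coordinate frames of both charts. The scale condition says precisely that this matrix is
  uniformly smooth.\<close>

lemma c_fam_scale:
  "c_fam True (I \<times> I) ov (\<lambda>k y. scl B (fst k) $ i * pd i (\<lambda>z. trans k z $ j) y / scl B (snd k) $ j)"
proof (rule c_fam_quotient[OF open_ov])
  show "c_fam True (I \<times> I) ov (\<lambda>k y. scl B (fst k) $ i * pd i (\<lambda>z. trans k z $ j) y)"
    by (intro c_fam_mult open_ov c_fam_pd c_fam_component c_fam_trans c_fam_const)
      (auto intro!: exI[of _ 1] simp: less_imp_le scl_pos scl_le_1)
  show "0 < scl B (snd k) $ j" if "k \<in> I \<times> I" for k using that scl_pos by auto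
  fix \<gamma> :: "'n => nat"
  have "scale_bounds B B (\<lambda>\<alpha> \<beta>. nbhd B \<alpha> \<inter> nbhd B \<beta>)" using sbg by (simp add: scaled_bg_structure_def)
  then obtain C where "\<forall>\<alpha>\<in>I. \<forall>\<beta>\<in>I. \<forall>x\<in>\<phi> \<alpha> ` (U \<alpha> \<inter> U \<beta>). \<forall>i j.
      \<bar>mpd \<gamma> (\<lambda>y. scl B \<alpha> $ i * pd i (\<lambda>z. transition B B \<alpha> \<beta> z $ j) y) x\<bar> \<le> C * scl B \<beta> $ j"
    unfolding scale_bounds_def by blast
  then show "\<exists>C. \<forall>k\<in>I\<times>I. \<forall>x\<in>ov k. \<bar>mpd \<gamma> (\<lambda>y. scl B (fst k) $ i * pd i (\<lambda>z. trans k z $ j) y) x\<bar> \<le> C * scl B (snd k) $ j"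
    by (intro exI[of _ C]) (auto simp: ov_def trans_def)
qed

text \<open>Smoothness refers to the atlas; both directions pass locally through the change between
  an atlas chart and a chart of the structure.\<close>

lemma smooth_fun_iff:
  fixes f :: "'a => 'b::real_normed_vector"
  shows "smooth_fun M f \<longleftrightarrow> (\<forall>\<alpha>\<in>I. smooth_on (cube 2) (\<lambda>x. f (\<psi> \<alpha> x)))"
proof
  assume f: "smooth_fun M f"
  show "\<forall>\<alpha>\<in>I. smooth_on (cube 2) (\<lambda>x. f (\<psi> \<alpha> x))"
  proof (intro ballI smooth_on_local)
    fix \<alpha> and x :: "real^'n" assume \<alpha>: "\<alpha> \<in> I" and x: "x \<in> cube 2"
    have "\<psi> \<alpha> x \<in> (\<Union>(U, \<psi>)\<in>M. U)" using atlas by (simp add: smooth_atlas_def)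
    then obtain W \<theta> where W: "(W, \<theta>) \<in> M" "\<psi> \<alpha> x \<in> W" by blast
    have hW: "open W" "open (\<theta> ` W)" "homeomorphism W (\<theta> ` W) \<theta> (inv_into W \<theta>)"
      using atlas W(1) unfolding smooth_atlas_def by blast+
    define T where "T = \<phi> \<alpha> ` (U \<alpha> \<inter> W)"
    have T: "open T" "x \<in> T" unfolding T_def using open_coord_image[OF \<alpha> hW(1)] W x by (auto simp: coord_image[OF \<alpha>])
    have s1: "smooth_on T (\<theta> \<circ> \<psi> \<alpha>)"
      using diffeo[OF \<alpha>] W(1) unfolding diffeo_onto_def T_def param_def by blast
    have s2: "smooth_on (\<theta> ` W) (f \<circ> inv_into W \<theta>)" using f W(1) unfolding smooth_fun_def by blast
    have Tx: "\<psi> \<alpha> y \<in> W" if "y \<in> T" for y using that unfolding T_def coord_image[OF \<alpha>] by simp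
    have "smooth_on T (\<lambda>y. (f \<circ> inv_into W \<theta>) ((\<theta> \<circ> \<psi> \<alpha>) y))"
      by (rule smooth_on_compose[OF T(1) hW(2) s1 _ s2]) (auto simp: Tx)
    moreover have "(f \<circ> inv_into W \<theta>) ((\<theta> \<circ> \<psi> \<alpha>) y) = f (\<psi> \<alpha> y)" if "y \<in> T" for y
      using hW(3) Tx[OF that] by (simp add: homeomorphism_def)
    ultimately have "smooth_on T (\<lambda>y. f (\<psi> \<alpha> y))"
      by (rule smooth_on_transfer[OF T(1)])
    then show "\<exists>T. x \<in> T \<and> smooth_on T (\<lambda>x. f (\<psi> \<alpha> x))" using T by blast
  qed
next
  assume f: "\<forall>\<alpha>\<in>I. smooth_on (cube 2) (\<lambda>x. f (\<psi> \<alpha> x))"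
  show "smooth_fun M f"
    unfolding smooth_fun_def
  proof (clarify, rule smooth_on_local)
    fix W \<theta> x assume W: "(W, \<theta>) \<in> M" and "x \<in> \<theta> ` W"
    then obtain q where q: "q \<in> W" "x = \<theta> q" by blast
    obtain \<alpha> where \<alpha>: "\<alpha> \<in> I" "q \<in> U \<alpha>" using covered by blast
    have hW: "open W" "open (\<theta> ` W)" "homeomorphism W (\<theta> ` W) \<theta> (inv_into W \<theta>)"
      using atlas W(1) unfolding smooth_atlas_def by blast+
    define T where "T = \<theta> ` (U \<alpha> \<inter> W)"
    have "T = \<theta> ` W \<inter> inv_into W \<theta> -` U \<alpha>"
      using hW(3) unfolding homeomorphism_def T_def by (force simp: image_iff)
    moreover have "continuous_on (\<theta> ` W) (inv_into W \<theta>)" using hW by (simp add: homeomorphism_def)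
    ultimately have T: "open T" using continuous_open_preimage[OF _ hW(2) open_U[OF \<alpha>(1)]] by simp
    have s1: "smooth_on T (\<phi> \<alpha> \<circ> inv_into W \<theta>)"
      using diffeo[OF \<alpha>(1)] W unfolding diffeo_onto_def T_def by blast
    have inv: "inv_into W \<theta> (\<theta> p) = p" if "p \<in> W" for p using hW(3) that by (simp add: homeomorphism_def)
    have "smooth_on T (\<lambda>y. f (\<psi> \<alpha> ((\<phi> \<alpha> \<circ> inv_into W \<theta>) y)))"
      using f \<alpha> by (intro smooth_on_compose[OF T open_cube s1]) (auto simp: T_def inv coord_in)
    moreover have "f (\<psi> \<alpha> ((\<phi> \<alpha> \<circ> inv_into W \<theta>) y)) = (f \<circ> inv_into W \<theta>) y" if "y \<in> T" for y
      using that \<alpha> by (auto simp: T_def inv param_coord)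
    ultimately have "smooth_on T (f \<circ> inv_into W \<theta>)"
      by (rule smooth_on_transfer[OF T])
    moreover have "x \<in> T" using q \<alpha> by (auto simp: T_def)
    ultimately show "\<exists>T. x \<in> T \<and> smooth_on T (f \<circ> inv_into W \<theta>)" by blast
  qed
qed

lemma c_fam_smooth_fun:
  fixes f :: "'a => 'b::real_normed_vector"
  shows "smooth_fun M f \<longleftrightarrow> c_fam False I (\<lambda>_. cube 2) (\<lambda>\<alpha> x. f (\<psi> \<alpha> x))"
  unfolding smooth_fun_iff by (subst c_fam_False) auto

lemma C_uni_iff:
  fixes f :: "'a => 'b::euclidean_space"
  shows "f \<in> C_uni M B \<longleftrightarrow> cfam (\<lambda>\<alpha> x. f (\<psi> \<alpha> x))"
  unfolding C_uni_def by (subst c_fam_True) (auto simp: smooth_fun_iff o_def)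

end

lemma c_fam_weaken: "c_fam True I D F ==> c_fam b I D F"
  unfolding c_fam_def cn_fam_def by blast

lemma c_fam_smooth_cube:
  fixes f :: "real^'n::finite => 'b::real_normed_vector"
  assumes f: "smooth_on UNIV f" and D: "\<And>k. k \<in> I ==> D k \<subseteq> ccube r"
  shows "c_fam b I D (\<lambda>_. f)"
  unfolding c_fam_def cn_fam_def
proof (intro allI impI conjI ballI)
  fix n :: nat and vs :: "(real^'n) list"
  show "iter_deriv vs f differentiable (at x)" for x using f unfolding smooth_on_def by blast
  have "continuous_on (ccube r) (iter_deriv vs f)"
    by (rule continuous_on_subset[OF smooth_on_continuous_on[OF smooth_on_iter_deriv[OF f]]]) simp
  then have "bounded (iter_deriv vs f ` ccube r)"
    by (intro compact_imp_bounded compact_continuous_image compact_ccube)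
  then obtain C where C: "\<And>x. x \<in> ccube r ==> norm (iter_deriv vs f x) \<le> C"
    unfolding bounded_iff by auto
  have "\<forall>k\<in>I. \<forall>x\<in>D k. norm (iter_deriv vs f x) \<le> C" using C D by auto
  then show "\<exists>C. \<forall>k\<in>I. \<forall>x\<in>D k. norm (iter_deriv vs f x) \<le> C" ..
qed

section \<open>Uniform local finiteness and colouring of shrunken charts\<close>

context scaled_bg
begin

lemma finite_charts:
  obtains A0 where "\<And>q. finite {\<beta> \<in> I. q \<in> U \<beta>}" "\<And>q. card {\<beta> \<in> I. q \<in> U \<beta>} \<le> A0"
proof -
  obtain A0 :: nat where A0: "\<And>J. J \<subseteq> I ==> finite J ==> card J = A0 + 1 ==> (\<Inter>\<alpha>\<in>J. U \<alpha>) = {}"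
  proof -
    have "\<exists>A0::nat. \<forall>J\<subseteq>I. finite J \<and> card J = A0 + 1 \<longrightarrow> (\<Inter>\<alpha>\<in>J. U \<alpha>) = {}"
      using bg unfolding bg_structure_def by (elim conjE)
    then obtain A0 :: nat where A0: "\<forall>J\<subseteq>I. finite J \<and> card J = A0 + 1 \<longrightarrow> (\<Inter>\<alpha>\<in>J. U \<alpha>) = {}" ..
    show ?thesis by (rule that[of A0]) (use A0 in auto)
  qed
  have no: False if J: "J \<subseteq> {\<beta> \<in> I. q \<in> U \<beta>}" "finite J" "card J = A0 + 1" for J q
  proof -
    have "J \<subseteq> I" using J(1) by blast
    then have "(\<Inter>\<alpha>\<in>J. U \<alpha>) = {}" by (rule A0) (rule J)+
    moreover have "q \<in> (\<Inter>\<alpha>\<in>J. U \<alpha>)" using J(1) by blast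
    ultimately show False by simp
  qed
  have fin: "finite {\<beta> \<in> I. q \<in> U \<beta>}" for q
  proof (rule ccontr)
    assume "infinite {\<beta> \<in> I. q \<in> U \<beta>}"
    then obtain J where "finite J" "card J = A0 + 1" "J \<subseteq> {\<beta> \<in> I. q \<in> U \<beta>}"
      using infinite_arbitrarily_large by meson
    then show False using no by simp
  qed
  have "card {\<beta> \<in> I. q \<in> U \<beta>} \<le> A0" for q
  proof (rule ccontr)
    assume "\<not> card {\<beta> \<in> I. q \<in> U \<beta>} \<le> A0"
    then have "A0 + 1 \<le> card {\<beta> \<in> I. q \<in> U \<beta>}" by simp
    then obtain J where "J \<subseteq> {\<beta> \<in> I. q \<in> U \<beta>}" "card J = A0 + 1" "finite J"
      by (rule obtain_subset_with_card_n)
    then show False using no by simp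
  qed
  with fin show ?thesis by (rule that)
qed

definition kc :: "real => 'i => 'a set" where
  "kc r \<alpha> = {q \<in> U \<alpha>. \<phi> \<alpha> q \<in> ccube r}"

lemma kc_image: "\<alpha> \<in> I ==> r < 2 ==> kc r \<alpha> = \<psi> \<alpha> ` ccube r"
  by (simp add: kc_def param_image[OF _ ccube_subset_cube])

text \<open>The image of a compact cube is compact, hence closed in a Hausdorff space. The radius is
  below 2 so that the closed cube lies in the domain of the parametrization.\<close>

lemma closed_kc: "\<alpha> \<in> I ==> r < 2 ==> closed (kc r \<alpha>)"
  by (simp add: kc_image closed_param_image compact_ccube ccube_subset_cube)

text \<open>Overlaps of charts need not be convex, so the derivative bound yields a Lipschitz
  estimate only along segments that stay in the overlap.\<close>

lemma trans_lipschitz: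
  obtains L where "L \<ge> 0"
    "\<And>\<alpha> \<beta> x a. \<alpha> \<in> I ==> \<beta> \<in> I ==> (\<And>t. 0 \<le> t ==> t \<le> 1 ==> x + t *\<^sub>R a \<in> ov (\<alpha>, \<beta>)) ==>
      norm (trans (\<alpha>, \<beta>) (x + a) - trans (\<alpha>, \<beta>) x) \<le> norm a * L"
proof -
  have "\<exists>C. C > 0 \<and> (\<forall>k\<in>I \<times> I. \<forall>x\<in>ov k. norm (pd i (trans k) x) \<le> C)" for i
  proof -
    have 1: "c_fam True (I \<times> I) ov (\<lambda>k. pd i (trans k))"
      by (rule c_fam_pd[OF open_ov c_fam_trans])
    show ?thesis by (rule c_fam_bound[OF 1]) auto
  qed
  then have "\<forall>i. \<exists>C. C > 0 \<and> (\<forall>k\<in>I \<times> I. \<forall>x\<in>ov k. norm (pd i (trans k) x) \<le> C)" by blast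
  from choice[OF this] obtain C where
    C: "\<And>i. C i > 0" "\<And>i k x. k \<in> I \<times> I ==> x \<in> ov k ==> norm (pd i (trans k) x) \<le> C i" by blast
  define L where "L = (\<Sum>i\<in>UNIV. C i)"
  show ?thesis
  proof (rule that[of L])
    show "L \<ge> 0" unfolding L_def using C(1) by (intro sum_nonneg) (simp add: less_imp_le)
    fix \<alpha> \<beta> and x a :: "real^'n"
    assume ab: "\<alpha> \<in> I" "\<beta> \<in> I" and seg: "\<And>t. 0 \<le> t ==> t \<le> 1 ==> x + t *\<^sub>R a \<in> ov (\<alpha>, \<beta>)"
    have k: "(\<alpha>, \<beta>) \<in> I \<times> I" using ab by simp
    have der: "(trans (\<alpha>, \<beta>) has_derivative (\<lambda>v. dird v (trans (\<alpha>, \<beta>)) y)) (at y)" if "y \<in> ov (\<alpha>, \<beta>)" for y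
      by (rule has_derivative_dird[OF c_fam_differentiable[OF c_fam_trans k that]])
    have on: "onorm (\<lambda>v. dird v (trans (\<alpha>, \<beta>)) y) \<le> L" if y: "y \<in> ov (\<alpha>, \<beta>)" for y
    proof (rule onorm_le)
      fix v :: "real^'n"
      have lin: "linear (\<lambda>v. dird v (trans (\<alpha>, \<beta>)) y)" using has_derivative_linear[OF der[OF y]] .
      have "(\<Sum>i\<in>UNIV. (v $ i) *\<^sub>R axis i 1) = v"
        using basis_expansion[of v] by (simp add: scalar_mult_eq_scaleR)
      then have "dird v (trans (\<alpha>, \<beta>)) y = dird (\<Sum>i\<in>UNIV. (v $ i) *\<^sub>R axis i 1) (trans (\<alpha>, \<beta>)) y"
        by simp
      also have "\<dots> = (\<Sum>i\<in>UNIV. (v $ i) *\<^sub>R pd i (trans (\<alpha>, \<beta>)) y)"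
        using linear_sum[OF lin, of "\<lambda>i. (v $ i) *\<^sub>R axis i 1" UNIV] linear_scale[OF lin] by (simp add: pd_dird)
      also have "norm \<dots> \<le> (\<Sum>i\<in>UNIV. norm ((v $ i) *\<^sub>R pd i (trans (\<alpha>, \<beta>)) y))" by (rule norm_sum)
      also have "\<dots> \<le> (\<Sum>i\<in>UNIV. norm v * C i)"
        by (intro sum_mono) (auto intro!: mult_mono component_le_norm_cart C(2)[OF k y])
      finally show "norm (dird v (trans (\<alpha>, \<beta>)) y) \<le> L * norm v"
        by (simp add: L_def sum_distrib_left mult.commute)
    qed
    show "norm (trans (\<alpha>, \<beta>) (x + a) - trans (\<alpha>, \<beta>) x) \<le> norm a * L"
    proof (rule differentiable_bound_segment[where f' = "\<lambda>y v. dird v (trans (\<alpha>, \<beta>)) y" and G = "ov (\<alpha>, \<beta>)"])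
      show "\<And>t. t \<in> {0..1} ==> x + t *\<^sub>R a \<in> ov (\<alpha>, \<beta>)" using seg by simp
      show "\<And>y. y \<in> ov (\<alpha>, \<beta>) ==> (trans (\<alpha>, \<beta>) has_derivative (\<lambda>v. dird v (trans (\<alpha>, \<beta>)) y)) (at y within ov (\<alpha>, \<beta>))"
        by (rule has_derivative_at_withinI[OF der])
      show "\<And>t. t \<in> {0..1} ==> onorm (\<lambda>v. dird v (trans (\<alpha>, \<beta>)) (x + t *\<^sub>R a)) \<le> L"
        by (rule on) (use seg in auto)
    qed
  qed
qed

text \<open>
  A line segment issuing from a point of two shrunken charts stays in both charts for a uniform
  time: by the Lipschitz bound its image in the second chart cannot leave a fixed compact cube.
\<close>

lemma overlap_ball:
  assumes s: "s < 2"
  obtains e where "e > 0"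
    "\<And>\<alpha> \<beta> q y. \<alpha> \<in> I ==> \<beta> \<in> I ==> q \<in> kc s \<alpha> ==> q \<in> kc s \<beta> ==> dist (\<phi> \<alpha> q) y < e ==> y \<in> ov (\<alpha>, \<beta>)"
proof -
  obtain L where L: "L \<ge> 0"
    "\<And>\<alpha> \<beta> x a. \<alpha> \<in> I ==> \<beta> \<in> I ==> (\<And>t. 0 \<le> t ==> t \<le> 1 ==> x + t *\<^sub>R a \<in> ov (\<alpha>, \<beta>)) ==>
      norm (trans (\<alpha>, \<beta>) (x + a) - trans (\<alpha>, \<beta>) x) \<le> norm a * L"
    using trans_lipschitz by blast
  \<comment> \<open>Half of the gap between \<open>s\<close> and 2. A displacement below
    \<open>e\<close> keeps the segment in the first chart because \<open>e \<le> d\<close>, and its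
    image in the closed cube of radius \<open>s + d\<close> because
    \<open>e * L \<le> d\<close>.\<close>
  define d where "d = (2 - s) / 2"
  define e where "e = d / (L + 1)"
  have d: "d > 0" "s + d < 2" using s by (auto simp: d_def field_simps)
  have e: "e > 0" "e * L \<le> d" "e \<le> d"
    using d(1) L(1) by (auto simp: e_def field_simps)
  show ?thesis
  proof (rule that[OF e(1)])
    fix \<alpha> \<beta> q and y :: "real^'n"
    assume ab: "\<alpha> \<in> I" "\<beta> \<in> I" and q: "q \<in> kc s \<alpha>" "q \<in> kc s \<beta>" and y: "dist (\<phi> \<alpha> q) y < e"
    define x where "x = \<phi> \<alpha> q"
    define a where "a = y - x"
    have qU: "q \<in> U \<alpha>" "q \<in> U \<beta>" and xs: "x \<in> ccube s" and qs: "\<phi> \<beta> q \<in> ccube s"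
      using q by (auto simp: kc_def x_def)
    have na: "norm a < e" using y by (simp add: a_def x_def dist_norm norm_minus_commute)
    have seg2: "x + t *\<^sub>R a \<in> cube 2" if t: "0 \<le> t" "t \<le> 1" for t
      unfolding cube_def
    proof (intro CollectI allI)
      fix i
      have "\<bar>(t *\<^sub>R a) $ i\<bar> \<le> norm (t *\<^sub>R a)" by (rule component_le_norm_cart)
      also have "\<dots> \<le> norm a" using t by (simp add: mult_left_le_one_le)
      finally have "\<bar>(t *\<^sub>R a) $ i\<bar> < d" using na e(3) by linarith
      moreover have "\<bar>x $ i\<bar> \<le> s" using xs by (simp add: ccube_def)
      ultimately show "\<bar>(x + t *\<^sub>R a) $ i\<bar> < 2" using d(2) by simp
    qed
    define Z where "Z = {t \<in> {0..1}. x + t *\<^sub>R a \<notin> ov (\<alpha>, \<beta>)}"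
    have "Z = {}"
    proof (rule ccontr)
      assume ne: "Z \<noteq> {}"
      have cont: "continuous_on {0..1} (\<lambda>t::real. x + t *\<^sub>R a)" by (intro continuous_intros)
      have "Z = {0..1} \<inter> (\<lambda>t. x + t *\<^sub>R a) -` (- ov (\<alpha>, \<beta>))" by (auto simp: Z_def)
      moreover have "closed (- ov (\<alpha>, \<beta>))" using open_ov ab by (simp add: closed_Compl)
      ultimately have "closed Z" using continuous_closed_preimage[OF cont closed_atLeastAtMost] by simp
      moreover have "bounded Z" by (rule bounded_subset[of "{0..1}"]) (auto simp: Z_def)
      ultimately have "compact Z" by (simp add: compact_eq_bounded_closed)
      \<comment> \<open>The first time at which the segment leaves the overlap: a least one exists
        because the overlap is open, and it is positive because the segment starts inside.\<close>
      then obtain t0 where t0: "t0 \<in> Z" "\<And>t. t \<in> Z ==> t0 \<le> t" using compact_attains_inf[OF _ ne] by blast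
      have t01: "0 \<le> t0" "t0 \<le> 1" "x + t0 *\<^sub>R a \<notin> ov (\<alpha>, \<beta>)" using t0(1) by (auto simp: Z_def)
      have "x \<in> ov (\<alpha>, \<beta>)" using qU ab by (auto simp: ov_eq x_def coord_in param_coord)
      then have t0p: "0 < t0" using t01 by (cases "t0 = 0") auto
      have before: "x + t *\<^sub>R a \<in> ov (\<alpha>, \<beta>)" if "0 \<le> t" "t < t0" for t
      proof (rule ccontr)
        assume "x + t *\<^sub>R a \<notin> ov (\<alpha>, \<beta>)"
        then have "t \<in> Z" using that t01 by (simp add: Z_def)
        then show False using t0(2) that by fastforce
      qed
      have K: "\<psi> \<alpha> (x + t *\<^sub>R a) \<in> kc (s + d) \<beta>" if t: "0 \<le> t" "t < t0" for t
      proof -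
        have xt: "x + t *\<^sub>R a \<in> ov (\<alpha>, \<beta>)" by (rule before[OF t])
        have "norm (trans (\<alpha>, \<beta>) (x + t *\<^sub>R a) - trans (\<alpha>, \<beta>) x) \<le> norm (t *\<^sub>R a) * L"
        proof (rule L(2)[OF ab])
          fix r :: real assume r: "0 \<le> r" "r \<le> 1"
          have "r * t \<le> 1 * t" using r t by (intro mult_right_mono) auto
          then have "0 \<le> r * t" "r * t < t0" using r t by auto
          from before[OF this] show "x + r *\<^sub>R t *\<^sub>R a \<in> ov (\<alpha>, \<beta>)" by simp
        qed
        also have "norm (t *\<^sub>R a) * L \<le> norm a * L"
          using t t01 L(1) by (intro mult_right_mono) (auto simp: mult_left_le_one_le)
        also have "\<dots> \<le> e * L" using na L(1) by (intro mult_right_mono) auto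
        also have "\<dots> \<le> d" by (rule e(2))
        finally have nd: "norm (trans (\<alpha>, \<beta>) (x + t *\<^sub>R a) - trans (\<alpha>, \<beta>) x) \<le> d" .
        have tx: "trans (\<alpha>, \<beta>) x \<in> ccube s" using qs qU ab by (simp add: trans_eq x_def param_coord)
        have "trans (\<alpha>, \<beta>) (x + t *\<^sub>R a) \<in> ccube (s + d)"
          unfolding ccube_def
        proof (intro CollectI allI)
          fix i
          have "\<bar>(trans (\<alpha>, \<beta>) (x + t *\<^sub>R a) - trans (\<alpha>, \<beta>) x) $ i\<bar> \<le> d"
            using component_le_norm_cart nd order_trans by blast
          moreover have "\<bar>trans (\<alpha>, \<beta>) x $ i\<bar> \<le> s" using tx by (simp add: ccube_def)
          ultimately show "\<bar>trans (\<alpha>, \<beta>) (x + t *\<^sub>R a) $ i\<bar> \<le> s + d" by simp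
        qed
        moreover have "\<psi> \<alpha> (x + t *\<^sub>R a) \<in> U \<beta>" using xt ab by (simp add: ov_eq)
        ultimately show ?thesis by (simp add: kc_def trans_eq)
      qed
      define f where "f = (\<lambda>t. \<psi> \<alpha> (x + t *\<^sub>R a))"
      have cf: "continuous_on {0..1} f" unfolding f_def
        by (rule continuous_on_compose2[OF continuous_param[OF ab(1)] cont]) (use seg2 in auto)
      have "closed (kc (s + d) \<beta>)" using closed_kc ab(2) d(2) by simp
      then have cl: "closed ({0..1} \<inter> f -` kc (s + d) \<beta>)"
        by (rule continuous_closed_preimage[OF cf closed_atLeastAtMost])
      \<comment> \<open>Before \<open>t0\<close> the segment lies in a set that is closed in the
        manifold and contained in the second chart. So the limit point at \<open>t0\<close> is still
        in the overlap, contrary to the choice of \<open>t0\<close>.\<close>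
      have "closure {0<..<t0} \<subseteq> {0..1} \<inter> f -` kc (s + d) \<beta>"
        by (rule closure_minimal[OF _ cl]) (use K t01 in \<open>auto simp: f_def\<close>)
      moreover have "t0 \<in> closure {0<..<t0}" using t0p by (simp add: closure_greaterThanLessThan)
      ultimately have "f t0 \<in> U \<beta>" by (auto simp: kc_def)
      then have "x + t0 *\<^sub>R a \<in> ov (\<alpha>, \<beta>)" using seg2[OF t01(1,2)] ab by (simp add: ov_eq f_def)
      then show False using t01(3) by simp
    qed
    then have "x + 1 *\<^sub>R a \<in> ov (\<alpha>, \<beta>)" unfolding Z_def by auto
    then show "y \<in> ov (\<alpha>, \<beta>)" by (simp add: a_def)
  qed
qed

text \<open>A common point of two shrunken charts puts a net point of the first cube into the
  overlap, by \<open>overlap_ball\<close>. So each neighbour contains one of the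
  \<open>card Y\<close> net points, and at most \<open>A0\<close> charts pass through each of
  these.\<close>

lemma neighbours_bound:
  assumes s: "s < 2"
  obtains N where "\<And>\<alpha>. \<alpha> \<in> I ==> finite {\<beta> \<in> I. kc s \<alpha> \<inter> kc s \<beta> \<noteq> {}}"
    "\<And>\<alpha>. \<alpha> \<in> I ==> card {\<beta> \<in> I. kc s \<alpha> \<inter> kc s \<beta> \<noteq> {}} \<le> N"
proof -
  obtain e where e: "e > 0"
    "\<And>\<alpha> \<beta> q y. \<alpha> \<in> I ==> \<beta> \<in> I ==> q \<in> kc s \<alpha> ==> q \<in> kc s \<beta> ==> dist (\<phi> \<alpha> q) y < e ==> y \<in> ov (\<alpha>, \<beta>)"
    using overlap_ball[OF s] by blast
  obtain A0 where A0: "\<And>q. finite {\<beta> \<in> I. q \<in> U \<beta>}" "\<And>q. card {\<beta> \<in> I. q \<in> U \<beta>} \<le> A0"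
    using finite_charts by blast
  obtain Y where Y: "Y \<subseteq> (ccube s :: (real^'n) set)" "finite Y" "ccube s \<subseteq> (\<Union>y\<in>Y. ball y e)"
  proof (rule compactE_image[OF compact_ccube, of "ccube s" "\<lambda>y. ball y e"])
    show "(ccube s :: (real^'n) set) \<subseteq> (\<Union>y\<in>ccube s. ball y e)" using e(1) by auto
  qed auto
  have sub: "{\<beta> \<in> I. kc s \<alpha> \<inter> kc s \<beta> \<noteq> {}} \<subseteq> (\<Union>y\<in>Y. {\<beta> \<in> I. \<psi> \<alpha> y \<in> U \<beta>})" if \<alpha>: "\<alpha> \<in> I" for \<alpha>
  proof
    fix \<beta> assume "\<beta> \<in> {\<beta> \<in> I. kc s \<alpha> \<inter> kc s \<beta> \<noteq> {}}"
    then obtain q where q: "\<beta> \<in> I" "q \<in> kc s \<alpha>" "q \<in> kc s \<beta>" by blast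
    then have "\<phi> \<alpha> q \<in> ccube s" by (simp add: kc_def)
    then obtain y where y: "y \<in> Y" "dist y (\<phi> \<alpha> q) < e" using Y(3) by auto
    then have "y \<in> ov (\<alpha>, \<beta>)" using e(2)[OF \<alpha> q] by (simp add: dist_commute)
    then show "\<beta> \<in> (\<Union>y\<in>Y. {\<beta> \<in> I. \<psi> \<alpha> y \<in> U \<beta>})" using y(1) q(1) \<alpha> by (auto simp: ov_eq)
  qed
  show ?thesis
  proof (rule that[of "card Y * A0"])
    fix \<alpha> assume \<alpha>: "\<alpha> \<in> I"
    have fin: "finite (\<Union>y\<in>Y. {\<beta> \<in> I. \<psi> \<alpha> y \<in> U \<beta>})" using Y(2) A0(1) by simp
    then show "finite {\<beta> \<in> I. kc s \<alpha> \<inter> kc s \<beta> \<noteq> {}}" by (rule finite_subset[OF sub[OF \<alpha>]])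
    have "card {\<beta> \<in> I. kc s \<alpha> \<inter> kc s \<beta> \<noteq> {}} \<le> card (\<Union>y\<in>Y. {\<beta> \<in> I. \<psi> \<alpha> y \<in> U \<beta>})"
      by (rule card_mono[OF fin sub[OF \<alpha>]])
    also have "\<dots> \<le> (\<Sum>y\<in>Y. card {\<beta> \<in> I. \<psi> \<alpha> y \<in> U \<beta>})" by (rule card_UN_le[OF Y(2)])
    also have "\<dots> \<le> (\<Sum>y\<in>Y. A0)" by (rule sum_mono[OF A0(2)])
    finally show "card {\<beta> \<in> I. kc s \<alpha> \<inter> kc s \<beta> \<noteq> {}} \<le> card Y * A0" by simp
  qed
qed

text \<open>Greedy colouring along an enumeration of the countable index set: an index has at most
  \<open>N\<close> neighbours, so one of the \<open>N + 1\<close> colours from 0 to \<open>N\<close>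
  is left free by those already coloured.\<close>

lemma colouring_exists:
  assumes s: "s < 2"
  shows "\<exists>(col :: 'i => nat) N. (\<forall>\<alpha>\<in>I. col \<alpha> < N) \<and>
    (\<forall>\<alpha>\<in>I. \<forall>\<beta>\<in>I. \<alpha> \<noteq> \<beta> \<longrightarrow> col \<alpha> = col \<beta> \<longrightarrow> kc s \<alpha> \<inter> kc s \<beta> = {})"
proof -
  obtain N where N: "\<And>\<alpha>. \<alpha> \<in> I ==> finite {\<beta> \<in> I. kc s \<alpha> \<inter> kc s \<beta> \<noteq> {}}"
    "\<And>\<alpha>. \<alpha> \<in> I ==> card {\<beta> \<in> I. kc s \<alpha> \<inter> kc s \<beta> \<noteq> {}} \<le> N"
    using neighbours_bound[OF s] by blast
  have cI: "countable I" using bg by (simp add: bg_structure_def)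
  define en where "en = to_nat_on I"
  define dec where "dec = inv_into I en"
  have inj: "inj_on en I" unfolding en_def by (rule inj_on_to_nat_on[OF cI])
  have dec: "dec (en \<alpha>) = \<alpha>" if "\<alpha> \<in> I" for \<alpha> unfolding dec_def using inj that by (rule inv_into_f_f)
  define nb where "nb = (\<lambda>m n. m \<in> en ` I \<and> n \<in> en ` I \<and> kc s (dec m) \<inter> kc s (dec n) \<noteq> {})"
  \<comment> \<open>\<open>P f n r\<close> admits the colour \<open>r\<close> at stage
    \<open>n\<close>. It looks at \<open>f\<close> below \<open>n\<close> only, as dependent choice
    along the natural numbers demands.\<close>
  define P where "P = (\<lambda>(f :: nat => nat) n r. r \<le> N \<and> (\<forall>m<n. nb m n \<longrightarrow> f m \<noteq> r))"
  have "\<exists>f. \<forall>n. P f n (f n)"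
  proof (rule dependent_wellorder_choice)
    show "P f n r = P g n r" if "\<And>m. m < n ==> f m = g m" for r f g n
      using that by (auto simp: P_def)
    show "\<exists>r. P f n r" for n f
    proof -
      have "\<exists>r\<le>N. r \<notin> f ` {m. m < n \<and> nb m n}"
      proof (cases "n \<in> en ` I")
        case True
        then obtain \<alpha> where \<alpha>: "\<alpha> \<in> I" "n = en \<alpha>" by blast
        define S where "S = {m. m < n \<and> nb m n}"
        have "S \<subseteq> en ` {\<beta> \<in> I. kc s \<alpha> \<inter> kc s \<beta> \<noteq> {}}"
        proof
          fix m assume "m \<in> S"
          then obtain \<beta> where "\<beta> \<in> I" "m = en \<beta>" "kc s (dec m) \<inter> kc s (dec n) \<noteq> {}" by (auto simp: S_def nb_def)
          then show "m \<in> en ` {\<beta> \<in> I. kc s \<alpha> \<inter> kc s \<beta> \<noteq> {}}" using \<alpha> dec by (auto simp: Int_commute)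
        qed
        then have "card S \<le> card (en ` {\<beta> \<in> I. kc s \<alpha> \<inter> kc s \<beta> \<noteq> {}})"
          by (rule card_mono[OF finite_imageI[OF N(1)[OF \<alpha>(1)]]])
        also have "\<dots> \<le> card {\<beta> \<in> I. kc s \<alpha> \<inter> kc s \<beta> \<noteq> {}}" by (rule card_image_le[OF N(1)[OF \<alpha>(1)]])
        also have "\<dots> \<le> N" by (rule N(2)[OF \<alpha>(1)])
        finally have "card S \<le> N" .
        moreover have "finite S" by (rule finite_subset[of _ "{..<n}"]) (auto simp: S_def)
        ultimately have "card (f ` S) < card {..N}" using card_image_le[of S f] by simp
        then have "\<not> {..N} \<subseteq> f ` S" using card_mono[of "f ` S" "{..N}"] \<open>finite S\<close> by fastforce
        then show ?thesis unfolding S_def by auto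
      qed (auto simp: nb_def)
      then show ?thesis unfolding P_def by (auto simp: image_iff)
    qed
  qed
  then obtain f where f: "\<And>n. P f n (f n)" by blast
  have sep: "kc s \<alpha> \<inter> kc s \<beta> = {}" if "\<alpha> \<in> I" "\<beta> \<in> I" "en \<alpha> < en \<beta>" "f (en \<alpha>) = f (en \<beta>)" for \<alpha> \<beta>
  proof (rule ccontr)
    assume "kc s \<alpha> \<inter> kc s \<beta> \<noteq> {}"
    then have "nb (en \<alpha>) (en \<beta>)" using that(1,2) by (simp add: nb_def dec)
    then show False using f[of "en \<beta>"] that(3,4) unfolding P_def by metis
  qed
  show ?thesis
  proof (intro exI conjI ballI impI)
    show "(f \<circ> en) \<alpha> < Suc N" if "\<alpha> \<in> I" for \<alpha> using f[of "en \<alpha>"] by (simp add: P_def)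
    fix \<alpha> \<beta> assume ab: "\<alpha> \<in> I" "\<beta> \<in> I" "\<alpha> \<noteq> \<beta>" "(f \<circ> en) \<alpha> = (f \<circ> en) \<beta>"
    then have "en \<alpha> \<noteq> en \<beta>" using inj by (auto dest: inj_onD)
    then show "kc s \<alpha> \<inter> kc s \<beta> = {}"
      using sep[of \<alpha> \<beta>] sep[of \<beta> \<alpha>] ab by (cases "en \<alpha> < en \<beta>") auto
  qed
qed

text \<open>A locally finite union of closed sets is closed; by \<open>neighbours_bound\<close> only
  finitely many members occur near \<open>q\<close>.\<close>

lemma closed_Union_kc:
  assumes A: "A \<subseteq> I" and r: "r < 2"
  shows "closed (\<Union>\<alpha>\<in>A. kc r \<alpha>)"
  unfolding closed_def
proof (subst open_subopen, intro ballI)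
  fix q assume q: "q \<in> - (\<Union>\<alpha>\<in>A. kc r \<alpha>)"
  obtain \<beta> where \<beta>: "\<beta> \<in> I" "q \<in> U \<beta>" "\<phi> \<beta> q \<in> cube 1" using covered by blast
  \<comment> \<open>At least 1, so that the unit cube of the chart \<open>\<beta>\<close> around
    \<open>q\<close> lies in \<open>kc s \<beta>\<close>, and at least \<open>r\<close>, so that
    \<open>kc r \<alpha>\<close> lies in \<open>kc s \<alpha>\<close>.\<close>
  define s where "s = max 1 r"
  have s: "s < 2" "1 \<le> s" "r \<le> s" using r by (auto simp: s_def)
  obtain N where N: "\<And>\<alpha>. \<alpha> \<in> I ==> finite {\<beta> \<in> I. kc s \<alpha> \<inter> kc s \<beta> \<noteq> {}}"
    using neighbours_bound[OF s(1)] by blast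
  define J where "J = {\<alpha> \<in> A. kc s \<beta> \<inter> kc s \<alpha> \<noteq> {}}"
  have "finite J" by (rule finite_subset[OF _ N[OF \<beta>(1)]]) (use A in \<open>auto simp: J_def\<close>)
  define T where "T = \<psi> \<beta> ` cube 1 - (\<Union>\<alpha>\<in>J. kc r \<alpha>)"
  have c12: "cube 1 \<subseteq> (cube 2 :: (real^'n) set)" by (rule cube_mono) simp
  have "closed (kc r \<alpha>)" if "\<alpha> \<in> J" for \<alpha> using closed_kc[of \<alpha> r] that A r by (auto simp: J_def)
  then have "closed (\<Union>\<alpha>\<in>J. kc r \<alpha>)" using \<open>finite J\<close> by (intro closed_UN) auto
  then have "open T" unfolding T_def by (intro open_Diff open_param_image \<beta>(1) c12) auto
  moreover have "q \<in> T" using q \<beta> by (auto simp: T_def J_def param_image[OF \<beta>(1) c12])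
  moreover have "T \<subseteq> - (\<Union>\<alpha>\<in>A. kc r \<alpha>)"
  proof
    fix p assume p: "p \<in> T"
    show "p \<in> - (\<Union>\<alpha>\<in>A. kc r \<alpha>)"
    proof
      assume "p \<in> (\<Union>\<alpha>\<in>A. kc r \<alpha>)"
      then obtain \<alpha> where \<alpha>: "\<alpha> \<in> A" "p \<in> kc r \<alpha>" by blast
      have "p \<in> kc s \<alpha>" using \<alpha>(2) ccube_mono[OF s(3)] by (auto simp: kc_def)
      moreover have "p \<in> kc s \<beta>"
        using p cube_subset_ccube[of 1] ccube_mono[OF s(2)] by (auto simp: T_def param_image[OF \<beta>(1) c12] kc_def)
      ultimately have "\<alpha> \<in> J" using \<alpha>(1) by (auto simp: J_def)
      then show False using p \<alpha>(2) by (auto simp: T_def)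
    qed
  qed
  ultimately show "\<exists>T. open T \<and> q \<in> T \<and> T \<subseteq> - (\<Union>\<alpha>\<in>A. kc r \<alpha>)" by blast
qed

text \<open>The chart domain and the complement of the closed set \<open>kc r \<alpha>\<close> cover
  the manifold. On the first the function is smooth by the transition maps, on the second it is
  zero.\<close>

lemma smooth_extension:
  assumes \<alpha>: "\<alpha> \<in> I" and r: "r < 2" and h: "smooth_on (cube 2) h" and z: "\<And>x. x \<notin> ccube r ==> h x = 0"
  shows "smooth_fun M (\<lambda>q. if q \<in> U \<alpha> then h (\<phi> \<alpha> q) else 0)"
  unfolding smooth_fun_iff
proof (intro ballI smooth_on_local)
  fix \<beta> and x :: "real^'n" assume \<beta>: "\<beta> \<in> I" and x: "x \<in> cube 2"
  let ?f = "\<lambda>x. if \<psi> \<beta> x \<in> U \<alpha> then h (\<phi> \<alpha> (\<psi> \<beta> x)) else 0"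
  show "\<exists>T. x \<in> T \<and> smooth_on T ?f"
  proof (cases "\<psi> \<beta> x \<in> U \<alpha>")
    case True
    have k: "(\<beta>, \<alpha>) \<in> I \<times> I" using \<alpha> \<beta> by simp
    have o: "open (ov (\<beta>, \<alpha>))" by (rule open_ov[OF k])
    have "smooth_on (ov (\<beta>, \<alpha>)) (trans (\<beta>, \<alpha>))"
      using c_fam_smooth[OF c_fam_trans] k by (subst (asm) c_fam_False) (auto intro: open_ov)
    then have "smooth_on (ov (\<beta>, \<alpha>)) (\<lambda>x. h (trans (\<beta>, \<alpha>) x))"
      by (rule smooth_on_compose[OF o open_cube _ _ h]) (use \<alpha> \<beta> in \<open>auto simp: ov_eq trans_eq coord_in\<close>)
    then have "smooth_on (ov (\<beta>, \<alpha>)) ?f"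
      by (rule smooth_on_transfer[OF o]) (use \<beta> in \<open>auto simp: ov_eq trans_eq\<close>)
    then show ?thesis using True x \<beta> by (intro exI[of _ "ov (\<beta>, \<alpha>)"]) (simp add: ov_eq)
  next
    case False
    define T where "T = \<phi> \<beta> ` (U \<beta> \<inter> (- kc r \<alpha>))"
    have T: "open T" unfolding T_def using closed_kc[OF \<alpha> r] by (intro open_coord_image[OF \<beta>]) auto
    have "smooth_on T (\<lambda>_. 0)" using c_fam_single[OF T, of "{()}" "\<lambda>_. 0"] c_fam_const'[of False "{()}" "\<lambda>_. T" 0] by simp
    then have "smooth_on T ?f"
      by (rule smooth_on_transfer[OF T]) (auto simp: T_def coord_image[OF \<beta>] kc_def z)
    then show ?thesis using False x by (intro exI[of _ T]) (simp add: T_def coord_image[OF \<beta>] kc_def)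
  qed
qed

end

lemma (in scaled_bg) finite_charts_at: "finite {\<beta> \<in> I. q \<in> U \<beta>}"
proof (rule finite_charts)
  assume "\<And>q. finite {\<beta> \<in> I. q \<in> U \<beta>}"
  then show ?thesis by simp
qed

section \<open>Sums over charts of one colour\<close>

locale coloured_bg = scaled_bg M B
  for M :: "('a::t2_space, 'n::finite) atlas" and B :: "('i, 'a, 'n) scaled_bg_data" +
  fixes s :: real and col :: "'i => nat" and N :: nat
  assumes s_ge: "1 \<le> s" and s_less: "s < 2"
    and col_less: "\<alpha> \<in> I ==> col \<alpha> < N"
    and col_sep: "\<alpha> \<in> I ==> \<beta> \<in> I ==> \<alpha> \<noteq> \<beta> ==> col \<alpha> = col \<beta> ==> kc s \<alpha> \<inter> kc s \<beta> = {}"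
begin

text \<open>At most one summand is present, since the sets \<open>kc s \<alpha>\<close> of one
  colour are disjoint. The form of a sum avoids choosing the chart and gives 0 off all of
  them.\<close>

definition csum :: "nat => ('i => real^'n => 'b::comm_monoid_add) => 'a => 'b" where
  "csum c h q = (\<Sum>\<alpha> | \<alpha> \<in> I \<and> col \<alpha> = c \<and> q \<in> kc s \<alpha>. h \<alpha> (\<phi> \<alpha> q))"

lemma csum_in:
  assumes "\<alpha> \<in> I" "col \<alpha> = c" "q \<in> kc s \<alpha>"
  shows "csum c h q = h \<alpha> (\<phi> \<alpha> q)"
proof -
  have "{\<alpha> \<in> I. col \<alpha> = c \<and> q \<in> kc s \<alpha>} = {\<alpha>}" using assms col_sep by blast
  then show ?thesis unfolding csum_def by simp
qed

lemma csum_param: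
  assumes "\<alpha> \<in> I" "col \<alpha> = c" "x \<in> ccube s"
  shows "csum c h (\<psi> \<alpha> x) = h \<alpha> x"
proof -
  have x: "x \<in> cube 2" using assms(3) ccube_subset_cube[OF s_less] by blast
  have "\<psi> \<alpha> x \<in> kc s \<alpha>" using assms x by (simp add: kc_def param_in coord_param)
  then show ?thesis using csum_in[OF assms(1,2), of "\<psi> \<alpha> x" h] x assms(1) by (simp add: coord_param)
qed

lemma csum_out: "(\<And>\<alpha>. \<alpha> \<in> I ==> col \<alpha> = c ==> q \<notin> kc s \<alpha>) ==> csum c h q = 0"
  unfolding csum_def by (rule sum.neutral) auto

lemma csum_cases:
  obtains (out) "\<And>\<alpha>. \<alpha> \<in> I ==> col \<alpha> = c ==> q \<notin> kc s \<alpha>"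
  | (inside) \<alpha> where "\<alpha> \<in> I" "col \<alpha> = c" "q \<in> kc s \<alpha>"
  by blast

lemma finite_kc: "finite {\<alpha> \<in> I. q \<in> kc r \<alpha>}"
proof -
  have "{\<alpha> \<in> I. q \<in> kc r \<alpha>} \<subseteq> {\<beta> \<in> I. q \<in> U \<beta>}" by (auto simp: kc_def)
  then show ?thesis using finite_charts_at by (rule finite_subset)
qed

text \<open>Patching over all charts becomes a sum of \<open>N\<close> globally defined functions,
  one for each colour. Charts containing \<open>q\<close> outside their shrunken part contribute 0
  on the left.\<close>

lemma sum_charts:
  assumes z: "\<And>\<alpha> x. \<alpha> \<in> I ==> x \<in> cube 2 ==> x \<notin> ccube s ==> h \<alpha> x = 0"
  shows "(\<Sum>\<alpha> | \<alpha> \<in> I \<and> q \<in> U \<alpha>. h \<alpha> (\<phi> \<alpha> q)) = (\<Sum>c<N. csum c h q)"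
proof -
  note fin = finite_charts_at
  have "(\<Sum>\<alpha> | \<alpha> \<in> I \<and> q \<in> U \<alpha>. h \<alpha> (\<phi> \<alpha> q)) = (\<Sum>\<alpha> | \<alpha> \<in> I \<and> q \<in> kc s \<alpha>. h \<alpha> (\<phi> \<alpha> q))"
    by (rule sum.mono_neutral_right[OF fin]) (auto simp: kc_def coord_in intro: z)
  also have "\<dots> = (\<Sum>c<N. \<Sum>\<alpha> \<in> {\<alpha> \<in> {\<alpha> \<in> I. q \<in> kc s \<alpha>}. col \<alpha> = c}. h \<alpha> (\<phi> \<alpha> q))"
    by (rule sum.group[OF finite_kc, symmetric]) (auto simp: col_less)
  also have "\<dots> = (\<Sum>c<N. csum c h q)"
    unfolding csum_def by (intro sum.cong refl) auto
  finally show ?thesis .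
qed

text \<open>\<open>h (\<alpha>, \<beta>)\<close> may depend on the viewing chart
  \<open>\<beta>\<close>, as coefficients of vector fields do. Seen from \<open>\<beta>\<close>, the
  open parts \<open>cube s\<close> of the charts of one colour and the complement of their closed
  parts \<open>kc r\<close> cover everything because \<open>r < s\<close>. On the former
  \<open>h\<close> is pulled back by a transition map, on the latter the sum is 0.\<close>

lemma c_fam_csum:
  fixes h :: "'i \<times> 'i => real^'n => 'b::real_normed_vector"
  assumes r: "r < s" and h: "c_fam b (I \<times> I) ov h"
    and z: "\<And>\<alpha> \<beta> x. \<alpha> \<in> I ==> \<beta> \<in> I ==> x \<notin> ccube r ==> h (\<alpha>, \<beta>) x = 0"
  shows "c_fam b I (\<lambda>_. cube 2) (\<lambda>\<beta> x. csum c (\<lambda>\<alpha>. h (\<alpha>, \<beta>)) (\<psi> \<beta> x))"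
proof -
  define F where "F = (\<lambda>\<beta> x. csum c (\<lambda>\<alpha>. h (\<alpha>, \<beta>)) (\<psi> \<beta> x))"
  define A where "A = {\<alpha> \<in> I. col \<alpha> = c}"
  define E where "E = (\<lambda>(\<beta>, \<alpha>). \<phi> \<beta> ` (U \<beta> \<inter> \<psi> \<alpha> ` cube s))"
  define D1 where "D1 = (\<lambda>\<beta>. \<Union>\<alpha>\<in>A. E (\<beta>, \<alpha>))"
  define D2 where "D2 = (\<lambda>\<beta>. \<phi> \<beta> ` (U \<beta> \<inter> - (\<Union>\<alpha>\<in>A. kc r \<alpha>)))"
  have r2: "r < 2" using r s_less by simp
  have cs: "cube s \<subseteq> (cube 2 :: (real^'n) set)" using cube_mono s_less by (simp add: cube_mono)
  have A: "A \<subseteq> I" by (auto simp: A_def)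
  have E: "E (\<beta>, \<alpha>) = {x \<in> cube 2. \<psi> \<beta> x \<in> U \<alpha> \<and> \<phi> \<alpha> (\<psi> \<beta> x) \<in> cube s}" if "\<alpha> \<in> I" "\<beta> \<in> I" for \<alpha> \<beta>
    using that by (auto simp: E_def coord_image param_image[OF _ cs])
  have opE: "open (E k)" if k: "k \<in> I \<times> A" for k
  proof -
    obtain \<beta> \<alpha> where k': "k = (\<beta>, \<alpha>)" "\<beta> \<in> I" "\<alpha> \<in> I" using k A by blast
    show ?thesis unfolding k'(1) E_def prod.case
      by (rule open_coord_image[OF k'(2) open_param_image[OF k'(3) open_cube cs]])
  qed
  have Esub: "E (\<beta>, \<alpha>) \<subseteq> ov (\<beta>, \<alpha>)" if "\<alpha> \<in> I" "\<beta> \<in> I" for \<alpha> \<beta>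
    using that by (auto simp: E ov_eq)
  have 1: "c_fam b (I \<times> A) E (\<lambda>(\<beta>, \<alpha>). F \<beta>)"
  proof (rule c_fam_cong[OF opE])
    have tr: "c_fam b (I \<times> A) E trans"
    proof (rule c_fam_reindex[where s = "\<lambda>k. k" and J = "I \<times> I" and E = ov])
      show "k \<in> I \<times> I" if "k \<in> I \<times> A" for k using that A by auto
      show "x \<in> ov k" if "k \<in> I \<times> A" "x \<in> E k" for k x using that A Esub by (cases k) auto
      show "c_fam b (I \<times> I) ov trans" by (rule c_fam_weaken[OF c_fam_trans])
    qed
    show "c_fam b (I \<times> A) E (\<lambda>k x. h (prod.swap k) (trans k x))"
    proof (rule c_fam_compose[where s = prod.swap and J = "I \<times> I" and E = ov and F = h and G = trans])
      show "prod.swap k \<in> I \<times> I" if "k \<in> I \<times> A" for k using that A by auto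
      show "trans k x \<in> ov (prod.swap k)" if "k \<in> I \<times> A" "x \<in> E k" for k x
        using that A Esub trans_in by (cases k) (auto simp: subset_iff)
      show "c_fam b (I \<times> A) E trans" by (rule tr)
      show "c_fam b (I \<times> I) ov h" by (rule h)
    qed (rule opE)
    show "h (prod.swap k) (trans k x) = (case k of (\<beta>, \<alpha>) => F \<beta>) x" if k: "k \<in> I \<times> A" "x \<in> E k" for k x
    proof -
      obtain \<beta> \<alpha> where k': "k = (\<beta>, \<alpha>)" "\<beta> \<in> I" "\<alpha> \<in> I" "col \<alpha> = c" using k A by (auto simp: A_def)
      have "\<psi> \<beta> x \<in> kc s \<alpha>" using k(2) k' cube_subset_ccube[of s] by (auto simp: E kc_def)
      then show ?thesis using csum_in[OF k'(3,4), of "\<psi> \<beta> x" "\<lambda>\<alpha>. h (\<alpha>, \<beta>)"] by (simp add: k'(1) F_def trans_eq)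
    qed
  qed
  have D1: "c_fam b I D1 F"
    by (rule c_fam_cover[OF _ 1]) (auto simp: D1_def)
  have opD2: "open (D2 \<beta>)" if "\<beta> \<in> I" for \<beta>
    unfolding D2_def by (rule open_coord_image[OF that open_Compl[OF closed_Union_kc[OF A r2]]])
  have D2: "c_fam b I D2 F"
  proof (rule c_fam_cong[OF opD2])
    show "c_fam b I D2 (\<lambda>k x. 0)" by (rule c_fam_const')
    show "0 = F \<beta> x" if \<beta>: "\<beta> \<in> I" and x: "x \<in> D2 \<beta>" for \<beta> x
    proof (cases rule: csum_cases[of c "\<psi> \<beta> x"])
      case out
      then show ?thesis unfolding F_def by (intro csum_out[symmetric]) auto
    next
      case (inside \<alpha>)
      have "\<psi> \<beta> x \<notin> kc r \<alpha>" using x inside \<beta> by (auto simp: D2_def coord_image A_def)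
      then have "\<phi> \<alpha> (\<psi> \<beta> x) \<notin> ccube r" using inside(3) by (simp add: kc_def)
      then show ?thesis using csum_in[OF inside, of "\<lambda>\<alpha>. h (\<alpha>, \<beta>)"] z[OF inside(1) \<beta>] by (simp add: F_def)
    qed
  qed
  have "c_fam b I (\<lambda>_. cube 2) F"
  proof (rule c_fam_Un[OF _ D1 D2])
    fix \<beta> and x :: "real^'n" assume \<beta>: "\<beta> \<in> I" and x: "x \<in> cube 2"
    show "x \<in> D1 \<beta> \<or> x \<in> D2 \<beta>"
    proof (cases "\<psi> \<beta> x \<in> (\<Union>\<alpha>\<in>A. kc r \<alpha>)")
      case True
      then obtain \<alpha> where \<alpha>: "\<alpha> \<in> A" "\<psi> \<beta> x \<in> kc r \<alpha>" by blast
      have "x \<in> E (\<beta>, \<alpha>)" using \<alpha> A x \<beta> ccube_subset_cube[OF r] by (subst E) (auto simp: kc_def)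
      then show ?thesis using \<alpha>(1) by (auto simp: D1_def)
    next
      case False
      then show ?thesis using x by (simp add: D2_def coord_image[OF \<beta>])
    qed
  qed
  then show ?thesis unfolding F_def .
qed

lemma ov_subset: "k \<in> I \<times> I ==> ov k \<subseteq> cube 2"
  by (cases k) (auto simp: ov_eq)

lemma C_uni_csum:
  fixes h :: "'i => real^'n => 'b::euclidean_space"
  assumes r: "r < s" and h: "cfam h"
    and z: "\<And>\<alpha> x. \<alpha> \<in> I ==> x \<notin> ccube r ==> h \<alpha> x = 0"
  shows "csum c h \<in> C_uni M B"
proof -
  have "c_fam True (I \<times> I) ov (\<lambda>k. h (fst k))"
    by (rule c_fam_reindex[OF _ _ h]) (use ov_subset in auto)
  from c_fam_csum[OF r this] show ?thesis using z by (simp add: C_uni_iff)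
qed

subsection \<open>Coordinate vector fields of one colour\<close>

definition cfield :: "(real^'n => real) => nat => 'n => 'a operator" where
  "cfield \<theta> c l u q = (if smooth_fun M u
     then csum c (\<lambda>\<alpha> x. cor (\<theta> x * scl B \<alpha> $ l) * pd l (u \<circ> \<psi> \<alpha>) x) q else 0)"

lemma pd_trans:
  fixes u :: "'a => complex"
  assumes ab: "\<alpha> \<in> I" "\<beta> \<in> I" and u: "smooth_fun M u" and y: "y \<in> ov (\<alpha>, \<beta>)"
  shows "pd l (u \<circ> \<psi> \<alpha>) y = (\<Sum>i\<in>UNIV. pd l (\<lambda>z. trans (\<alpha>, \<beta>) z $ i) y *\<^sub>R pd i (u \<circ> \<psi> \<beta>) (trans (\<alpha>, \<beta>) y))"
proof -
  have k: "(\<alpha>, \<beta>) \<in> I \<times> I" using ab by simp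
  have "pd l (u \<circ> \<psi> \<alpha>) y = pd l (\<lambda>z. (u \<circ> \<psi> \<beta>) (trans (\<alpha>, \<beta>) z)) y"
    unfolding pd_dird
    by (rule dird_local_cong[OF open_ov[OF k] y]) (use ab in \<open>simp add: param_trans\<close>)
  also have "\<dots> = (\<Sum>i\<in>UNIV. pd l (\<lambda>z. trans (\<alpha>, \<beta>) z $ i) y *\<^sub>R pd i (u \<circ> \<psi> \<beta>) (trans (\<alpha>, \<beta>) y))"
  proof (rule pd_compose)
    have "trans (\<alpha>, \<beta>) y \<in> cube 2" using trans_in[OF ab y] ov_subset[of "(\<beta>, \<alpha>)"] ab by auto
    moreover have "smooth_on (cube 2) (u \<circ> \<psi> \<beta>)" using u ab by (simp add: smooth_fun_iff o_def)
    ultimately show "(u \<circ> \<psi> \<beta>) differentiable (at (trans (\<alpha>, \<beta>) y))" by (rule smooth_on_differentiable[rotated])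
    show "trans (\<alpha>, \<beta>) differentiable (at y)" by (rule c_fam_differentiable[OF c_fam_trans k y])
  qed
  finally show ?thesis .
qed

text \<open>In the frame of \<open>\<beta>\<close>, the i-th coefficient of the scaled l-th
  coordinate field of \<open>\<alpha>\<close> is the entry of the scaled Jacobian from
  \<open>c_fam_scale\<close>, times the cutoff. \<open>c_fam_csum\<close> makes the sum over one
  colour uniform.\<close>

lemma cfield_in:
  assumes r: "r < s" and \<theta>: "smooth_on UNIV \<theta>" and z: "\<And>x. x \<notin> ccube r ==> \<theta> x = 0"
  shows "cfield \<theta> c l \<in> op_lie_algebra M B"
proof -
  define h where "h = (\<lambda>i k y. \<theta> y * (scl B (fst k) $ l * pd l (\<lambda>z. trans k z $ i) y / scl B (snd k) $ i))"
  define v where "v = (\<lambda>\<beta> x. \<chi> i. csum c (\<lambda>\<alpha>. h i (\<alpha>, \<beta>)) (\<psi> \<beta> x))"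
  have h: "c_fam True (I \<times> I) ov (h i)" for i
    unfolding h_def
  proof (rule c_fam_mult[OF open_ov _ c_fam_scale])
    show "c_fam True (I \<times> I) ov (\<lambda>k. \<theta>)"
      by (rule c_fam_smooth_cube[OF \<theta>, where r = 2]) (use ov_subset cube_subset_ccube[of 2] in blast)
  qed
  have v: "cfam v"
  proof (rule c_fam_vec)
    show "cfam (\<lambda>\<beta> x. v \<beta> x $ i)" for i
      unfolding v_def using c_fam_csum[OF r h[of i], of c] z by (simp add: h_def)
  qed simp
  have eq: "cfield \<theta> c l u (\<psi> \<beta> x) =
      (\<Sum>i\<in>UNIV. cor (v \<beta> x $ i * scl B \<beta> $ i) * pd i (u \<circ> \<psi> \<beta>) x)"
    if u: "smooth_fun M u" and \<beta>: "\<beta> \<in> I" and x: "x \<in> cube 2" for u \<beta> x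
  proof (cases rule: csum_cases[of c "\<psi> \<beta> x"])
    case out
    have "csum c (g :: 'i => real^'n => real) (\<psi> \<beta> x) = 0" for g by (rule csum_out) (rule out)
    then have "v \<beta> x $ i = 0" for i unfolding v_def by simp
    moreover have "csum c (g :: 'i => real^'n => complex) (\<psi> \<beta> x) = 0" for g by (rule csum_out) (rule out)
    then have "cfield \<theta> c l u (\<psi> \<beta> x) = 0" unfolding cfield_def by simp
    ultimately show ?thesis by simp
  next
    case (inside \<alpha>)
    define y where "y = \<phi> \<alpha> (\<psi> \<beta> x)"
    have U: "\<psi> \<beta> x \<in> U \<alpha>" using inside(3) by (simp add: kc_def)
    have y: "y \<in> ov (\<alpha>, \<beta>)" using U inside(1) \<beta> x by (simp add: ov_eq y_def coord_in param_coord param_in)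
    have tr: "trans (\<alpha>, \<beta>) y = x" using U inside(1) \<beta> x by (simp add: trans_eq y_def param_coord coord_param)
    have vi: "v \<beta> x $ i * scl B \<beta> $ i = \<theta> y * scl B \<alpha> $ l * pd l (\<lambda>z. trans (\<alpha>, \<beta>) z $ i) y" for i
      using scl_pos[OF \<beta>, of i] csum_in[OF inside, of "\<lambda>\<alpha>. h i (\<alpha>, \<beta>)"] by (simp add: v_def h_def y_def)
    have "cfield \<theta> c l u (\<psi> \<beta> x) = cor (\<theta> y * scl B \<alpha> $ l) * pd l (u \<circ> \<psi> \<alpha>) y"
      unfolding cfield_def using u csum_in[OF inside] by (simp add: y_def)
    also have "\<dots> = (\<Sum>i\<in>UNIV. cor (v \<beta> x $ i * scl B \<beta> $ i) * pd i (u \<circ> \<psi> \<beta>) x)"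
      unfolding pd_trans[OF inside(1) \<beta> u y] tr vi
      by (simp add: sum_distrib_left scaleR_conv_of_real mult.assoc)
    finally show ?thesis .
  qed
  show ?thesis
    unfolding op_lie_algebra_def bg_vector_fields_def
  proof (intro CollectI conjI allI impI exI[of _ v] ballI)
    show "cfield \<theta> c l u = (\<lambda>q. 0)" if "\<not> smooth_fun M u" for u
      using that by (simp add: cfield_def fun_eq_iff)
    have "(\<forall>k\<in>I. smooth_on (cube 2) (v k)) \<and> unif_bounded_derivs I (\<lambda>_. cube 2) v"
      using v by (subst (asm) c_fam_True) auto
    then show "unif_bounded_derivs I (\<lambda>_. cube 2) v" "\<And>\<alpha>. \<alpha> \<in> I ==> smooth_on (cube 2) (v \<alpha>)" by auto
  qed (rule eq)
qed

lemma cfield_param: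
  assumes "\<alpha> \<in> I" "col \<alpha> = c" "x \<in> ccube s" "smooth_fun M u"
  shows "cfield \<theta> c l u (\<psi> \<alpha> x) = cor (\<theta> x * scl B \<alpha> $ l) * pd l (u \<circ> \<psi> \<alpha>) x"
  unfolding cfield_def using assms csum_param[OF assms(1-3)] by simp

subsection \<open>The partition of unity\<close>

definition denom :: "(real^'n => real) => 'a => real" where
  "denom \<kappa> q = (\<Sum>\<beta> | \<beta> \<in> I \<and> q \<in> U \<beta>. pull_cutoff B \<kappa> \<beta> q)"

text \<open>The unit cubes cover, and the cutoff is nonnegative and equals 1 on them. The bound
  makes the reciprocal of the denominator uniformly smooth.\<close>

lemma denom_ge:
  assumes "cutoff \<kappa>"
  shows "1 \<le> denom \<kappa> q"
proof -
  note fin = finite_charts_at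
  obtain \<alpha> where \<alpha>: "\<alpha> \<in> I" "q \<in> U \<alpha>" "\<phi> \<alpha> q \<in> cube 1" by (rule covered)
  have "pull_cutoff B \<kappa> \<alpha> q = 1"
    using assms \<alpha> by (auto simp: pull_cutoff_def cutoff_def cube_def less_imp_le)
  moreover have "pull_cutoff B \<kappa> \<alpha> q \<le> denom \<kappa> q"
    unfolding denom_def using \<alpha> fin assms
    by (intro member_le_sum) (auto simp: pull_cutoff_def cutoff_def)
  ultimately show ?thesis by simp
qed

lemma denom_csum:
  assumes "\<And>x. \<kappa> x \<noteq> 0 ==> x \<in> ccube s"
  shows "denom \<kappa> q = (\<Sum>c<N. csum c (\<lambda>_. \<kappa>) q)"
proof -
  have "denom \<kappa> q = (\<Sum>\<beta> | \<beta> \<in> I \<and> q \<in> U \<beta>. \<kappa> (\<phi> \<beta> q))"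
    unfolding denom_def by (intro sum.cong refl) (auto simp: pull_cutoff_def)
  also have "\<dots> = (\<Sum>c<N. csum c (\<lambda>_. \<kappa>) q)"
    by (rule sum_charts) (use assms in blast)
  finally show ?thesis .
qed

lemma c_fam_partition:
  assumes \<kappa>: "cutoff \<kappa>" and r: "r < s" and z: "\<And>x. \<kappa> x \<noteq> 0 ==> x \<in> ccube r"
  shows "cfam (\<lambda>\<alpha> x. chart_partition B \<kappa> \<alpha> (\<psi> \<alpha> x))"
proof (rule c_fam_cong)
  have k: "cfam (\<lambda>_. \<kappa>)"
    by (rule c_fam_smooth_cube[OF cutoff_smooth[OF \<kappa>] cube_subset_ccube])
  have zs: "x \<in> ccube s" if "\<kappa> x \<noteq> 0" for x
    using z[OF that] ccube_mono[of r s] r by auto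
  have "csum c (\<lambda>_. \<kappa>) \<in> C_uni M B" for c
    by (rule C_uni_csum[OF r k]) (use z in blast)
  then have "cfam (\<lambda>\<alpha> x. \<Sum>c<N. csum c (\<lambda>_. \<kappa>) (\<psi> \<alpha> x))"
    by (intro c_fam_sum) (auto simp: C_uni_iff)
  then have d: "cfam (\<lambda>\<alpha> x. denom \<kappa> (\<psi> \<alpha> x))"
    by (simp add: denom_csum[OF zs])
  have pos: "1 \<le> \<bar>denom \<kappa> q\<bar>" for q using denom_ge[OF \<kappa>, of q] by simp
  have i: "cfam (\<lambda>\<alpha> x. inverse (denom \<kappa> (\<psi> \<alpha> x)))"
  proof (rule c_fam_inverse[OF _ _ _ d])
    show "denom \<kappa> (\<psi> \<alpha> x) \<noteq> 0" for \<alpha> x using pos[of "\<psi> \<alpha> x"] by auto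
    show "\<exists>c>0. \<forall>k\<in>I. \<forall>x\<in>cube 2. c \<le> norm (denom \<kappa> (\<psi> k x))"
      by (intro exI[of _ 1]) (use pos in auto)
  qed simp
  show "cfam (\<lambda>\<alpha> x. \<kappa> x * inverse (denom \<kappa> (\<psi> \<alpha> x)))"
    by (rule c_fam_mult[OF _ k i]) simp
  show "\<kappa> x * inverse (denom \<kappa> (\<psi> \<alpha> x)) = chart_partition B \<kappa> \<alpha> (\<psi> \<alpha> x)"
    if "\<alpha> \<in> I" "x \<in> cube 2" for \<alpha> x
    using that by (simp add: chart_partition_def pull_cutoff_def denom_def param_in coord_param field_simps)
qed simp

lemma sum_partition:
  assumes "cutoff \<kappa>"
  shows "(\<Sum>\<alpha> | \<alpha> \<in> I \<and> q \<in> U \<alpha>. chart_partition B \<kappa> \<alpha> q) = 1"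
proof -
  have "(\<Sum>\<alpha> | \<alpha> \<in> I \<and> q \<in> U \<alpha>. chart_partition B \<kappa> \<alpha> q) = denom \<kappa> q / denom \<kappa> q"
    unfolding chart_partition_def denom_def[symmetric] sum_divide_distrib[symmetric] by (simp add: denom_def)
  then show ?thesis using denom_ge[OF assms, of q] by simp
qed

lemma partition_zero: "\<kappa> (\<phi> \<alpha> q) = 0 ==> chart_partition B \<kappa> \<alpha> q = 0"
  by (simp add: chart_partition_def pull_cutoff_def)

end

section \<open>Monomials\<close>

text \<open>The exponents left after differentiating a monomial along the list, last entry first as
  in \<open>iter_deriv\<close>. Subtraction is truncated at 0, but the matching factor in
  \<open>falling\<close> vanishes in that case.\<close>

definition lowers :: "'n list => ('n => nat) => 'n => nat" where
  "lowers is \<delta> = foldr (\<lambda>i d. d(i := d i - 1)) is \<delta>"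

text \<open>The product of the exponents met while differentiating, a falling factorial in several
  variables.\<close>

fun falling :: "'n list => ('n => nat) => nat" where
  "falling [] \<delta> = 1"
| "falling (i # is) \<delta> = lowers is \<delta> i * falling is \<delta>"

lemma lowers_simps [simp]:
  "lowers [] \<delta> = \<delta>" "lowers (i # is) \<delta> = (lowers is \<delta>)(i := lowers is \<delta> i - 1)"
  by (simp_all add: lowers_def)

lemma falling_nonzero: "falling is \<delta> \<noteq> 0 ==> \<delta> j = lowers is \<delta> j + midx is j"
  by (induction "is") (auto simp: midx_def)

lemma falling_ne_0_if:
  "(\<And>j. midx is j \<le> \<delta> j) ==> falling is \<delta> \<noteq> 0 \<and> (\<forall>j. lowers is \<delta> j = \<delta> j - midx is j)"
proof (induction "is")
  case (Cons i "is")
  have "midx is j \<le> \<delta> j" for j using Cons.prems[of j] by (auto simp: midx_def split: if_splits)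
  then have IH: "falling is \<delta> \<noteq> 0" "\<And>j. lowers is \<delta> j = \<delta> j - midx is j" using Cons.IH by auto
  have "midx is i < \<delta> i" using Cons.prems[of i] by (simp add: midx_def)
  then show ?case using IH by (auto simp: midx_def)
qed (simp add: midx_def)

lemma mlen_lowers: "falling is \<delta> \<noteq> 0 ==> mlen \<delta> = mlen (lowers is \<delta>) + length is"
proof -
  assume "falling is \<delta> \<noteq> 0"
  then have "mlen \<delta> = (\<Sum>j\<in>UNIV. lowers is \<delta> j + midx is j)"
    unfolding mlen_def by (intro sum.cong refl) (rule falling_nonzero)
  also have "\<dots> = mlen (lowers is \<delta>) + mlen (midx is)" unfolding mlen_def by (rule sum.distrib)
  finally show ?thesis by simp
qed

lemma has_derivative_component [derivative_intros]:
  "((\<lambda>x::real^'n::finite. cor (x $ i)) has_derivative (\<lambda>v. cor (v $ i))) (at x)"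
  using bounded_linear_imp_has_derivative[OF bounded_linear_compose[OF bounded_linear_of_real bounded_linear_vec_nth[of i]]] .

lemma smooth_mmonom: "smooth_on UNIV (mmonom \<gamma> :: real^'n::finite => complex)"
proof -
  have "c_fam False {()} (\<lambda>_. UNIV) (\<lambda>_ x :: real^'n. cor (x $ i) ^ \<gamma> i)" for i
    by (intro c_fam_power c_fam_of_real c_fam_component c_fam_id) auto
  then have "c_fam False {()} (\<lambda>_. UNIV) (\<lambda>_ x :: real^'n. mmonom \<gamma> x)"
    unfolding mmonom_def by (intro c_fam_prod) auto
  then show ?thesis by (simp add: c_fam_single)
qed

lemma pd_mmonom: "pd i (mmonom \<gamma>) \<xi> = of_nat (\<gamma> i) * mmonom (\<gamma>(i := \<gamma> i - 1)) \<xi>"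
proof -
  define f where "f = (\<lambda>j (x::real^'a). cor (x $ j) ^ \<gamma> j)"
  define f' where "f' = (\<lambda>j (v::real^'a). of_nat (\<gamma> j) * (cor (v $ j) * cor (\<xi> $ j) ^ (\<gamma> j - 1)))"
  have f: "(f j has_derivative f' j) (at \<xi>)" for j
    unfolding f_def f'_def using has_derivative_power[OF has_derivative_component, where n = "\<gamma> j"] by (simp add: mult.assoc)
  have *: "((\<lambda>x. \<Prod>j\<in>UNIV. f j x) has_derivative (\<lambda>v. \<Sum>j\<in>UNIV. f' j v * (\<Prod>k\<in>UNIV - {j}. f k \<xi>))) (at \<xi>)"
    by (rule has_derivative_prod[OF f])
  have "pd i (mmonom \<gamma>) \<xi> = (\<Sum>j\<in>UNIV. f' j (axis i 1) * (\<Prod>k\<in>UNIV - {j}. f k \<xi>))"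
  proof -
    have "mmonom \<gamma> = (\<lambda>x. \<Prod>j\<in>UNIV. f j x)" by (simp add: fun_eq_iff mmonom_def f_def)
    then show ?thesis unfolding pd_dird using dird_eqI[OF *] by simp
  qed
  also have "\<dots> = (\<Sum>j\<in>UNIV. if j = i then f' i (axis i 1) * (\<Prod>k\<in>UNIV - {i}. f k \<xi>) else 0)"
    by (intro sum.cong refl) (simp add: f'_def axis_def)
  also have "\<dots> = f' i (axis i 1) * (\<Prod>k\<in>UNIV - {i}. f k \<xi>)" by simp
  also have "\<dots> = of_nat (\<gamma> i) * (cor (\<xi> $ i) ^ (\<gamma> i - 1) * (\<Prod>k\<in>UNIV - {i}. cor (\<xi> $ k) ^ \<gamma> k))"
    by (simp add: f'_def f_def axis_def)
  also have "cor (\<xi> $ i) ^ (\<gamma> i - 1) * (\<Prod>k\<in>UNIV - {i}. cor (\<xi> $ k) ^ \<gamma> k) = mmonom (\<gamma>(i := \<gamma> i - 1)) \<xi>"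
    unfolding mmonom_def by (subst (2) prod.remove[of _ i]) (auto intro!: prod.cong)
  finally show ?thesis .
qed

lemma iter_deriv_mmonom:
  "iter_deriv (map (\<lambda>i. axis i 1) is) (mmonom \<delta>) \<xi> = of_nat (falling is \<delta>) * mmonom (lowers is \<delta>) \<xi>"
proof (induction "is" arbitrary: \<xi>)
  case (Cons i "is")
  have "iter_deriv (map (\<lambda>i. axis i 1) (i # is)) (mmonom \<delta>) \<xi>
      = pd i (\<lambda>\<xi>. of_nat (falling is \<delta>) * mmonom (lowers is \<delta>) \<xi>) \<xi>"
  proof -
    have "iter_deriv (map (\<lambda>i. axis i 1) is) (mmonom \<delta>) = (\<lambda>\<xi>. of_nat (falling is \<delta>) * mmonom (lowers is \<delta>) \<xi>)"
      using Cons by (simp add: fun_eq_iff)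
    then show ?thesis by (simp add: pd_dird)
  qed
  also have "\<dots> = of_nat (falling is \<delta>) * pd i (mmonom (lowers is \<delta>)) \<xi>"
    unfolding pd_dird
    by (rule dird_linear[OF bounded_linear_mult_right smooth_on_differentiable[OF smooth_mmonom UNIV_I]])
  finally show ?case by (simp add: pd_mmonom fun_upd_def)
qed simp

lemma mmonom_0: "mmonom \<gamma> 0 = (if \<forall>i. \<gamma> i = 0 then 1 else 0)"
  by (auto simp: mmonom_def)

text \<open>This is \<open>\<gamma>\<close> factorial, the product of the factorials of its
  entries.\<close>

definition mfact :: "('n::finite => nat) => nat" where
  "mfact \<gamma> = falling (ilist \<gamma>) \<gamma>"

lemma mfact_nonzero: "mfact \<gamma> \<noteq> 0"
  unfolding mfact_def using falling_ne_0_if[of "ilist \<gamma>" \<gamma>] by simp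

text \<open>Differentiation at the origin isolates one coefficient of a polynomial. It serves both
  to recover coefficients from a symbol and to prove their uniqueness.\<close>

lemma mpd_mmonom_0: "mpd \<gamma> (mmonom \<delta>) 0 = (if \<delta> = \<gamma> then of_nat (mfact \<gamma>) else 0)"
proof -
  have v: "mpd \<gamma> (mmonom \<delta>) 0 = of_nat (falling (ilist \<gamma>) \<delta>) * mmonom (lowers (ilist \<gamma>) \<delta>) 0"
    unfolding mpd_ilist by (rule iter_deriv_mmonom)
  show ?thesis
  proof (cases "\<delta> = \<gamma>")
    case True
    have "\<forall>j. lowers (ilist \<gamma>) \<gamma> j = 0" using falling_ne_0_if[of "ilist \<gamma>" \<gamma>] by simp
    then show ?thesis using True v by (simp add: mmonom_0 mfact_def)
  next
    case False
    have "falling (ilist \<gamma>) \<delta> = 0 \<or> \<not> (\<forall>i. lowers (ilist \<gamma>) \<delta> i = 0)"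
    proof (rule ccontr)
      assume "\<not> ?thesis"
      then have "\<delta> j = \<gamma> j" for j using falling_nonzero[of "ilist \<gamma>" \<delta> j] by simp
      then show False using False by blast
    qed
    then show ?thesis using False v by (auto simp: mmonom_0)
  qed
qed

lemma norm_mmonom: "norm (mmonom \<gamma> \<xi>) \<le> sqrt (1 + (norm \<xi>)\<^sup>2) ^ mlen \<gamma>"
proof -
  have 1: "\<bar>\<xi> $ i\<bar> \<le> sqrt (1 + (norm \<xi>)\<^sup>2)" for i
  proof -
    have "\<bar>\<xi> $ i\<bar> \<le> norm \<xi>" by (rule component_le_norm_cart)
    also have "\<dots> \<le> sqrt (1 + (norm \<xi>)\<^sup>2)" by (rule real_le_rsqrt) simp
    finally show ?thesis .
  qed
  have "norm (mmonom \<gamma> \<xi>) = (\<Prod>i\<in>UNIV. \<bar>\<xi> $ i\<bar> ^ \<gamma> i)"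
    by (simp add: mmonom_def prod_norm[symmetric] norm_power)
  also have "\<dots> \<le> (\<Prod>i\<in>UNIV. sqrt (1 + (norm \<xi>)\<^sup>2) ^ \<gamma> i)"
    by (intro prod_mono) (auto intro!: power_mono 1)
  also have "\<dots> = sqrt (1 + (norm \<xi>)\<^sup>2) ^ mlen \<gamma>" by (simp add: mlen_def power_sum)
  finally show ?thesis .
qed

text \<open>A derivative of order \<open>mlen \<gamma>\<close> either vanishes or leaves a monomial
  of degree \<open>mlen \<delta> - mlen \<gamma>\<close>; as the square root is at least 1, its
  exponent may be raised to the one belonging to \<open>m\<close>.\<close>

lemma norm_mpd_mmonom:
  assumes "int (mlen \<delta>) \<le> m"
  shows "norm (mpd \<gamma> (mmonom \<delta>) \<xi>)
    \<le> of_nat (falling (ilist \<gamma>) \<delta>) * sqrt (1 + (norm \<xi>)\<^sup>2) powr (of_int m - real (mlen \<gamma>))"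
proof (cases "falling (ilist \<gamma>) \<delta> = 0")
  case False
  define J where "J = sqrt (1 + (norm \<xi>)\<^sup>2)"
  have J: "1 \<le> J" by (simp add: J_def)
  have l: "mlen \<delta> = mlen (lowers (ilist \<gamma>) \<delta>) + mlen \<gamma>" using mlen_lowers[OF False] by (simp add: length_ilist)
  have "J ^ mlen (lowers (ilist \<gamma>) \<delta>) = J powr real (mlen (lowers (ilist \<gamma>) \<delta>))"
    using J by (simp add: powr_realpow)
  also have "\<dots> \<le> J powr (of_int m - real (mlen \<gamma>))"
    by (intro powr_mono J) (use l assms in linarith)
  finally have "norm (mmonom (lowers (ilist \<gamma>) \<delta>) \<xi>) \<le> J powr (of_int m - real (mlen \<gamma>))"
    using norm_mmonom[of "lowers (ilist \<gamma>) \<delta>" \<xi>] by (simp add: J_def)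
  then show ?thesis
    unfolding mpd_ilist iter_deriv_mmonom by (simp add: norm_mult J_def mult_left_mono)
qed (simp add: mpd_ilist iter_deriv_mmonom)

lemma iter_deriv_sum:
  fixes f :: "'k => 'e::real_normed_vector => 'b::real_normed_vector"
  assumes "open S" "\<And>k. k \<in> A ==> smooth_on S (f k)" "finite A" "x \<in> S"
  shows "iter_deriv vs (\<lambda>x. \<Sum>k\<in>A. f k x) x = (\<Sum>k\<in>A. iter_deriv vs (f k) x)"
  using assms(4)
proof (induction vs arbitrary: x)
  case (Cons v vs)
  have "iter_deriv (v # vs) (\<lambda>x. \<Sum>k\<in>A. f k x) x = dird v (\<lambda>x. \<Sum>k\<in>A. iter_deriv vs (f k) x) x"
    unfolding iter_deriv_Cons by (rule dird_local_cong[OF assms(1) Cons.prems Cons.IH])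
  also have "\<dots> = (\<Sum>k\<in>A. dird v (iter_deriv vs (f k)) x)"
    by (rule dird_eqI, rule has_derivative_sum)
      (intro has_derivative_dird smooth_on_differentiable[OF smooth_on_iter_deriv[OF assms(2)] Cons.prems])
  finally show ?case by simp
qed simp

lemma mpd_sum_mult:
  fixes f :: "'k => real^'n::finite => complex"
  assumes "open S" "\<And>k. k \<in> A ==> smooth_on S (f k)" "finite A" "x \<in> S"
  shows "mpd \<beta> (\<lambda>x. \<Sum>k\<in>A. f k x * c k) x = (\<Sum>k\<in>A. mpd \<beta> (f k) x * c k)"
proof -
  have sm: "smooth_on S (\<lambda>x. f k x * c k)" if "k \<in> A" for k
    by (rule smooth_on_linear[OF bounded_linear_mult_left assms(2)[OF that] assms(1)])
  have "mpd \<beta> (\<lambda>x. \<Sum>k\<in>A. f k x * c k) x = (\<Sum>k\<in>A. mpd \<beta> (\<lambda>x. f k x * c k) x)"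
    unfolding mpd_def by (rule iter_deriv_sum[OF assms(1) sm assms(3,4)])
  also have "\<dots> = (\<Sum>k\<in>A. mpd \<beta> (f k) x * c k)"
    unfolding mpd_def
    by (intro sum.cong refl iter_deriv_linear[OF bounded_linear_mult_left assms(2) assms(1,4)])
  finally show ?thesis .
qed

lemma mpd_sum_mult_left:
  fixes f :: "'k => real^'n::finite => complex"
  assumes "open S" "\<And>k. k \<in> A ==> smooth_on S (f k)" "finite A" "x \<in> S"
  shows "mpd \<beta> (\<lambda>x. \<Sum>k\<in>A. c k * f k x) x = (\<Sum>k\<in>A. c k * mpd \<beta> (f k) x)"
  using mpd_sum_mult[OF assms, where \<beta> = \<beta> and c = c] by (simp add: mult.commute)

text \<open>Joint smoothness is used one fibre at a time: a derivative along the fibre is a joint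
  derivative in a direction with first component 0.\<close>

lemma iter_deriv_slice:
  fixes f :: "'e::euclidean_space \<times> 'f::euclidean_space => 'b::real_normed_vector"
  assumes "open S" "smooth_on (S \<times> UNIV) f" "x \<in> S"
  shows "iter_deriv vs (\<lambda>\<xi>. f (x, \<xi>)) \<xi> = iter_deriv (map (\<lambda>v. (0, v)) vs) f (x, \<xi>)"
proof (induction vs arbitrary: \<xi>)
  case (Cons v vs)
  define g where "g = iter_deriv (map (\<lambda>v. (0::'e, v)) vs) f"
  have "smooth_on (S \<times> UNIV) g" unfolding g_def by (rule smooth_on_iter_deriv[OF assms(2)])
  then have dg: "g differentiable (at (x, \<xi>))" by (rule smooth_on_differentiable) (use assms(3) in auto)
  have "((\<lambda>\<xi>. g (x, \<xi>)) has_derivative (\<lambda>v. dird (0, v) g (x, \<xi>))) (at \<xi>)"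
  proof (rule has_derivative_compose[where f = "\<lambda>\<xi>. (x, \<xi>)" and f' = "\<lambda>v. (0, v)" and g = g and g' = "\<lambda>v. dird v g (x, \<xi>)"])
    show "((\<lambda>\<xi>. (x, \<xi>)) has_derivative (\<lambda>v. (0, v))) (at \<xi>)" by (auto intro!: derivative_eq_intros)
    show "(g has_derivative (\<lambda>v. dird v g (x, \<xi>))) (at (x, \<xi>))" by (rule has_derivative_dird[OF dg])
  qed
  then have "dird v (\<lambda>\<xi>. g (x, \<xi>)) \<xi> = dird (0, v) g (x, \<xi>)" by (rule dird_eqI)
  moreover have "iter_deriv vs (\<lambda>\<xi>. f (x, \<xi>)) = (\<lambda>\<xi>. g (x, \<xi>))" using Cons by (simp add: g_def fun_eq_iff)
  ultimately show ?case by (simp add: g_def)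
qed simp

lemma smooth_on_slice:
  fixes f :: "'e::euclidean_space \<times> 'f::euclidean_space => 'b::real_normed_vector"
  assumes "open S" "smooth_on (S \<times> UNIV) f"
  shows "smooth_on S (\<lambda>x. f (x, \<xi>))"
proof -
  have bl: "bounded_linear (\<lambda>x::'e. (x, 0::'f))" by (intro bounded_linear_Pair bounded_linear_ident bounded_linear_zero)
  have "c_fam False {()} (\<lambda>_. S) (\<lambda>_ x. (x, 0) + (0, \<xi>))"
    by (intro c_fam_add c_fam_linear[OF bl] c_fam_id c_fam_const') (use assms(1) in auto)
  then have "smooth_on S (\<lambda>x. (x, \<xi>))" using assms(1) by (simp add: c_fam_single)
  from smooth_on_compose[OF assms(1) open_Times[OF assms(1) open_UNIV] this _ assms(2)]
  show ?thesis by auto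
qed

lemma smooth_on_fst:
  fixes f :: "'e::euclidean_space => 'b::real_normed_vector"
  assumes "open S" "smooth_on S f"
  shows "smooth_on (S \<times> (UNIV :: 'f::euclidean_space set)) (\<lambda>p. f (fst p))"
proof -
  have "c_fam False {()} (\<lambda>_. S \<times> (UNIV :: 'f set)) (\<lambda>_ p. fst p)"
    by (intro c_fam_linear[OF bounded_linear_fst] c_fam_id) (use assms(1) in \<open>auto intro: open_Times\<close>)
  then have "smooth_on (S \<times> (UNIV :: 'f set)) fst" using assms(1) by (simp add: c_fam_single open_Times)
  from smooth_on_compose[OF open_Times[OF assms(1) open_UNIV] assms(1) this _ assms(2)] show ?thesis by auto
qed

lemma smooth_on_snd:
  fixes f :: "'f::euclidean_space => 'b::real_normed_vector"
  assumes "open S" "smooth_on UNIV f"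
  shows "smooth_on ((S :: 'e::euclidean_space set) \<times> UNIV) (\<lambda>p. f (snd p))"
proof -
  have "c_fam False {()} (\<lambda>_. S \<times> (UNIV :: 'f set)) (\<lambda>_ p. snd p)"
    by (intro c_fam_linear[OF bounded_linear_snd] c_fam_id) (use assms(1) in \<open>auto intro: open_Times\<close>)
  then have "smooth_on (S \<times> (UNIV :: 'f set)) snd" using assms(1) by (simp add: c_fam_single open_Times)
  from smooth_on_compose[OF open_Times[OF assms(1) open_UNIV] open_UNIV this _ assms(2)] show ?thesis by auto
qed

section \<open>The cotangent bundle in charts\<close>

context scaled_bg
begin

lemma atlas_diffeo:
  assumes "(W, \<theta>) \<in> M"
  shows "diffeo_onto M W \<theta> (\<theta> ` W)" "open W" "open (\<theta> ` W)"
proof -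
  have 1: "\<forall>(U, \<psi>)\<in>M. open U \<and> open (\<psi> ` U) \<and> homeomorphism U (\<psi> ` U) \<psi> (inv_into U \<psi>)"
    and 2: "\<forall>(U, \<psi>)\<in>M. \<forall>(V, \<theta>)\<in>M. smooth_on (\<psi> ` (U \<inter> V)) (\<theta> \<circ> inv_into U \<psi>)"
    using atlas by (auto simp: smooth_atlas_def)
  show "open W" "open (\<theta> ` W)" using 1 assms by auto
  have "smooth_on (\<psi> ` (W \<inter> V)) (\<theta> \<circ> inv_into V \<psi>) \<and> smooth_on (\<theta> ` (W \<inter> V)) (\<psi> \<circ> inv_into W \<theta>)"
    if "(V, \<psi>) \<in> M" for V \<psi>
  proof
    show "smooth_on (\<psi> ` (W \<inter> V)) (\<theta> \<circ> inv_into V \<psi>)"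
      using bspec[OF bspec[OF 2 that, unfolded prod.case] assms, unfolded prod.case] by (simp add: Int_commute)
    show "smooth_on (\<theta> ` (W \<inter> V)) (\<psi> \<circ> inv_into W \<theta>)"
      using bspec[OF bspec[OF 2 assms, unfolded prod.case] that, unfolded prod.case] .
  qed
  then show "diffeo_onto M W \<theta> (\<theta> ` W)" unfolding diffeo_onto_def using 1 assms by auto
qed

lemma pd_chart_change:
  assumes d1: "diffeo_onto M V1 \<theta>1 S1" and d2: "diffeo_onto M V2 \<theta>2 S2"
    and op: "open V1" "open V2" "open S1" and q: "q \<in> V1" "q \<in> V2"
    and f: "(f \<circ> inv_into V2 \<theta>2) differentiable (at (\<theta>2 q))"
  shows "pd i (f \<circ> inv_into V1 \<theta>1) (\<theta>1 q) =
    (\<Sum>j\<in>UNIV. pd i (\<lambda>z. (\<theta>2 \<circ> inv_into V1 \<theta>1) z $ j) (\<theta>1 q) *\<^sub>R pd j (f \<circ> inv_into V2 \<theta>2) (\<theta>2 q))"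
proof -
  have h1: "homeomorphism V1 S1 \<theta>1 (inv_into V1 \<theta>1)" and h2: "homeomorphism V2 S2 \<theta>2 (inv_into V2 \<theta>2)"
    using d1 d2 by (simp_all add: diffeo_onto_def)
  have inv1: "inv_into V1 \<theta>1 (\<theta>1 p) = p" if "p \<in> V1" for p using h1 that by (simp add: homeomorphism_def)
  have inv2: "inv_into V2 \<theta>2 (\<theta>2 p) = p" if "p \<in> V2" for p using h2 that by (simp add: homeomorphism_def)
  define T where "T = \<theta>1 ` (V1 \<inter> V2)"
  have "T = S1 \<inter> inv_into V1 \<theta>1 -` V2"
    using h1 unfolding homeomorphism_def T_def by (force simp: image_iff)
  then have T: "open T" using continuous_open_preimage[OF _ op(3) op(2), of "inv_into V1 \<theta>1"] h1
    by (simp add: homeomorphism_def)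
  have qT: "\<theta>1 q \<in> T" using q by (simp add: T_def)
  have sm: "smooth_on T (\<theta>2 \<circ> inv_into V1 \<theta>1)" unfolding T_def by (rule smooth_charts[OF d1 d2 op])
  have "pd i (f \<circ> inv_into V1 \<theta>1) (\<theta>1 q) = pd i (\<lambda>z. (f \<circ> inv_into V2 \<theta>2) ((\<theta>2 \<circ> inv_into V1 \<theta>1) z)) (\<theta>1 q)"
    unfolding pd_dird by (rule dird_local_cong[OF T qT]) (auto simp: T_def inv1 inv2)
  also have "\<dots> = (\<Sum>j\<in>UNIV. pd i (\<lambda>z. (\<theta>2 \<circ> inv_into V1 \<theta>1) z $ j) (\<theta>1 q) *\<^sub>R
      pd j (f \<circ> inv_into V2 \<theta>2) ((\<theta>2 \<circ> inv_into V1 \<theta>1) (\<theta>1 q)))"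
  proof (rule pd_compose[OF _ smooth_on_differentiable[OF sm qT]])
    have "(\<theta>2 \<circ> inv_into V1 \<theta>1) (\<theta>1 q) = \<theta>2 q" using q by (simp add: inv1)
    then show "(f \<circ> inv_into V2 \<theta>2) differentiable (at ((\<theta>2 \<circ> inv_into V1 \<theta>1) (\<theta>1 q)))" using f by (simp only:)
  qed
  finally show ?thesis using q by (simp add: inv1)
qed

text \<open>\<open>differential\<close> quantifies over all charts of the atlas. By the chain rule,
  equality of the partial derivatives in one chart, here one of the structure, forces equality in
  all.\<close>

lemma differential_eq:
  assumes \<alpha>: "\<alpha> \<in> I" and q: "q \<in> U \<alpha>" and f: "smooth_fun M f"
  shows "differential M q f =
    {g. smooth_fun M g \<and> (\<forall>i. pd i (g \<circ> \<psi> \<alpha>) (\<phi> \<alpha> q) = pd i (f \<circ> \<psi> \<alpha>) (\<phi> \<alpha> q))}"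
proof -
  have dc: "(g \<circ> \<psi> \<alpha>) differentiable (at (\<phi> \<alpha> q))" if "smooth_fun M g" for g :: "'a => real"
    using that \<alpha> coord_in[OF \<alpha> q] smooth_on_differentiable[of "cube 2" "\<lambda>x. g (\<psi> \<alpha> x)"]
    by (simp add: smooth_fun_iff o_def)
  have dW: "(g \<circ> inv_into W \<theta>) differentiable (at (\<theta> q))" if "smooth_fun M g" "(W, \<theta>) \<in> M" "q \<in> W" for g :: "'a => real" and W \<theta>
  proof -
    have "smooth_on (\<theta> ` W) (g \<circ> inv_into W \<theta>)" using that unfolding smooth_fun_def by auto
    then show ?thesis by (rule smooth_on_differentiable) (use that in auto)
  qed
  have "(\<forall>(W, \<theta>)\<in>M. q \<in> W \<longrightarrow> (\<forall>i. pd i (g \<circ> inv_into W \<theta>) (\<theta> q) = pd i (f \<circ> inv_into W \<theta>) (\<theta> q)))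
    \<longleftrightarrow> (\<forall>i. pd i (g \<circ> \<psi> \<alpha>) (\<phi> \<alpha> q) = pd i (f \<circ> \<psi> \<alpha>) (\<phi> \<alpha> q))" (is "?L \<longleftrightarrow> ?R")
    if g: "smooth_fun M g" for g
  proof
    assume L: ?L
    have "q \<in> (\<Union>(U, \<psi>)\<in>M. U)" using atlas by (simp add: smooth_atlas_def)
    then obtain W \<theta> where W: "(W, \<theta>) \<in> M" "q \<in> W" by blast
    have eq: "pd i (g \<circ> inv_into W \<theta>) (\<theta> q) = pd i (f \<circ> inv_into W \<theta>) (\<theta> q)" for i using L W by auto
    note ch = pd_chart_change[OF diffeo[OF \<alpha>] atlas_diffeo(1)[OF W(1)] open_U[OF \<alpha>] atlas_diffeo(2)[OF W(1)] open_cube q W(2)]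
    show ?R unfolding param_def by (simp add: ch[OF dW[OF g W]] ch[OF dW[OF f W]] eq)
  next
    assume R: ?R
    show ?L
    proof (intro ballI, clarify)
      fix W \<theta> i assume W: "(W, \<theta>) \<in> M" "q \<in> W"
      note ch = pd_chart_change[OF atlas_diffeo(1)[OF W(1)] diffeo[OF \<alpha>] atlas_diffeo(2)[OF W(1)] open_U[OF \<alpha>] atlas_diffeo(3)[OF W(1)] W(2) q]
      show "pd i (g \<circ> inv_into W \<theta>) (\<theta> q) = pd i (f \<circ> inv_into W \<theta>) (\<theta> q)"
        using ch[OF dc[OF g, unfolded param_def]] ch[OF dc[OF f, unfolded param_def]] R by (simp add: param_def)
    qed
  qed
  then show ?thesis unfolding differential_def by blast
qed

text \<open>A bump function made from the given cutoff turns any smooth function on Euclidean space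
  into the local form of a global one, so operators and covectors can be tested locally. The radii
  are \<open>r0\<close>, the largest coordinate of \<open>x\<close>, and two successive midpoints
  towards 2.\<close>

lemma test_function:
  fixes f :: "real^'n => 'b::real_normed_vector"
  assumes \<kappa>: "cutoff (\<kappa> :: real^'n => real)" and \<alpha>: "\<alpha> \<in> I" and x: "x \<in> cube 2" and f: "smooth_on UNIV f"
  obtains g T where "smooth_fun M g" "open T" "x \<in> T" "T \<subseteq> cube 2" "\<And>y. y \<in> T ==> g (\<psi> \<alpha> y) = f y"
proof -
  define r0 where "r0 = Max (range (\<lambda>i. \<bar>x $ i\<bar>))"
  have le: "\<bar>x $ i\<bar> \<le> r0" for i unfolding r0_def by (rule Max_ge) auto
  have "r0 \<in> range (\<lambda>i. \<bar>x $ i\<bar>)" unfolding r0_def by (rule Max_in) auto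
  then have r0: "r0 < 2" using x by (auto simp: cube_def)
  define r1 where "r1 = (r0 + 2) / 2"
  define r2 where "r2 = (r1 + 2) / 2"
  have r: "r0 < r1" "r1 < r2" "r2 < 2" using r0 by (auto simp: r1_def r2_def)
  obtain \<theta> :: "real^'n => real" where \<theta>: "smooth_on UNIV \<theta>" "\<And>x. x \<in> ccube r1 ==> \<theta> x = 1" "\<And>x. \<theta> x \<noteq> 0 ==> x \<in> ccube r2"
    using cutoff_between_cubes[OF \<kappa> r(2)] by blast
  have "c_fam False {()} (\<lambda>_. UNIV) (\<lambda>_ x. \<theta> x *\<^sub>R f x)"
    by (rule c_fam_bilinear[OF bounded_bilinear_scaleR]) (use \<theta>(1) f in \<open>auto simp: c_fam_single\<close>)
  then have "smooth_on (cube 2) (\<lambda>x. \<theta> x *\<^sub>R f x)" using smooth_on_subset by (auto simp: c_fam_single)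
  then have g: "smooth_fun M (\<lambda>q. if q \<in> U \<alpha> then \<theta> (\<phi> \<alpha> q) *\<^sub>R f (\<phi> \<alpha> q) else 0)"
    by (rule smooth_extension[OF \<alpha> r(3)]) (use \<theta>(3) in force)
  show ?thesis
  proof (rule that[OF g, of "cube r1"])
    show "x \<in> cube r1" using le r(1) by (auto simp: cube_def intro: le_less_trans)
    show c: "cube r1 \<subseteq> (cube 2 :: (real^'n) set)" using r by (intro cube_mono) auto
    fix y :: "real^'n" assume y: "y \<in> cube r1"
    then have "y \<in> cube 2" "\<theta> y = 1" using c \<theta>(2) cube_subset_ccube by blast+
    then show "(if \<psi> \<alpha> y \<in> U \<alpha> then \<theta> (\<phi> \<alpha> (\<psi> \<alpha> y)) *\<^sub>R f (\<phi> \<alpha> (\<psi> \<alpha> y)) else 0) = f y"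
      using \<alpha> by (simp add: param_in coord_param)
  qed simp
qed

end

locale scaled_bg_cutoff = scaled_bg M B
  for M :: "('a::t2_space, 'n::finite) atlas" and B :: "('i, 'a, 'n) scaled_bg_data" +
  fixes \<kappa> :: "real^'n => real"
  assumes cutoff: "cutoff \<kappa>"
begin

lemma cot_function:
  assumes \<alpha>: "\<alpha> \<in> I" and x: "x \<in> cube 2"
  obtains g :: "'a => real" where "smooth_fun M g" "\<And>i. pd i (g \<circ> \<psi> \<alpha>) x = \<xi> $ i"
proof -
  have bl: "bounded_linear (\<lambda>y. y \<bullet> \<xi>)" by (rule bounded_linear_inner_left)
  have "smooth_on UNIV (\<lambda>y. y \<bullet> \<xi>)"
    using c_fam_linear[OF bl _ c_fam_id, of "{()}" "\<lambda>_. UNIV"] by (simp add: c_fam_single)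
  then obtain g T where g: "smooth_fun M g" "open T" "x \<in> T" "T \<subseteq> cube 2" "\<And>y. y \<in> T ==> g (\<psi> \<alpha> y) = y \<bullet> \<xi>"
    using test_function[OF cutoff \<alpha> x] by blast
  have "pd i (g \<circ> \<psi> \<alpha>) x = \<xi> $ i" for i
  proof -
    have "pd i (g \<circ> \<psi> \<alpha>) x = pd i (\<lambda>y. y \<bullet> \<xi>) x"
      unfolding pd_dird by (rule dird_local_cong[OF g(2,3)]) (simp add: g(5))
    also have "\<dots> = axis i 1 \<bullet> \<xi>"
      unfolding pd_dird by (rule dird_eqI) (rule bounded_linear_imp_has_derivative[OF bl])
    finally show ?thesis by (simp add: inner_axis')
  qed
  then show ?thesis using that g(1) by blast
qed

text \<open>Covectors are sets of functions, so distinct \<open>\<xi>\<close> would collapse if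
  these sets were empty. A function with prescribed gradient rules this out and makes
  \<open>cot_param\<close> injective.\<close>

lemma cot_param_nonempty:
  assumes "\<alpha> \<in> I" "x \<in> cube 2"
  obtains g where "smooth_fun M g" "\<And>i. pd i (g \<circ> \<psi> \<alpha>) x = \<xi> $ i / scl B \<alpha> $ i" "g \<in> snd (cot_param M B \<alpha> (x, \<xi>))"
proof -
  obtain g where "smooth_fun M g" "\<And>i. pd i (g \<circ> \<psi> \<alpha>) x = (\<chi> i. \<xi> $ i / scl B \<alpha> $ i) $ i"
    using cot_function[OF assms] by blast
  then show ?thesis by (intro that[of g]) (auto simp: cot_param_def)
qed

lemma cot_param_in:
  assumes "\<alpha> \<in> I" "x \<in> cube 2"
  shows "cot_param M B \<alpha> (x, \<xi>) \<in> cotangent_bundle M"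
proof -
  obtain g where g: "smooth_fun M g" "\<And>i. pd i (g \<circ> \<psi> \<alpha>) x = \<xi> $ i / scl B \<alpha> $ i"
    using cot_param_nonempty[OF assms] by blast
  have "cot_param M B \<alpha> (x, \<xi>) = (\<psi> \<alpha> x, differential M (\<psi> \<alpha> x) g)"
    using differential_eq[OF assms(1) param_in[OF assms] g(1)]
    by (simp add: cot_param_def coord_param[OF assms] g(2))
  then show ?thesis using g(1) by (auto simp: cotangent_bundle_def)
qed

lemma cot_cover:
  assumes "z \<in> cotangent_bundle M" "\<alpha> \<in> I" "fst z \<in> U \<alpha>"
  obtains \<xi> where "z = cot_param M B \<alpha> (\<phi> \<alpha> (fst z), \<xi>)"
proof -
  obtain q f where z: "z = (q, differential M q f)" and f: "smooth_fun M f"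
    using assms(1) by (auto simp: cotangent_bundle_def)
  have q: "q \<in> U \<alpha>" using assms(3) z by simp
  show ?thesis
  proof (rule that[of "\<chi> i. scl B \<alpha> $ i * pd i (f \<circ> \<psi> \<alpha>) (\<phi> \<alpha> q)"])
    have "scl B \<alpha> $ i \<noteq> 0" for i using scl_pos[OF assms(2), of i] by simp
    then show "z = cot_param M B \<alpha> (\<phi> \<alpha> (fst z), \<chi> i. scl B \<alpha> $ i * pd i (f \<circ> \<psi> \<alpha>) (\<phi> \<alpha> q))"
      unfolding z differential_eq[OF assms(2) q f] by (simp add: cot_param_def param_coord[OF assms(2) q])
  qed
qed

lemma cot_cases:
  assumes "z \<in> cotangent_bundle M"
  obtains \<alpha> x \<xi> where "\<alpha> \<in> I" "x \<in> cube 2" "z = cot_param M B \<alpha> (x, \<xi>)"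
proof -
  obtain \<alpha> where \<alpha>: "\<alpha> \<in> I" "fst z \<in> U \<alpha>" by (rule covered)
  obtain \<xi> where "z = cot_param M B \<alpha> (\<phi> \<alpha> (fst z), \<xi>)" using cot_cover[OF assms \<alpha>] .
  then show ?thesis by (rule that[OF \<alpha>(1) coord_in[OF \<alpha>]])
qed

lemma fst_cot_param [simp]: "fst (cot_param M B \<alpha> (x, \<xi>)) = \<psi> \<alpha> x"
  by (simp add: cot_param_def)

lemma cot_param_inj:
  assumes "\<alpha> \<in> I" "x \<in> cube 2" "y \<in> cube 2" "cot_param M B \<alpha> (x, \<xi>) = cot_param M B \<alpha> (y, \<eta>)"
  shows "x = y \<and> \<xi> = \<eta>"
proof -
  have xy: "x = y"
  proof -
    have "\<psi> \<alpha> x = \<psi> \<alpha> y" using arg_cong[OF assms(4), of fst] by simp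
    then have "\<phi> \<alpha> (\<psi> \<alpha> x) = \<phi> \<alpha> (\<psi> \<alpha> y)" by simp
    then show ?thesis by (simp only: coord_param[OF assms(1,2)] coord_param[OF assms(1,3)])
  qed
  obtain g where g: "\<And>i. pd i (g \<circ> \<psi> \<alpha>) x = \<xi> $ i / scl B \<alpha> $ i" "g \<in> snd (cot_param M B \<alpha> (x, \<xi>))"
    using cot_param_nonempty[OF assms(1,2)] by blast
  have "g \<in> snd (cot_param M B \<alpha> (y, \<eta>))" using g(2) assms(4) by simp
  then have "pd i (g \<circ> \<psi> \<alpha>) y = \<eta> $ i / scl B \<alpha> $ i" for i by (simp add: cot_param_def)
  then have "\<xi> $ i / scl B \<alpha> $ i = \<eta> $ i / scl B \<alpha> $ i" for i using g(1)[of i] xy by metis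
  then have "\<xi> $ i = \<eta> $ i" for i using scl_pos[OF assms(1), of i]
    by (metis divide_cancel_right order_less_irrefl)
  then show ?thesis using xy by (simp add: vec_eq_iff)
qed

lemma pull_cot:
  assumes "\<alpha> \<in> I" "x \<in> cube 2"
  shows "pull M B \<alpha> b (cot_param M B \<alpha> (x, \<xi>)) = b x \<xi>"
proof -
  have "inj_on (cot_param M B \<alpha>) (cube 2 \<times> UNIV)"
    using cot_param_inj[OF assms(1)] by (auto simp: inj_on_def)
  then have "inv_into (cube 2 \<times> UNIV) (cot_param M B \<alpha>) (cot_param M B \<alpha> (x, \<xi>)) = (x, \<xi>)"
    by (rule inv_into_f_f) (use assms in auto)
  then show ?thesis using assms by (simp add: pull_def)
qed

lemma pull_outside:
  assumes "\<alpha> \<in> I" "z \<notin> cotangent_bundle M"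
  shows "pull M B \<alpha> b z = 0"
  using cot_param_in[OF assms(1)] assms(2) by (auto simp: pull_def)

lemma symbol_eqI:
  assumes "\<And>z. z \<notin> cotangent_bundle M ==> a z = 0" "\<And>z. z \<notin> cotangent_bundle M ==> b z = 0"
    and "\<And>\<alpha> x \<xi>. \<alpha> \<in> I ==> x \<in> cube 2 ==> push M B \<alpha> a x \<xi> = push M B \<alpha> b x \<xi>"
  shows "a = b"
proof
  fix z show "a z = b z"
  proof (cases "z \<in> cotangent_bundle M")
    case True
    then obtain \<alpha> x \<xi> where "\<alpha> \<in> I" "x \<in> cube 2" "z = cot_param M B \<alpha> (x, \<xi>)" by (rule cot_cases)
    then show ?thesis using assms(3) by (simp add: push_def)
  qed (simp add: assms)
qed

section \<open>Polynomial symbols\<close>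

definition psym :: "int => 'a symbol => ('i => ('n => nat) => real^'n => complex) => bool" where
  "psym m a c \<longleftrightarrow> (\<forall>z. z \<notin> cotangent_bundle M \<longrightarrow> a z = 0) \<and>
     (\<forall>\<gamma>. cfam (\<lambda>\<alpha>. c \<alpha> \<gamma>)) \<and>
     (\<forall>\<alpha>\<in>I. \<forall>x\<in>cube 2. \<forall>\<xi>. push M B \<alpha> a x \<xi> = (\<Sum>\<gamma>\<in>midxs m. c \<alpha> \<gamma> x * mmonom \<gamma> \<xi>))"

text \<open>Each monomial of degree at most \<open>m\<close> satisfies the symbol estimate, and the
  coefficients depend on \<open>x\<close> alone, so mixed derivatives factor into those of the
  coefficients and those of the monomials.\<close>

lemma psym_poly_symbols:
  assumes "psym m a c"
  shows "a \<in> poly_symbols M B m"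
proof -
  have off: "\<And>z. z \<notin> cotangent_bundle M ==> a z = 0"
    and c: "\<And>\<gamma>. cfam (\<lambda>\<alpha>. c \<alpha> \<gamma>)"
    and p: "\<And>\<alpha> x \<xi>. \<alpha> \<in> I ==> x \<in> cube 2 ==> push M B \<alpha> a x \<xi> = (\<Sum>\<gamma>\<in>midxs m. c \<alpha> \<gamma> x * mmonom \<gamma> \<xi>)"
    using assms by (auto simp: psym_def)
  have c': "(\<forall>\<alpha>\<in>I. smooth_on (cube 2) (c \<alpha> \<gamma>)) \<and> unif_bounded_derivs I (\<lambda>_. cube 2) (\<lambda>\<alpha>. c \<alpha> \<gamma>)" for \<gamma>
    using c[of \<gamma>] by (subst (asm) c_fam_True) auto
  have op: "open (cube 2 \<times> (UNIV :: (real^'n) set) :: ((real^'n) \<times> (real^'n)) set)" by (intro open_Times) auto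
  have sm: "smooth_on (cube 2 \<times> UNIV) (\<lambda>(x, \<xi>). push M B \<alpha> a x \<xi>)" if \<alpha>: "\<alpha> \<in> I" for \<alpha>
  proof -
    have s: "c_fam False {()} (\<lambda>_. cube 2 \<times> UNIV) (\<lambda>_ p :: (real^'n) \<times> (real^'n). c \<alpha> \<gamma> (fst p))"
      "c_fam False {()} (\<lambda>_. cube 2 \<times> UNIV) (\<lambda>_ p :: (real^'n) \<times> (real^'n). mmonom \<gamma> (snd p))" for \<gamma>
    proof -
      have "smooth_on (cube 2) (c \<alpha> \<gamma>)" using c'[of \<gamma>] \<alpha> by blast
      then show "c_fam False {()} (\<lambda>_. cube 2 \<times> UNIV) (\<lambda>_ p :: (real^'n) \<times> (real^'n). c \<alpha> \<gamma> (fst p))"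
        unfolding c_fam_single[OF op] by (intro disjI2 smooth_on_fst[OF open_cube])
      show "c_fam False {()} (\<lambda>_. cube 2 \<times> UNIV) (\<lambda>_ p :: (real^'n) \<times> (real^'n). mmonom \<gamma> (snd p))"
        unfolding c_fam_single[OF op] by (intro disjI2 smooth_on_snd[OF open_cube smooth_mmonom])
    qed
    have "c_fam False {()} (\<lambda>_. cube 2 \<times> UNIV) (\<lambda>_ p :: (real^'n) \<times> (real^'n). \<Sum>\<gamma>\<in>midxs m. c \<alpha> \<gamma> (fst p) * mmonom \<gamma> (snd p))"
      by (intro c_fam_sum c_fam_mult s op)
    then have "smooth_on (cube 2 \<times> UNIV) (\<lambda>p :: (real^'n) \<times> (real^'n). \<Sum>\<gamma>\<in>midxs m. c \<alpha> \<gamma> (fst p) * mmonom \<gamma> (snd p))"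
      by (simp add: c_fam_single[OF op])
    then show ?thesis by (rule smooth_on_transfer[OF op]) (auto simp: p \<alpha>)
  qed
  have bd: "\<exists>C. \<forall>\<alpha>\<in>I. \<forall>x\<in>cube 2. \<forall>\<xi>. norm (mpd \<beta> (\<lambda>y. mpd \<gamma> (push M B \<alpha> a y) \<xi>) x)
      \<le> C * sqrt (1 + (norm \<xi>)\<^sup>2) powr (of_int m - real (mlen \<gamma>))" for \<beta> \<gamma> :: "'n => nat"
  proof -
    have "\<exists>C. \<forall>\<alpha>\<in>I. \<forall>x\<in>cube 2. norm (mpd \<beta> (c \<alpha> \<delta>) x) \<le> C" for \<delta>
      using c'[of \<delta>] unfolding unif_bounded_derivs_def by blast
    then have "\<forall>\<delta>. \<exists>C. \<forall>\<alpha>\<in>I. \<forall>x\<in>cube 2. norm (mpd \<beta> (c \<alpha> \<delta>) x) \<le> C" by blast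
    from choice[OF this] obtain C where C: "\<And>\<delta> \<alpha> x. \<alpha> \<in> I ==> x \<in> cube 2 ==> norm (mpd \<beta> (c \<alpha> \<delta>) x) \<le> C \<delta>" by blast
    define J where "J = (\<lambda>\<xi>::real^'n. sqrt (1 + (norm \<xi>)\<^sup>2) powr (of_int m - real (mlen \<gamma>)))"
    have "norm (mpd \<beta> (\<lambda>y. mpd \<gamma> (push M B \<alpha> a y) \<xi>) x)
        \<le> (\<Sum>\<delta>\<in>midxs m. C \<delta> * of_nat (falling (ilist \<gamma>) \<delta>)) * J \<xi>"
      if \<alpha>: "\<alpha> \<in> I" and x: "x \<in> cube 2" for \<alpha> x \<xi>
    proof -
      have 1: "mpd \<gamma> (push M B \<alpha> a y) \<xi> = (\<Sum>\<delta>\<in>midxs m. c \<alpha> \<delta> y * mpd \<gamma> (mmonom \<delta>) \<xi>)" if y: "y \<in> cube 2" for y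
      proof -
        have "push M B \<alpha> a y = (\<lambda>\<xi>. \<Sum>\<delta>\<in>midxs m. c \<alpha> \<delta> y * mmonom \<delta> \<xi>)"
          using p[OF \<alpha> y] by (simp add: fun_eq_iff)
        then show ?thesis using mpd_sum_mult_left[OF open_UNIV smooth_mmonom finite_mlen_int UNIV_I] by simp
      qed
      have "mpd \<beta> (\<lambda>y. mpd \<gamma> (push M B \<alpha> a y) \<xi>) x
          = mpd \<beta> (\<lambda>y. \<Sum>\<delta>\<in>midxs m. c \<alpha> \<delta> y * mpd \<gamma> (mmonom \<delta>) \<xi>) x"
        unfolding mpd_def[of \<beta>] by (rule iter_deriv_local_cong[OF open_cube 1 x])
      also have "\<dots> = (\<Sum>\<delta>\<in>midxs m. mpd \<beta> (c \<alpha> \<delta>) x * mpd \<gamma> (mmonom \<delta>) \<xi>)"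
        by (rule mpd_sum_mult[OF open_cube _ finite_mlen_int x]) (use c' \<alpha> in blast)
      also have "norm \<dots> \<le> (\<Sum>\<delta>\<in>midxs m. norm (mpd \<beta> (c \<alpha> \<delta>) x * mpd \<gamma> (mmonom \<delta>) \<xi>))"
        by (rule norm_sum)
      also have "\<dots> \<le> (\<Sum>\<delta>\<in>midxs m. C \<delta> * (of_nat (falling (ilist \<gamma>) \<delta>) * J \<xi>))"
      proof (rule sum_mono)
        fix \<delta> :: "'n => nat" assume \<delta>: "\<delta> \<in> {\<delta>. int (mlen \<delta>) \<le> m}"
        have "norm (mpd \<beta> (c \<alpha> \<delta>) x) * norm (mpd \<gamma> (mmonom \<delta>) \<xi>) \<le> C \<delta> * (of_nat (falling (ilist \<gamma>) \<delta>) * J \<xi>)"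
        proof (rule mult_mono[OF C[OF \<alpha> x]])
          show "norm (mpd \<gamma> (mmonom \<delta>) \<xi>) \<le> of_nat (falling (ilist \<gamma>) \<delta>) * J \<xi>"
            unfolding J_def by (rule norm_mpd_mmonom) (use \<delta> in simp)
          show "0 \<le> C \<delta>" using C[OF \<alpha> x, of \<delta>] norm_ge_zero order_trans by blast
        qed simp
        then show "norm (mpd \<beta> (c \<alpha> \<delta>) x * mpd \<gamma> (mmonom \<delta>) \<xi>) \<le> C \<delta> * (of_nat (falling (ilist \<gamma>) \<delta>) * J \<xi>)"
          by (simp add: norm_mult)
      qed
      finally show ?thesis by (simp add: sum_distrib_right mult.assoc)
    qed
    then show ?thesis unfolding J_def by blast
  qed
  have "a \<in> symbols M B (of_int m)"
    unfolding symbols_def using off sm bd by blast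
  moreover have "\<exists>c. \<forall>\<xi>. push M B \<alpha> a x \<xi> = (\<Sum>\<gamma>\<in>midxs m. c \<gamma> * mmonom \<gamma> \<xi>)"
    if "\<alpha> \<in> I" "x \<in> cube 2" for \<alpha> x
    using p[OF that] by (intro exI[of _ "\<lambda>\<gamma>. c \<alpha> \<gamma> x"]) simp
  ultimately show ?thesis unfolding poly_symbols_def by blast
qed

text \<open>Polynomiality is assumed pointwise in \<open>x\<close>, without regularity of the
  coefficients. They are recovered as Taylor coefficients at \<open>\<xi> = 0\<close>, where the
  weight in the symbol estimates equals 1 and the estimates become uniform bounds.\<close>

lemma poly_symbols_psym:
  assumes a: "a \<in> poly_symbols M B m"
  obtains c where "psym m a c"
proof -
  have off: "\<And>z. z \<notin> cotangent_bundle M ==> a z = 0"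
    and sm: "\<And>\<alpha>. \<alpha> \<in> I ==> smooth_on (cube 2 \<times> UNIV) (\<lambda>(x, \<xi>). push M B \<alpha> a x \<xi>)"
    and bd: "\<And>\<beta> \<gamma>. \<exists>C. \<forall>\<alpha>\<in>I. \<forall>x\<in>cube 2. \<forall>\<xi>. norm (mpd \<beta> (\<lambda>y. mpd \<gamma> (push M B \<alpha> a y) \<xi>) x)
      \<le> C * sqrt (1 + (norm \<xi>)\<^sup>2) powr (of_int m - real (mlen \<gamma>))"
    and p: "\<And>\<alpha> x. \<alpha> \<in> I ==> x \<in> cube 2 ==> \<exists>c. \<forall>\<xi>. push M B \<alpha> a x \<xi> = (\<Sum>\<gamma>\<in>midxs m. c \<gamma> * mmonom \<gamma> \<xi>)"
    using a unfolding poly_symbols_def symbols_def by blast+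
  define c where "c = (\<lambda>\<alpha> \<gamma> x. inverse (of_nat (mfact \<gamma>)) * mpd \<gamma> (push M B \<alpha> a x) 0)"
  have "psym m a c"
    unfolding psym_def
  proof (intro conjI allI impI ballI)
    show "a z = 0" if "z \<notin> cotangent_bundle M" for z by (rule off[OF that])
    fix \<gamma> :: "'n => nat"
    have s: "smooth_on (cube 2) (\<lambda>x. mpd \<gamma> (push M B \<alpha> a x) 0)" if \<alpha>: "\<alpha> \<in> I" for \<alpha>
    proof (rule smooth_on_transfer[OF open_cube smooth_on_slice[OF open_cube smooth_on_iter_deriv[OF sm[OF \<alpha>]]]])
      fix x :: "real^'n" assume "x \<in> cube 2"
      from iter_deriv_slice[OF open_cube sm[OF \<alpha>] this]
      show "iter_deriv (map (\<lambda>v. (0, v)) (map (\<lambda>i. axis i 1) (ilist \<gamma>))) (\<lambda>(x, \<xi>). push M B \<alpha> a x \<xi>) (x, 0) = mpd \<gamma> (push M B \<alpha> a x) 0"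
        unfolding mpd_ilist by simp
    qed
    have "unif_bounded_derivs I (\<lambda>_. cube 2) (\<lambda>\<alpha> x. mpd \<gamma> (push M B \<alpha> a x) 0)"
    proof (rule unif_bounded_derivsI)
      fix \<beta> :: "'n => nat"
      obtain C where C: "\<forall>\<alpha>\<in>I. \<forall>x\<in>cube 2. \<forall>\<xi>. norm (mpd \<beta> (\<lambda>y. mpd \<gamma> (push M B \<alpha> a y) \<xi>) x)
        \<le> C * sqrt (1 + (norm \<xi>)\<^sup>2) powr (of_int m - real (mlen \<gamma>))" using bd by blast
      have "norm (mpd \<beta> (\<lambda>y. mpd \<gamma> (push M B \<alpha> a y) 0) x) \<le> C" if "\<alpha> \<in> I" "x \<in> cube 2" for \<alpha> x
        using C[rule_format, OF that, of 0] by simp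
      then show "\<exists>C. \<forall>\<alpha>\<in>I. \<forall>x\<in>cube 2. norm (mpd \<beta> (\<lambda>y. mpd \<gamma> (push M B \<alpha> a y) 0) x) \<le> C" by blast
    qed
    then have "cfam (\<lambda>\<alpha> x. mpd \<gamma> (push M B \<alpha> a x) 0)"
      using s by (subst c_fam_True) auto
    then show "cfam (\<lambda>\<alpha>. c \<alpha> \<gamma>)"
      unfolding c_def by (intro c_fam_mult c_fam_const') auto
  next
    fix \<alpha> and x \<xi> :: "real^'n" assume "\<alpha> \<in> I" "x \<in> cube 2"
    then obtain d where d: "\<And>\<xi>. push M B \<alpha> a x \<xi> = (\<Sum>\<gamma>\<in>midxs m. d \<gamma> * mmonom \<gamma> \<xi>)" using p by blast
    have "c \<alpha> \<gamma> x = d \<gamma>" if "int (mlen \<gamma>) \<le> m" for \<gamma>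
    proof -
      have "push M B \<alpha> a x = (\<lambda>\<xi>. \<Sum>\<delta>\<in>midxs m. d \<delta> * mmonom \<delta> \<xi>)" using d by (simp add: fun_eq_iff)
      then have "mpd \<gamma> (push M B \<alpha> a x) 0 = (\<Sum>\<delta>\<in>midxs m. d \<delta> * mpd \<gamma> (mmonom \<delta>) 0)"
        using mpd_sum_mult_left[OF open_UNIV smooth_mmonom finite_mlen_int UNIV_I] by simp
      also have "\<dots> = (\<Sum>\<delta>\<in>midxs m. if \<delta> = \<gamma> then d \<gamma> * of_nat (mfact \<gamma>) else 0)"
        by (intro sum.cong refl) (simp add: mpd_mmonom_0)
      also have "\<dots> = d \<gamma> * of_nat (mfact \<gamma>)" using that by simp
      finally show ?thesis using mfact_nonzero[of \<gamma>] by (simp add: c_def)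
    qed
    then show "push M B \<alpha> a x \<xi> = (\<Sum>\<gamma>\<in>midxs m. c \<alpha> \<gamma> x * mmonom \<gamma> \<xi>)"
      unfolding d by (intro sum.cong refl) simp
  qed
  then show ?thesis by (rule that)
qed

end

text \<open>For finitely many classes the maximum of their constants serves. The classes will be the
  colours.\<close>

lemma c_fam_fibres:
  fixes F :: "'k => 'e::euclidean_space => 'b::real_normed_vector"
  assumes "\<And>k. k \<in> I ==> p k < (N::nat)" "\<And>c. c < N ==> c_fam b {k \<in> I. p k = c} D F"
  shows "c_fam b I D F"
  unfolding c_fam_def cn_fam_def
proof (intro allI impI conjI ballI)
  fix n and vs :: "'e list" assume vs: "length vs \<le> n \<and> set vs \<subseteq> Basis"
  have *: "(\<forall>k\<in>{k \<in> I. p k = c}. \<forall>x\<in>D k. iter_deriv vs (F k) differentiable (at x)) \<and>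
        (b \<longrightarrow> (\<exists>C. \<forall>k\<in>{k \<in> I. p k = c}. \<forall>x\<in>D k. norm (iter_deriv vs (F k) x) \<le> C))" if "c < N" for c
    using c_fam_D[OF assms(2)[OF that], of n] vs unfolding cn_fam_def by blast
  show "iter_deriv vs (F k) differentiable (at x)" if "k \<in> I" "x \<in> D k" for k x
    using *[OF assms(1)[OF that(1)]] that by blast
  assume b: b
  have "\<forall>c. \<exists>C. c < N \<longrightarrow> (\<forall>k\<in>{k \<in> I. p k = c}. \<forall>x\<in>D k. norm (iter_deriv vs (F k) x) \<le> C)"
    using * b by blast
  from choice[OF this] obtain C where
    C: "\<And>c k x. c < N ==> k \<in> I ==> p k = c ==> x \<in> D k ==> norm (iter_deriv vs (F k) x) \<le> C c" by blast
  have "norm (iter_deriv vs (F k) x) \<le> Max (C ` {..<N})" if k: "k \<in> I" and x: "x \<in> D k" for k x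
  proof -
    have "norm (iter_deriv vs (F k) x) \<le> C (p k)" by (rule C[OF assms(1)[OF k] k refl x])
    also have "\<dots> \<le> Max (C ` {..<N})" using assms(1)[OF k] by (intro Max_ge) auto
    finally show ?thesis .
  qed
  then show "\<exists>C. \<forall>k\<in>I. \<forall>x\<in>D k. norm (iter_deriv vs (F k) x) \<le> C" by blast
qed

lemma pd_of_real:
  "f differentiable (at x) ==> pd i (\<lambda>y. of_real (f y) :: complex) x = of_real (pd i f x)"
  unfolding pd_dird by (rule dird_linear[OF bounded_linear_of_real])

lemma differentiable_cor: "f differentiable (at x) ==> (\<lambda>y. cor (f y)) differentiable (at x)"
  using bounded_linear.has_derivative[OF bounded_linear_of_real has_derivative_dird] by (rule differentiableI)

lemma pd_mult:
  fixes f g :: "real^'n::finite => 'b::real_normed_algebra"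
  assumes "f differentiable (at x)" "g differentiable (at x)"
  shows "pd i (\<lambda>y. f y * g y) x = f x * pd i g x + pd i f x * g x"
  unfolding pd_dird
  using dird_eqI[OF has_derivative_mult[OF has_derivative_dird[OF assms(1)] has_derivative_dird[OF assms(2)]]] .

lemma pd_sum:
  assumes "\<And>k. k \<in> A ==> f k differentiable (at x)"
  shows "pd i (\<lambda>y. \<Sum>k\<in>A. f k y) x = (\<Sum>k\<in>A. pd i (f k) x)"
  unfolding pd_dird by (rule dird_eqI, rule has_derivative_sum) (rule has_derivative_dird[OF assms])

lemma pd_add:
  assumes "f differentiable (at x)" "g differentiable (at x)"
  shows "pd i (\<lambda>y. f y + g y) x = pd i f x + pd i g x"
  unfolding pd_dird
  using dird_eqI[OF has_derivative_add[OF has_derivative_dird[OF assms(1)] has_derivative_dird[OF assms(2)]]] .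

lemma pd_inverse:
  fixes f :: "real^'n::finite => real"
  assumes "f differentiable (at x)" "f x \<noteq> 0"
  shows "pd i (\<lambda>y. inverse (f y)) x = - pd i f x / (f x * f x)"
  unfolding pd_dird
  using dird_eqI[OF Deriv.has_derivative_inverse[OF assms(2) has_derivative_dird[OF assms(1)]], of "axis i 1"]
  by (simp add: field_simps)

lemma pd_local_cong:
  "open S ==> x \<in> S ==> (\<And>y. y \<in> S ==> f y = g y) ==> pd i f x = pd i g x"
  unfolding pd_dird by (rule dird_local_cong)

lemma pd_const [simp]: "pd i (\<lambda>y. c) = (\<lambda>x. 0)"
  by (simp add: pd_dird)

context scaled_bg
begin

section \<open>Vector fields in charts\<close>

definition vrep :: "'a operator => ('i => real^'n => real^'n) => bool" where
  "vrep V v \<longleftrightarrow> (\<forall>u. \<not> smooth_fun M u \<longrightarrow> V u = (\<lambda>q. 0)) \<and>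
     (\<forall>i. cfam (\<lambda>\<alpha> x. v \<alpha> x $ i)) \<and>
     (\<forall>u. smooth_fun M u \<longrightarrow> (\<forall>\<alpha>\<in>I. \<forall>x\<in>cube 2. V u (\<psi> \<alpha> x) =
        (\<Sum>i\<in>UNIV. cor (v \<alpha> x $ i * scl B \<alpha> $ i) * pd i (u \<circ> \<psi> \<alpha>) x)))"

lemma op_lie_iff: "V \<in> op_lie_algebra M B \<longleftrightarrow> (\<exists>v. vrep V v)"
proof -
  have "(\<forall>i. cfam (\<lambda>\<alpha> x. v \<alpha> x $ i)) \<longleftrightarrow>
      (\<forall>\<alpha>\<in>I. smooth_on (cube 2) (v \<alpha>)) \<and> unif_bounded_derivs I (\<lambda>_. cube 2) v" for v :: "'i => real^'n => real^'n"
  proof -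
    have "(\<forall>i. cfam (\<lambda>\<alpha> x. v \<alpha> x $ i)) \<longleftrightarrow> cfam v"
    proof
      assume "\<forall>i. cfam (\<lambda>\<alpha> x. v \<alpha> x $ i)"
      then show "cfam v" by (intro c_fam_vec) auto
    next
      assume v: "cfam v"
      show "\<forall>i. cfam (\<lambda>\<alpha> x. v \<alpha> x $ i)"
        by (intro allI c_fam_component v) simp
    qed
    also have "\<dots> \<longleftrightarrow> (\<forall>\<alpha>\<in>I. smooth_on (cube 2) (v \<alpha>)) \<and> unif_bounded_derivs I (\<lambda>_. cube 2) v"
      by (rule c_fam_True) simp
    finally show ?thesis .
  qed
  then show ?thesis unfolding op_lie_algebra_def bg_vector_fields_def vrep_def by blast
qed

lemma smooth_chart: "smooth_fun M u ==> \<alpha> \<in> I ==> smooth_on (cube 2) (u \<circ> \<psi> \<alpha>)"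
  by (simp add: smooth_fun_iff o_def)

lemma c_fam_smooth_fun': "smooth_fun M f \<longleftrightarrow> c_fam False I (\<lambda>_. cube 2) (\<lambda>\<alpha>. f \<circ> \<psi> \<alpha>)"
  unfolding c_fam_smooth_fun by (simp add: o_def)

lemma vrep_smooth:
  assumes "vrep V v" "smooth_fun M u"
  shows "smooth_fun M (V u)"
proof -
  have "c_fam False I (\<lambda>_. cube 2) (\<lambda>\<alpha> x. v \<alpha> x $ i)" for i
    using assms(1) unfolding vrep_def by (intro c_fam_weaken[THEN c_fam_smooth]) blast
  then have 1: "c_fam False I (\<lambda>_. cube 2) (\<lambda>\<alpha> x. \<Sum>i\<in>UNIV. cor (v \<alpha> x $ i * scl B \<alpha> $ i) * pd i (u \<circ> \<psi> \<alpha>) x)"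
    using assms(2)
    by (intro c_fam_sum c_fam_mult c_fam_of_real c_fam_pd c_fam_const) (auto simp: c_fam_smooth_fun')
  show ?thesis
    unfolding c_fam_smooth_fun
    by (rule c_fam_cong[OF _ _ 1]) (use assms in \<open>auto simp: vrep_def\<close>)
qed

lemma smooth_fun_add:
  fixes f g :: "'a => 'b::real_normed_vector"
  shows "smooth_fun M f ==> smooth_fun M g ==> smooth_fun M (\<lambda>q. f q + g q)"
  unfolding c_fam_smooth_fun by (rule c_fam_add) auto

lemma smooth_fun_mult:
  fixes f g :: "'a => 'b::real_normed_algebra"
  shows "smooth_fun M f ==> smooth_fun M g ==> smooth_fun M (\<lambda>q. f q * g q)"
  unfolding c_fam_smooth_fun by (rule c_fam_mult) auto

lemma smooth_fun_of_real: "smooth_fun M f ==> smooth_fun M (\<lambda>q. cor (f q))"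
  unfolding c_fam_smooth_fun by (rule c_fam_of_real) auto

lemma smooth_fun_const [simp]: "smooth_fun M (\<lambda>q. c :: 'b::real_normed_vector)"
  unfolding c_fam_smooth_fun by (rule c_fam_const')

lemma smooth_fun_C_uni:
  fixes f :: "'a => 'b::real_normed_vector"
  shows "f \<in> C_uni M B ==> smooth_fun M f"
  by (simp add: C_uni_def)

section \<open>Weights in charts\<close>

text \<open>With all scales equal to 1 the scale condition is a bound on derivatives of the
  transition maps, which every bounded geometry structure has. Hence what holds for the operator Lie
  algebra also applies to the fields that define weights.\<close>

lemma unscaled: "scaled_bg M (B\<lparr>scl := \<lambda>_. \<chi> i. 1\<rparr>)"
proof
  show "smooth_atlas M" by (rule atlas)
  define B1 where "B1 = B\<lparr>scl := \<lambda>_. (\<chi> i. 1) :: real^'n\<rparr>"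
  have f: "indices B1 = I" "nbhd B1 = U" "coord B1 = \<phi>" "scl B1 = (\<lambda>_. \<chi> i. 1)" by (simp_all add: B1_def)
  have t: "transition B1 B1 = transition B B" by (simp add: transition_def param_def f fun_eq_iff)
  have "bg_structure M B1" using bg by (simp add: bg_structure_def f t)
  moreover have "scale_bounds B1 B1 (\<lambda>\<alpha> \<beta>. nbhd B1 \<alpha> \<inter> nbhd B1 \<beta>)"
    unfolding scale_bounds_def f t
  proof
    fix \<gamma> :: "'n => nat"
    have "\<exists>C. \<forall>k\<in>I\<times>I. \<forall>x\<in>ov k. norm (mpd \<gamma> (\<lambda>y. pd i (\<lambda>z. trans k z $ j) y) x) \<le> C" for i j
    proof -
      have "c_fam True (I \<times> I) ov (\<lambda>k. pd i (\<lambda>z. trans k z $ j))"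
        by (intro c_fam_pd c_fam_component c_fam_trans) (auto intro: open_ov)
      then have "unif_bounded_derivs (I \<times> I) ov (\<lambda>k. pd i (\<lambda>z. trans k z $ j))"
        by (subst (asm) c_fam_True) (auto intro: open_ov)
      then obtain C where "\<forall>k\<in>I\<times>I. \<forall>x\<in>ov k. \<forall>\<delta>. mlen \<delta> \<le> mlen \<gamma> \<longrightarrow> norm (mpd \<delta> (pd i (\<lambda>z. trans k z $ j)) x) \<le> C"
        unfolding unif_bounded_derivs_def by blast
      then show ?thesis by (intro exI[of _ C]) auto
    qed
    then have "\<forall>ij. \<exists>C. \<forall>k\<in>I\<times>I. \<forall>x\<in>ov k. norm (mpd \<gamma> (\<lambda>y. pd (fst ij) (\<lambda>z. trans k z $ snd ij) y) x) \<le> C" by blast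
    from choice[OF this] obtain C where
      C: "\<And>ij k x. k \<in> I\<times>I ==> x \<in> ov k ==> norm (mpd \<gamma> (\<lambda>y. pd (fst ij) (\<lambda>z. trans k z $ snd ij) y) x) \<le> C ij" by blast
    have bd: "\<bar>mpd \<gamma> (\<lambda>y. pd i (\<lambda>z. trans k z $ j) y) x\<bar> \<le> Max (range C)" if "k \<in> I \<times> I" "x \<in> ov k" for k x i j
    proof -
      have "\<bar>mpd \<gamma> (\<lambda>y. pd i (\<lambda>z. trans k z $ j) y) x\<bar> \<le> C (i, j)" using C[OF that, of "(i, j)"] by simp
      also have "\<dots> \<le> Max (range C)" by (rule Max_ge) auto
      finally show ?thesis .
    qed
    show "\<exists>C. \<forall>\<alpha>\<in>I. \<forall>\<beta>\<in>I. \<forall>x\<in>\<phi> \<alpha> ` (U \<alpha> \<inter> U \<beta>). \<forall>i j.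
        \<bar>mpd \<gamma> (\<lambda>y. (\<chi> i. 1) $ i * pd i (\<lambda>z. transition B B \<alpha> \<beta> z $ j) y) x\<bar> \<le> C * (\<chi> i. 1) $ j"
    proof (intro exI[of _ "Max (range C)"] ballI allI)
      fix \<alpha> \<beta> x i j assume "\<alpha> \<in> I" "\<beta> \<in> I" "x \<in> \<phi> \<alpha> ` (U \<alpha> \<inter> U \<beta>)"
      then show "\<bar>mpd \<gamma> (\<lambda>y. (\<chi> i. 1) $ i * pd i (\<lambda>z. transition B B \<alpha> \<beta> z $ j) y) x\<bar> \<le> Max (range C) * (\<chi> i. 1) $ j"
        using bd[of "(\<alpha>, \<beta>)" x i j] by (simp add: ov_def trans_def)
    qed
  qed
  ultimately show "scaled_bg_structure M (B\<lparr>scl := \<lambda>_. \<chi> i. 1\<rparr>)"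
    unfolding scaled_bg_structure_def B1_def by simp
qed

lemma uni_vector_fields_eq: "uni_vector_fields M B = op_lie_algebra M (B\<lparr>scl := \<lambda>_. \<chi> i. 1\<rparr>)"
  by (simp add: uni_vector_fields_def op_lie_algebra_def bg_vector_fields_def param_def)

text \<open>The i-th partial derivative of \<open>log w\<close> in the chart.\<close>

definition logd :: "('a => real) => 'n => 'i => real^'n => real" where
  "logd w i \<alpha> x = pd i (\<lambda>y. w (\<psi> \<alpha> y)) x / w (\<psi> \<alpha> x)"

lemma logd_trans:
  assumes w: "smooth_fun M w" and ab: "\<alpha> \<in> I" "\<beta> \<in> I" and x: "x \<in> ov (\<beta>, \<alpha>)"
  shows "logd w i \<beta> x = (\<Sum>l\<in>UNIV. pd i (\<lambda>z. trans (\<beta>, \<alpha>) z $ l) x * logd w l \<alpha> (trans (\<beta>, \<alpha>) x))"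
proof -
  have k: "(\<beta>, \<alpha>) \<in> I \<times> I" using ab by simp
  have "pd i (\<lambda>y. w (\<psi> \<beta> y)) x = pd i (\<lambda>z. (\<lambda>y. w (\<psi> \<alpha> y)) (trans (\<beta>, \<alpha>) z)) x"
    by (rule pd_local_cong[OF open_ov[OF k] x]) (use ab in \<open>simp add: param_trans\<close>)
  also have "\<dots> = (\<Sum>l\<in>UNIV. pd i (\<lambda>z. trans (\<beta>, \<alpha>) z $ l) x *\<^sub>R pd l (\<lambda>y. w (\<psi> \<alpha> y)) (trans (\<beta>, \<alpha>) x))"
  proof (rule pd_compose)
    have "trans (\<beta>, \<alpha>) x \<in> cube 2" using trans_in[OF ab(2,1) x] ab by (simp add: ov_eq)
    moreover have "smooth_on (cube 2) (\<lambda>y. w (\<psi> \<alpha> y))" using w ab by (simp add: smooth_fun_iff)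
    ultimately show "(\<lambda>y. w (\<psi> \<alpha> y)) differentiable (at (trans (\<beta>, \<alpha>) x))" by (rule smooth_on_differentiable[rotated])
    show "trans (\<beta>, \<alpha>) differentiable (at x)" by (rule c_fam_differentiable[OF c_fam_trans k x])
  qed
  finally show ?thesis
    unfolding logd_def using param_trans[OF ab x] by (simp add: sum_divide_distrib)
qed

end

context scaled_bg_cutoff
begin

text \<open>Weights are defined by means of global fields. The coordinate fields of one colour are
  such fields and give the logarithmic derivatives on the unit cubes; since these cubes cover, the
  transformation rule \<open>logd_trans\<close> carries the bounds to the full cubes.\<close>

lemma weight_logd:
  assumes "weight M B w"
  shows "cfam (logd w i)"
proof -
  have w: "\<And>q. 0 < w q" "smooth_fun M w"
    "\<And>W. W \<in> uni_vector_fields M B ==> (\<lambda>q. W (\<lambda>q'. cor (w q')) q / cor (w q)) \<in> C_uni M B"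
    using assms by (auto simp: weight_def)
  define B1 where "B1 = B\<lparr>scl := \<lambda>_. (\<chi> i. 1) :: real^'n\<rparr>"
  interpret B1: scaled_bg M B1 unfolding B1_def by (rule unscaled)
  have f: "indices B1 = I" "nbhd B1 = U" "coord B1 = \<phi>" "scl B1 = (\<lambda>_. \<chi> i. 1)" by (simp_all add: B1_def)
  have pf: "param B1 = \<psi>" by (simp add: param_def f fun_eq_iff)
  obtain col :: "'i => nat" and N where col: "\<forall>\<alpha>\<in>I. col \<alpha> < N"
    "\<forall>\<alpha>\<in>I. \<forall>\<beta>\<in>I. \<alpha> \<noteq> \<beta> \<longrightarrow> col \<alpha> = col \<beta> \<longrightarrow> B1.kc (3/2) \<alpha> \<inter> B1.kc (3/2) \<beta> = {}"
    using B1.colouring_exists[of "3/2"] by (auto simp: f)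
  interpret C1: coloured_bg M B1 "3/2" col N
    by unfold_locales (use col in \<open>auto simp: f\<close>)
  \<comment> \<open>The radii \<open>1 < 5/4 < 3/2\<close> give a cutoff that is 1 on the unit cube
    and supported strictly inside the cubes of radius \<open>3/2\<close>, whose images are disjoint
    within one colour.\<close>
  obtain \<theta> :: "real^'n => real" where \<theta>: "smooth_on UNIV \<theta>" "\<And>x. x \<in> ccube 1 ==> \<theta> x = 1" "\<And>x. \<theta> x \<noteq> 0 ==> x \<in> ccube (5/4)"
    using cutoff_between_cubes[OF cutoff, of 1 "5/4"] by auto
  define h where "h = (\<lambda>c l q. C1.cfield \<theta> c l (\<lambda>q'. cor (w q')) q / cor (w q))"
  have "h c l \<in> C_uni M B" for c l
    unfolding h_def
    by (rule w(3), unfold uni_vector_fields_eq, fold B1_def, rule C1.cfield_in[of "5/4"]) (use \<theta> in auto)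
  then have h: "cfam (\<lambda>\<alpha> x. Re (h c l (\<psi> \<alpha> x)))" for c l
    by (intro c_fam_linear[OF bounded_linear_Re]) (auto simp: C_uni_iff)
  have c12: "cube 1 \<subseteq> (cube 2 :: (real^'n) set)" "cube 1 \<subseteq> (ccube (3/2) :: (real^'n) set)"
    "cube 1 \<subseteq> (ccube 1 :: (real^'n) set)"
    using cube_mono[of 1 2] cube_mono[of 1 "3/2"] cube_subset_ccube[of "3/2"] cube_subset_ccube[of 1] by auto
  have hl: "Re (h (col \<alpha>) l (\<psi> \<alpha> x)) = logd w l \<alpha> x" if \<alpha>: "\<alpha> \<in> I" and x: "x \<in> cube 1" for \<alpha> x l
  proof -
    have "C1.cfield \<theta> (col \<alpha>) l (\<lambda>q'. cor (w q')) (\<psi> \<alpha> x)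
        = cor (\<theta> x * scl B1 \<alpha> $ l) * pd l ((\<lambda>q'. cor (w q')) \<circ> \<psi> \<alpha>) x"
      using C1.cfield_param[of \<alpha> "col \<alpha>" x "\<lambda>q'. cor (w q')" \<theta> l] \<alpha> x c12 w(2) smooth_fun_of_real
      by (auto simp: f pf)
    also have "\<dots> = cor (pd l (\<lambda>y. w (\<psi> \<alpha> y)) x)"
    proof -
      have "(\<lambda>y. w (\<psi> \<alpha> y)) differentiable (at x)"
        using w(2) \<alpha> x c12 smooth_on_differentiable[of "cube 2" "\<lambda>y. w (\<psi> \<alpha> y)" x] by (auto simp: smooth_fun_iff)
      then show ?thesis using \<theta>(2)[of x] x c12 pd_of_real[of "\<lambda>y. w (\<psi> \<alpha> y)" x l] by (auto simp: f o_def)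
    qed
    finally show ?thesis by (simp add: h_def logd_def)
  qed
  have s1: "c_fam True I (\<lambda>_. cube 1) (logd w l)" for l
  proof (rule c_fam_fibres[where p = col and N = N])
    show "col k < N" if "k \<in> I" for k using col that by blast
    fix c
    have "c_fam True {k \<in> I. col k = c} (\<lambda>_. cube 1) (\<lambda>\<alpha> x. Re (h c l (\<psi> \<alpha> x)))"
      by (rule c_fam_reindex[OF _ _ h[of c l], where s = "\<lambda>k. k"]) (use c12 in auto)
    then show "c_fam True {k \<in> I. col k = c} (\<lambda>_. cube 1) (logd w l)"
      by (rule c_fam_cong[rotated 2]) (use hl in auto)
  qed
  define E where "E = (\<lambda>(\<beta>, \<alpha>). \<phi> \<beta> ` (U \<beta> \<inter> \<psi> \<alpha> ` cube 1))"
  have E: "E (\<beta>, \<alpha>) = {x \<in> cube 2. \<psi> \<beta> x \<in> U \<alpha> \<and> \<phi> \<alpha> (\<psi> \<beta> x) \<in> cube 1}" if "\<alpha> \<in> I" "\<beta> \<in> I" for \<alpha> \<beta>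
    using that by (auto simp: E_def coord_image param_image[OF _ c12(1)])
  have opE: "open (E k)" if k: "k \<in> I \<times> I" for k
  proof -
    obtain \<beta> \<alpha> where k': "k = (\<beta>, \<alpha>)" "\<beta> \<in> I" "\<alpha> \<in> I" using k by blast
    show ?thesis unfolding k'(1) E_def prod.case
      by (rule open_coord_image[OF k'(2) open_param_image[OF k'(3) open_cube c12(1)]])
  qed
  have Eov: "E k \<subseteq> ov k" if "k \<in> I \<times> I" for k using that by (cases k) (auto simp: E ov_eq)
  have tr: "c_fam True (I \<times> I) E trans"
    by (rule c_fam_reindex[OF _ _ c_fam_trans, where s = "\<lambda>k. k"]) (use Eov in auto)
  show ?thesis
  proof (rule c_fam_cover[where J = "I \<times> I" and E = E])
    fix \<beta> and x :: "real^'n" assume b: "\<beta> \<in> I" "x \<in> cube 2"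
    obtain \<alpha> where "\<alpha> \<in> I" "\<psi> \<beta> x \<in> U \<alpha>" "\<phi> \<alpha> (\<psi> \<beta> x) \<in> cube 1" by (rule covered)
    then show "\<exists>\<alpha>. (\<beta>, \<alpha>) \<in> I \<times> I \<and> x \<in> E (\<beta>, \<alpha>)" using b by (auto simp: E)
  next
    have 1: "c_fam True (I \<times> I) E (\<lambda>k x. \<Sum>l\<in>UNIV. pd i (\<lambda>z. trans k z $ l) x * logd w l (snd k) (trans k x))"
    proof (intro c_fam_sum c_fam_mult c_fam_pd c_fam_component tr)
      fix l
      show "c_fam True (I \<times> I) E (\<lambda>k x. logd w l (snd k) (trans k x))"
      proof (rule c_fam_compose[where s = snd and J = I and E = "\<lambda>_. cube 1" and F = "logd w l" and G = trans])
        show "trans k x \<in> cube 1" if "k \<in> I \<times> I" "x \<in> E k" for k x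
          using that by (cases k) (auto simp: E trans_eq)
      qed (use opE tr s1 in auto)
    qed (use opE in auto)
    show "c_fam True (I \<times> I) E (\<lambda>(\<beta>, \<alpha>). logd w i \<beta>)"
    proof (rule c_fam_cong[OF opE _ 1])
      fix k x assume k: "k \<in> I \<times> I" "x \<in> E k"
      then show "(\<Sum>l\<in>UNIV. pd i (\<lambda>z. trans k z $ l) x * logd w l (snd k) (trans k x)) = (case k of (\<beta>, \<alpha>) => logd w i \<beta>) x"
        using logd_trans[OF w(2), of "snd k" "fst k" x i] Eov[of k] by (cases k) auto
    qed
  qed
qed

lemma weight_iff:
  "weight M B w \<longleftrightarrow> (\<forall>q. 0 < w q) \<and> smooth_fun M w \<and> (\<forall>i. cfam (logd w i))"
proof
  assume "weight M B w"
  then show "(\<forall>q. 0 < w q) \<and> smooth_fun M w \<and> (\<forall>i. cfam (logd w i))"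
    using weight_logd by (simp add: weight_def)
next
  assume w: "(\<forall>q. 0 < w q) \<and> smooth_fun M w \<and> (\<forall>i. cfam (logd w i))"
  have "(\<lambda>q. W (\<lambda>q'. cor (w q')) q / cor (w q)) \<in> C_uni M B"
    if W: "W \<in> uni_vector_fields M B" for W
  proof -
    interpret B1: scaled_bg M "B\<lparr>scl := \<lambda>_. \<chi> i. 1\<rparr>" by (rule unscaled)
    have pf: "param (B\<lparr>scl := \<lambda>_. \<chi> i. 1\<rparr>) = \<psi>" by (simp add: param_def fun_eq_iff)
    obtain v where v: "B1.vrep W v" using W B1.op_lie_iff by (auto simp: uni_vector_fields_eq)
    have v1: "cfam (\<lambda>\<alpha> x. v \<alpha> x $ i)" for i
      using v unfolding B1.vrep_def by simp
    have v2: "W (\<lambda>q'. cor (w q')) (\<psi> \<alpha> x) = (\<Sum>i\<in>UNIV. cor (v \<alpha> x $ i) * pd i ((\<lambda>q'. cor (w q')) \<circ> \<psi> \<alpha>) x)"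
      if "\<alpha> \<in> I" "x \<in> cube 2" for \<alpha> x
      using v w that smooth_fun_of_real unfolding B1.vrep_def by (simp add: pf)
    have 1: "cfam (\<lambda>\<alpha> x. cor (\<Sum>i\<in>UNIV. v \<alpha> x $ i * logd w i \<alpha> x))"
      using w by (intro c_fam_of_real c_fam_sum c_fam_mult v1) auto
    show ?thesis
      unfolding C_uni_iff
    proof (rule c_fam_cong[OF _ _ 1])
      fix \<alpha> and x :: "real^'n" assume \<alpha>: "\<alpha> \<in> I" and x: "x \<in> cube 2"
      have "(\<lambda>y. w (\<psi> \<alpha> y)) differentiable (at x)"
        using w \<alpha> x smooth_on_differentiable[of "cube 2" "\<lambda>y. w (\<psi> \<alpha> y)" x] by (auto simp: smooth_fun_iff)
      then have "pd i ((\<lambda>q'. cor (w q')) \<circ> \<psi> \<alpha>) x = cor (pd i (\<lambda>y. w (\<psi> \<alpha> y)) x)" for i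
        using pd_of_real[of "\<lambda>y. w (\<psi> \<alpha> y)" x i] by (simp add: o_def)
      then show "cor (\<Sum>i\<in>UNIV. v \<alpha> x $ i * logd w i \<alpha> x) =
          W (\<lambda>q'. cor (w q')) (\<psi> \<alpha> x) / cor (w (\<psi> \<alpha> x))"
        by (simp add: v2[OF \<alpha> x] logd_def sum_divide_distrib)
    qed simp
  qed
  then show "weight M B w" using w by (simp add: weight_def)
qed

lemma weightD:
  assumes "weight M B w"
  shows "0 < w q" "w q \<noteq> 0" "smooth_fun M w" "cfam (logd w i)"
  using assms unfolding weight_iff by (auto simp: less_imp_neq[THEN not_sym] order_less_imp_not_eq2)

lemma weight_differentiable:
  assumes "weight M B w" "\<alpha> \<in> I" "x \<in> cube 2"
  shows "(\<lambda>y. w (\<psi> \<alpha> y)) differentiable (at x)"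
  using weightD(3)[OF assms(1)] assms(2,3) smooth_on_differentiable[of "cube 2" "\<lambda>y. w (\<psi> \<alpha> y)" x]
  by (auto simp: smooth_fun_iff)

lemma weight_1: "weight M B (\<lambda>q. 1)"
  unfolding weight_iff logd_def by simp

lemma weight_mult:
  assumes w: "weight M B w" and w': "weight M B w'"
  shows "weight M B (\<lambda>q. w q * w' q)"
  unfolding weight_iff
proof (intro conjI allI)
  show "0 < w q * w' q" for q using weightD(1)[OF w] weightD(1)[OF w'] by simp
  show "smooth_fun M (\<lambda>q. w q * w' q)" by (rule smooth_fun_mult[OF weightD(3)[OF w] weightD(3)[OF w']])
  fix i
  have 1: "cfam (\<lambda>\<alpha> x. logd w i \<alpha> x + logd w' i \<alpha> x)"
    by (rule c_fam_add[OF _ weightD(4)[OF w] weightD(4)[OF w']]) simp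
  show "cfam (logd (\<lambda>q. w q * w' q) i)"
    by (rule c_fam_cong[OF _ _ 1])
      (simp_all add: logd_def pd_mult[OF weight_differentiable[OF w] weight_differentiable[OF w']]
        weightD(2)[OF w] weightD(2)[OF w'] field_simps)
qed

lemma weight_inverse:
  assumes w: "weight M B w"
  shows "weight M B (\<lambda>q. inverse (w q))"
  unfolding weight_iff
proof (intro conjI allI)
  show "0 < inverse (w q)" for q using weightD(1)[OF w] by simp
  have "c_fam False I (\<lambda>_. cube 2) (\<lambda>\<alpha> x. inverse (w (\<psi> \<alpha> x)))"
    by (rule c_fam_inverse) (use weightD[OF w] in \<open>auto simp: c_fam_smooth_fun\<close>)
  then show "smooth_fun M (\<lambda>q. inverse (w q))" by (simp add: c_fam_smooth_fun)
  fix i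
  have 1: "cfam (\<lambda>\<alpha> x. - logd w i \<alpha> x)"
    by (rule c_fam_minus[OF _ weightD(4)[OF w]]) simp
  show "cfam (logd (\<lambda>q. inverse (w q)) i)"
  proof (rule c_fam_cong[OF _ _ 1])
    fix \<alpha> and x :: "real^'n" assume "\<alpha> \<in> I" "x \<in> cube 2"
    from pd_inverse[OF weight_differentiable[OF w this] weightD(2)[OF w], of i]
    show "- logd w i \<alpha> x = logd (\<lambda>q. inverse (w q)) i \<alpha> x"
      unfolding logd_def using weightD(2)[OF w, of "\<psi> \<alpha> x"] by simp
  qed simp
qed

text \<open>A constant factor on each chart does not affect the logarithmic derivative, so a size
  bound on the rescaled weight gives bounds on all its derivatives.\<close>

lemma c_fam_weight:
  assumes w: "weight M B w" and c: "\<And>\<alpha>. \<alpha> \<in> I ==> c \<alpha> \<noteq> 0"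
    and bd: "\<And>\<alpha> x. \<alpha> \<in> I ==> x \<in> cube 2 ==> \<bar>c \<alpha> * w (\<psi> \<alpha> x)\<bar> \<le> C"
  shows "cfam (\<lambda>\<alpha> x. c \<alpha> * w (\<psi> \<alpha> x))"
proof (rule c_fam_log_derivative[OF _ _ _ bd])
  show "c_fam False I (\<lambda>_. cube 2) (\<lambda>\<alpha> x. c \<alpha> * w (\<psi> \<alpha> x))"
    by (intro c_fam_mult c_fam_const) (use weightD(3)[OF w] in \<open>auto simp: c_fam_smooth_fun\<close>)
  show "c \<alpha> * w (\<psi> \<alpha> x) \<noteq> 0" if "\<alpha> \<in> I" "x \<in> cube 2" for \<alpha> x using c[OF that(1)] weightD(2)[OF w] by simp
  fix v :: "real^'n" assume "v \<in> Basis"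
  then obtain i where v: "v = axis i 1" by (auto simp: Basis_vec_def)
  show "cfam (\<lambda>\<alpha> x. dird v (\<lambda>x. c \<alpha> * w (\<psi> \<alpha> x)) x / (c \<alpha> * w (\<psi> \<alpha> x)))"
  proof (rule c_fam_cong[OF _ _ weightD(4)[OF w, of i]])
    fix \<alpha> and x :: "real^'n" assume a: "\<alpha> \<in> I" "x \<in> cube 2"
    have "pd i (\<lambda>x. c \<alpha> * w (\<psi> \<alpha> x)) x = c \<alpha> * pd i (\<lambda>x. w (\<psi> \<alpha> x)) x"
      unfolding pd_dird by (rule dird_linear[OF bounded_linear_mult_right weight_differentiable[OF w a]])
    then show "logd w i \<alpha> x = dird v (\<lambda>x. c \<alpha> * w (\<psi> \<alpha> x)) x / (c \<alpha> * w (\<psi> \<alpha> x))"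
      using c[OF a(1)] by (simp add: v pd_dird[symmetric] logd_def)
  qed simp
qed simp

end

text \<open>Inserting the identity, written as Jacobian times inverse Jacobian, compares one scale
  with the largest scale of another chart: the scaled Jacobian \<open>S $ i * J j\<close> is bounded
  by the target scales, the inverse \<open>K\<close> by a constant.\<close>

lemma scale_compare:
  fixes S T :: "real^'n::finite"
  assumes J: "(\<Sum>j\<in>UNIV. J j * K j) = 1" and S: "\<And>j. \<bar>S $ i * J j\<bar> \<le> A * T $ j"
    and K: "\<And>j. \<bar>K j\<bar> \<le> A'" and A: "0 \<le> A" "0 \<le> A'"
  shows "S $ i \<le> real CARD('n) * (A * A') * Max (range (\<lambda>i. T $ i))"
proof -
  have "S $ i = (\<Sum>j\<in>UNIV. (S $ i * J j) * K j)"
    using J by (simp add: mult.assoc sum_distrib_left[symmetric])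
  also have "\<dots> \<le> (\<Sum>j\<in>(UNIV::'n set). A * A' * Max (range (\<lambda>i. T $ i)))"
  proof (rule sum_mono)
    fix j
    have T: "T $ j \<le> Max (range (\<lambda>i. T $ i))" by (rule Max_ge) auto
    have "(S $ i * J j) * K j \<le> \<bar>S $ i * J j\<bar> * \<bar>K j\<bar>" by (simp add: abs_mult[symmetric])
    also have "\<dots> \<le> (A * T $ j) * A'" using S[of j] K[of j] by (intro mult_mono) auto
    also have "\<dots> = (A * A') * T $ j" by simp
    also have "\<dots> \<le> (A * A') * Max (range (\<lambda>i. T $ i))" using A T by (intro mult_left_mono) auto
    finally show "(S $ i * J j) * K j \<le> A * A' * Max (range (\<lambda>i. T $ i))" by simp
  qed
  also have "\<dots> = real CARD('n) * (A * A') * Max (range (\<lambda>i. T $ i))" by simp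
  finally show ?thesis .
qed

lemma pd_component: "pd i (\<lambda>z. z $ k) x = (if i = k then 1 else 0 :: real)"
proof -
  have "pd i (\<lambda>z. z $ k) x = axis i 1 $ k"
    unfolding pd_dird by (rule dird_eqI) (rule bounded_linear_imp_has_derivative[OF bounded_linear_vec_nth])
  then show ?thesis by (simp add: axis_def)
qed

lemma c_fam_bounds:
  fixes F :: "'n::finite => 'n => 'k => 'e::euclidean_space => real"
  assumes "\<And>i j. c_fam True I D (F i j)"
  obtains A where "A > 0" "\<And>i j k x. k \<in> I ==> x \<in> D k ==> \<bar>F i j k x\<bar> \<le> A"
proof -
  have "\<exists>C. \<forall>k\<in>I. \<forall>x\<in>D k. \<bar>F (fst ij) (snd ij) k x\<bar> \<le> C" for ij
    by (rule c_fam_bound[OF assms[of "fst ij" "snd ij"]]) auto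
  then have "\<forall>ij. \<exists>C. \<forall>k\<in>I. \<forall>x\<in>D k. \<bar>F (fst ij) (snd ij) k x\<bar> \<le> C" by blast
  from choice[OF this] obtain C where C: "\<And>ij k x. k \<in> I ==> x \<in> D k ==> \<bar>F (fst ij) (snd ij) k x\<bar> \<le> C ij" by blast
  show ?thesis
  proof (rule that[of "max 1 (Max (range C))"])
    fix i j k x assume k: "k \<in> I" "x \<in> D k"
    have "\<bar>F i j k x\<bar> \<le> C (i, j)" using C[OF k, of "(i, j)"] by simp
    also have "\<dots> \<le> Max (range C)" by (rule Max_ge) auto
    finally show "\<bar>F i j k x\<bar> \<le> max 1 (Max (range C))" by simp
  qed simp
qed

lemma (in scaled_bg) jacobian_inverse:
  assumes ab: "\<alpha> \<in> I" "\<beta> \<in> I" and x: "x \<in> ov (\<alpha>, \<beta>)"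
  shows "(\<Sum>j\<in>UNIV. pd i (\<lambda>z. trans (\<alpha>, \<beta>) z $ j) x * pd j (\<lambda>z. trans (\<beta>, \<alpha>) z $ k) (trans (\<alpha>, \<beta>) x))
    = (if i = k then 1 else 0)"
proof -
  have I: "(\<alpha>, \<beta>) \<in> I \<times> I" "(\<beta>, \<alpha>) \<in> I \<times> I" using ab by auto
  have y: "trans (\<alpha>, \<beta>) x \<in> ov (\<beta>, \<alpha>)" by (rule trans_in[OF ab x])
  have "c_fam True (I \<times> I) ov (\<lambda>l z. trans l z $ k)"
    by (rule c_fam_component[OF open_ov c_fam_trans])
  from c_fam_differentiable[OF this I(2) y]
  have d: "(\<lambda>z. trans (\<beta>, \<alpha>) z $ k) differentiable (at (trans (\<alpha>, \<beta>) x))" .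
  have "(\<Sum>j\<in>UNIV. pd i (\<lambda>z. trans (\<alpha>, \<beta>) z $ j) x * pd j (\<lambda>z. trans (\<beta>, \<alpha>) z $ k) (trans (\<alpha>, \<beta>) x))
      = pd i (\<lambda>z. trans (\<beta>, \<alpha>) (trans (\<alpha>, \<beta>) z) $ k) x"
    using pd_compose[OF d c_fam_differentiable[OF c_fam_trans I(1) x], of i] by simp
  also have "\<dots> = pd i (\<lambda>z. z $ k) x"
    by (rule pd_local_cong[OF open_ov[OF I(1)] x]) (simp add: trans_trans[OF ab])
  finally show ?thesis by (simp add: pd_component)
qed

locale scaled_bg_weight = scaled_bg_cutoff M B \<kappa>
  for M :: "('a::t2_space, 'n::finite) atlas" and B :: "('i, 'a, 'n) scaled_bg_data"
    and \<kappa> :: "real^'n => real" +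
  fixes \<rho> :: "'a => real"
  assumes scaling: "scaling_weight M B \<rho>"
begin

lemma weight_rho: "weight M B \<rho>"
  using scaling by (simp add: scaling_weight_def)

text \<open>A scaling weight is compared with the scales on the inner charts only. For a point in
  the outer part of \<open>U \<alpha>\<close>, the scales of \<open>\<alpha>\<close> are first
  compared with those of a chart in which the point is inner.\<close>

lemma rho_bounds:
  obtains C where "C > 0" "\<And>\<alpha> q i. \<alpha> \<in> I ==> q \<in> U \<alpha> ==> scl B \<alpha> $ i \<le> C * \<rho> q" "\<And>q. \<rho> q \<le> C"
proof -
  obtain C0 where C0: "C0 > 0" "\<And>\<alpha> q. \<alpha> \<in> I ==> q \<in> inner B \<alpha> ==>
      Max (range (\<lambda>i. scl B \<alpha> $ i)) / C0 \<le> \<rho> q \<and> \<rho> q \<le> C0 * Max (range (\<lambda>i. scl B \<alpha> $ i))"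
    using scaling unfolding scaling_weight_def by blast
  obtain A where A: "A > 0" "\<And>i j k y. k \<in> I \<times> I ==> y \<in> ov k ==>
      \<bar>scl B (fst k) $ i * pd i (\<lambda>z. trans k z $ j) y / scl B (snd k) $ j\<bar> \<le> A"
    using c_fam_bounds[of "I \<times> I" ov "\<lambda>i j k y. scl B (fst k) $ i * pd i (\<lambda>z. trans k z $ j) y / scl B (snd k) $ j"]
      c_fam_scale by blast
  have "c_fam True (I \<times> I) ov (\<lambda>k. pd i (\<lambda>z. trans k z $ j))" for i j
    by (intro c_fam_pd c_fam_component c_fam_trans open_ov)
  then obtain A' where A': "A' > 0" "\<And>i j k y. k \<in> I \<times> I ==> y \<in> ov k ==> \<bar>pd i (\<lambda>z. trans k z $ j) y\<bar> \<le> A'"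
    using c_fam_bounds[of "I \<times> I" ov "\<lambda>i j k. pd i (\<lambda>z. trans k z $ j)"] by blast
  define D where "D = real CARD('n) * (A * A')"
  have D: "D > 0" using A(1) A'(1) by (simp add: D_def)
  have near: "\<exists>\<beta>\<in>I. q \<in> U \<beta> \<and> q \<in> inner B \<beta>" for q
  proof -
    obtain \<beta> where "\<beta> \<in> I" "q \<in> U \<beta>" "\<phi> \<beta> q \<in> cube 1" by (rule covered)
    then show ?thesis using cube_mono[of 1 "3/2"] by (auto simp: inner_def)
  qed
  have 1: "scl B \<alpha> $ i \<le> (D * C0) * \<rho> q" if \<alpha>: "\<alpha> \<in> I" and q: "q \<in> U \<alpha>" for \<alpha> q i
  proof -
    obtain \<beta> where \<beta>: "\<beta> \<in> I" "q \<in> U \<beta>" "q \<in> inner B \<beta>" using near by blast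
    define x where "x = \<phi> \<alpha> q"
    have x: "x \<in> ov (\<alpha>, \<beta>)" using \<alpha> q \<beta> by (simp add: ov_eq x_def coord_in param_coord)
    have ab: "(\<alpha>, \<beta>) \<in> I \<times> I" "(\<beta>, \<alpha>) \<in> I \<times> I" using \<alpha> \<beta> by auto
    have "scl B \<alpha> $ i \<le> real CARD('n) * (A * A') * Max (range (\<lambda>i. scl B \<beta> $ i))"
    proof (rule scale_compare)
      show "(\<Sum>j\<in>UNIV. pd i (\<lambda>z. trans (\<alpha>, \<beta>) z $ j) x * pd j (\<lambda>z. trans (\<beta>, \<alpha>) z $ i) (trans (\<alpha>, \<beta>) x)) = 1"
        using jacobian_inverse[OF \<alpha> \<beta>(1) x, of i i] by simp
      show "\<bar>scl B \<alpha> $ i * pd i (\<lambda>z. trans (\<alpha>, \<beta>) z $ j) x\<bar> \<le> A * scl B \<beta> $ j" for j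
        using A(2)[OF ab(1) x, of i j] scl_pos[OF \<beta>(1), of j] by (simp add: abs_mult field_simps)
      show "\<bar>pd j (\<lambda>z. trans (\<beta>, \<alpha>) z $ i) (trans (\<alpha>, \<beta>) x)\<bar> \<le> A'" for j
        by (rule A'(2)[OF ab(2) trans_in[OF \<alpha> \<beta>(1) x]])
    qed (use A A' in auto)
    also have "\<dots> \<le> D * (C0 * \<rho> q)"
      unfolding D_def[symmetric] using C0(2)[OF \<beta>(1,3)] C0(1) D by (intro mult_left_mono) (auto simp: field_simps)
    finally show ?thesis by simp
  qed
  have 2: "\<rho> q \<le> C0" for q
  proof -
    obtain \<beta> where \<beta>: "\<beta> \<in> I" "q \<in> U \<beta>" "q \<in> inner B \<beta>" using near by blast
    have "Max (range (\<lambda>i. scl B \<beta> $ i)) \<le> 1" using scl_le_1[OF \<beta>(1)] by (subst Max_le_iff) auto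
    then have "C0 * Max (range (\<lambda>i. scl B \<beta> $ i)) \<le> C0 * 1" using C0(1) by (intro mult_left_mono) auto
    then show ?thesis using C0(2)[OF \<beta>(1,3)] by linarith
  qed
  show ?thesis
  proof (rule that[of "D * C0 + C0"])
    show "D * C0 + C0 > 0" using D C0(1) by (simp add: add_pos_pos)
    show "scl B \<alpha> $ i \<le> (D * C0 + C0) * \<rho> q" if "\<alpha> \<in> I" "q \<in> U \<alpha>" for \<alpha> q i
    proof -
      have "(D * C0) * \<rho> q \<le> (D * C0 + C0) * \<rho> q"
        using C0(1) weightD(1)[OF weight_rho, of q] by (intro mult_right_mono) auto
      then show ?thesis using 1[OF that, of i] by linarith
    qed
    show "\<rho> q \<le> D * C0 + C0" for q using 2[of q] D C0(1) by (smt (verit) mult_pos_pos)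
  qed
qed

text \<open>The source of every gain: each scale is \<open>\<rho>\<close> times a uniformly smooth
  factor, so a derivative of a coefficient along the operator Lie algebra can be credited with a
  factor \<open>\<rho>\<close>.\<close>

lemma c_fam_scl_rho: "cfam (\<lambda>\<alpha> x. scl B \<alpha> $ i * inverse (\<rho> (\<psi> \<alpha> x)))"
proof -
  obtain C where C: "C > 0" "\<And>\<alpha> q i. \<alpha> \<in> I ==> q \<in> U \<alpha> ==> scl B \<alpha> $ i \<le> C * \<rho> q" "\<And>q. \<rho> q \<le> C"
    using rho_bounds by blast
  show ?thesis
  proof (rule c_fam_weight[OF weight_inverse[OF weight_rho]])
    show "scl B \<alpha> $ i \<noteq> 0" if "\<alpha> \<in> I" for \<alpha> using scl_pos[OF that, of i] by simp
    fix \<alpha> and x :: "real^'n" assume a: "\<alpha> \<in> I" "x \<in> cube 2"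
    have "scl B \<alpha> $ i \<le> C * \<rho> (\<psi> \<alpha> x)" by (rule C(2)[OF a(1) param_in[OF a]])
    then show "\<bar>scl B \<alpha> $ i * inverse (\<rho> (\<psi> \<alpha> x))\<bar> \<le> C"
      using scl_pos[OF a(1), of i] weightD(1)[OF weight_rho, of "\<psi> \<alpha> x"] by (simp add: field_simps)
  qed
qed

lemma c_fam_rho: "cfam (\<lambda>\<alpha> x. \<rho> (\<psi> \<alpha> x))"
proof -
  obtain C where C: "C > 0" "\<And>\<alpha> q i. \<alpha> \<in> I ==> q \<in> U \<alpha> ==> scl B \<alpha> $ i \<le> C * \<rho> q" "\<And>q. \<rho> q \<le> C"
    using rho_bounds by blast
  have "cfam (\<lambda>\<alpha> x. 1 * \<rho> (\<psi> \<alpha> x))"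
    by (rule c_fam_weight[OF weight_rho, of "\<lambda>_. 1" C]) (use C weightD(1)[OF weight_rho] in \<open>auto simp: abs_of_pos\<close>)
  then show ?thesis by simp
qed

lemma rho_C_uni: "(\<lambda>q. cor (\<rho> q)) \<in> C_uni M B"
  unfolding C_uni_iff by (rule c_fam_of_real[OF _ c_fam_rho]) simp

text \<open>Two scaling weights are comparable through the scales, so by \<open>c_fam_weight\<close>
  their quotient is uniformly smooth. Hence the lower order symbols do not depend on which of them
  is taken.\<close>

lemma scaling_quotient:
  assumes "scaling_weight M B \<rho>'"
  shows "(\<lambda>q. cor (\<rho>' q * inverse (\<rho> q))) \<in> C_uni M B"
proof -
  have w': "weight M B \<rho>'" using assms by (simp add: scaling_weight_def)
  obtain C where C: "C > 0" "\<And>\<alpha> q i. \<alpha> \<in> I ==> q \<in> U \<alpha> ==> scl B \<alpha> $ i \<le> C * \<rho> q" "\<And>q. \<rho> q \<le> C"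
    using rho_bounds by blast
  obtain C' where C': "C' > 0" "\<And>\<alpha> q. \<alpha> \<in> I ==> q \<in> inner B \<alpha> ==> \<rho>' q \<le> C' * Max (range (\<lambda>i. scl B \<alpha> $ i))"
    using assms unfolding scaling_weight_def by blast
  have bd: "\<bar>1 * (\<rho>' q * inverse (\<rho> q))\<bar> \<le> C' * C" for q
  proof -
    obtain \<beta> where \<beta>: "\<beta> \<in> I" "q \<in> U \<beta>" "\<phi> \<beta> q \<in> cube 1" by (rule covered)
    then have "q \<in> inner B \<beta>" using cube_mono[of 1 "3/2"] by (auto simp: inner_def)
    then have "\<rho>' q \<le> C' * Max (range (\<lambda>i. scl B \<beta> $ i))" by (rule C'(2)[OF \<beta>(1)])
    also have "\<dots> \<le> C' * (C * \<rho> q)"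
      using C'(1) C(2)[OF \<beta>(1,2)] by (intro mult_left_mono) (auto simp: Max_le_iff)
    finally show ?thesis
      using weightD(1)[OF weight_rho, of q] weightD(1)[OF w', of q] by (simp add: field_simps)
  qed
  have "cfam (\<lambda>\<alpha> x. 1 * (\<rho>' (\<psi> \<alpha> x) * inverse (\<rho> (\<psi> \<alpha> x))))"
    by (rule c_fam_weight[OF weight_mult[OF w' weight_inverse[OF weight_rho]] _ bd]) simp
  then show ?thesis unfolding C_uni_iff by (intro c_fam_of_real) auto
qed

end

section \<open>Operators with their symbols\<close>

text \<open>
  Up to the factor \<open>\<i>\<close> this is the symbol of the vector field \<open>V\<close>: the covector is evaluated by
  applying \<open>V\<close> to a representative.
\<close>

definition vsym :: "('a, 'n::finite) atlas => 'a operator => 'a symbol" where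
  "vsym M V z = (if z \<in> cotangent_bundle M
     then V (\<lambda>q. cor ((SOME g. g \<in> snd z) q)) (fst z) else 0)"

text \<open>
  Pairs of an operator and a globally defined representative of its principal symbol, of weight
  \<open>w\<close> and order \<open>m\<close>; \<open>C\<close>, \<open>W\<close> and \<open>L\<close> are the admissible functions, weights and vector fields.
\<close>

inductive gen ::
  "('a, 'n::finite) atlas => ('a => complex) set => ('a => real) set => 'a operator set =>
    ('a => real) => int => 'a operator => 'a symbol => bool"
  for M C W L where
  zero: "w \<in> W ==> gen M C W L w m (\<lambda>u q. 0) (\<lambda>z. 0)"
| unit: "0 \<le> m ==> gen M C W L (\<lambda>q. 1) m (smooth_id M) (\<lambda>z. if z \<in> cotangent_bundle M then 1 else 0)"
| mult: "f \<in> C ==> gen M C W L w m P a ==> gen M C W L w m (\<lambda>u q. f q * P u q) (\<lambda>z. f (fst z) * a z)"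
| wmult: "w' \<in> W ==> gen M C W L w m P a ==>
    gen M C W L (\<lambda>q. w' q * w q) m (\<lambda>u q. cor (w' q) * P u q) (\<lambda>z. cor (w' (fst z)) * a z)"
| field: "V \<in> L ==> gen M C W L w m P a ==> gen M C W L w (m + 1) (\<lambda>u. V (P u)) (\<lambda>z. \<i> * vsym M V z * a z)"
| add: "gen M C W L w m P a ==> gen M C W L w m Q b ==> gen M C W L w m (\<lambda>u q. P u q + Q u q) (\<lambda>z. a z + b z)"
| mono: "gen M C W L w m P a ==> m \<le> m' ==> gen M C W L w m' P a"

lemma gen_off: "gen M C W L w m P a ==> z \<notin> cotangent_bundle M ==> a z = 0"
  by (induction rule: gen.induct) auto

text \<open>The induction runs over the outer pair. Its case \<open>unit\<close> composes
  \<open>smooth_id\<close> with \<open>Q\<close>, which is why the values of \<open>Q\<close> must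
  be fixed by \<open>smooth_id\<close>.\<close>

lemma gen_compose:
  assumes "gen M C W L w m P a" "gen M C W L w' m' Q b"
    and W: "\<And>w1 w2. w1 \<in> W ==> w2 \<in> W ==> (\<lambda>q. w1 q * w2 q) \<in> W" "w' \<in> W"
    and Q: "\<And>u. smooth_id M (Q u) = Q u"
  shows "gen M C W L (\<lambda>q. w q * w' q) (m + m') (\<lambda>u. P (Q u)) (\<lambda>z. a z * b z)"
  using assms(1)
proof (induction rule: gen.induct)
  case (zero w m)
  then show ?case using gen.zero[OF W(1)[OF zero W(2)]] by simp
next
  case (unit m)
  have "(\<lambda>z. (if z \<in> cotangent_bundle M then 1 else 0) * b z) = b"
    using gen_off[OF assms(2)] by (auto simp: fun_eq_iff)
  moreover have "gen M C W L w' (m + m') Q b" by (rule gen.mono[OF assms(2)]) (use unit in simp)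
  ultimately show ?case by (simp add: Q)
next
  case (mult f w m P a)
  from gen.mult[OF mult(1) mult.IH] show ?case by (simp add: mult.assoc)
next
  case (wmult v w m P a)
  from gen.wmult[OF wmult(1) wmult.IH] show ?case by (simp add: mult.assoc)
next
  case (field V w m P a)
  from gen.field[OF field(1) field.IH] show ?case by (simp add: mult.assoc add.assoc add.left_commute add.commute)
next
  case (add w m P a Q' b')
  from gen.add[OF add.IH] show ?case by (simp add: distrib_right)
next
  case (mono w m P a k)
  show ?case by (rule gen.mono[OF mono.IH]) (use mono in simp)
qed

lemma gen_sum:
  assumes "finite A" "\<And>k. k \<in> A ==> gen M C W L w m (P k) (a k)" "w \<in> W"
  shows "gen M C W L w m (\<lambda>u q. \<Sum>k\<in>A. P k u q) (\<lambda>z. \<Sum>k\<in>A. a k z)"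
  using assms(1,2)
  by induction (auto intro: gen.zero[OF assms(3)] gen.add)

section \<open>Local coefficients\<close>

abbreviation lowerm :: "'n => ('n => nat) => 'n => nat" where
  "lowerm i \<gamma> \<equiv> \<gamma>(i := \<gamma> i - 1)"

lemma mlen_lowerm: "0 < \<gamma> i ==> mlen \<gamma> = Suc (mlen (lowerm i \<gamma>))"
  using mlen_raise[where i = i and \<gamma> = "lowerm i \<gamma>"] by simp

text \<open>A shift of the summation index by a unit vector. The guard \<open>0 < \<gamma> i\<close>
  removes the indices that are not raised ones, where lowering would be truncated.\<close>

lemma sum_raise:
  fixes h F :: "('n::finite => nat) => complex"
  shows "(\<Sum>\<gamma>\<in>midxs m. h \<gamma> * F (raise i \<gamma>)) =
    (\<Sum>\<gamma>\<in>midxs (m + 1). (if 0 < \<gamma> i then h (lowerm i \<gamma>) else 0) * F \<gamma>)"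
proof -
  have "(\<Sum>\<gamma>\<in>midxs (m + 1). (if 0 < \<gamma> i then h (lowerm i \<gamma>) else 0) * F \<gamma>)
      = (\<Sum>\<gamma> | int (mlen \<gamma>) \<le> m + 1 \<and> 0 < \<gamma> i. h (lowerm i \<gamma>) * F \<gamma>)"
    by (rule sum.mono_neutral_cong_right) auto
  also have "\<dots> = (\<Sum>\<gamma>\<in>midxs m. h \<gamma> * F (raise i \<gamma>))"
  proof (rule sum.reindex_bij_witness[where i = "raise i" and j = "lowerm i"])
    fix \<gamma> :: "'n => nat" assume g: "\<gamma> \<in> {\<gamma>. int (mlen \<gamma>) \<le> m + 1 \<and> 0 < \<gamma> i}"
    show "raise i (lowerm i \<gamma>) = \<gamma>" using g by auto
    show "lowerm i \<gamma> \<in> {\<gamma>. int (mlen \<gamma>) \<le> m}" using g mlen_lowerm[of \<gamma> i] by auto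
    show "h (lowerm i \<gamma>) * F (raise i (lowerm i \<gamma>)) = h (lowerm i \<gamma>) * F \<gamma>" using g by auto
  next
    fix \<gamma> :: "'n => nat" assume "\<gamma> \<in> {\<gamma>. int (mlen \<gamma>) \<le> m}"
    then show "raise i \<gamma> \<in> {\<gamma>. int (mlen \<gamma>) \<le> m + 1 \<and> 0 < \<gamma> i}" by simp
  qed simp
  finally show ?thesis by simp
qed

lemma mmonom_raise: "mmonom (raise i \<gamma>) \<xi> = cor (\<xi> $ i) * mmonom \<gamma> \<xi>"
  unfolding mmonom_def by (subst (1 2) prod.remove[of _ i]) (auto intro!: prod.cong simp: mult.assoc)

text \<open>As \<open>D\<close> is the derivative divided by \<open>\<i>\<close>, a scaled
  coordinate derivative raises the multi-index and leaves a factor \<open>\<i>\<close>. This is the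
  factor in the symbol that \<open>gen\<close> attaches to a field.\<close>

lemma scaled_D_raise:
  fixes u :: "real^'n::finite => complex"
  assumes "open S" "smooth_on S u" "x \<in> S"
  shows "cor (r $ i) * pd i (scaled_D r \<gamma> u) x = \<i> * scaled_D r (raise i \<gamma>) u x"
proof -
  define K where "K = (\<lambda>\<gamma>. \<Prod>j\<in>UNIV. (cor (r $ j) * inverse \<i>) ^ \<gamma> j)"
  have K: "K (raise i \<gamma>) = (cor (r $ i) * inverse \<i>) * K \<gamma>"
    unfolding K_def by (subst (1 2) prod.remove[of _ i]) (auto intro!: prod.cong simp: mult.assoc)
  have "scaled_D r \<gamma> u = (\<lambda>x. K \<gamma> * mpd \<gamma> u x)" by (simp add: scaled_D_def K_def fun_eq_iff)
  then have "pd i (scaled_D r \<gamma> u) x = K \<gamma> * pd i (mpd \<gamma> u) x"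
    unfolding pd_dird
    using dird_linear[OF bounded_linear_mult_right smooth_on_differentiable[OF smooth_on_mpd[OF assms(2)] assms(3)]] by simp
  then have "pd i (scaled_D r \<gamma> u) x = K \<gamma> * mpd (raise i \<gamma>) u x" using pd_mpd[OF assms] by simp
  moreover have "scaled_D r (raise i \<gamma>) u x = K (raise i \<gamma>) * mpd (raise i \<gamma>) u x" by (simp add: scaled_D_def K_def)
  moreover have "\<i> * ((z * inverse \<i>) * k * y) = z * (k * y)" for z k y
  proof -
    have "\<i> * ((z * inverse \<i>) * k * y) = (\<i> * inverse \<i>) * (z * (k * y))" by (simp only: mult_ac)
    then show ?thesis by simp
  qed
  ultimately show ?thesis by (simp only: K)
qed

lemma smooth_on_scaled_D:
  assumes "open S" "smooth_on S u"
  shows "smooth_on S (scaled_D r \<gamma> u)"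
  unfolding scaled_D_def
  by (rule smooth_on_linear[OF bounded_linear_mult_right smooth_on_mpd[OF assms(2)] assms(1)])

lemma scaled_D_0: "scaled_D r (\<lambda>_. 0) u x = u x"
  by (simp add: scaled_D_def)

lemma mmonom_zero: "mmonom (\<lambda>_. 0) \<xi> = 1"
  by (simp add: mmonom_def)

lemma mlen_0: "mlen (\<lambda>_. 0) = 0"
  by (simp add: mlen_def)

context scaled_bg_weight
begin

abbreviation "SD \<alpha> \<gamma> u \<equiv> scaled_D (scl B \<alpha>) \<gamma> (u \<circ> \<psi> \<alpha>)"

abbreviation "Wt \<equiv> {w. weight M B w}"

abbreviation "gn \<equiv> gen M (C_uni M B) Wt (op_lie_algebra M B)"

text \<open>A field sees only the first derivatives of a function at the point, so the
  representative chosen in \<open>vsym\<close> is immaterial; the scales of the field cancel against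
  those in \<open>cot_param\<close>.\<close>

lemma vsym_push:
  assumes "vrep V v" "\<alpha> \<in> I" "x \<in> cube 2"
  shows "push M B \<alpha> (vsym M V) x \<xi> = (\<Sum>i\<in>UNIV. cor (v \<alpha> x $ i) * cor (\<xi> $ i))"
proof -
  define z where "z = cot_param M B \<alpha> (x, \<xi>)"
  define g where "g = (SOME g. g \<in> snd z)"
  obtain g0 where "g0 \<in> snd z" unfolding z_def using cot_param_nonempty[OF assms(2,3)] by blast
  then have "g \<in> snd z" unfolding g_def by (rule someI[where P = "\<lambda>g. g \<in> snd z"])
  then have g: "smooth_fun M g" "\<And>i. pd i (g \<circ> \<psi> \<alpha>) x = \<xi> $ i / scl B \<alpha> $ i" by (auto simp: z_def cot_param_def)
  have d: "(g \<circ> \<psi> \<alpha>) differentiable (at x)" by (rule smooth_on_differentiable[OF smooth_chart[OF g(1) assms(2)] assms(3)])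
  have pd: "pd i ((\<lambda>q. cor (g q)) \<circ> \<psi> \<alpha>) x = cor (\<xi> $ i / scl B \<alpha> $ i)" for i
    using pd_of_real[OF d, of i] g(2)[of i] by (simp add: o_def)
  have "push M B \<alpha> (vsym M V) x \<xi> = V (\<lambda>q. cor (g q)) (\<psi> \<alpha> x)"
    unfolding push_def vsym_def z_def[symmetric] g_def[symmetric]
    using cot_param_in[OF assms(2,3), of \<xi>] by (simp add: z_def)
  also have "\<dots> = (\<Sum>i\<in>UNIV. cor (v \<alpha> x $ i * scl B \<alpha> $ i) * cor (\<xi> $ i / scl B \<alpha> $ i))"
    using assms smooth_fun_of_real[OF g(1)] by (simp add: vrep_def pd)
  also have "\<dots> = (\<Sum>i\<in>UNIV. cor (v \<alpha> x $ i) * cor (\<xi> $ i))"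
    using scl_pos[OF assms(2)] by (intro sum.cong refl) (simp add: less_imp_neq[THEN not_sym] order_less_imp_not_eq2)
  finally show ?thesis .
qed

text \<open>How an operator and its symbol are related in charts: after division by \<open>w\<close>
  the symbol has the coefficients \<open>c\<close> and the operator \<open>c + \<rho> r\<close>,
  where \<open>r\<close> already vanishes in degree \<open>m\<close>. The discrepancy is thus
  \<open>\<rho>\<close> times something of order \<open>m - 1\<close>.\<close>

definition lco ::
  "('a => real) => int => 'a operator => 'a symbol => ('i => ('n => nat) => real^'n => complex) =>
    ('i => ('n => nat) => real^'n => complex) => bool" where
  "lco w m P a c r \<longleftrightarrow> weight M B w \<and>
     (\<forall>\<gamma>. cfam (\<lambda>\<alpha>. c \<alpha> \<gamma>)) \<and> (\<forall>\<gamma>. cfam (\<lambda>\<alpha>. r \<alpha> \<gamma>)) \<and>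
     (\<forall>\<alpha> \<gamma>. m < int (mlen \<gamma>) \<longrightarrow> c \<alpha> \<gamma> = (\<lambda>x. 0)) \<and> (\<forall>\<alpha> \<gamma>. m \<le> int (mlen \<gamma>) \<longrightarrow> r \<alpha> \<gamma> = (\<lambda>x. 0)) \<and>
     (\<forall>u. \<not> smooth_fun M u \<longrightarrow> P u = (\<lambda>q. 0)) \<and>
     (\<forall>\<alpha>\<in>I. \<forall>x\<in>cube 2.
        (\<forall>\<xi>. push M B \<alpha> a x \<xi> = cor (w (\<psi> \<alpha> x)) * (\<Sum>\<gamma>\<in>midxs m. c \<alpha> \<gamma> x * mmonom \<gamma> \<xi>)) \<and>
        (\<forall>u. smooth_fun M u \<longrightarrow> P u (\<psi> \<alpha> x) = cor (w (\<psi> \<alpha> x)) *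
           (\<Sum>\<gamma>\<in>midxs m. (c \<alpha> \<gamma> x + cor (\<rho> (\<psi> \<alpha> x)) * r \<alpha> \<gamma> x) * SD \<alpha> \<gamma> u x)))"

lemma lcoD:
  assumes "lco w m P a c r"
  shows "weight M B w" "cfam (\<lambda>\<alpha>. c \<alpha> \<gamma>)" "cfam (\<lambda>\<alpha>. r \<alpha> \<gamma>)"
    and "m < int (mlen \<gamma>) ==> c \<alpha> \<gamma> = (\<lambda>x. 0)" "m \<le> int (mlen \<gamma>) ==> r \<alpha> \<gamma> = (\<lambda>x. 0)"
    and "\<not> smooth_fun M u ==> P u = (\<lambda>q. 0)"
    and "\<alpha> \<in> I ==> x \<in> cube 2 ==> push M B \<alpha> a x \<xi> = cor (w (\<psi> \<alpha> x)) * (\<Sum>\<gamma>\<in>midxs m. c \<alpha> \<gamma> x * mmonom \<gamma> \<xi>)"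
    and "\<alpha> \<in> I ==> x \<in> cube 2 ==> smooth_fun M u ==> P u (\<psi> \<alpha> x) = cor (w (\<psi> \<alpha> x)) *
      (\<Sum>\<gamma>\<in>midxs m. (c \<alpha> \<gamma> x + cor (\<rho> (\<psi> \<alpha> x)) * r \<alpha> \<gamma> x) * SD \<alpha> \<gamma> u x)"
  using assms unfolding lco_def by blast+

lemma sum_mlen_mono:
  fixes F :: "('n => nat) => complex"
  assumes "m \<le> m'" "\<And>\<gamma>. m < int (mlen \<gamma>) ==> F \<gamma> = 0"
  shows "(\<Sum>\<gamma>\<in>midxs m'. F \<gamma>) = (\<Sum>\<gamma>\<in>midxs m. F \<gamma>)"
  by (rule sum.mono_neutral_right) (use assms in \<open>auto simp: not_le\<close>)

text \<open>By the Leibniz rule the field either hits a derivative of \<open>u\<close>, which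
  multiplies the symbol by that of the field, or hits \<open>w\<close> or a coefficient, which keeps
  the degree and costs a scale, hence a factor \<open>\<rho>\<close>. The second contribution goes
  into the remainder.\<close>

lemma lco_field:
  assumes V: "vrep V v" and P: "lco w m P a c r"
  shows "\<exists>c' r'. lco w (m + 1) (\<lambda>u. V (P u)) (\<lambda>z. \<i> * vsym M V z * a z) c' r'"
proof -
  note w = lcoD(1)[OF P] and c = lcoD(2)[OF P] and r = lcoD(3)[OF P] and c0 = lcoD(4)[OF P]
    and r0 = lcoD(5)[OF P] and P0 = lcoD(6)[OF P] and a = lcoD(7)[OF P] and Pu = lcoD(8)[OF P]
  define e where "e = (\<lambda>\<alpha> \<gamma> x. c \<alpha> \<gamma> x + cor (\<rho> (\<psi> \<alpha> x)) * r \<alpha> \<gamma> x)"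
  have e: "cfam (\<lambda>\<alpha>. e \<alpha> \<gamma>)" for \<gamma>
    unfolding e_def by (intro c_fam_add c_fam_mult c_fam_of_real c r c_fam_rho) auto
  have e0: "e \<alpha> \<gamma> = (\<lambda>x. 0)" if "m < int (mlen \<gamma>)" for \<alpha> \<gamma>
    using that c0[OF that] r0[of \<gamma>] by (simp add: e_def)
  have vc: "cfam (\<lambda>\<alpha> x. cor (v \<alpha> x $ i))" for i
    by (intro c_fam_of_real) (use V in \<open>auto simp: vrep_def\<close>)
  define sr where "sr = (\<lambda>i \<alpha> x. cor (scl B \<alpha> $ i * inverse (\<rho> (\<psi> \<alpha> x))))"
  have sr: "cfam (sr i)" for i
    unfolding sr_def by (rule c_fam_of_real[OF _ c_fam_scl_rho]) simp
  \<comment> \<open>The coefficients of a polynomial after multiplication by \<open>\<i>\<close>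
    times the linear form of the field.\<close>
  define up where "up = (\<lambda>(d :: 'i => ('n => nat) => real^'n => complex) \<alpha> \<gamma> x. \<Sum>i\<in>UNIV.
      if 0 < \<gamma> i then \<i> * (cor (v \<alpha> x $ i) * d \<alpha> (lowerm i \<gamma>) x) else 0)"
  have up: "cfam (\<lambda>\<alpha>. up d \<alpha> \<gamma>)" if d: "\<And>\<gamma>. cfam (\<lambda>\<alpha>. d \<alpha> \<gamma>)" for d \<gamma>
    unfolding up_def
  proof (intro c_fam_sum)
    show "cfam (\<lambda>\<alpha> x. if 0 < \<gamma> i then \<i> * (cor (v \<alpha> x $ i) * d \<alpha> (lowerm i \<gamma>) x) else 0)" for i
    proof (cases "0 < \<gamma> i")
      case True
      have "cfam (\<lambda>\<alpha> x. \<i> * (cor (v \<alpha> x $ i) * d \<alpha> (lowerm i \<gamma>) x))"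
        by (intro c_fam_mult vc d c_fam_const') auto
      then show ?thesis by (simp only: True if_True)
    qed simp
  qed simp
  have sum_up: "(\<Sum>\<gamma>\<in>midxs (m + 1). up d \<alpha> \<gamma> x * F \<gamma>)
      = (\<Sum>i\<in>UNIV. \<i> * cor (v \<alpha> x $ i) * (\<Sum>\<gamma>\<in>midxs m. d \<alpha> \<gamma> x * F (raise i \<gamma>)))" for d \<alpha> x and F :: "('n => nat) => complex"
  proof -
    have "(\<Sum>i\<in>UNIV. \<i> * cor (v \<alpha> x $ i) * (\<Sum>\<gamma>\<in>midxs m. d \<alpha> \<gamma> x * F (raise i \<gamma>)))
      = (\<Sum>i\<in>UNIV. \<Sum>\<gamma>\<in>midxs (m + 1). (if 0 < \<gamma> i then \<i> * (cor (v \<alpha> x $ i) * d \<alpha> (lowerm i \<gamma>) x) else 0) * F \<gamma>)"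
    proof (rule sum.cong[OF refl])
      fix i
      have e: "(\<Sum>\<gamma>\<in>midxs m. d \<alpha> \<gamma> x * F (raise i \<gamma>))
          = (\<Sum>\<gamma>\<in>midxs (m + 1). (if 0 < \<gamma> i then d \<alpha> (lowerm i \<gamma>) x else 0) * F \<gamma>)"
        by (rule sum_raise[where h = "\<lambda>\<gamma>. d \<alpha> \<gamma> x" and F = F])
      show "\<i> * cor (v \<alpha> x $ i) * (\<Sum>\<gamma>\<in>midxs m. d \<alpha> \<gamma> x * F (raise i \<gamma>))
          = (\<Sum>\<gamma>\<in>midxs (m + 1). (if 0 < \<gamma> i then \<i> * (cor (v \<alpha> x $ i) * d \<alpha> (lowerm i \<gamma>) x) else 0) * F \<gamma>)"
        unfolding e sum_distrib_left by (intro sum.cong[OF refl]) simp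
    qed
    also have "\<dots> = (\<Sum>\<gamma>\<in>midxs (m + 1). up d \<alpha> \<gamma> x * F \<gamma>)"
      unfolding up_def sum_distrib_right by (rule sum.swap)
    finally show ?thesis by simp
  qed
  \<comment> \<open>The terms in which the field differentiates \<open>w\<close> or a coefficient,
    with \<open>\<rho>\<close> divided out. Their degree is at most \<open>m\<close>, one below the
    new order, as the remainder requires.\<close>
  define ex where "ex = (\<lambda>\<alpha> \<gamma> x. \<Sum>i\<in>UNIV. cor (v \<alpha> x $ i) * sr i \<alpha> x *
      (cor (logd w i \<alpha> x) * e \<alpha> \<gamma> x + pd i (e \<alpha> \<gamma>) x))"
  have ex: "cfam (\<lambda>\<alpha>. ex \<alpha> \<gamma>)" for \<gamma>
    unfolding ex_def
    by (intro c_fam_sum c_fam_mult c_fam_add vc sr c_fam_of_real weightD(4)[OF w] e c_fam_pd) auto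
  have ex0: "ex \<alpha> \<gamma> = (\<lambda>x. 0)" if "m < int (mlen \<gamma>)" for \<alpha> \<gamma>
    unfolding ex_def e0[OF that] by simp
  have "lco w (m + 1) (\<lambda>u. V (P u)) (\<lambda>z. \<i> * vsym M V z * a z) (up c) (\<lambda>\<alpha> \<gamma> x. up r \<alpha> \<gamma> x + ex \<alpha> \<gamma> x)"
    unfolding lco_def
  proof (intro conjI allI impI ballI)
    show "weight M B w" by (rule w)
    show "cfam (\<lambda>\<alpha>. up c \<alpha> \<gamma>)" for \<gamma> by (rule up[OF c])
    show "cfam (\<lambda>\<alpha> x. up r \<alpha> \<gamma> x + ex \<alpha> \<gamma> x)" for \<gamma>
      by (rule c_fam_add[OF _ up[OF r] ex]) simp
    show "up c \<alpha> \<gamma> = (\<lambda>x. 0)" if g: "m + 1 < int (mlen \<gamma>)" for \<alpha> \<gamma>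
    proof -
      have "(if 0 < \<gamma> i then \<i> * (cor (v \<alpha> x $ i) * c \<alpha> (lowerm i \<gamma>) x) else 0) = 0" for i x
        using c0[of "lowerm i \<gamma>" \<alpha>] mlen_lowerm[of \<gamma> i] g by auto
      then show ?thesis by (simp add: up_def fun_eq_iff)
    qed
    show "(\<lambda>x. up r \<alpha> \<gamma> x + ex \<alpha> \<gamma> x) = (\<lambda>x. 0)" if g: "m + 1 \<le> int (mlen \<gamma>)" for \<alpha> \<gamma>
    proof -
      have "(if 0 < \<gamma> i then \<i> * (cor (v \<alpha> x $ i) * r \<alpha> (lowerm i \<gamma>) x) else 0) = 0" for i x
        using r0[of "lowerm i \<gamma>" \<alpha>] mlen_lowerm[of \<gamma> i] g by auto
      then show ?thesis using ex0[of \<gamma> \<alpha>] g by (simp add: up_def fun_eq_iff)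
    qed
    show "V (P u) = (\<lambda>q. 0)" if u: "\<not> smooth_fun M u" for u
    proof
      fix q
      obtain \<alpha> where \<alpha>: "\<alpha> \<in> I" "q \<in> U \<alpha>" by (rule covered)
      have "smooth_fun M (P u)" using P0[OF u] by simp
      then have "V (P u) (\<psi> \<alpha> (\<phi> \<alpha> q)) = (\<Sum>i\<in>UNIV. cor (v \<alpha> (\<phi> \<alpha> q) $ i * scl B \<alpha> $ i) * pd i (P u \<circ> \<psi> \<alpha>) (\<phi> \<alpha> q))"
        using V \<alpha> coord_in[OF \<alpha>] unfolding vrep_def by blast
      then show "V (P u) q = 0" using P0[OF u] \<alpha> by (simp add: o_def param_coord)
    qed
  next
    fix \<alpha> and x \<xi> :: "real^'n" assume \<alpha>: "\<alpha> \<in> I" and x: "x \<in> cube 2"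
    have "push M B \<alpha> (\<lambda>z. \<i> * vsym M V z * a z) x \<xi> = \<i> * push M B \<alpha> (vsym M V) x \<xi> * push M B \<alpha> a x \<xi>"
      by (simp add: push_def)
    also have "\<dots> = cor (w (\<psi> \<alpha> x)) * (\<Sum>i\<in>UNIV. \<i> * cor (v \<alpha> x $ i) * (\<Sum>\<gamma>\<in>midxs m. c \<alpha> \<gamma> x * mmonom (raise i \<gamma>) \<xi>))"
      unfolding vsym_push[OF V \<alpha> x] a[OF \<alpha> x] mmonom_raise
      by (simp add: sum_distrib_left sum_distrib_right mult_ac) (rule sum.swap)
    finally show "push M B \<alpha> (\<lambda>z. \<i> * vsym M V z * a z) x \<xi> =
        cor (w (\<psi> \<alpha> x)) * (\<Sum>\<gamma>\<in>midxs (m + 1). up c \<alpha> \<gamma> x * mmonom \<gamma> \<xi>)"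
      by (simp only: sum_up)
  next
    fix \<alpha> and x :: "real^'n" and u :: "'a => complex"
    assume \<alpha>: "\<alpha> \<in> I" and x: "x \<in> cube 2" and u: "smooth_fun M u"
    define S where "S = (\<lambda>y. \<Sum>\<gamma>\<in>midxs m. e \<alpha> \<gamma> y * SD \<alpha> \<gamma> u y)"
    have su: "smooth_on (cube 2) (u \<circ> \<psi> \<alpha>)" by (rule smooth_chart[OF u \<alpha>])
    have dSD: "SD \<alpha> \<gamma> u differentiable (at x)" for \<gamma>
      by (rule smooth_on_differentiable[OF smooth_on_scaled_D[OF open_cube su] x])
    have de: "e \<alpha> \<gamma> differentiable (at x)" for \<gamma> by (rule c_fam_differentiable[OF e \<alpha> x])
    have deSD: "(\<lambda>y. e \<alpha> \<gamma> y * SD \<alpha> \<gamma> u y) differentiable (at x)" for \<gamma> by (rule differentiable_mult[OF de dSD])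
    have dS: "S differentiable (at x)"
      unfolding S_def by (rule differentiable_sum) (auto intro: deSD)
    have dw: "(\<lambda>y. w (\<psi> \<alpha> y)) differentiable (at x)" by (rule weight_differentiable[OF w \<alpha> x])
    have dwc: "(\<lambda>y. cor (w (\<psi> \<alpha> y))) differentiable (at x)" by (rule differentiable_cor[OF dw])
    have PuS: "(P u \<circ> \<psi> \<alpha>) y = cor (w (\<psi> \<alpha> y)) * S y" if "y \<in> cube 2" for y
      using Pu[OF \<alpha> that u] by (simp add: S_def e_def)
    have smP: "smooth_fun M (P u)"
      unfolding c_fam_smooth_fun
    proof (rule c_fam_cong)
      have sd: "c_fam False I (\<lambda>_. cube 2) (\<lambda>\<beta>. SD \<beta> \<gamma> u)" for \<gamma>
        by (subst c_fam_False) (auto intro: smooth_on_scaled_D smooth_chart[OF u])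
      show "c_fam False I (\<lambda>_. cube 2) (\<lambda>\<beta> y. cor (w (\<psi> \<beta> y)) * (\<Sum>\<gamma>\<in>midxs m. e \<beta> \<gamma> y * SD \<beta> \<gamma> u y))"
        by (intro c_fam_mult c_fam_sum c_fam_of_real sd c_fam_smooth[OF e]) (use weightD(3)[OF w] in \<open>auto simp: c_fam_smooth_fun\<close>)
      show "cor (w (\<psi> \<beta> y)) * (\<Sum>\<gamma>\<in>midxs m. e \<beta> \<gamma> y * SD \<beta> \<gamma> u y) = P u (\<psi> \<beta> y)"
        if "\<beta> \<in> I" "y \<in> cube 2" for \<beta> y using Pu[OF that u] by (simp add: e_def)
    qed simp
    have pdP: "pd i (P u \<circ> \<psi> \<alpha>) x = cor (w (\<psi> \<alpha> x)) *
       (\<Sum>\<gamma>\<in>midxs m. (cor (logd w i \<alpha> x) * e \<alpha> \<gamma> x + pd i (e \<alpha> \<gamma>) x) * SD \<alpha> \<gamma> u x + e \<alpha> \<gamma> x * pd i (SD \<alpha> \<gamma> u) x)" for i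
    proof -
      have "pd i (P u \<circ> \<psi> \<alpha>) x = pd i (\<lambda>y. cor (w (\<psi> \<alpha> y)) * S y) x"
        by (rule pd_local_cong[OF open_cube x PuS])
      also have "\<dots> = cor (w (\<psi> \<alpha> x)) * pd i S x + cor (pd i (\<lambda>y. w (\<psi> \<alpha> y)) x) * S x"
        unfolding pd_mult[OF dwc dS] pd_of_real[OF dw] ..
      also have "pd i S x = (\<Sum>\<gamma>\<in>midxs m. e \<alpha> \<gamma> x * pd i (SD \<alpha> \<gamma> u) x + pd i (e \<alpha> \<gamma>) x * SD \<alpha> \<gamma> u x)"
        unfolding S_def by (subst pd_sum[OF deSD]) (simp add: pd_mult[OF de dSD])
      also have "cor (pd i (\<lambda>y. w (\<psi> \<alpha> y)) x) = cor (w (\<psi> \<alpha> x)) * cor (logd w i \<alpha> x)"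
        using weightD(2)[OF w] by (simp add: logd_def)
      finally have fin: "pd i (P u \<circ> \<psi> \<alpha>) x = cor (w (\<psi> \<alpha> x)) *
          (\<Sum>\<gamma>\<in>midxs m. e \<alpha> \<gamma> x * pd i (SD \<alpha> \<gamma> u) x + pd i (e \<alpha> \<gamma>) x * SD \<alpha> \<gamma> u x) +
          cor (w (\<psi> \<alpha> x)) * cor (logd w i \<alpha> x) * S x" .
      have "W * (\<Sum>\<gamma>\<in>midxs m. a \<gamma> * d \<gamma> + b \<gamma> * k \<gamma>) + W * l * (\<Sum>\<gamma>\<in>midxs m. a \<gamma> * k \<gamma>)
          = W * (\<Sum>\<gamma>\<in>midxs m. (l * a \<gamma> + b \<gamma>) * k \<gamma> + a \<gamma> * d \<gamma>)"
        for W l and a b d k :: "('n => nat) => complex"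
        by (simp add: sum_distrib_left sum.distrib algebra_simps)
      then show ?thesis unfolding fin S_def .
    qed
    have sc: "cor (scl B \<alpha> $ i) = cor (\<rho> (\<psi> \<alpha> x)) * sr i \<alpha> x" for i
      using weightD(2)[OF weight_rho] by (simp add: sr_def)
    have "V (P u) (\<psi> \<alpha> x) = (\<Sum>i\<in>UNIV. cor (v \<alpha> x $ i * scl B \<alpha> $ i) * pd i (P u \<circ> \<psi> \<alpha>) x)"
      using V smP \<alpha> x unfolding vrep_def by blast
    also have "\<dots> = (\<Sum>i\<in>UNIV. cor (w (\<psi> \<alpha> x)) * (
        cor (\<rho> (\<psi> \<alpha> x)) * (\<Sum>\<gamma>\<in>midxs m. cor (v \<alpha> x $ i) * sr i \<alpha> x *
      (cor (logd w i \<alpha> x) * e \<alpha> \<gamma> x + pd i (e \<alpha> \<gamma>) x) * SD \<alpha> \<gamma> u x)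
       + \<i> * cor (v \<alpha> x $ i) * (\<Sum>\<gamma>\<in>midxs m. e \<alpha> \<gamma> x * SD \<alpha> (raise i \<gamma>) u x)))"
    proof (rule sum.cong[OF refl])
      fix i
      have 1: "cor (scl B \<alpha> $ i) * (\<Sum>\<gamma>\<in>midxs m. e \<alpha> \<gamma> x * pd i (SD \<alpha> \<gamma> u) x)
         = \<i> * (\<Sum>\<gamma>\<in>midxs m. e \<alpha> \<gamma> x * SD \<alpha> (raise i \<gamma>) u x)"
        unfolding sum_distrib_left
      proof (rule sum.cong[OF refl])
        fix \<gamma>
        show "cor (scl B \<alpha> $ i) * (e \<alpha> \<gamma> x * pd i (SD \<alpha> \<gamma> u) x) = \<i> * (e \<alpha> \<gamma> x * SD \<alpha> (raise i \<gamma>) u x)"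
          using scaled_D_raise[OF open_cube su x, of "scl B \<alpha>" i \<gamma>] by (metis mult.left_commute)
      qed
      have "cor (v \<alpha> x $ i * scl B \<alpha> $ i) * pd i (P u \<circ> \<psi> \<alpha>) x
        = cor (w (\<psi> \<alpha> x)) * (cor (v \<alpha> x $ i) * cor (scl B \<alpha> $ i) *
          (\<Sum>\<gamma>\<in>midxs m. (cor (logd w i \<alpha> x) * e \<alpha> \<gamma> x + pd i (e \<alpha> \<gamma>) x) * SD \<alpha> \<gamma> u x)
         + cor (v \<alpha> x $ i) * (cor (scl B \<alpha> $ i) * (\<Sum>\<gamma>\<in>midxs m. e \<alpha> \<gamma> x * pd i (SD \<alpha> \<gamma> u) x)))"
        unfolding pdP sum.distrib by (simp add: algebra_simps)
      also have "\<dots> = cor (w (\<psi> \<alpha> x)) * (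
        cor (\<rho> (\<psi> \<alpha> x)) * (\<Sum>\<gamma>\<in>midxs m. cor (v \<alpha> x $ i) * sr i \<alpha> x *
      (cor (logd w i \<alpha> x) * e \<alpha> \<gamma> x + pd i (e \<alpha> \<gamma>) x) * SD \<alpha> \<gamma> u x)
       + \<i> * cor (v \<alpha> x $ i) * (\<Sum>\<gamma>\<in>midxs m. e \<alpha> \<gamma> x * SD \<alpha> (raise i \<gamma>) u x))"
        unfolding 1 unfolding sc by (simp add: sum_distrib_left mult_ac)
      finally show "cor (v \<alpha> x $ i * scl B \<alpha> $ i) * pd i (P u \<circ> \<psi> \<alpha>) x
        = cor (w (\<psi> \<alpha> x)) * (
        cor (\<rho> (\<psi> \<alpha> x)) * (\<Sum>\<gamma>\<in>midxs m. cor (v \<alpha> x $ i) * sr i \<alpha> x *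
      (cor (logd w i \<alpha> x) * e \<alpha> \<gamma> x + pd i (e \<alpha> \<gamma>) x) * SD \<alpha> \<gamma> u x)
       + \<i> * cor (v \<alpha> x $ i) * (\<Sum>\<gamma>\<in>midxs m. e \<alpha> \<gamma> x * SD \<alpha> (raise i \<gamma>) u x))" .
    qed
    also have "\<dots> = cor (w (\<psi> \<alpha> x)) * (
        cor (\<rho> (\<psi> \<alpha> x)) * (\<Sum>\<gamma>\<in>midxs m. ex \<alpha> \<gamma> x * SD \<alpha> \<gamma> u x)
       + (\<Sum>\<gamma>\<in>midxs (m + 1). up e \<alpha> \<gamma> x * SD \<alpha> \<gamma> u x))"
    proof -
      have "(\<Sum>\<gamma>\<in>midxs m. ex \<alpha> \<gamma> x * SD \<alpha> \<gamma> u x) =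
          (\<Sum>i\<in>UNIV. \<Sum>\<gamma>\<in>midxs m. cor (v \<alpha> x $ i) * sr i \<alpha> x *
            (cor (logd w i \<alpha> x) * e \<alpha> \<gamma> x + pd i (e \<alpha> \<gamma>) x) * SD \<alpha> \<gamma> u x)"
        unfolding ex_def sum_distrib_right by (rule sum.swap)
      then show ?thesis unfolding sum_up by (simp only: sum_distrib_left[symmetric] sum.distrib)
    qed
    also have "(\<Sum>\<gamma>\<in>midxs m. ex \<alpha> \<gamma> x * SD \<alpha> \<gamma> u x) = (\<Sum>\<gamma>\<in>midxs (m + 1). ex \<alpha> \<gamma> x * SD \<alpha> \<gamma> u x)"
      by (rule sum_mlen_mono[symmetric]) (simp_all add: ex0)
    also have "cor (\<rho> (\<psi> \<alpha> x)) * (\<Sum>\<gamma>\<in>midxs (m + 1). ex \<alpha> \<gamma> x * SD \<alpha> \<gamma> u x) + (\<Sum>\<gamma>\<in>midxs (m + 1). up e \<alpha> \<gamma> x * SD \<alpha> \<gamma> u x)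
        = (\<Sum>\<gamma>\<in>midxs (m + 1). (up c \<alpha> \<gamma> x + cor (\<rho> (\<psi> \<alpha> x)) * (up r \<alpha> \<gamma> x + ex \<alpha> \<gamma> x)) * SD \<alpha> \<gamma> u x)"
    proof -
      have "up e \<alpha> \<gamma> x = up c \<alpha> \<gamma> x + cor (\<rho> (\<psi> \<alpha> x)) * up r \<alpha> \<gamma> x" for \<gamma>
        unfolding up_def e_def sum_distrib_left sum.distrib[symmetric]
        by (rule sum.cong) (simp_all add: algebra_simps)
      then show ?thesis by (simp add: sum_distrib_left sum.distrib[symmetric] algebra_simps)
    qed
    finally show "V (P u) (\<psi> \<alpha> x) = cor (w (\<psi> \<alpha> x)) *
        (\<Sum>\<gamma>\<in>midxs (m + 1). (up c \<alpha> \<gamma> x + cor (\<rho> (\<psi> \<alpha> x)) * (up r \<alpha> \<gamma> x + ex \<alpha> \<gamma> x)) * SD \<alpha> \<gamma> u x)" .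
  qed
  then show ?thesis by blast
qed

lemma gen_lco:
  assumes "gn w m P a"
  shows "\<exists>c r. lco w m P a c r"
  using assms
proof (induction rule: gen.induct)
  case (zero w m)
  have "lco w m (\<lambda>u q. 0) (\<lambda>z. 0) (\<lambda>\<alpha> \<gamma> x. 0) (\<lambda>\<alpha> \<gamma> x. 0)"
    using zero by (simp add: lco_def push_def)
  then show ?case by blast
next
  case (unit m)
  define c where "c = (\<lambda>(\<alpha>::'i) \<gamma> (x::real^'n). if \<gamma> = (\<lambda>_::'n. 0::nat) then 1 else 0 :: complex)"
  have s: "(\<Sum>\<gamma>\<in>midxs m. c \<alpha> \<gamma> x * F \<gamma>) = F (\<lambda>_. 0)" for \<alpha> x and F :: "('n => nat) => complex"
  proof -
    have "c \<alpha> \<gamma> x * F \<gamma> = (if \<gamma> = (\<lambda>_. 0) then F (\<lambda>_. 0) else 0)" for \<gamma> by (simp add: c_def)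
    then show ?thesis using unit by (simp add: mlen_0)
  qed
  have c0: "c \<alpha> \<gamma> = (\<lambda>x. 0)" if "m < int (mlen \<gamma>)" for \<alpha> \<gamma>
    using that unit by (auto simp: c_def mlen_0)
  have "lco (\<lambda>q. 1) m (smooth_id M) (\<lambda>z. if z \<in> cotangent_bundle M then 1 else 0) c (\<lambda>\<alpha> \<gamma> x. 0)"
    unfolding lco_def
  proof (intro conjI allI impI ballI)
    show "cfam (\<lambda>\<alpha>. c \<alpha> \<gamma>)" for \<gamma> unfolding c_def by (rule c_fam_const')
    show "push M B \<alpha> (\<lambda>z. if z \<in> cotangent_bundle M then 1 else 0) x \<xi> = cor 1 * (\<Sum>\<gamma>\<in>midxs m. c \<alpha> \<gamma> x * mmonom \<gamma> \<xi>)"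
      if "\<alpha> \<in> I" "x \<in> cube 2" for \<alpha> x \<xi> using cot_param_in[OF that] by (simp add: s push_def mmonom_zero)
    show "smooth_id M u (\<psi> \<alpha> x) = cor 1 * (\<Sum>\<gamma>\<in>midxs m. (c \<alpha> \<gamma> x + cor (\<rho> (\<psi> \<alpha> x)) * 0) * SD \<alpha> \<gamma> u x)"
      if "smooth_fun M u" for \<alpha> x u using that by (simp add: s smooth_id_def scaled_D_0)
  qed (simp_all add: weight_1 c0 smooth_id_def)
  then show ?case by blast
next
  case (mult f w m P a)
  then obtain c r where l: "lco w m P a c r" by blast
  have f: "cfam (\<lambda>\<alpha> x. f (\<psi> \<alpha> x))" using mult(1) by (simp add: C_uni_iff)
  have "lco w m (\<lambda>u q. f q * P u q) (\<lambda>z. f (fst z) * a z) (\<lambda>\<alpha> \<gamma> x. f (\<psi> \<alpha> x) * c \<alpha> \<gamma> x) (\<lambda>\<alpha> \<gamma> x. f (\<psi> \<alpha> x) * r \<alpha> \<gamma> x)"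
    using l unfolding lco_def
    by (auto simp: push_def sum_distrib_left algebra_simps intro!: c_fam_mult f)
  then show ?case by blast
next
  case (wmult w' w m P a)
  then obtain c r where l: "lco w m P a c r" by blast
  have "lco (\<lambda>q. w' q * w q) m (\<lambda>u q. cor (w' q) * P u q) (\<lambda>z. cor (w' (fst z)) * a z) c r"
    using l wmult(1) unfolding lco_def by (auto simp: push_def mult.assoc intro!: weight_mult)
  then show ?case by blast
next
  case (field V w m P a)
  obtain v where "vrep V v" using field(1) op_lie_iff by blast
  moreover obtain c r where "lco w m P a c r" using field.IH by blast
  ultimately show ?case by (rule lco_field)
next
  case (add w m P a Q b)
  then obtain c r c' r' where l: "lco w m P a c r" "lco w m Q b c' r'" by blast
  have "lco w m (\<lambda>u q. P u q + Q u q) (\<lambda>z. a z + b z) (\<lambda>\<alpha> \<gamma> x. c \<alpha> \<gamma> x + c' \<alpha> \<gamma> x) (\<lambda>\<alpha> \<gamma> x. r \<alpha> \<gamma> x + r' \<alpha> \<gamma> x)"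
    using l unfolding lco_def
    by (auto simp: push_def algebra_simps sum.distrib intro!: c_fam_add)
  then show ?case by blast
next
  case (mono w m P a m')
  then obtain c r where l: "lco w m P a c r" by blast
  have c0: "\<And>\<alpha> \<gamma>. m < int (mlen \<gamma>) ==> c \<alpha> \<gamma> = (\<lambda>x. 0)" and r0: "\<And>\<alpha> \<gamma>. m < int (mlen \<gamma>) ==> r \<alpha> \<gamma> = (\<lambda>x. 0)"
    using l by (auto simp: lco_def)
  have s: "(\<Sum>\<gamma>\<in>midxs m'. c \<alpha> \<gamma> x * F \<gamma>) = (\<Sum>\<gamma>\<in>midxs m. c \<alpha> \<gamma> x * F \<gamma>)"
    "(\<Sum>\<gamma>\<in>midxs m'. (c \<alpha> \<gamma> x + k * r \<alpha> \<gamma> x) * F \<gamma>) = (\<Sum>\<gamma>\<in>midxs m. (c \<alpha> \<gamma> x + k * r \<alpha> \<gamma> x) * F \<gamma>)"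
    for \<alpha> x k and F :: "('n => nat) => complex"
    by (rule sum_mlen_mono[OF mono(2)]; simp add: c0 r0)+
  have "lco w m' P a c r"
    using l mono(2) unfolding lco_def s by auto
  then show ?case by blast
qed

end

lemma exp_test:
  fixes \<eta> x :: "real^'n::finite"
  defines "f \<equiv> \<lambda>y. exp (\<i> * cor ((y - x) \<bullet> \<eta>))"
  shows "smooth_on UNIV f"
    and "iter_deriv (map (\<lambda>i. axis i 1) is) f y = (\<Prod>l\<leftarrow>is. \<i> * cor (\<eta> $ l)) * f y"
proof -
  have bl: "bounded_linear (\<lambda>y::real^'n. y \<bullet> \<eta>)" by (rule bounded_linear_inner_left)
  have 1: "c_fam False {()} (\<lambda>_. UNIV) (\<lambda>_ y :: real^'n. y - x)"
    by (rule c_fam_diff[OF _ c_fam_id c_fam_const']) simp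
  have "c_fam False {()} (\<lambda>_. UNIV) (\<lambda>_ y :: real^'n. (y - x) \<bullet> \<eta>)"
    by (rule c_fam_linear[OF bl _ 1]) simp
  then have "c_fam False {()} (\<lambda>_. UNIV) (\<lambda>_ y :: real^'n. \<i> * cor ((y - x) \<bullet> \<eta>))"
    by (intro c_fam_mult c_fam_of_real c_fam_const') auto
  then have s1: "smooth_on UNIV (\<lambda>y :: real^'n. \<i> * cor ((y - x) \<bullet> \<eta>))" by (simp add: c_fam_single)
  have s2: "smooth_on UNIV (exp :: complex => complex)"
    using c_fam_exp[of "{()}" "\<lambda>_. UNIV"] by (simp add: c_fam_single)
  show sm: "smooth_on UNIV f" unfolding f_def by (rule smooth_on_compose[OF open_UNIV open_UNIV s1 _ s2]) simp
  have d: "dird v f y = \<i> * cor (v \<bullet> \<eta>) * f y" for v y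
  proof -
    have "((\<lambda>y. \<i> * cor ((y - x) \<bullet> \<eta>)) has_derivative (\<lambda>v. \<i> * cor (v \<bullet> \<eta>))) (at y)"
      by (auto intro!: derivative_eq_intros)
    then have "(f has_derivative (\<lambda>v. exp (\<i> * cor ((y - x) \<bullet> \<eta>)) * (\<i> * cor (v \<bullet> \<eta>)))) (at y)"
      unfolding f_def
      by (rule has_derivative_compose) (use DERIV_exp[of "\<i> * cor ((y - x) \<bullet> \<eta>)"] in \<open>simp add: has_field_derivative_def\<close>)
    then show ?thesis by (simp add: dird_eqI f_def mult_ac)
  qed
  show "iter_deriv (map (\<lambda>i. axis i 1) is) f y = (\<Prod>l\<leftarrow>is. \<i> * cor (\<eta> $ l)) * f y"
  proof (induction "is" arbitrary: y)
    case (Cons l "is")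
    then have "iter_deriv (map (\<lambda>i. axis i 1) is) f = (\<lambda>y. (\<Prod>l\<leftarrow>is. \<i> * cor (\<eta> $ l)) * f y)"
      by (simp add: fun_eq_iff)
    then have "iter_deriv (map (\<lambda>i. axis i 1) (l # is)) f y = (\<Prod>l\<leftarrow>is. \<i> * cor (\<eta> $ l)) * dird (axis l 1) f y"
      using dird_linear[OF bounded_linear_mult_right smooth_on_differentiable[OF sm UNIV_I]] by simp
    then show ?case by (simp add: d inner_axis' mult_ac)
  qed simp
qed

lemma Diff_sum:
  assumes "finite A" "\<And>k. k \<in> A ==> P k \<in> Diff M B m"
  shows "(\<lambda>u q. \<Sum>k\<in>A. P k u q) \<in> Diff M B m"
  using assms by induction (auto intro: Diff.zero Diff.add)

context scaled_bg_weight
begin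

text \<open>A plane wave centred at \<open>x\<close> with frequency \<open>\<xi>\<close> divided by
  the scales, cut off away from \<open>x\<close>: it has the value 1 at \<open>x\<close>, and each
  scaled derivative there is the corresponding monomial.\<close>

lemma symbol_test:
  assumes \<alpha>: "\<alpha> \<in> I" and x: "x \<in> cube 2"
  obtains u where "smooth_fun M u" "\<And>\<gamma>. SD \<alpha> \<gamma> u x = mmonom \<gamma> \<xi>"
proof -
  define \<eta> where "\<eta> = (\<chi> i. \<xi> $ i / scl B \<alpha> $ i)"
  define f where "f = (\<lambda>y. exp (\<i> * cor ((y - x) \<bullet> \<eta>)))"
  have "smooth_on UNIV f" unfolding f_def by (rule exp_test)
  then obtain u T where u: "smooth_fun M u" "open T" "x \<in> T" "T \<subseteq> cube 2" "\<And>y. y \<in> T ==> u (\<psi> \<alpha> y) = f y"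
    using test_function[OF cutoff \<alpha> x] by blast
  have "SD \<alpha> \<gamma> u x = mmonom \<gamma> \<xi>" for \<gamma>
  proof -
    have "mpd \<gamma> (u \<circ> \<psi> \<alpha>) x = mpd \<gamma> f x"
      unfolding mpd_def by (rule iter_deriv_local_cong[OF u(2) _ u(3)]) (simp add: u(5))
    also have "\<dots> = (\<Prod>l\<leftarrow>ilist \<gamma>. \<i> * cor (\<eta> $ l)) * f x"
      unfolding mpd_ilist f_def by (rule exp_test)
    also have "\<dots> = (\<Prod>i\<in>UNIV. (\<i> * cor (\<eta> $ i)) ^ \<gamma> i)"
      by (simp add: prod_list_ilist f_def)
    finally have "SD \<alpha> \<gamma> u x = (\<Prod>i\<in>UNIV. ((cor (scl B \<alpha> $ i) * inverse \<i>) * (\<i> * cor (\<eta> $ i))) ^ \<gamma> i)"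
      by (simp only: scaled_D_def prod.distrib[symmetric] power_mult_distrib[symmetric])
    also have "\<dots> = mmonom \<gamma> \<xi>"
      unfolding mmonom_def
    proof (rule prod.cong[OF refl])
      fix i
      have "(cor (scl B \<alpha> $ i) * inverse \<i>) * (\<i> * cor (\<eta> $ i)) = (\<i> * inverse \<i>) * (cor (scl B \<alpha> $ i) * cor (\<eta> $ i))"
        by (simp only: mult_ac)
      then have "(cor (scl B \<alpha> $ i) * inverse \<i>) * (\<i> * cor (\<eta> $ i)) = cor (scl B \<alpha> $ i * \<eta> $ i)"
        by simp
      also have "scl B \<alpha> $ i * \<eta> $ i = \<xi> $ i" using scl_pos[OF \<alpha>, of i] by (simp add: \<eta>_def)
      finally show "((cor (scl B \<alpha> $ i) * inverse \<i>) * (\<i> * cor (\<eta> $ i))) ^ \<gamma> i = cor (\<xi> $ i) ^ \<gamma> i"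
        by simp
    qed
    finally show ?thesis .
  qed
  then show ?thesis using that u(1) by blast
qed

text \<open>Applying the operator to the plane wave of \<open>symbol_test\<close> reads off the
  polynomial, so every choice of local coefficients gives the same local symbol.\<close>

lemma local_symbol_eq:
  assumes \<alpha>: "\<alpha> \<in> I" and x: "x \<in> cube 2" and c: "local_coeffs M B m P \<alpha> c"
  shows "local_symbol M B m P \<alpha> x \<xi> = (\<Sum>\<gamma>\<in>midxs m. c \<gamma> x * mmonom \<gamma> \<xi>)"
proof -
  define c' where "c' = (SOME c. local_coeffs M B m P \<alpha> c)"
  have c': "local_coeffs M B m P \<alpha> c'" unfolding c'_def by (rule someI[where P = "local_coeffs M B m P \<alpha>", OF c])
  obtain u where u: "smooth_fun M u" "\<And>\<gamma>. SD \<alpha> \<gamma> u x = mmonom \<gamma> \<xi>" using symbol_test[OF \<alpha> x] by blast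
  have "(\<Sum>\<gamma>\<in>midxs m. d \<gamma> x * mmonom \<gamma> \<xi>) = P u (\<psi> \<alpha> x)" if "local_coeffs M B m P \<alpha> d" for d
    using that u x unfolding local_coeffs_def by simp
  from this[OF c] this[OF c'] show ?thesis unfolding local_symbol_def c'_def[symmetric] by simp
qed

lemma gen_word:
  assumes "set Vs \<subseteq> op_lie_algebra M B"
  shows "gn (\<lambda>q. 1) (int (length Vs)) (foldr (\<circ>) Vs (smooth_id M))
    (\<lambda>z. if z \<in> cotangent_bundle M then \<Prod>V\<leftarrow>Vs. \<i> * vsym M V z else 0)"
  using assms
proof (induction Vs)
  case Nil
  show ?case using gen.unit[of 0 M "C_uni M B" Wt "op_lie_algebra M B"] by (simp cong: if_cong)
next
  case (Cons V Vs)
  then have "gn (\<lambda>q. 1) (int (length Vs) + 1) (\<lambda>u. V (foldr (\<circ>) Vs (smooth_id M) u))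
    (\<lambda>z. \<i> * vsym M V z * (if z \<in> cotangent_bundle M then \<Prod>V\<leftarrow>Vs. \<i> * vsym M V z else 0))"
    by (intro gen.field) auto
  moreover have "(\<lambda>z. \<i> * vsym M V z * (if z \<in> cotangent_bundle M then \<Prod>V\<leftarrow>Vs. \<i> * vsym M V z else 0))
     = (\<lambda>z. if z \<in> cotangent_bundle M then \<Prod>V\<leftarrow>V # Vs. \<i> * vsym M V z else 0)"
    by (auto simp: fun_eq_iff)
  moreover have "(\<lambda>u. V (foldr (\<circ>) Vs (smooth_id M) u)) = foldr (\<circ>) (V # Vs) (smooth_id M)"
    by (simp add: fun_eq_iff)
  moreover have "int (length Vs) + 1 = int (length (V # Vs))" by simp
  ultimately show ?case by metis
qed

lemma word_smooth:
  assumes "set Vs \<subseteq> op_lie_algebra M B"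
  shows "smooth_fun M (foldr (\<circ>) Vs (smooth_id M) u)"
  using assms
proof (induction Vs)
  case Nil
  then show ?case by (simp add: smooth_id_def)
next
  case (Cons V Vs)
  obtain v where "vrep V v" using Cons.prems op_lie_iff by auto
  moreover have "smooth_fun M (foldr (\<circ>) Vs (smooth_id M) u)" by (rule Cons.IH) (use Cons.prems in simp)
  ultimately have 1: "smooth_fun M (V (foldr (\<circ>) Vs (smooth_id M) u))" by (rule vrep_smooth)
  have 2: "(\<lambda>u. V (foldr (\<circ>) Vs (smooth_id M) u)) = foldr (\<circ>) (V # Vs) (smooth_id M)"
    by (simp add: fun_eq_iff)
  show ?case using 1 by (simp only: fun_cong[OF 2, of u, symmetric])
qed

lemma Diff_gen:
  assumes "P \<in> Diff M B m"
  shows "\<exists>a. gn (\<lambda>q. 1) m P a"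
  using assms
proof (induction rule: Diff.induct)
  case zero
  show ?case using gen.zero[of "\<lambda>q. 1"] weight_1 by blast
next
  case (comp f Vs)
  from gen.mono[OF gen.mult[OF comp(1) gen_word[OF comp(2)]] comp(3)] show ?case by blast
next
  case (add P Q)
  then show ?case using gen.add by blast
qed

lemma C_uni_mult_const:
  fixes f :: "'a => complex"
  assumes "f \<in> C_uni M B"
  shows "(\<lambda>q. f q * c) \<in> C_uni M B"
  using assms unfolding C_uni_iff by (intro c_fam_mult c_fam_const') auto

text \<open>Local operators glued by the partition of unity. That the result lies in
  \<open>Diff\<close> is not visible from this form; it is the content of
  \<open>reconstruct\<close>.\<close>

definition patch :: "int => ('i => ('n => nat) => real^'n => complex) => 'a operator" where
  "patch m r u q = (\<Sum>\<alpha> | \<alpha> \<in> I \<and> q \<in> U \<alpha>. cor (chart_partition B \<kappa> \<alpha> q) *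
     (\<Sum>\<gamma>\<in>midxs m. r \<alpha> \<gamma> (\<phi> \<alpha> q) * SD \<alpha> \<gamma> u (\<phi> \<alpha> q)))"

definition patch_symbol :: "int => ('i => ('n => nat) => real^'n => complex) => 'a symbol" where
  "patch_symbol m r z = (\<Sum>\<alpha> | \<alpha> \<in> I \<and> fst z \<in> U \<alpha>. cor (chart_partition B \<kappa> \<alpha> (fst z)) *
     pull M B \<alpha> (\<lambda>x \<xi>. \<Sum>\<gamma>\<in>midxs m. r \<alpha> \<gamma> x * mmonom \<gamma> \<xi>) z)"

text \<open>
  On the support of the partition function of a chart the words in the coordinate vector fields of
  its colour act as pure derivatives, so that finitely many words suffice.
\<close>

lemma reconstruct:
  assumes r: "\<And>\<gamma>. cfam (\<lambda>\<alpha>. r \<alpha> \<gamma>)"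
  obtains Q where "Q \<in> Diff M B m" "gn (\<lambda>q. 1) m Q (patch_symbol m r)"
    "\<And>u. smooth_fun M u ==> Q u = patch m r u"
proof -
  obtain s0 where s0: "1 \<le> s0" "s0 < 2" "\<And>x. \<kappa> x \<noteq> 0 ==> x \<in> ccube s0"
    using cutoff_support[OF cutoff] by blast
  \<comment> \<open>Four nested radii below 2: \<open>\<kappa>\<close> is supported in
    \<open>s0\<close>, \<open>\<theta>\<close> equals 1 on \<open>s1\<close> and is supported in
    \<open>s2\<close>, and the colours are separated on \<open>s\<close>. The gap between
    \<open>s0\<close> and \<open>s1\<close> leaves an open set with \<open>\<theta> = 1\<close>
    around the support of \<open>\<kappa>\<close>, where fields can be iterated.\<close>
  define d where "d = (2 - s0) / 4"
  have d: "d > 0" "s0 + 3 * d < 2" using s0(2) unfolding d_def by (simp, simp add: field_simps)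
  define s1 s2 s where "s1 = s0 + d" and "s2 = s0 + 2 * d" and "s = s0 + 3 * d"
  have ss: "s0 < s1" "s1 < s2" "s2 < s" "s < 2" "1 \<le> s" using d s0 by (auto simp: s1_def s2_def s_def)
  obtain col :: "'i => nat" and N where col: "\<forall>\<alpha>\<in>I. col \<alpha> < N"
    "\<forall>\<alpha>\<in>I. \<forall>\<beta>\<in>I. \<alpha> \<noteq> \<beta> \<longrightarrow> col \<alpha> = col \<beta> \<longrightarrow> kc s \<alpha> \<inter> kc s \<beta> = {}"
    using colouring_exists[OF ss(4)] by (elim exE conjE) (rule that)
  interpret C: coloured_bg M B s col N
    by unfold_locales (use ss(4,5) in linarith, use ss(4,5) in linarith, use col(1) in blast, use col(2) in blast)
  obtain \<theta> :: "real^'n => real" where \<theta>: "smooth_on UNIV \<theta>" "\<And>x. x \<in> ccube s1 ==> \<theta> x = 1" "\<And>x. \<theta> x \<noteq> 0 ==> x \<in> ccube s2"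
    using cutoff_between_cubes[OF cutoff ss(2)] by blast
  have V: "C.cfield \<theta> c l \<in> op_lie_algebra M B" for c l
    by (rule C.cfield_in[OF ss(3) \<theta>(1)]) (use \<theta>(3) in blast)
  define Vs where "Vs = (\<lambda>c is. map (C.cfield \<theta> c) is)"
  have Vs: "set (Vs c is) \<subseteq> op_lie_algebra M B" for c "is" using V by (auto simp: Vs_def)
  define X where "X = (\<lambda>c is. foldr (\<circ>) (Vs c is) (smooth_id M))"
  have sub1: "cube s1 \<subseteq> (ccube s :: (real^'n) set)" "cube s1 \<subseteq> (cube 2 :: (real^'n) set)" "cube s1 \<subseteq> (ccube s1 :: (real^'n) set)"
    using cube_mono[of s1 s] cube_mono[of s1 2] cube_subset_ccube[of s] cube_subset_ccube[of s1] ss by auto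
  have X: "X c is u (\<psi> \<alpha> x) = (\<Prod>l\<leftarrow>is. cor (scl B \<alpha> $ l)) * iter_deriv (map (\<lambda>i. axis i 1) is) (u \<circ> \<psi> \<alpha>) x"
    if \<alpha>: "\<alpha> \<in> I" "col \<alpha> = c" and x: "x \<in> cube s1" and u: "smooth_fun M u" for c "is" u \<alpha> x
    using x
  proof (induction "is" arbitrary: x)
    case Nil
    then show ?case using u by (simp add: X_def Vs_def smooth_id_def)
  next
    case (Cons l "is")
    have "smooth_fun M (X c is u)" unfolding X_def by (rule word_smooth[OF Vs])
    then have "X c (l # is) u (\<psi> \<alpha> x) = cor (\<theta> x * scl B \<alpha> $ l) * pd l (X c is u \<circ> \<psi> \<alpha>) x"
      using C.cfield_param[OF \<alpha>, of x "X c is u" \<theta> l] Cons.prems sub1 by (auto simp: X_def Vs_def)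
    also have "\<theta> x = 1" using \<theta>(2) Cons.prems sub1 by blast
    also have "pd l (X c is u \<circ> \<psi> \<alpha>) x = pd l (\<lambda>y. (\<Prod>l\<leftarrow>is. cor (scl B \<alpha> $ l)) * iter_deriv (map (\<lambda>i. axis i 1) is) (u \<circ> \<psi> \<alpha>) y) x"
      by (rule pd_local_cong[OF open_cube Cons.prems]) (subst comp_apply, erule Cons.IH)
    also have "\<dots> = (\<Prod>l\<leftarrow>is. cor (scl B \<alpha> $ l)) * pd l (iter_deriv (map (\<lambda>i. axis i 1) is) (u \<circ> \<psi> \<alpha>)) x"
      unfolding pd_dird
    proof (rule dird_linear[OF bounded_linear_mult_right])
      show "iter_deriv (map (\<lambda>i. axis i 1) is) (u \<circ> \<psi> \<alpha>) differentiable (at x)"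
        by (rule smooth_on_differentiable[OF smooth_on_iter_deriv[OF smooth_chart[OF u \<alpha>(1)]]]) (use Cons.prems sub1 in blast)
    qed
    finally show ?case by (simp only: list.map prod_list.Cons iter_deriv_Cons mult_1_left pd_dird mult_ac)
  qed
  \<comment> \<open>Words of fields give plain scaled derivatives, while \<open>SD\<close> uses
    \<open>D\<close>; the power of \<open>inverse \<i>\<close> converts one into the other.\<close>
  have X\<gamma>: "inverse \<i> ^ mlen \<gamma> * X c (ilist \<gamma>) u (\<psi> \<alpha> x) = SD \<alpha> \<gamma> u x"
    if \<alpha>: "\<alpha> \<in> I" "col \<alpha> = c" and x: "x \<in> cube s1" and u: "smooth_fun M u" for c \<gamma> u \<alpha> x
  proof -
    have "inverse \<i> ^ mlen \<gamma> = (\<Prod>i\<in>UNIV. inverse \<i> ^ \<gamma> i)" by (simp only: mlen_def power_sum)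
    then show ?thesis
      by (simp only: X[OF \<alpha> x u] prod_list_ilist scaled_D_def mpd_ilist power_mult_distrib prod.distrib mult_ac)
  qed
  define sy where "sy = (\<lambda>c \<gamma> z. if z \<in> cotangent_bundle M then \<Prod>V\<leftarrow>Vs c (ilist \<gamma>). \<i> * vsym M V z else 0)"
  have sy: "inverse \<i> ^ mlen \<gamma> * sy c \<gamma> (cot_param M B \<alpha> (x, \<xi>)) = mmonom \<gamma> \<xi>"
    if \<alpha>: "\<alpha> \<in> I" "col \<alpha> = c" and x: "x \<in> cube s1" for c \<gamma> \<alpha> x \<xi>
  proof -
    define z where "z = cot_param M B \<alpha> (x, \<xi>)"
    have x2: "x \<in> cube 2" using x sub1 by blast
    have z: "z \<in> cotangent_bundle M" unfolding z_def by (rule cot_param_in[OF \<alpha>(1) x2])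
    have vs: "vsym M (C.cfield \<theta> c l) z = cor (\<xi> $ l)" for l
    proof -
      define g where "g = (SOME g. g \<in> snd z)"
      obtain g0 where "g0 \<in> snd z" unfolding z_def using cot_param_nonempty[OF \<alpha>(1) x2] by blast
      then have "g \<in> snd z" unfolding g_def by (rule someI[where P = "\<lambda>g. g \<in> snd z"])
      then have g: "smooth_fun M g" "\<And>i. pd i (g \<circ> \<psi> \<alpha>) x = \<xi> $ i / scl B \<alpha> $ i" by (auto simp: z_def cot_param_def)
      have dg: "(g \<circ> \<psi> \<alpha>) differentiable (at x)" by (rule smooth_on_differentiable[OF smooth_chart[OF g(1) \<alpha>(1)] x2])
      have "vsym M (C.cfield \<theta> c l) z = C.cfield \<theta> c l (\<lambda>q. cor (g q)) (\<psi> \<alpha> x)"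
        unfolding vsym_def g_def[symmetric] using z by (simp add: z_def)
      also have "\<dots> = cor (\<theta> x * scl B \<alpha> $ l) * pd l ((\<lambda>q. cor (g q)) \<circ> \<psi> \<alpha>) x"
        by (rule C.cfield_param[OF \<alpha> _ smooth_fun_of_real[OF g(1)]]) (use x sub1 in blast)
      also have "pd l ((\<lambda>q. cor (g q)) \<circ> \<psi> \<alpha>) x = cor (\<xi> $ l / scl B \<alpha> $ l)"
        using pd_of_real[OF dg, of l] g(2)[of l] by (simp add: o_def)
      also have "\<theta> x = 1" using \<theta>(2) x sub1 by blast
      finally show ?thesis using scl_pos[OF \<alpha>(1), of l] by simp
    qed
    have "sy c \<gamma> z = (\<Prod>l\<leftarrow>ilist \<gamma>. \<i> * cor (\<xi> $ l))"
      using z by (simp add: sy_def Vs_def o_def vs)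
    also have "\<dots> = \<i> ^ mlen \<gamma> * mmonom \<gamma> \<xi>"
      unfolding prod_list_ilist power_mult_distrib prod.distrib by (simp only: mlen_def power_sum mmonom_def)
    finally have "sy c \<gamma> z = \<i> ^ mlen \<gamma> * mmonom \<gamma> \<xi>" .
    moreover have "inverse \<i> ^ mlen \<gamma> * (\<i> ^ mlen \<gamma> * y) = y" for y
      unfolding mult.assoc[symmetric] power_mult_distrib[symmetric] by simp
    ultimately show ?thesis by (simp add: z_def)
  qed
  define \<chi>' where "\<chi>' = (\<lambda>\<alpha> x. cor (chart_partition B \<kappa> \<alpha> (\<psi> \<alpha> x)))"
  have \<chi>c: "cfam \<chi>'"
    unfolding \<chi>'_def
    by (rule c_fam_of_real[OF _ C.c_fam_partition[OF cutoff _ s0(3)]]) (use ss in auto)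
  \<comment> \<open>Outside \<open>ccube s0\<close> the value is set to 0 by hand: beyond the chart
    \<open>r\<close> and the pulled back partition function are arbitrary, while sums over a colour
    require vanishing everywhere off a smaller cube.\<close>
  define h where "h = (\<lambda>\<gamma> \<alpha> x. if x \<in> ccube s0 then \<chi>' \<alpha> x * r \<alpha> \<gamma> x else 0)"
  have \<chi>0: "\<chi>' \<alpha> x = 0" if "\<alpha> \<in> I" "x \<in> cube 2" "x \<notin> ccube s0" for \<alpha> x
    using C.partition_zero[of \<kappa> \<alpha> "\<psi> \<alpha> x"] s0(3)[of x] that by (auto simp: \<chi>'_def coord_param)
  have hc: "cfam (h \<gamma>)" for \<gamma>
  proof (rule c_fam_cong)
    show "cfam (\<lambda>\<alpha> x. \<chi>' \<alpha> x * r \<alpha> \<gamma> x)" by (rule c_fam_mult[OF _ \<chi>c r]) simp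
    show "\<chi>' \<alpha> x * r \<alpha> \<gamma> x = h \<gamma> \<alpha> x" if "\<alpha> \<in> I" "x \<in> cube 2" for \<alpha> x
      using \<chi>0[OF that] by (simp add: h_def)
  qed simp
  define f where "f = (\<lambda>c \<gamma> q. C.csum c (h \<gamma>) q * inverse \<i> ^ mlen \<gamma>)"
  have f: "f c \<gamma> \<in> C_uni M B" for c \<gamma>
    unfolding f_def
    by (rule C_uni_mult_const[OF C.C_uni_csum[OF _ hc, of s0]]) (use ss in \<open>auto simp: h_def\<close>)
  define \<Gamma> where "\<Gamma> = {\<gamma> :: 'n => nat. int (mlen \<gamma>) \<le> m}"
  have \<Gamma>: "finite \<Gamma>" by (simp add: \<Gamma>_def)
  define Q where "Q = (\<lambda>u q. \<Sum>k\<in>{..<N} \<times> \<Gamma>. f (fst k) (snd k) q * X (fst k) (ilist (snd k)) u q)"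
  have QD: "Q \<in> Diff M B m"
    unfolding Q_def
  proof (rule Diff_sum)
    fix k assume "k \<in> {..<N} \<times> \<Gamma>"
    then have "int (length (Vs (fst k) (ilist (snd k)))) \<le> m" by (auto simp: Vs_def length_ilist \<Gamma>_def)
    from Diff.comp[OF f Vs this] show "(\<lambda>u q. f (fst k) (snd k) q * X (fst k) (ilist (snd k)) u q) \<in> Diff M B m"
      unfolding X_def .
  qed (use \<Gamma> in simp)
  have "gn (\<lambda>q. 1) m Q (\<lambda>z. \<Sum>k\<in>{..<N} \<times> \<Gamma>. f (fst k) (snd k) (fst z) * sy (fst k) (snd k) z)"
    unfolding Q_def
  proof (rule gen_sum)
    fix k assume k: "k \<in> {..<N} \<times> \<Gamma>"
    then have "int (length (Vs (fst k) (ilist (snd k)))) \<le> m" by (auto simp: Vs_def length_ilist \<Gamma>_def)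
    from gen.mono[OF gen.mult[OF f gen_word[OF Vs]] this]
    show "gn (\<lambda>q. 1) m (\<lambda>u q. f (fst k) (snd k) q * X (fst k) (ilist (snd k)) u q) (\<lambda>z. f (fst k) (snd k) (fst z) * sy (fst k) (snd k) z)"
      unfolding X_def sy_def .
  qed (use \<Gamma> weight_1 in auto)
  moreover have "(\<lambda>z. \<Sum>k\<in>{..<N} \<times> \<Gamma>. f (fst k) (snd k) (fst z) * sy (fst k) (snd k) z) = patch_symbol m r"
  proof
    fix z
    show "(\<Sum>k\<in>{..<N} \<times> \<Gamma>. f (fst k) (snd k) (fst z) * sy (fst k) (snd k) z) = patch_symbol m r z"
    proof (cases "z \<in> cotangent_bundle M")
      case False
      then show ?thesis by (simp add: sy_def patch_symbol_def pull_outside)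
    next
      case True
      define q where "q = fst z"
      have "\<exists>\<xi>. \<alpha> \<in> I \<longrightarrow> q \<in> U \<alpha> \<longrightarrow> z = cot_param M B \<alpha> (\<phi> \<alpha> q, \<xi>)" for \<alpha>
        using cot_cover[OF True, of \<alpha>] unfolding q_def by metis
      then have "\<forall>\<alpha>. \<exists>\<xi>. \<alpha> \<in> I \<longrightarrow> q \<in> U \<alpha> \<longrightarrow> z = cot_param M B \<alpha> (\<phi> \<alpha> q, \<xi>)" by blast
      from choice[OF this] obtain \<Xi> where
        \<Xi>: "\<And>\<alpha>. \<alpha> \<in> I ==> q \<in> U \<alpha> ==> z = cot_param M B \<alpha> (\<phi> \<alpha> q, \<Xi> \<alpha>)" by blast
      define k where "k = (\<lambda>\<gamma> \<alpha> x. h \<gamma> \<alpha> x * mmonom \<gamma> (\<Xi> \<alpha>))"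
      have 1: "f c \<gamma> q * sy c \<gamma> z = C.csum c (k \<gamma>) q" for c \<gamma>
      proof (cases rule: C.csum_cases[of c q])
        case out
        have "C.csum c (g :: 'i => real^'n => complex) q = 0" for g by (rule C.csum_out) (rule out)
        then show ?thesis by (simp add: f_def)
      next
        case (inside \<alpha>)
        have q: "q \<in> U \<alpha>" using inside(3) by (simp add: kc_def)
        have "h \<gamma> \<alpha> (\<phi> \<alpha> q) * (inverse \<i> ^ mlen \<gamma> * sy c \<gamma> z) = h \<gamma> \<alpha> (\<phi> \<alpha> q) * mmonom \<gamma> (\<Xi> \<alpha>)"
        proof (cases "\<phi> \<alpha> q \<in> ccube s0")
          case True
          then have "\<phi> \<alpha> q \<in> cube s1" using ccube_subset_cube[OF ss(1)] by blast
          then show ?thesis using sy[OF inside(1,2), of "\<phi> \<alpha> q" \<gamma> "\<Xi> \<alpha>"] \<Xi>[OF inside(1) q] by simp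
        qed (simp add: h_def)
        then show ?thesis
          using C.csum_in[OF inside, of "h \<gamma>"] C.csum_in[OF inside, of "k \<gamma>"] by (simp add: f_def k_def mult.assoc)
      qed
      have "(\<Sum>k\<in>{..<N} \<times> \<Gamma>. f (fst k) (snd k) q * sy (fst k) (snd k) z) = (\<Sum>c<N. \<Sum>\<gamma>\<in>\<Gamma>. C.csum c (k \<gamma>) q)"
        by (simp add: sum.cartesian_product 1 case_prod_beta)
      also have "\<dots> = (\<Sum>\<gamma>\<in>\<Gamma>. \<Sum>c<N. C.csum c (k \<gamma>) q)" by (rule sum.swap)
      also have "\<dots> = (\<Sum>\<gamma>\<in>\<Gamma>. \<Sum>\<alpha> | \<alpha> \<in> I \<and> q \<in> U \<alpha>. k \<gamma> \<alpha> (\<phi> \<alpha> q))"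
      proof (rule sum.cong[OF refl], rule C.sum_charts[symmetric])
        show "k \<gamma> \<alpha> x = 0" if "x \<notin> ccube s" for \<gamma> \<alpha> x
          using that ccube_mono[of s0 s] ss by (auto simp: k_def h_def)
      qed
      also have "\<dots> = (\<Sum>\<alpha> | \<alpha> \<in> I \<and> q \<in> U \<alpha>. \<Sum>\<gamma>\<in>\<Gamma>. k \<gamma> \<alpha> (\<phi> \<alpha> q))" by (rule sum.swap)
      also have "\<dots> = patch_symbol m r z"
        unfolding patch_symbol_def q_def[symmetric]
      proof (rule sum.cong[OF refl])
        fix \<alpha> assume "\<alpha> \<in> {\<alpha>. \<alpha> \<in> I \<and> q \<in> U \<alpha>}"
        then have \<alpha>: "\<alpha> \<in> I" "q \<in> U \<alpha>" by auto
        have "pull M B \<alpha> (\<lambda>x \<xi>. \<Sum>\<gamma>\<in>midxs m. r \<alpha> \<gamma> x * mmonom \<gamma> \<xi>) z = (\<Sum>\<gamma>\<in>\<Gamma>. r \<alpha> \<gamma> (\<phi> \<alpha> q) * mmonom \<gamma> (\<Xi> \<alpha>))"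
          by (subst \<Xi>[OF \<alpha>], subst pull_cot[OF \<alpha>(1) coord_in[OF \<alpha>]]) (simp add: \<Gamma>_def)
        moreover have "k \<gamma> \<alpha> (\<phi> \<alpha> q) = cor (chart_partition B \<kappa> \<alpha> q) * (r \<alpha> \<gamma> (\<phi> \<alpha> q) * mmonom \<gamma> (\<Xi> \<alpha>))" for \<gamma>
          using \<chi>0[OF \<alpha>(1) coord_in[OF \<alpha>]] by (auto simp: k_def h_def \<chi>'_def param_coord[OF \<alpha>])
        ultimately show "(\<Sum>\<gamma>\<in>\<Gamma>. k \<gamma> \<alpha> (\<phi> \<alpha> q)) = cor (chart_partition B \<kappa> \<alpha> q) *
            pull M B \<alpha> (\<lambda>x \<xi>. \<Sum>\<gamma>\<in>midxs m. r \<alpha> \<gamma> x * mmonom \<gamma> \<xi>) z"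
          by (simp add: sum_distrib_left)
      qed
      finally show ?thesis by (simp add: q_def)
    qed
  qed
  moreover have "Q u = patch m r u" if u: "smooth_fun M u" for u
  proof
    fix q
    define k where "k = (\<lambda>\<gamma> \<alpha> x. h \<gamma> \<alpha> x * SD \<alpha> \<gamma> u x)"
    have 1: "f c \<gamma> q * X c (ilist \<gamma>) u q = C.csum c (k \<gamma>) q" for c \<gamma>
    proof (cases rule: C.csum_cases[of c q])
      case out
      have "C.csum c (g :: 'i => real^'n => complex) q = 0" for g by (rule C.csum_out) (rule out)
      then show ?thesis by (simp add: f_def)
    next
      case (inside \<alpha>)
      have q: "q \<in> U \<alpha>" using inside(3) by (simp add: kc_def)
      have "h \<gamma> \<alpha> (\<phi> \<alpha> q) * (inverse \<i> ^ mlen \<gamma> * X c (ilist \<gamma>) u q) = h \<gamma> \<alpha> (\<phi> \<alpha> q) * SD \<alpha> \<gamma> u (\<phi> \<alpha> q)"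
      proof (cases "\<phi> \<alpha> q \<in> ccube s0")
        case True
        then have "\<phi> \<alpha> q \<in> cube s1" using ccube_subset_cube[OF ss(1)] by blast
        then show ?thesis using X\<gamma>[OF inside(1,2) _ u, of "\<phi> \<alpha> q" \<gamma>] param_coord[OF inside(1) q] by simp
      qed (simp add: h_def)
      then show ?thesis
        using C.csum_in[OF inside, of "h \<gamma>"] C.csum_in[OF inside, of "k \<gamma>"] by (simp add: f_def k_def mult.assoc)
    qed
    have "Q u q = (\<Sum>c<N. \<Sum>\<gamma>\<in>\<Gamma>. C.csum c (k \<gamma>) q)"
      unfolding Q_def by (simp add: sum.cartesian_product 1 case_prod_beta)
    also have "\<dots> = (\<Sum>\<gamma>\<in>\<Gamma>. \<Sum>c<N. C.csum c (k \<gamma>) q)" by (rule sum.swap)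
    also have "\<dots> = (\<Sum>\<gamma>\<in>\<Gamma>. \<Sum>\<alpha> | \<alpha> \<in> I \<and> q \<in> U \<alpha>. k \<gamma> \<alpha> (\<phi> \<alpha> q))"
    proof (rule sum.cong[OF refl], rule C.sum_charts[symmetric])
      show "k \<gamma> \<alpha> x = 0" if "x \<notin> ccube s" for \<gamma> \<alpha> x
        using that ccube_mono[of s0 s] ss by (auto simp: k_def h_def)
    qed
    also have "\<dots> = (\<Sum>\<alpha> | \<alpha> \<in> I \<and> q \<in> U \<alpha>. \<Sum>\<gamma>\<in>\<Gamma>. k \<gamma> \<alpha> (\<phi> \<alpha> q))" by (rule sum.swap)
    also have "\<dots> = patch m r u q"
      unfolding patch_def
    proof (rule sum.cong[OF refl])
      fix \<alpha> assume "\<alpha> \<in> {\<alpha>. \<alpha> \<in> I \<and> q \<in> U \<alpha>}"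
      then have \<alpha>: "\<alpha> \<in> I" "q \<in> U \<alpha>" by auto
      have "k \<gamma> \<alpha> (\<phi> \<alpha> q) = cor (chart_partition B \<kappa> \<alpha> q) * (r \<alpha> \<gamma> (\<phi> \<alpha> q) * SD \<alpha> \<gamma> u (\<phi> \<alpha> q))" for \<gamma>
        using \<chi>0[OF \<alpha>(1) coord_in[OF \<alpha>]] by (auto simp: k_def h_def \<chi>'_def param_coord[OF \<alpha>])
      then show "(\<Sum>\<gamma>\<in>\<Gamma>. k \<gamma> \<alpha> (\<phi> \<alpha> q)) = cor (chart_partition B \<kappa> \<alpha> q) *
          (\<Sum>\<gamma>\<in>midxs m. r \<alpha> \<gamma> (\<phi> \<alpha> q) * SD \<alpha> \<gamma> u (\<phi> \<alpha> q))"
        by (simp add: sum_distrib_left \<Gamma>_def)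
    qed
    finally show "Q u q = patch m r u q" .
  qed
  ultimately show ?thesis using that[OF QD] by simp
qed

lemma sum_chart_partition: "(\<Sum>\<alpha> | \<alpha> \<in> I \<and> q \<in> U \<alpha>. chart_partition B \<kappa> \<alpha> q) = 1"
proof -
  obtain col :: "'i => nat" and N where col: "\<forall>\<alpha>\<in>I. col \<alpha> < N"
    "\<forall>\<alpha>\<in>I. \<forall>\<beta>\<in>I. \<alpha> \<noteq> \<beta> \<longrightarrow> col \<alpha> = col \<beta> \<longrightarrow> kc 1 \<alpha> \<inter> kc 1 \<beta> = {}"
    using colouring_exists[of 1, simplified] by (elim exE conjE) (rule that)
  interpret C: coloured_bg M B 1 col N
    by unfold_locales (simp, simp, use col(1) in blast, use col(2) in blast)
  show ?thesis by (rule C.sum_partition[OF cutoff])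
qed

text \<open>If the local expressions come from one global object, gluing returns that
  object.\<close>

lemma sum_chart_partition_const:
  assumes "\<And>\<alpha>. \<alpha> \<in> I ==> q \<in> U \<alpha> ==> F \<alpha> = y"
  shows "(\<Sum>\<alpha> | \<alpha> \<in> I \<and> q \<in> U \<alpha>. cor (chart_partition B \<kappa> \<alpha> q) * F \<alpha>) = y"
proof -
  have "(\<Sum>\<alpha> | \<alpha> \<in> I \<and> q \<in> U \<alpha>. cor (chart_partition B \<kappa> \<alpha> q) * F \<alpha>)
    = cor (\<Sum>\<alpha> | \<alpha> \<in> I \<and> q \<in> U \<alpha>. chart_partition B \<kappa> \<alpha> q) * y"
    unfolding of_real_sum sum_distrib_right by (rule sum.cong[OF refl]) (simp add: assms)
  then show ?thesis by (simp add: sum_chart_partition)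
qed

end

section \<open>The principal symbol map\<close>

lemma mmonom_independent:
  fixes k :: "('n::finite => nat) => complex"
  assumes eq: "\<And>\<xi>. (\<Sum>\<gamma>\<in>midxs m. k \<gamma> * mmonom \<gamma> \<xi>) = 0" and \<gamma>: "int (mlen \<gamma>) \<le> m"
  shows "k \<gamma> = 0"
proof -
  have "mpd \<gamma> (\<lambda>\<xi>. \<Sum>\<delta>\<in>midxs m. k \<delta> * mmonom \<delta> \<xi>) 0 = (\<Sum>\<delta>\<in>midxs m. k \<delta> * mpd \<gamma> (mmonom \<delta>) 0)"
    by (rule mpd_sum_mult_left[OF open_UNIV smooth_mmonom]) auto
  also have "\<dots> = (\<Sum>\<delta>\<in>midxs m. if \<delta> = \<gamma> then k \<gamma> * of_nat (mfact \<gamma>) else 0)"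
    by (rule sum.cong) (auto simp: mpd_mmonom_0)
  also have "\<dots> = k \<gamma> * of_nat (mfact \<gamma>)" using \<gamma> by simp
  finally have "k \<gamma> * of_nat (mfact \<gamma>) = mpd \<gamma> (\<lambda>\<xi> :: real^'n. 0 :: complex) 0" by (simp add: eq)
  also have "\<dots> = 0"
  proof -
    have "mpd \<gamma> (\<lambda>\<xi> :: real^'n. \<Sum>\<delta>\<in>{}. (0::complex) * mmonom \<gamma> \<xi>) 0 = 0"
      by (subst mpd_sum_mult_left[OF open_UNIV smooth_mmonom]) auto
    then show ?thesis by simp
  qed
  finally show ?thesis using mfact_nonzero[of \<gamma>] by simp
qed

lemma additive_group_simps [simp]:
  "carrier (additive_group X) = X" "x \<otimes>\<^bsub>additive_group X\<^esub> y = x + y" "\<one>\<^bsub>additive_group X\<^esub> = 0"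
  by (auto simp: additive_group_def)

lemma additive_group_comm_group:
  fixes X :: "'g::ab_group_add set"
  assumes "0 \<in> X" "\<And>x y. x \<in> X ==> y \<in> X ==> x + y \<in> X" "\<And>x. x \<in> X ==> - x \<in> X"
  shows "comm_group (additive_group X)"
proof (rule comm_groupI)
  show "\<exists>y\<in>carrier (additive_group X). y \<otimes>\<^bsub>additive_group X\<^esub> x = \<one>\<^bsub>additive_group X\<^esub>"
    if "x \<in> carrier (additive_group X)" for x
    using assms(3)[of x] that by (intro bexI[of _ "- x"]) auto
qed (use assms in \<open>auto simp: add.assoc add.commute\<close>)

lemma additive_group_subgroup:
  fixes X :: "'g::ab_group_add set"
  assumes X: "comm_group (additive_group X)" and Y: "Y \<subseteq> X"
    "0 \<in> Y" "\<And>x y. x \<in> Y ==> y \<in> Y ==> x + y \<in> Y" "\<And>x. x \<in> Y ==> - x \<in> Y"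
  shows "subgroup Y (additive_group X)"
proof -
  interpret comm_group "additive_group X" by (rule X)
  show ?thesis
  proof (rule subgroupI)
    fix x assume x: "x \<in> Y"
    then have "inv\<^bsub>additive_group X\<^esub> x = - x"
      using Y by (intro inv_equality) auto
    then show "inv\<^bsub>additive_group X\<^esub> x \<in> Y" using Y x by simp
  qed (use Y in auto)
qed

lemma weight_times_image: "weight_times w (weight_times w' S) = weight_times (\<lambda>q. w q * w' q) S"
  unfolding weight_times_def image_image by (simp add: mult.assoc)

lemma weight_times_1 [simp]: "weight_times (\<lambda>q. 1) S = S"
  unfolding weight_times_def by simp

lemma wDiff_1 [simp]: "wDiff M B (\<lambda>q. 1) m = Diff M B m"
  unfolding wDiff_def by simp

lemma wpoly_symbols_1 [simp]: "wpoly_symbols M B (\<lambda>q. 1) m = poly_symbols M B m"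
  unfolding wpoly_symbols_def by simp

lemma weighted_principal_symbol_1 [simp]:
  "weighted_principal_symbol M B \<kappa> \<rho> (\<lambda>q. 1) m P = principal_symbol M B \<kappa> \<rho> m P"
  unfolding weighted_principal_symbol_def by simp

context scaled_bg_weight
begin

lemma gen_weight: "gn w m P a ==> weight M B w"
  using gen_lco unfolding lco_def by blast

lemma gen_nonsmooth: "gn w m P a ==> \<not> smooth_fun M u ==> P u = (\<lambda>q. 0)"
  using gen_lco unfolding lco_def by blast

lemma gen_smooth:
  assumes "gn w m P a"
  shows "smooth_fun M (P u)"
  using assms
proof (induction rule: gen.induct)
  case (unit m)
  then show ?case by (simp add: smooth_id_def)
next
  case (mult f w m P a)
  show ?case by (rule smooth_fun_mult[OF smooth_fun_C_uni[OF mult(1)] mult.IH])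
next
  case (wmult w' w m P a)
  then show ?case by (intro smooth_fun_mult smooth_fun_of_real weightD(3)) auto
next
  case (field V w m P a)
  obtain v where "vrep V v" using field(1) op_lie_iff by blast
  then show ?case using field.IH by (rule vrep_smooth)
next
  case (add w m P a Q b)
  show ?case by (rule smooth_fun_add[OF add.IH])
qed simp_all

lemma gen_smooth_id: "gn w m P a ==> smooth_id M (P u) = P u"
  by (simp add: smooth_id_def gen_smooth)

lemma gen_cong: "gn w m P a ==> (\<And>q. w q = w' q) ==> m = m' ==> (\<And>u q. P u q = P' u q) ==> (\<And>z. a z = a' z) ==> gn w' m' P' a'"
proof -
  assume "gn w m P a" "\<And>q. w q = w' q" "m = m'" "\<And>u q. P u q = P' u q" "\<And>z. a z = a' z"
  moreover from this have "w = w'" "P = P'" "a = a'" by (simp_all add: fun_eq_iff)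
  ultimately show "gn w' m' P' a'" by simp
qed

lemma C_uni_const: "(\<lambda>q. c :: complex) \<in> C_uni M B"
  unfolding C_uni_iff by (rule c_fam_const')

lemma gen_scale: "gn w m P a ==> gn w m (\<lambda>u q. c * P u q) (\<lambda>z. c * a z)"
  using gen.mult[OF C_uni_const[of c]] by blast

text \<open>\<open>\<rho>\<close> is itself uniformly bounded with all derivatives, so it can be
  moved from the weight to the coefficients: multiply by the weight \<open>inverse \<rho>\<close>
  and then by the function \<open>\<rho>\<close>.\<close>

lemma gen_lower:
  assumes "gn (\<lambda>q. w q * \<rho> q) (m - 1) P a"
  shows "gn w m P a"
proof -
  have "(\<lambda>q. inverse (\<rho> q)) \<in> Wt" using weight_inverse[OF weight_rho] by simp
  from gen.mult[OF rho_C_uni gen.wmult[OF this gen.mono[OF assms, of m]]]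
  have "gn (\<lambda>q. inverse (\<rho> q) * (w q * \<rho> q)) m (\<lambda>u q. cor (\<rho> q) * (cor (inverse (\<rho> q)) * P u q))
     (\<lambda>z. cor (\<rho> (fst z)) * (cor (inverse (\<rho> (fst z))) * a z))" by simp
  then show ?thesis by (rule gen_cong) (use weightD(2)[OF weight_rho] in simp_all)
qed

text \<open>Multiply by \<open>w' / w\<close>, taken as a weight, and then by \<open>w / w'\<close>,
  taken as a uniform function: the operator is restored but the weight has changed.\<close>

lemma gen_equivalent:
  assumes "gn w m P a" "weight M B w'" "(\<lambda>q. cor (w q * inverse (w' q))) \<in> C_uni M B"
  shows "gn w' m P a"
proof -
  note w = gen_weight[OF assms(1)]
  have "(\<lambda>q. w' q * inverse (w q)) \<in> Wt" using weight_mult[OF assms(2) weight_inverse[OF w]] by simp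
  from gen.mult[OF assms(3) gen.wmult[OF this assms(1)]] show ?thesis
    by (rule gen_cong) (use weightD(2)[OF w] weightD(2)[OF assms(2)] in \<open>simp_all add: field_simps\<close>)
qed

lemma patch_symbol_eq:
  assumes "\<And>z. z \<notin> cotangent_bundle M ==> b z = 0"
    and "\<And>\<alpha> x \<xi>. \<alpha> \<in> I ==> x \<in> cube 2 ==> push M B \<alpha> b x \<xi> = (\<Sum>\<gamma>\<in>midxs m. r \<alpha> \<gamma> x * mmonom \<gamma> \<xi>)"
  shows "patch_symbol m r = b"
proof
  fix z show "patch_symbol m r z = b z"
  proof (cases "z \<in> cotangent_bundle M")
    case False
    then show ?thesis by (simp add: patch_symbol_def pull_outside assms(1))
  next
    case True
    show ?thesis unfolding patch_symbol_def
    proof (rule sum_chart_partition_const)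
      fix \<alpha> assume \<alpha>: "\<alpha> \<in> I" "fst z \<in> U \<alpha>"
      obtain \<xi> where z: "z = cot_param M B \<alpha> (\<phi> \<alpha> (fst z), \<xi>)" using cot_cover[OF True \<alpha>] .
      show "pull M B \<alpha> (\<lambda>x \<xi>. \<Sum>\<gamma>\<in>midxs m. r \<alpha> \<gamma> x * mmonom \<gamma> \<xi>) z = b z"
        by (subst (1 2) z) (simp only: pull_cot[OF \<alpha>(1) coord_in[OF \<alpha>]] assms(2)[OF \<alpha>(1) coord_in[OF \<alpha>], symmetric] push_def)
    qed
  qed
qed

lemma patch_eq:
  assumes "\<And>\<alpha> x. \<alpha> \<in> I ==> x \<in> cube 2 ==> f (\<psi> \<alpha> x) = (\<Sum>\<gamma>\<in>midxs m. r \<alpha> \<gamma> x * SD \<alpha> \<gamma> u x)"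
  shows "patch m r u q = f q"
  unfolding patch_def
proof (rule sum_chart_partition_const)
  fix \<alpha> assume \<alpha>: "\<alpha> \<in> I" "q \<in> U \<alpha>"
  show "(\<Sum>\<gamma>\<in>midxs m. r \<alpha> \<gamma> (\<phi> \<alpha> q) * SD \<alpha> \<gamma> u (\<phi> \<alpha> q)) = f q"
    using assms[OF \<alpha>(1) coord_in[OF \<alpha>]] by (simp add: param_coord[OF \<alpha>])
qed

lemma patch_symbol_linear:
  "patch_symbol m (\<lambda>\<alpha> \<gamma> x. c \<alpha> \<gamma> x + cor (\<rho> (\<psi> \<alpha> x)) * r \<alpha> \<gamma> x) z
    = patch_symbol m c z + cor (\<rho> (fst z)) * patch_symbol m r z"
proof (cases "z \<in> cotangent_bundle M")
  case False
  then show ?thesis by (simp add: patch_symbol_def pull_outside)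
next
  case True
  have "cor (chart_partition B \<kappa> \<alpha> (fst z)) * pull M B \<alpha> (\<lambda>x \<xi>. \<Sum>\<gamma>\<in>midxs m. (c \<alpha> \<gamma> x + cor (\<rho> (\<psi> \<alpha> x)) * r \<alpha> \<gamma> x) * mmonom \<gamma> \<xi>) z
    = cor (chart_partition B \<kappa> \<alpha> (fst z)) * pull M B \<alpha> (\<lambda>x \<xi>. \<Sum>\<gamma>\<in>midxs m. c \<alpha> \<gamma> x * mmonom \<gamma> \<xi>) z
     + cor (\<rho> (fst z)) * (cor (chart_partition B \<kappa> \<alpha> (fst z)) * pull M B \<alpha> (\<lambda>x \<xi>. \<Sum>\<gamma>\<in>midxs m. r \<alpha> \<gamma> x * mmonom \<gamma> \<xi>) z)"
    if \<alpha>: "\<alpha> \<in> {\<alpha>. \<alpha> \<in> I \<and> fst z \<in> U \<alpha>}" for \<alpha>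
  proof -
    have \<alpha>: "\<alpha> \<in> I" "fst z \<in> U \<alpha>" using that by auto
    obtain \<xi> where z: "z = cot_param M B \<alpha> (\<phi> \<alpha> (fst z), \<xi>)" using cot_cover[OF True \<alpha>] .
    have pz: "pull M B \<alpha> b z = b (\<phi> \<alpha> (fst z)) \<xi>" for b
      by (subst z) (rule pull_cot[OF \<alpha>(1) coord_in[OF \<alpha>]])
    have "(\<Sum>\<gamma>\<in>midxs m. (c \<alpha> \<gamma> y + k * r \<alpha> \<gamma> y) * mmonom \<gamma> \<xi>)
        = (\<Sum>\<gamma>\<in>midxs m. c \<alpha> \<gamma> y * mmonom \<gamma> \<xi>) + k * (\<Sum>\<gamma>\<in>midxs m. r \<alpha> \<gamma> y * mmonom \<gamma> \<xi>)" for k y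
      by (simp add: distrib_right sum.distrib sum_distrib_left mult.assoc)
    then show ?thesis unfolding pz param_coord[OF \<alpha>] by (simp add: distrib_left mult.left_commute)
  qed
  then show ?thesis unfolding patch_symbol_def sum_distrib_left sum.distrib[symmetric] by (rule sum.cong[OF refl])
qed

lemma full_symbol_eq:
  assumes "\<And>\<alpha>. \<alpha> \<in> I ==> local_coeffs M B m P \<alpha> (r \<alpha>)"
  shows "full_symbol M B \<kappa> m P = patch_symbol m r"
proof
  fix z show "full_symbol M B \<kappa> m P z = patch_symbol m r z"
  proof (cases "z \<in> cotangent_bundle M")
    case False
    then show ?thesis by (simp add: patch_symbol_def full_symbol_def pull_outside)
  next
    case True
    show ?thesis unfolding patch_symbol_def full_symbol_def
    proof (rule sum.cong[OF refl])
      fix \<alpha> assume "\<alpha> \<in> {\<alpha>. \<alpha> \<in> I \<and> fst z \<in> U \<alpha>}"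
      then have \<alpha>: "\<alpha> \<in> I" "fst z \<in> U \<alpha>" by auto
      obtain \<xi> where z: "z = cot_param M B \<alpha> (\<phi> \<alpha> (fst z), \<xi>)" using cot_cover[OF True \<alpha>] .
      have pz: "pull M B \<alpha> b z = b (\<phi> \<alpha> (fst z)) \<xi>" for b
        by (subst z) (rule pull_cot[OF \<alpha>(1) coord_in[OF \<alpha>]])
      show "cor (chart_partition B \<kappa> \<alpha> (fst z)) * pull M B \<alpha> (local_symbol M B m P \<alpha>) z
         = cor (chart_partition B \<kappa> \<alpha> (fst z)) * pull M B \<alpha> (\<lambda>x \<xi>. \<Sum>\<gamma>\<in>midxs m. r \<alpha> \<gamma> x * mmonom \<gamma> \<xi>) z"
        unfolding pz local_symbol_eq[OF \<alpha>(1) coord_in[OF \<alpha>] assms[OF \<alpha>(1)]] ..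
    qed
  qed
qed

lemma Diff_nonsmooth: "P \<in> Diff M B m ==> \<not> smooth_fun M u ==> P u = (\<lambda>q. 0)"
  using Diff_gen gen_nonsmooth by blast

text \<open>An operator is the gluing of its own local forms, so by \<open>reconstruct\<close>
  uniform local coefficients suffice for membership in \<open>Diff\<close>, although
  \<open>Diff\<close> is defined by compositions of global fields.\<close>

lemma local_form_gen:
  assumes w: "weight M B w" and e: "\<And>\<gamma>. cfam (\<lambda>\<alpha>. e \<alpha> \<gamma>)"
    and P0: "\<And>u. \<not> smooth_fun M u ==> P u = (\<lambda>q. 0)"
    and Pu: "\<And>\<alpha> x u. \<alpha> \<in> I ==> x \<in> cube 2 ==> smooth_fun M u ==>
      P u (\<psi> \<alpha> x) = cor (w (\<psi> \<alpha> x)) * (\<Sum>\<gamma>\<in>midxs m. e \<alpha> \<gamma> x * SD \<alpha> \<gamma> u x)"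
  shows "P \<in> wDiff M B w m"
proof -
  obtain Q where Q: "Q \<in> Diff M B m" "gn (\<lambda>q. 1) m Q (patch_symbol m e)"
    "\<And>u. smooth_fun M u ==> Q u = patch m e u"
    by (rule reconstruct[where r = e and m = m, OF e]) (rule that, assumption, assumption, simp)
  have "P u q = cor (w q) * Q u q" for u q
  proof (cases "smooth_fun M u")
    case True
    have "patch m e u q = inverse (cor (w q)) * P u q"
    proof (rule patch_eq)
      fix \<alpha> and x :: "real^'n" assume "\<alpha> \<in> I" "x \<in> cube 2"
      from Pu[OF this True] show "inverse (cor (w (\<psi> \<alpha> x))) * P u (\<psi> \<alpha> x) = (\<Sum>\<gamma>\<in>midxs m. e \<alpha> \<gamma> x * SD \<alpha> \<gamma> u x)"
        using weightD(2)[OF w, of "\<psi> \<alpha> x"] by (simp only: mult.assoc[symmetric]) simp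
    qed
    then show ?thesis using Q(3)[OF True] weightD(2)[OF w, of q] by simp
  next
    case False
    then show ?thesis using P0[OF False] Diff_nonsmooth[OF Q(1) False] by simp
  qed
  then have "P = (\<lambda>u q. cor (w q) * Q u q)" by (simp add: fun_eq_iff)
  then show ?thesis using Q(1) unfolding wDiff_def by blast
qed

text \<open>From right to left the proof passes through local coefficients, because a weight inside
  a word cannot be moved to the front without commutator terms.\<close>

lemma wDiff_iff:
  assumes w: "weight M B w"
  shows "P \<in> wDiff M B w m \<longleftrightarrow> (\<exists>a. gn w m P a)"
proof
  assume "P \<in> wDiff M B w m"
  then obtain Q where Q: "Q \<in> Diff M B m" "P = (\<lambda>u q. cor (w q) * Q u q)" unfolding wDiff_def by blast
  obtain a where "gn (\<lambda>q. 1) m Q a" using Diff_gen[OF Q(1)] by blast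
  from gen.wmult[OF _ this, of w] w Q(2) show "\<exists>a. gn w m P a" by auto
next
  assume "\<exists>a. gn w m P a"
  then obtain a c r where l: "lco w m P a c r" using gen_lco by blast
  note c = lcoD(2)[OF l] and r = lcoD(3)[OF l] and P0 = lcoD(6)[OF l] and Pu = lcoD(8)[OF l]
  show "P \<in> wDiff M B w m"
  proof (rule local_form_gen[OF w _ P0 Pu])
    show "cfam (\<lambda>\<alpha> x. c \<alpha> \<gamma> x + cor (\<rho> (\<psi> \<alpha> x)) * r \<alpha> \<gamma> x)" for \<gamma>
      by (intro c_fam_add c_fam_mult c_fam_of_real c r c_fam_rho) auto
  qed
qed

text \<open>Every polynomial symbol is the gluing of its own local forms, and
  \<open>reconstruct\<close> provides an operator for it. This is the surjectivity of the symbol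
  map.\<close>

lemma wpoly_iff:
  assumes w: "weight M B w"
  shows "a \<in> wpoly_symbols M B w m \<longleftrightarrow> (\<exists>P. gn w m P a)"
proof
  assume "a \<in> wpoly_symbols M B w m"
  then obtain b where b: "b \<in> poly_symbols M B m" "a = (\<lambda>z. cor (w (fst z)) * b z)"
    unfolding wpoly_symbols_def weight_times_def by blast
  obtain c where c: "psym m b c" using poly_symbols_psym[OF b(1)] by blast
  then have cf: "cfam (\<lambda>\<alpha>. c \<alpha> \<gamma>)" for \<gamma> unfolding psym_def by simp
  obtain Q where "gn (\<lambda>q. 1) m Q (patch_symbol m c)" by (rule reconstruct[where r = c and m = m, OF cf])
  moreover have "patch_symbol m c = b" by (rule patch_symbol_eq) (use c in \<open>auto simp: psym_def\<close>)
  ultimately have "gn (\<lambda>q. 1) m Q b" by simp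
  from gen.wmult[OF _ this, of w] w b(2) show "\<exists>P. gn w m P a" by auto
next
  assume "\<exists>P. gn w m P a"
  then obtain P where P: "gn w m P a" by blast
  then obtain c r where l: "lco w m P a c r" using gen_lco by blast
  note c = lcoD(2)[OF l] and a = lcoD(7)[OF l]
  define b where "b = (\<lambda>z. inverse (cor (w (fst z))) * a z)"
  have "psym m b c"
    unfolding psym_def
  proof (intro conjI allI impI ballI c)
    show "b z = 0" if "z \<notin> cotangent_bundle M" for z using gen_off[OF P that] by (simp add: b_def)
    show "push M B \<alpha> b x \<xi> = (\<Sum>\<gamma>\<in>midxs m. c \<alpha> \<gamma> x * mmonom \<gamma> \<xi>)" if "\<alpha> \<in> I" "x \<in> cube 2" for \<alpha> x \<xi>
      using a[OF that, of \<xi>] weightD(2)[OF w, of "\<psi> \<alpha> x"] by (simp add: b_def push_def)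
  qed
  then have "b \<in> poly_symbols M B m" by (rule psym_poly_symbols)
  moreover have "a = (\<lambda>z. cor (w (fst z)) * b z)" using weightD(2)[OF w] by (simp add: b_def fun_eq_iff)
  ultimately show "a \<in> wpoly_symbols M B w m" unfolding wpoly_symbols_def weight_times_def by blast
qed

lemma weight_mult_rho: "weight M B w ==> weight M B (\<lambda>q. w q * \<rho> q)"
  by (rule weight_mult[OF _ weight_rho])

lemma wpoly_group:
  assumes w: "weight M B w"
  shows "0 \<in> wpoly_symbols M B w m"
    and "a \<in> wpoly_symbols M B w m ==> b \<in> wpoly_symbols M B w m ==> a + b \<in> wpoly_symbols M B w m"
    and "a \<in> wpoly_symbols M B w m ==> (\<lambda>z. c * a z) \<in> wpoly_symbols M B w m"
    and "a \<in> wpoly_symbols M B w m ==> - a \<in> wpoly_symbols M B w m"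
proof -
  note i = wpoly_iff[OF w]
  have z: "gn w m (\<lambda>u q. 0) (\<lambda>z. 0)" by (rule gen.zero) (simp add: w)
  then show "0 \<in> wpoly_symbols M B w m" unfolding i zero_fun_def by blast
  show "a + b \<in> wpoly_symbols M B w m" if "a \<in> wpoly_symbols M B w m" "b \<in> wpoly_symbols M B w m"
    using that gen.add unfolding i plus_fun_def by blast
  show s: "(\<lambda>z. c * a z) \<in> wpoly_symbols M B w m" if "a \<in> wpoly_symbols M B w m" for c
    using that gen_scale unfolding i by blast
  show "- a \<in> wpoly_symbols M B w m" if "a \<in> wpoly_symbols M B w m"
    using s[OF that, of "- 1"] by (simp add: fun_Compl_def)
qed

lemma wDiff_group:
  assumes w: "weight M B w"
  shows "0 \<in> wDiff M B w m"
    and "P \<in> wDiff M B w m ==> Q \<in> wDiff M B w m ==> P + Q \<in> wDiff M B w m"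
    and "P \<in> wDiff M B w m ==> (\<lambda>u q. c * P u q) \<in> wDiff M B w m"
    and "P \<in> wDiff M B w m ==> - P \<in> wDiff M B w m"
proof -
  note i = wDiff_iff[OF w]
  have z: "gn w m (\<lambda>u q. 0) (\<lambda>z. 0)" by (rule gen.zero) (simp add: w)
  then show "0 \<in> wDiff M B w m" unfolding i zero_fun_def by blast
  show "P + Q \<in> wDiff M B w m" if "P \<in> wDiff M B w m" "Q \<in> wDiff M B w m"
    using that gen.add unfolding i plus_fun_def by blast
  show s: "(\<lambda>u q. c * P u q) \<in> wDiff M B w m" if "P \<in> wDiff M B w m" for c
    using that gen_scale unfolding i by blast
  show "- P \<in> wDiff M B w m" if "P \<in> wDiff M B w m"
    using s[OF that, of "- 1"] by (simp add: fun_Compl_def)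
qed

lemma wpoly_lower:
  assumes w: "weight M B w"
  shows "wpoly_symbols M B (\<lambda>q. w q * \<rho> q) (m - 1) \<subseteq> wpoly_symbols M B w m"
    and "wDiff M B (\<lambda>q. w q * \<rho> q) (m - 1) \<subseteq> wDiff M B w m"
  by (auto simp: wpoly_iff[OF w] wpoly_iff[OF weight_mult_rho[OF w]]
    wDiff_iff[OF w] wDiff_iff[OF weight_mult_rho[OF w]] dest!: gen_lower)

lemma wpoly_comm_group: "weight M B w ==> comm_group (additive_group (wpoly_symbols M B w m))"
  by (rule additive_group_comm_group) (auto intro: wpoly_group)

lemma wDiff_comm_group: "weight M B w ==> comm_group (additive_group (wDiff M B w m))"
  by (rule additive_group_comm_group) (auto intro: wDiff_group)

lemma wpoly_subgroup:
  "weight M B w ==> subgroup (wpoly_symbols M B (\<lambda>q. w q * \<rho> q) (m - 1)) (additive_group (wpoly_symbols M B w m))"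
  using additive_group_subgroup[OF wpoly_comm_group wpoly_lower(1)] wpoly_group[OF weight_mult_rho] by blast

lemma wDiff_subgroup:
  "weight M B w ==> subgroup (wDiff M B (\<lambda>q. w q * \<rho> q) (m - 1)) (additive_group (wDiff M B w m))"
  using additive_group_subgroup[OF wDiff_comm_group wpoly_lower(2)] wDiff_group[OF weight_mult_rho] by blast

lemma symbol_class_eq:
  "symbol_class M B \<rho> w m a = {d + a | d. d \<in> wpoly_symbols M B (\<lambda>q. w q * \<rho> q) (m - 1)}"
  unfolding symbol_class_def r_coset_def by auto

lemma symbol_class_shift:
  assumes w: "weight M B w" and d: "d \<in> wpoly_symbols M B (\<lambda>q. w q * \<rho> q) (m - 1)"
  shows "symbol_class M B \<rho> w m (d + a) = symbol_class M B \<rho> w m a"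
proof -
  note g = wpoly_group[OF weight_mult_rho[OF w]]
  have "\<exists>e'. e + (d + a) = e' + a \<and> e' \<in> wpoly_symbols M B (\<lambda>q. w q * \<rho> q) (m - 1)"
    if "e \<in> wpoly_symbols M B (\<lambda>q. w q * \<rho> q) (m - 1)" for e
    using g(2)[OF that d] by (intro exI[of _ "e + d"]) (simp add: add.assoc)
  moreover have "\<exists>e'. e + a = e' + (d + a) \<and> e' \<in> wpoly_symbols M B (\<lambda>q. w q * \<rho> q) (m - 1)"
    if "e \<in> wpoly_symbols M B (\<lambda>q. w q * \<rho> q) (m - 1)" for e
    using g(2)[OF that g(4)[OF d]] by (intro exI[of _ "e + - d"]) (simp add: add.assoc)
  ultimately show ?thesis unfolding symbol_class_eq by blast
qed

text \<open>Gluing is linear in the coefficients: \<open>c\<close> returns \<open>a\<close>, and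
  \<open>\<rho> r\<close> contributes an element of order \<open>m - 1\<close>, which is a genuine
  symbol because \<open>reconstruct\<close> realises it.\<close>

lemma gen_full_symbol:
  assumes P: "gn (\<lambda>q. 1) m P a"
  obtains d where "d \<in> wpoly_symbols M B (\<lambda>q. 1 * \<rho> q) (m - 1)" "full_symbol M B \<kappa> m P = d + a"
proof -
  obtain c r where "lco (\<lambda>q. 1) m P a c r" using gen_lco[OF P] by blast
  then have r: "\<And>\<gamma>. cfam (\<lambda>\<alpha>. r \<alpha> \<gamma>)"
    and r0: "\<And>\<alpha> \<gamma>. m \<le> int (mlen \<gamma>) ==> r \<alpha> \<gamma> = (\<lambda>x. 0)"
    and a: "\<And>\<alpha> x \<xi>. \<alpha> \<in> I ==> x \<in> cube 2 ==> push M B \<alpha> a x \<xi> = (\<Sum>\<gamma>\<in>midxs m. c \<alpha> \<gamma> x * mmonom \<gamma> \<xi>)"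
    and Pu: "\<And>\<alpha> x u. \<alpha> \<in> I ==> x \<in> cube 2 ==> smooth_fun M u ==> P u (\<psi> \<alpha> x) =
           (\<Sum>\<gamma>\<in>midxs m. (c \<alpha> \<gamma> x + cor (\<rho> (\<psi> \<alpha> x)) * r \<alpha> \<gamma> x) * SD \<alpha> \<gamma> u x)"
    unfolding lco_def by simp_all
  have "full_symbol M B \<kappa> m P = patch_symbol m (\<lambda>\<alpha> \<gamma> x. c \<alpha> \<gamma> x + cor (\<rho> (\<psi> \<alpha> x)) * r \<alpha> \<gamma> x)"
    by (rule full_symbol_eq) (use Pu in \<open>simp add: local_coeffs_def\<close>)
  moreover have "patch_symbol m c = a" by (rule patch_symbol_eq[OF gen_off[OF P] a])
  moreover have "patch_symbol m r = patch_symbol (m - 1) r"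
  proof -
    have "(\<Sum>\<gamma>\<in>midxs m. r \<alpha> \<gamma> x * mmonom \<gamma> \<xi>) = (\<Sum>\<gamma>\<in>midxs (m - 1). r \<alpha> \<gamma> x * mmonom \<gamma> \<xi>)" for \<alpha> x \<xi>
      by (rule sum_mlen_mono) (simp_all add: r0)
    then show ?thesis unfolding patch_symbol_def by simp
  qed
  ultimately have "full_symbol M B \<kappa> m P = (\<lambda>z. cor (\<rho> (fst z)) * patch_symbol (m - 1) r z) + a"
    by (simp add: fun_eq_iff patch_symbol_linear)
  moreover have "(\<lambda>z. cor (\<rho> (fst z)) * patch_symbol (m - 1) r z) \<in> wpoly_symbols M B (\<lambda>q. 1 * \<rho> q) (m - 1)"
  proof -
    obtain Q where "gn (\<lambda>q. 1) (m - 1) Q (patch_symbol (m - 1) r)" by (rule reconstruct[where r = r and m = "m - 1", OF r])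
    from gen.wmult[OF _ this, of \<rho>] show ?thesis using weight_rho by (auto simp: wpoly_iff)
  qed
  ultimately show ?thesis using that by blast
qed

text \<open>The right-hand side involves neither the cutoff nor local coefficients; the independence
  statements are read off from this equation.\<close>

lemma principal_symbol_eq:
  assumes P: "gn w m P a"
  shows "weighted_principal_symbol M B \<kappa> \<rho> w m P = symbol_class M B \<rho> w m a"
proof -
  note w = gen_weight[OF P]
  have "(\<lambda>q. inverse (w q)) \<in> Wt" using weight_inverse[OF w] by simp
  from gen.wmult[OF this P] have P1: "gn (\<lambda>q. 1) m (\<lambda>u q. inverse (cor (w q)) * P u q) (\<lambda>z. inverse (cor (w (fst z))) * a z)"
    (is "gn _ _ ?P ?a") by (rule gen_cong) (use weightD(2)[OF w] in simp_all)
  obtain d where d: "d \<in> wpoly_symbols M B (\<lambda>q. 1 * \<rho> q) (m - 1)" "full_symbol M B \<kappa> m ?P = d + ?a"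
    using gen_full_symbol[OF P1] by blast
  have "principal_symbol M B \<kappa> \<rho> m ?P = symbol_class M B \<rho> (\<lambda>q. 1) m ?a"
    unfolding principal_symbol_def d(2) by (rule symbol_class_shift[OF weight_1 d(1)])
  then have "weighted_principal_symbol M B \<kappa> \<rho> w m P = weight_times w {e + ?a | e. e \<in> wpoly_symbols M B (\<lambda>q. 1 * \<rho> q) (m - 1)}"
    unfolding weighted_principal_symbol_def symbol_class_eq by simp
  also have "\<dots> = {e + a | e. e \<in> weight_times w (wpoly_symbols M B (\<lambda>q. 1 * \<rho> q) (m - 1))}"
  proof -
    have "(\<lambda>z. cor (w (fst z)) * (e + ?a) z) = (\<lambda>z. cor (w (fst z)) * e z) + a" for e
      using weightD(2)[OF w] by (simp add: fun_eq_iff distrib_left)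
    then show ?thesis unfolding weight_times_def Setcompr_eq_image image_image by simp
  qed
  also have "weight_times w (wpoly_symbols M B (\<lambda>q. 1 * \<rho> q) (m - 1)) = wpoly_symbols M B (\<lambda>q. w q * \<rho> q) (m - 1)"
    unfolding wpoly_symbols_def weight_times_image by simp
  finally show ?thesis unfolding symbol_class_eq .
qed

text \<open>If the symbol is \<open>\<rho>\<close> times one of lower degree, uniqueness of
  polynomial coefficients shows that \<open>c\<close> is divisible by \<open>\<rho>\<close> and has
  no top degree part. The remainder carries the factor already, so all local coefficients of the
  operator do.\<close>

lemma gen_kernel:
  assumes P: "gn w m P a" and a: "a \<in> wpoly_symbols M B (\<lambda>q. w q * \<rho> q) (m - 1)"
  shows "P \<in> wDiff M B (\<lambda>q. w q * \<rho> q) (m - 1)"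
proof -
  note w = gen_weight[OF P]
  obtain c r where l: "lco w m P a c r" using gen_lco[OF P] by blast
  note c = lcoD(2)[OF l] and r = lcoD(3)[OF l]
    and r0 = lcoD(5)[OF l] and P0 = lcoD(6)[OF l]
    and pa = lcoD(7)[OF l] and Pu = lcoD(8)[OF l]
  obtain b where b: "b \<in> poly_symbols M B (m - 1)" "a = (\<lambda>z. cor (w (fst z) * \<rho> (fst z)) * b z)"
    using a unfolding wpoly_symbols_def weight_times_def by blast
  obtain d where d: "psym (m - 1) b d" using poly_symbols_psym[OF b(1)] by blast
  show ?thesis
  proof (rule local_form_gen[OF weight_mult_rho[OF w] _ P0])
    show "cfam (\<lambda>\<alpha> x. d \<alpha> \<gamma> x + r \<alpha> \<gamma> x)" for \<gamma>
      by (rule c_fam_add[OF _ _ r]) (use d in \<open>auto simp: psym_def\<close>)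
    fix \<alpha> and x :: "real^'n" and u :: "'a => complex" assume \<alpha>: "\<alpha> \<in> I" and x: "x \<in> cube 2" and u: "smooth_fun M u"
    \<comment> \<open>\<open>psym\<close> says nothing about \<open>d\<close> in degree
      \<open>m\<close>, so the values there are replaced by 0 before coefficients of degree at most
      \<open>m\<close> are compared.\<close>
    define d' where "d' = (\<lambda>\<gamma>. if int (mlen \<gamma>) \<le> m - 1 then d \<alpha> \<gamma> x else 0)"
    have d': "(\<Sum>\<gamma>\<in>midxs m. d' \<gamma> * F \<gamma>) = (\<Sum>\<gamma>\<in>midxs (m - 1). d \<alpha> \<gamma> x * F \<gamma>)" for F :: "('n => nat) => complex"
    proof -
      have "(\<Sum>\<gamma>\<in>midxs m. d' \<gamma> * F \<gamma>) = (\<Sum>\<gamma>\<in>midxs (m - 1). d' \<gamma> * F \<gamma>)"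
        by (rule sum_mlen_mono) (auto simp: d'_def)
      then show ?thesis by (simp add: d'_def)
    qed
    have "(\<Sum>\<gamma>\<in>midxs m. (c \<alpha> \<gamma> x - cor (\<rho> (\<psi> \<alpha> x)) * d' \<gamma>) * mmonom \<gamma> \<xi>) = 0" for \<xi>
    proof -
      have "cor (w (\<psi> \<alpha> x)) * (\<Sum>\<gamma>\<in>midxs m. c \<alpha> \<gamma> x * mmonom \<gamma> \<xi>)
          = cor (w (\<psi> \<alpha> x) * \<rho> (\<psi> \<alpha> x)) * push M B \<alpha> b x \<xi>"
        using pa[OF \<alpha> x, of \<xi>, symmetric] by (simp add: b(2) push_def)
      also have "push M B \<alpha> b x \<xi> = (\<Sum>\<gamma>\<in>midxs m. d' \<gamma> * mmonom \<gamma> \<xi>)"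
        unfolding d' using d \<alpha> x by (simp add: psym_def)
      finally have "(\<Sum>\<gamma>\<in>midxs m. c \<alpha> \<gamma> x * mmonom \<gamma> \<xi>) = cor (\<rho> (\<psi> \<alpha> x)) * (\<Sum>\<gamma>\<in>midxs m. d' \<gamma> * mmonom \<gamma> \<xi>)"
        using weightD(2)[OF w, of "\<psi> \<alpha> x"] by (simp add: mult.assoc)
      then show ?thesis by (simp add: left_diff_distrib sum_subtractf sum_distrib_left mult.assoc)
    qed
    from mmonom_independent[OF this] have cd: "c \<alpha> \<gamma> x = cor (\<rho> (\<psi> \<alpha> x)) * d' \<gamma>" if "int (mlen \<gamma>) \<le> m" for \<gamma>
      using that by simp
    have "P u (\<psi> \<alpha> x) = cor (w (\<psi> \<alpha> x)) *
           (\<Sum>\<gamma>\<in>midxs m. cor (\<rho> (\<psi> \<alpha> x)) * ((d' \<gamma> + r \<alpha> \<gamma> x) * SD \<alpha> \<gamma> u x))"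
      unfolding Pu[OF \<alpha> x u] by (rule arg_cong[where f = "\<lambda>y. cor (w (\<psi> \<alpha> x)) * y"], rule sum.cong[OF refl]) (simp add: cd distrib_left distrib_right mult.assoc)
    also have "\<dots> = cor (w (\<psi> \<alpha> x) * \<rho> (\<psi> \<alpha> x)) * (\<Sum>\<gamma>\<in>midxs m. (d' \<gamma> + r \<alpha> \<gamma> x) * SD \<alpha> \<gamma> u x)"
      by (simp add: sum_distrib_left[symmetric] mult.assoc)
    also have "(\<Sum>\<gamma>\<in>midxs m. (d' \<gamma> + r \<alpha> \<gamma> x) * SD \<alpha> \<gamma> u x) = (\<Sum>\<gamma>\<in>midxs (m - 1). (d' \<gamma> + r \<alpha> \<gamma> x) * SD \<alpha> \<gamma> u x)"
      by (rule sum_mlen_mono) (auto simp: d'_def r0)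
    also have "\<dots> = (\<Sum>\<gamma>\<in>midxs (m - 1). (d \<alpha> \<gamma> x + r \<alpha> \<gamma> x) * SD \<alpha> \<gamma> u x)" by (simp add: d'_def)
    finally show "P u (\<psi> \<alpha> x) = cor (w (\<psi> \<alpha> x) * \<rho> (\<psi> \<alpha> x)) * (\<Sum>\<gamma>\<in>midxs (m - 1). (d \<alpha> \<gamma> x + r \<alpha> \<gamma> x) * SD \<alpha> \<gamma> u x)" .
  qed
qed

text \<open>Operators and symbols are the two components of the same pairs: surjectivity is
  \<open>wpoly_iff\<close>, and the kernel is found by \<open>gen_kernel\<close>, with
  \<open>gen_lower\<close> for the converse inclusion.\<close>

lemma short_exact:
  assumes w: "weight M B w"
  shows "symbol_short_exact (wDiff M B (\<lambda>q. w q * \<rho> q) (m - 1)) (wDiff M B w m)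
    (weighted_principal_symbol M B \<kappa> \<rho> w m) (wpoly_symbols M B w m) (wpoly_symbols M B (\<lambda>q. w q * \<rho> q) (m - 1))"
proof -
  define S where "S = wpoly_symbols M B w m"
  define N where "N = wpoly_symbols M B (\<lambda>q. w q * \<rho> q) (m - 1)"
  define D where "D = wDiff M B w m"
  define \<sigma> where "\<sigma> = weighted_principal_symbol M B \<kappa> \<rho> w m"
  interpret G: comm_group "additive_group S" unfolding S_def by (rule wpoly_comm_group[OF w])
  interpret D: comm_group "additive_group D" unfolding D_def by (rule wDiff_comm_group[OF w])
  have sub: "subgroup N (additive_group S)" unfolding S_def N_def by (rule wpoly_subgroup[OF w])
  interpret N: normal N "additive_group S" using G.normal_iff_subgroup sub by blast
  have \<sigma>: "\<sigma> P = N #>\<^bsub>additive_group S\<^esub> a" "a \<in> S" if "gn w m P a" for P a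
    using principal_symbol_eq[OF that] wpoly_iff[OF w] that by (auto simp: \<sigma>_def S_def N_def symbol_class_def)
  have gD: "\<exists>a. gn w m P a" if "P \<in> D" for P using that wDiff_iff[OF w] by (simp add: D_def)
  have "\<sigma> \<in> hom (additive_group D) (additive_group S Mod N)"
  proof (rule homI)
    fix P assume "P \<in> carrier (additive_group D)"
    then obtain a where "gn w m P a" using gD by auto
    from \<sigma>[OF this] show "\<sigma> P \<in> carrier (additive_group S Mod N)" by (auto simp: FactGroup_def RCOSETS_def)
  next
    fix P Q assume "P \<in> carrier (additive_group D)" "Q \<in> carrier (additive_group D)"
    then obtain a b where a: "gn w m P a" "gn w m Q b" using gD by (metis additive_group_simps(1))
    then have "gn w m (P + Q) (a + b)" using gen.add[OF a] by (simp add: plus_fun_def)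
    from \<sigma>(1)[OF this] have "\<sigma> (P + Q) = N #>\<^bsub>additive_group S\<^esub> (a \<otimes>\<^bsub>additive_group S\<^esub> b)" by simp
    also have "\<dots> = (N #>\<^bsub>additive_group S\<^esub> a) <#>\<^bsub>additive_group S\<^esub> (N #>\<^bsub>additive_group S\<^esub> b)"
      using \<sigma>(2)[OF a(1)] \<sigma>(2)[OF a(2)] by (intro N.rcos_sum[symmetric]) auto
    finally show "\<sigma> (P \<otimes>\<^bsub>additive_group D\<^esub> Q) = \<sigma> P \<otimes>\<^bsub>additive_group S Mod N\<^esub> \<sigma> Q"
      by (simp add: \<sigma>(1)[OF a(1)] \<sigma>(1)[OF a(2)])
  qed
  moreover have "\<sigma> ` D = carrier (additive_group S Mod N)"
  proof (intro equalityI subsetI)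
    fix X assume "X \<in> carrier (additive_group S Mod N)"
    then obtain a where a: "a \<in> S" "X = N #>\<^bsub>additive_group S\<^esub> a" by (auto simp: FactGroup_def RCOSETS_def)
    then obtain P where P: "gn w m P a" using wpoly_iff[OF w] by (auto simp: S_def)
    then have "P \<in> D" using wDiff_iff[OF w] by (auto simp: D_def)
    then show "X \<in> \<sigma> ` D" using \<sigma>(1)[OF P] a by blast
  qed (use \<open>\<sigma> \<in> hom _ _\<close> in \<open>auto simp: hom_def\<close>)
  ultimately have epi: "\<sigma> \<in> epi (additive_group D) (additive_group S Mod N)" by (simp add: epi_def)
  have ker: "kernel (additive_group D) (additive_group S Mod N) \<sigma> = wDiff M B (\<lambda>q. w q * \<rho> q) (m - 1)"
  proof (intro equalityI subsetI)
    fix P assume "P \<in> kernel (additive_group D) (additive_group S Mod N) \<sigma>"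
    then have P: "P \<in> D" "\<sigma> P = N" by (auto simp: kernel_def)
    obtain a where a: "gn w m P a" using gD[OF P(1)] by blast
    have "a \<in> N" using G.coset_join1[OF _ _ sub, of a] \<sigma>[OF a] P(2) sub by (auto simp: subgroup_def)
    then show "P \<in> wDiff M B (\<lambda>q. w q * \<rho> q) (m - 1)" using gen_kernel[OF a] by (simp add: N_def)
  next
    fix P assume P: "P \<in> wDiff M B (\<lambda>q. w q * \<rho> q) (m - 1)"
    then obtain a where a: "gn (\<lambda>q. w q * \<rho> q) (m - 1) P a" using wDiff_iff[OF weight_mult_rho[OF w]] by blast
    then have "a \<in> N" using wpoly_iff[OF weight_mult_rho[OF w]] by (auto simp: N_def)
    then have "\<sigma> P = N" using \<sigma>[OF gen_lower[OF a]] G.coset_join2[OF _ sub] by simp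
    moreover have "P \<in> D" using P wpoly_lower(2)[OF w] by (auto simp: D_def)
    ultimately show "P \<in> kernel (additive_group D) (additive_group S Mod N) \<sigma>" by (simp add: kernel_def)
  qed
  have sc: "(\<lambda>z. c * p z) \<in> \<sigma> (\<lambda>u q. c * P u q)" if P: "P \<in> D" "p \<in> \<sigma> P" for c P p
  proof -
    obtain a where a: "gn w m P a" using gD[OF P(1)] by blast
    have "\<sigma> P = symbol_class M B \<rho> w m a" unfolding \<sigma>_def by (rule principal_symbol_eq[OF a])
    then obtain d where d: "d \<in> N" "p = d + a" using P(2) unfolding symbol_class_eq N_def by blast
    have "\<sigma> (\<lambda>u q. c * P u q) = symbol_class M B \<rho> w m (\<lambda>z. c * a z)"
      unfolding \<sigma>_def by (rule principal_symbol_eq[OF gen_scale[OF a]])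
    moreover have "(\<lambda>z. c * p z) = (\<lambda>z. c * d z) + (\<lambda>z. c * a z)" by (simp add: d(2) fun_eq_iff distrib_left)
    moreover have "(\<lambda>z. c * d z) \<in> N" using d(1) wpoly_group(3)[OF weight_mult_rho[OF w]] by (simp add: N_def)
    ultimately show ?thesis unfolding symbol_class_eq N_def by blast
  qed
  have "subgroup (wDiff M B (\<lambda>q. w q * \<rho> q) (m - 1)) (additive_group D)" unfolding D_def by (rule wDiff_subgroup[OF w])
  then show ?thesis
    unfolding symbol_short_exact_def S_def[symmetric] N_def[symmetric] D_def[symmetric] \<sigma>_def[symmetric]
    using G.group_axioms D.group_axioms sub epi ker sc
      wDiff_group(3)[OF w, of _ m] wDiff_group(3)[OF weight_mult_rho[OF w], of _ "m - 1"]
      wpoly_group(3)[OF w, of _ m] wpoly_group(3)[OF weight_mult_rho[OF w], of _ "m - 1"]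
    by (simp add: S_def N_def D_def)
qed

end

section \<open>Commutators and Poisson brackets\<close>

lemma local_poisson_antisym: "local_poisson r b a x \<xi> = - local_poisson r a b x \<xi>"
  unfolding local_poisson_def sum_negf[symmetric] by (rule sum.cong[OF refl]) (simp add: algebra_simps)

lemma local_poisson_mult:
  assumes "s x differentiable (at \<xi>)" "a x differentiable (at \<xi>)"
    and "(\<lambda>y. s y \<xi>) differentiable (at x)" "(\<lambda>y. a y \<xi>) differentiable (at x)"
  shows "local_poisson r (\<lambda>y \<eta>. s y \<eta> * a y \<eta>) b x \<xi> = s x \<xi> * local_poisson r a b x \<xi> + local_poisson r s b x \<xi> * a x \<xi>"
  unfolding local_poisson_def pd_mult[OF assms(1,2)] pd_mult[OF assms(3,4)] sum_distrib_left sum_distrib_right sum.distrib[symmetric]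
  by (rule sum.cong[OF refl]) (simp add: algebra_simps)

lemma local_poisson_add:
  assumes "s x differentiable (at \<xi>)" "a x differentiable (at \<xi>)"
    and "(\<lambda>y. s y \<xi>) differentiable (at x)" "(\<lambda>y. a y \<xi>) differentiable (at x)"
  shows "local_poisson r (\<lambda>y \<eta>. s y \<eta> + a y \<eta>) b x \<xi> = local_poisson r s b x \<xi> + local_poisson r a b x \<xi>"
  unfolding local_poisson_def pd_add[OF assms(1,2)] pd_add[OF assms(3,4)] sum.distrib[symmetric]
  by (rule sum.cong[OF refl]) (simp add: algebra_simps)

lemma pd_linear_form:
  "pd i (\<lambda>\<eta> :: real^'n::finite. \<i> * (\<Sum>k\<in>UNIV. cor (v $ k) * cor (\<eta> $ k))) \<xi> = \<i> * cor (v $ i)"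
proof -
  have "((\<lambda>\<eta> :: real^'n. \<i> * (\<Sum>k\<in>UNIV. cor (v $ k) * cor (\<eta> $ k))) has_derivative
     (\<lambda>d. \<i> * (\<Sum>k\<in>UNIV. cor (v $ k) * cor (d $ k)))) (at \<xi>)"
    by (intro has_derivative_mult_right has_derivative_sum has_derivative_component)
  then have "pd i (\<lambda>\<eta> :: real^'n. \<i> * (\<Sum>k\<in>UNIV. cor (v $ k) * cor (\<eta> $ k))) \<xi>
     = \<i> * (\<Sum>k\<in>UNIV. cor (v $ k) * cor (axis i 1 $ k))"
    unfolding pd_dird by (rule dird_eqI)
  also have "(\<Sum>k\<in>UNIV. cor (v $ k) * cor (axis i 1 $ k)) = (\<Sum>k\<in>UNIV. if k = i then cor (v $ i) else 0)"
    by (rule sum.cong[OF refl]) (simp add: axis_def)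
  finally show ?thesis by simp
qed

text \<open>\<open>A\<close> stands for the second derivatives of the argument; its symmetry cancels
  the second order part of the commutator of two fields.\<close>

lemma bracket_algebra:
  fixes V W p :: "'n::finite => complex" and A E F :: "'n => 'n => complex"
  assumes A: "\<And>i j. A i j = A j i"
  shows "(\<Sum>i\<in>UNIV. V i * (\<Sum>j\<in>UNIV. W j * A i j + E i j * p j)) - (\<Sum>i\<in>UNIV. W i * (\<Sum>j\<in>UNIV. V j * A i j + F i j * p j))
    = (\<Sum>j\<in>UNIV. (\<Sum>i\<in>UNIV. V i * E i j - W i * F i j) * p j)"
proof -
  have 1: "(\<Sum>i\<in>UNIV. \<Sum>j\<in>UNIV. V i * (W j * A i j)) = (\<Sum>i\<in>UNIV. \<Sum>j\<in>UNIV. W i * (V j * A i j))"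
    by (subst sum.swap) (intro sum.cong refl, subst A, simp add: mult_ac)
  have 2: "(\<Sum>i\<in>UNIV. U i * (\<Sum>j\<in>UNIV. T j * A i j + G i j * p j))
      = (\<Sum>i\<in>UNIV. \<Sum>j\<in>UNIV. U i * (T j * A i j)) + (\<Sum>j\<in>UNIV. (\<Sum>i\<in>UNIV. U i * G i j) * p j)" for U T G
  proof -
    have "(\<Sum>i\<in>UNIV. U i * (\<Sum>j\<in>UNIV. T j * A i j + G i j * p j))
        = (\<Sum>i\<in>UNIV. \<Sum>j\<in>UNIV. U i * (T j * A i j)) + (\<Sum>i\<in>UNIV. \<Sum>j\<in>UNIV. U i * G i j * p j)"
      by (simp add: sum_distrib_left sum.distrib[symmetric] distrib_left mult.assoc)
    also have "(\<Sum>i\<in>UNIV. \<Sum>j\<in>UNIV. U i * G i j * p j) = (\<Sum>j\<in>UNIV. (\<Sum>i\<in>UNIV. U i * G i j) * p j)"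
      by (subst sum.swap) (simp add: sum_distrib_right)
    finally show ?thesis .
  qed
  show ?thesis unfolding 2 1 by (simp add: sum_subtractf left_diff_distrib)
qed

context scaled_bg_weight
begin

lemma chart_differentiable: "smooth_fun M u ==> \<alpha> \<in> I ==> x \<in> cube 2 ==> (u \<circ> \<psi> \<alpha>) differentiable (at x)"
  by (rule smooth_on_differentiable[OF smooth_chart])

lemma in_chart:
  obtains \<alpha> x where "\<alpha> \<in> I" "x \<in> cube 2" "q = \<psi> \<alpha> x"
proof -
  obtain \<alpha> where \<alpha>: "\<alpha> \<in> I" "q \<in> U \<alpha>" by (rule covered)
  show ?thesis by (rule that[OF \<alpha>(1) coord_in[OF \<alpha>]]) (simp add: param_coord[OF \<alpha>])
qed

lemma vrep_linear:
  assumes V: "vrep V v" and u: "smooth_fun M u" "smooth_fun M u'"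
  shows "V (\<lambda>q. c * u q + d * u' q) = (\<lambda>q. c * V u q + d * V u' q)"
proof
  fix q
  obtain \<alpha> x where x: "\<alpha> \<in> I" "x \<in> cube 2" "q = \<psi> \<alpha> x" by (rule in_chart)
  note d = chart_differentiable[OF u(1) x(1,2)] chart_differentiable[OF u(2) x(1,2)]
  have dc: "(\<lambda>y. k * (u \<circ> \<psi> \<alpha>) y) differentiable (at x)" "(\<lambda>y. k * (u' \<circ> \<psi> \<alpha>) y) differentiable (at x)" for k
    by - (rule differentiable_mult[OF differentiable_const d(1)], rule differentiable_mult[OF differentiable_const d(2)])
  have e: "(\<lambda>q. c * u q + d * u' q) \<circ> \<psi> \<alpha> = (\<lambda>y. c * (u \<circ> \<psi> \<alpha>) y + d * (u' \<circ> \<psi> \<alpha>) y)" by (simp add: fun_eq_iff)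
  have pd: "pd i ((\<lambda>q. c * u q + d * u' q) \<circ> \<psi> \<alpha>) x = c * pd i (u \<circ> \<psi> \<alpha>) x + d * pd i (u' \<circ> \<psi> \<alpha>) x" for i
    unfolding e pd_add[OF dc] pd_mult[OF differentiable_const d(1)] pd_mult[OF differentiable_const d(2)] by simp
  have s: "smooth_fun M (\<lambda>q. c * u q + d * u' q)"
    using u by (intro smooth_fun_add smooth_fun_mult smooth_fun_const)
  have Vu: "V f (\<psi> \<alpha> x) = (\<Sum>i\<in>UNIV. cor (v \<alpha> x $ i * scl B \<alpha> $ i) * pd i (f \<circ> \<psi> \<alpha>) x)" if "smooth_fun M f" for f
    using V that x unfolding vrep_def by blast
  have "(\<Sum>i\<in>UNIV. k i * (c * f i + d * g i)) = c * (\<Sum>i\<in>UNIV. k i * f i) + d * (\<Sum>i\<in>UNIV. k i * g i)" for k f g :: "'n => complex"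
    by (simp add: sum_distrib_left sum.distrib distrib_left mult.left_commute)
  then show "V (\<lambda>q. c * u q + d * u' q) q = c * V u q + d * V u' q"
    unfolding x(3) Vu[OF s] Vu[OF u(1)] Vu[OF u(2)] pd .
qed

lemma vrep_mult:
  assumes V: "vrep V v" and u: "smooth_fun M u" "smooth_fun M u'"
  shows "V (\<lambda>q. u q * u' q) q = u q * V u' q + V u q * u' q"
proof -
  obtain \<alpha> x where x: "\<alpha> \<in> I" "x \<in> cube 2" "q = \<psi> \<alpha> x" by (rule in_chart)
  note d = chart_differentiable[OF u(1) x(1,2)] chart_differentiable[OF u(2) x(1,2)]
  have e: "(\<lambda>q. u q * u' q) \<circ> \<psi> \<alpha> = (\<lambda>y. (u \<circ> \<psi> \<alpha>) y * (u' \<circ> \<psi> \<alpha>) y)" by (simp add: fun_eq_iff)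
  have pd: "pd i ((\<lambda>q. u q * u' q) \<circ> \<psi> \<alpha>) x = u (\<psi> \<alpha> x) * pd i (u' \<circ> \<psi> \<alpha>) x + pd i (u \<circ> \<psi> \<alpha>) x * u' (\<psi> \<alpha> x)" for i
    unfolding e unfolding pd_mult[OF d] unfolding comp_apply ..
  have s: "smooth_fun M (\<lambda>q. u q * u' q)" by (rule smooth_fun_mult[OF u])
  have Vu: "V f (\<psi> \<alpha> x) = (\<Sum>i\<in>UNIV. cor (v \<alpha> x $ i * scl B \<alpha> $ i) * pd i (f \<circ> \<psi> \<alpha>) x)" if "smooth_fun M f" for f
    using V that x unfolding vrep_def by blast
  have "(\<Sum>i\<in>UNIV. k i * (c * f i + g i * d)) = c * (\<Sum>i\<in>UNIV. k i * f i) + (\<Sum>i\<in>UNIV. k i * g i) * d" for k f g :: "'n => complex" and c d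
    by (simp add: sum_distrib_left sum_distrib_right sum.distrib distrib_left mult.left_commute mult.assoc)
  then show ?thesis unfolding x(3) Vu[OF s] Vu[OF u(1)] Vu[OF u(2)] pd .
qed

lemma gen_linear:
  assumes "gn w m P a" and u: "smooth_fun M u" "smooth_fun M u'"
  shows "P (\<lambda>q. c * u q + d * u' q) = (\<lambda>q. c * P u q + d * P u' q)"
  using assms(1)
proof (induction rule: gen.induct)
  case (unit m)
  have "smooth_fun M (\<lambda>q. c * u q + d * u' q)"
    using u by (intro smooth_fun_add smooth_fun_mult smooth_fun_const)
  then show ?case using u by (simp add: smooth_id_def)
next
  case (field V w m P a)
  obtain v where v: "vrep V v" using field(1) op_lie_iff by blast
  show ?case unfolding field.IH by (rule vrep_linear[OF v gen_smooth gen_smooth]) (rule field.hyps)+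
qed (simp_all add: fun_eq_iff algebra_simps)

lemma gen_zero_arg: "gn w m P a ==> P (\<lambda>q. 0) = (\<lambda>q. 0)"
  using gen_linear[of w m P a "\<lambda>q. 0" "\<lambda>q. 0" 0 0] by simp

lemma gen_comp:
  assumes "gn w m P a" "gn w' m' Q b"
  shows "gn (\<lambda>q. w q * w' q) (m + m') (\<lambda>u. P (Q u)) (\<lambda>z. a z * b z)"
  by (rule gen_compose[OF assms]) (simp_all add: weight_mult gen_weight[OF assms(2)] gen_smooth_id[OF assms(2)])

text \<open>The Leibniz rule for \<open>local_poisson\<close> needs differentiability separately
  along the fibre and along the base; every generated symbol has it.\<close>

definition dsym :: "'a symbol => bool" where
  "dsym a \<longleftrightarrow> (\<forall>\<alpha>\<in>I. \<forall>x\<in>cube 2. \<forall>\<xi>. push M B \<alpha> a x differentiable (at \<xi>) \<and> (\<lambda>y. push M B \<alpha> a y \<xi>) differentiable (at x))"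

lemma gen_dsym:
  assumes "gn w m P a"
  shows "dsym a"
proof -
  obtain c r where l: "lco w m P a c r" using gen_lco[OF assms] by blast
  note w = lcoD(1)[OF l] and c = lcoD(2)[OF l] and a = lcoD(7)[OF l]
  show ?thesis
    unfolding dsym_def
  proof (intro ballI allI conjI)
    fix \<alpha> and x \<xi> :: "real^'n" assume x: "\<alpha> \<in> I" "x \<in> cube 2"
    have "push M B \<alpha> a x = (\<lambda>\<xi>. cor (w (\<psi> \<alpha> x)) * (\<Sum>\<gamma>\<in>midxs m. c \<alpha> \<gamma> x * mmonom \<gamma> \<xi>))"
      using a[OF x] by (simp add: fun_eq_iff)
    moreover have "mmonom \<gamma> differentiable (at \<xi>)" for \<gamma> by (rule smooth_on_differentiable[OF smooth_mmonom UNIV_I])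
    ultimately show "push M B \<alpha> a x differentiable (at \<xi>)"
      by (auto intro!: differentiable_mult differentiable_sum differentiable_const)
    have dw: "(\<lambda>y. w (\<psi> \<alpha> y)) differentiable (at x)" by (rule weight_differentiable[OF w x])
    have "(\<lambda>y. cor (w (\<psi> \<alpha> y))) differentiable (at x)" by (rule differentiable_cor[OF dw])
    moreover have "c \<alpha> \<gamma> differentiable (at x)" for \<gamma> by (rule c_fam_differentiable[OF c x])
    ultimately have "(\<lambda>y. cor (w (\<psi> \<alpha> y)) * (\<Sum>\<gamma>\<in>midxs m. c \<alpha> \<gamma> y * mmonom \<gamma> \<xi>)) differentiable (at x)"
      by (auto intro!: differentiable_mult differentiable_sum differentiable_const)
    then show "(\<lambda>y. push M B \<alpha> a y \<xi>) differentiable (at x)"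
      by (subst differentiable_local_cong[OF open_cube x(2) a[OF x(1)]])
  qed
qed

text \<open>Stands in for the definite description in \<open>poisson\<close>, whose existence is not
  known in advance. Uniqueness follows because symbols are determined by their values in
  charts.\<close>

definition is_poisson :: "'a symbol => 'a symbol => 'a symbol => bool" where
  "is_poisson a b c \<longleftrightarrow> (\<forall>z. z \<notin> cotangent_bundle M \<longrightarrow> c z = 0) \<and>
     (\<forall>\<alpha>\<in>I. \<forall>x\<in>cube 2. \<forall>\<xi>. push M B \<alpha> c x \<xi> = local_poisson (scl B \<alpha>) (push M B \<alpha> a) (push M B \<alpha> b) x \<xi>)"

lemma is_poisson_unique:
  assumes "is_poisson a b c"
  shows "poisson M B a b = c"
  unfolding poisson_def
proof (rule the_equality)
  show "(\<forall>z. z \<notin> cotangent_bundle M \<longrightarrow> c z = 0) \<and>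
     (\<forall>\<alpha>\<in>I. \<forall>x\<in>cube 2. \<forall>\<xi>. push M B \<alpha> c x \<xi> = local_poisson (scl B \<alpha>) (push M B \<alpha> a) (push M B \<alpha> b) x \<xi>)"
    using assms by (simp add: is_poisson_def)
  show "d = c" if "(\<forall>z. z \<notin> cotangent_bundle M \<longrightarrow> d z = 0) \<and>
     (\<forall>\<alpha>\<in>I. \<forall>x\<in>cube 2. \<forall>\<xi>. push M B \<alpha> d x \<xi> = local_poisson (scl B \<alpha>) (push M B \<alpha> a) (push M B \<alpha> b) x \<xi>)" for d
    by (rule symbol_eqI) (use that assms in \<open>auto simp: is_poisson_def\<close>)
qed

lemma is_poisson_antisym: "is_poisson a b c ==> is_poisson b a (\<lambda>z. - 1 * c z)"
  unfolding is_poisson_def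
  by (subst local_poisson_antisym) (simp add: push_def)

lemma is_poisson_mult:
  assumes d: "dsym s" "dsym a" and p: "is_poisson a b c" "is_poisson s b c'"
  shows "is_poisson (\<lambda>z. s z * a z) b (\<lambda>z. s z * c z + c' z * a z)"
  unfolding is_poisson_def
proof (intro conjI allI impI ballI)
  fix \<alpha> and x \<xi> :: "real^'n" assume x: "\<alpha> \<in> I" "x \<in> cube 2"
  have e: "push M B \<alpha> (\<lambda>z. s z * a z) = (\<lambda>y \<eta>. push M B \<alpha> s y \<eta> * push M B \<alpha> a y \<eta>)" by (simp add: push_def fun_eq_iff)
  show "push M B \<alpha> (\<lambda>z. s z * c z + c' z * a z) x \<xi> = local_poisson (scl B \<alpha>) (push M B \<alpha> (\<lambda>z. s z * a z)) (push M B \<alpha> b) x \<xi>"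
    unfolding e
    by (subst local_poisson_mult) (use x p d in \<open>auto simp: dsym_def is_poisson_def, simp add: push_def\<close>)
qed (use p in \<open>simp add: is_poisson_def del: split_paired_All\<close>)

lemma is_poisson_add:
  assumes d: "dsym s" "dsym a" and p: "is_poisson s b c" "is_poisson a b c'"
  shows "is_poisson (\<lambda>z. s z + a z) b (\<lambda>z. c z + c' z)"
  unfolding is_poisson_def
proof (intro conjI allI impI ballI)
  fix \<alpha> and x \<xi> :: "real^'n" assume x: "\<alpha> \<in> I" "x \<in> cube 2"
  have e: "push M B \<alpha> (\<lambda>z. s z + a z) = (\<lambda>y \<eta>. push M B \<alpha> s y \<eta> + push M B \<alpha> a y \<eta>)" by (simp add: push_def fun_eq_iff)
  have "push M B \<alpha> (\<lambda>z. c z + c' z) x \<xi> = push M B \<alpha> c x \<xi> + push M B \<alpha> c' x \<xi>" by (simp add: push_def)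
  then show "push M B \<alpha> (\<lambda>z. c z + c' z) x \<xi> = local_poisson (scl B \<alpha>) (push M B \<alpha> (\<lambda>z. s z + a z)) (push M B \<alpha> b) x \<xi>"
    unfolding e
    by (subst local_poisson_add) (use x p d in \<open>auto simp: dsym_def is_poisson_def\<close>)
qed (use p in \<open>simp add: is_poisson_def del: split_paired_All\<close>)

text \<open>Existence of the Poisson bracket is part of the claim: one global \<open>c\<close> must
  fit the local brackets in all charts, and it must be the symbol paired with the commutator in
  \<open>gen\<close>, with the extra weight \<open>\<rho>\<close>.\<close>

definition bracket ::
  "('a => real) => 'a operator => 'a symbol => ('a => real) => 'a operator => 'a symbol => int => bool" where
  "bracket w P a v Q b k \<longleftrightarrow>
     (\<exists>c. is_poisson a b c \<and> gn (\<lambda>q. w q * v q * \<rho> q) k (i_commutator P Q) c)"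

lemma bracket_antisym: "bracket w P a v Q b k ==> bracket v Q b w P a k"
proof -
  assume "bracket w P a v Q b k"
  then obtain c where c: "is_poisson a b c" "gn (\<lambda>q. w q * v q * \<rho> q) k (i_commutator P Q) c" unfolding bracket_def by blast
  have "gn (\<lambda>q. v q * w q * \<rho> q) k (i_commutator Q P) (\<lambda>z. - 1 * c z)"
    by (rule gen_cong[OF gen_scale[OF c(2), of "- 1"]]) (simp_all add: i_commutator_def algebra_simps)
  then show ?thesis using is_poisson_antisym[OF c(1)] unfolding bracket_def by blast
qed

lemma bracket_cong:
  "bracket w P a v Q b k ==> (\<And>q. w q = w' q) ==> (\<And>u q. P u q = P' u q) ==> (\<And>z. a z = a' z) ==> k \<le> k' ==>
    bracket w' P' a' v Q b k'"
proof -
  assume b: "bracket w P a v Q b k" and e: "\<And>q. w q = w' q" "\<And>u q. P u q = P' u q" "\<And>z. a z = a' z" and k: "k \<le> k'"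
  have "w = w'" "P = P'" "a = a'" using e by (simp_all add: fun_eq_iff)
  then show ?thesis using b gen.mono[OF _ k] unfolding bracket_def by blast
qed

text \<open>Commutator and Poisson bracket obey the same Leibniz rule,
  \<open>[X P, Q] = X [P, Q] + [X, Q] P\<close>, and composition in \<open>gen\<close> multiplies
  symbols.\<close>

lemma bracket_compose:
  assumes X: "gn w m X s" and P: "gn v k P a" and Q: "gn y l Q b"
    and XQ: "bracket w X s y Q b (m + l - 1)" and PQ: "bracket v P a y Q b (k + l - 1)"
  shows "bracket (\<lambda>q. w q * v q) (\<lambda>u. X (P u)) (\<lambda>z. s z * a z) y Q b (m + k + l - 1)"
proof -
  obtain c where c: "is_poisson s b c" "gn (\<lambda>q. w q * y q * \<rho> q) (m + l - 1) (i_commutator X Q) c" using XQ unfolding bracket_def by blast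
  obtain d where d: "is_poisson a b d" "gn (\<lambda>q. v q * y q * \<rho> q) (k + l - 1) (i_commutator P Q) d" using PQ unfolding bracket_def by blast
  have "is_poisson (\<lambda>z. s z * a z) b (\<lambda>z. s z * d z + c z * a z)"
    by (rule is_poisson_mult[OF gen_dsym[OF X] gen_dsym[OF P] d(1) c(1)])
  moreover have "gn (\<lambda>q. w q * v q * y q * \<rho> q) (m + k + l - 1) (i_commutator (\<lambda>u. X (P u)) Q) (\<lambda>z. s z * d z + c z * a z)"
  proof -
    have 1: "gn (\<lambda>q. w q * v q * y q * \<rho> q) (m + k + l - 1) (\<lambda>u. X (i_commutator P Q u)) (\<lambda>z. s z * d z)"
      by (rule gen_cong[OF gen_comp[OF X d(2)]]) (simp_all add: mult_ac)
    have 2: "gn (\<lambda>q. w q * v q * y q * \<rho> q) (m + k + l - 1) (\<lambda>u. i_commutator X Q (P u)) (\<lambda>z. c z * a z)"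
      by (rule gen_cong[OF gen_comp[OF c(2) P]]) (simp_all add: mult_ac)
    show ?thesis
    proof (rule gen_cong[OF gen.add[OF 1 2]])
      fix u q
      have "i_commutator P Q u = (\<lambda>q. \<i> * P (Q u) q + (- \<i>) * Q (P u) q)" by (simp add: i_commutator_def algebra_simps)
      then have "X (i_commutator P Q u) q = \<i> * X (P (Q u)) q + (- \<i>) * X (Q (P u)) q"
        using fun_cong[OF gen_linear[OF X gen_smooth[OF P] gen_smooth[OF Q]], of \<i> "Q u" "- \<i>" "P u" q] by simp
      then show "X (i_commutator P Q u) q + i_commutator X Q (P u) q = i_commutator (\<lambda>u. X (P u)) Q u q"
        unfolding i_commutator_def[of X Q] i_commutator_def[of "\<lambda>u. X (P u)"] by (simp add: algebra_simps)
    qed simp_all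
  qed
  ultimately show ?thesis unfolding bracket_def by blast
qed

text \<open>The single letters in the form in which they arise from \<open>unit\<close> in
  \<open>gen\<close>; this is why \<open>smooth_id\<close> and the indicator of the cotangent bundle
  appear.\<close>

abbreviation mulop :: "('a => real) => ('a => complex) => 'a operator" where
  "mulop w e \<equiv> \<lambda>u q. cor (w q) * (e q * smooth_id M u q)"

abbreviation mulsym :: "('a => real) => ('a => complex) => 'a symbol" where
  "mulsym w e \<equiv> \<lambda>z. cor (w (fst z)) * (e (fst z) * (if z \<in> cotangent_bundle M then 1 else 0))"

abbreviation vecop :: "'a operator => 'a operator" where
  "vecop V \<equiv> \<lambda>u. V (smooth_id M u)"

abbreviation vecsym :: "'a operator => 'a symbol" where
  "vecsym V \<equiv> \<lambda>z. \<i> * vsym M V z * (if z \<in> cotangent_bundle M then 1 else 0)"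

lemma gen_mulop:
  assumes "weight M B w" "e \<in> C_uni M B"
  shows "gn w 0 (mulop w e) (mulsym w e)"
  by (rule gen_cong[OF gen.wmult[OF _ gen.mult[OF assms(2) gen.unit[of 0]]], of w]) (use assms(1) in simp_all)

lemma gen_vecop: "V \<in> op_lie_algebra M B ==> gn (\<lambda>q. 1) 1 (vecop V) (vecsym V)"
proof -
  assume V: "V \<in> op_lie_algebra M B"
  have "gn (\<lambda>q. 1) 0 (smooth_id M) (\<lambda>z. if z \<in> cotangent_bundle M then 1 else 0)" by (rule gen.unit) simp
  from gen.field[OF V this] show ?thesis by (simp only: add_0)
qed

lemma is_poisson_zero: "is_poisson (\<lambda>z. 0) b (\<lambda>z. 0)"
  unfolding is_poisson_def push_def local_poisson_def by simp

text \<open>Induction over words leaves single letters in the first argument. The orders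
  \<open>l - 1\<close> and \<open>l\<close> are those of letters of order 0 and 1 in the formula
  \<open>k + l - 1\<close>.\<close>

lemma bracket_gen:
  assumes Q: "gn y l Q b"
    and M: "\<And>w e. weight M B w ==> e \<in> C_uni M B ==> bracket w (mulop w e) (mulsym w e) y Q b (l - 1)"
    and V: "\<And>V. V \<in> op_lie_algebra M B ==> bracket (\<lambda>q. 1) (vecop V) (vecsym V) y Q b l"
    and P: "gn v k P a"
  shows "bracket v P a y Q b (k + l - 1)"
  using P
proof (induction rule: gen.induct)
  case (zero w m)
  have "gn (\<lambda>q. w q * y q * \<rho> q) (m + l - 1) (i_commutator (\<lambda>u q. 0) Q) (\<lambda>z. 0)"
    by (rule gen_cong[OF gen.zero[of "\<lambda>q. w q * y q * \<rho> q"]])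
      (use zero in \<open>simp_all add: i_commutator_def gen_zero_arg[OF Q] weight_mult gen_weight[OF Q] weight_rho\<close>)
  then show ?case using is_poisson_zero unfolding bracket_def by blast
next
  case (unit m)
  show ?case
    by (rule bracket_cong[OF M[OF weight_1 C_uni_const[of 1]]]) (use unit in simp_all)
next
  case (mult f w m P a)
  show ?case
    by (rule bracket_cong[OF bracket_compose[OF gen_mulop[OF weight_1 mult(1)] mult(2) Q _ mult.IH]])
      (use M[OF weight_1 mult(1)] gen_smooth_id[OF mult(2)] gen_off[OF mult(2)] in auto)
next
  case (wmult w' w m P a)
  have w': "weight M B w'" using wmult(1) by simp
  show ?case
    by (rule bracket_cong[OF bracket_compose[OF gen_mulop[OF w' C_uni_const[of 1]] wmult(2) Q _ wmult.IH]])
      (use M[OF w' C_uni_const[of 1]] gen_smooth_id[OF wmult(2)] gen_off[OF wmult(2)] in auto)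
next
  case (field V w m P a)
  show ?case
    by (rule bracket_cong[OF bracket_compose[OF gen_vecop[OF field(1)] field(2) Q _ field.IH]])
      (use V[OF field(1)] gen_smooth_id[OF field(2)] gen_off[OF field(2)] in auto)
next
  case (add w m P a P' a')
  obtain c where c: "is_poisson a b c" "gn (\<lambda>q. w q * y q * \<rho> q) (m + l - 1) (i_commutator P Q) c" using add.IH(1) unfolding bracket_def by blast
  obtain d where d: "is_poisson a' b d" "gn (\<lambda>q. w q * y q * \<rho> q) (m + l - 1) (i_commutator P' Q) d" using add.IH(2) unfolding bracket_def by blast
  have "gn (\<lambda>q. w q * y q * \<rho> q) (m + l - 1) (i_commutator (\<lambda>u q. P u q + P' u q) Q) (\<lambda>z. c z + d z)"
  proof (rule gen_cong[OF gen.add[OF c(2) d(2)]])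
    fix u q
    have "Q (\<lambda>q. P u q + P' u q) q = Q (P u) q + Q (P' u) q"
      using fun_cong[OF gen_linear[OF Q gen_smooth[OF add(1)] gen_smooth[OF add(2)]], of 1 u 1 u q] by simp
    then show "i_commutator P Q u q + i_commutator P' Q u q = i_commutator (\<lambda>u q. P u q + P' u q) Q u q"
      unfolding i_commutator_def by (simp add: algebra_simps)
  qed simp_all
  then show ?case using is_poisson_add[OF gen_dsym[OF add(1)] gen_dsym[OF add(2)] c(1) d(1)] unfolding bracket_def by blast
next
  case (mono w m P a m')
  show ?case by (rule bracket_cong[OF mono.IH]) (use mono in simp_all)
qed

lemma push_mulsym: "\<alpha> \<in> I ==> x \<in> cube 2 ==> push M B \<alpha> (mulsym w e) x \<eta> = cor (w (\<psi> \<alpha> x)) * e (\<psi> \<alpha> x)"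
  using cot_param_in by (simp add: push_def)

lemma pd_push_mulsym: "\<alpha> \<in> I ==> x \<in> cube 2 ==> pd i (\<lambda>\<eta>. push M B \<alpha> (mulsym w e) x \<eta>) \<xi> = 0"
  by (simp add: push_mulsym)

lemma push_vecsym:
  "vrep V v ==> \<alpha> \<in> I ==> x \<in> cube 2 ==>
    push M B \<alpha> (vecsym V) x \<eta> = \<i> * (\<Sum>i\<in>UNIV. cor (v \<alpha> x $ i) * cor (\<eta> $ i))"
  using vsym_push cot_param_in by (simp add: push_def)

lemma pd_push_vecsym:
  "vrep V v ==> \<alpha> \<in> I ==> x \<in> cube 2 ==> pd i (\<lambda>\<eta>. push M B \<alpha> (vecsym V) x \<eta>) \<xi> = \<i> * cor (v \<alpha> x $ i)"
  unfolding push_vecsym by (rule pd_linear_form)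

lemma bracket_mul_mul:
  assumes "weight M B w" "e \<in> C_uni M B" "weight M B w'" "e' \<in> C_uni M B"
  shows "bracket w (mulop w e) (mulsym w e) w' (mulop w' e') (mulsym w' e') k"
proof -
  have "is_poisson (mulsym w e) (mulsym w' e') (\<lambda>z. 0)"
    unfolding is_poisson_def local_poisson_def by (auto simp: pd_push_mulsym push_def[of M B _ "\<lambda>z. 0"])
  moreover have "gn (\<lambda>q. w q * w' q * \<rho> q) k (i_commutator (mulop w e) (mulop w' e')) (\<lambda>z. 0)"
    by (rule gen_cong[OF gen.zero[of "\<lambda>q. w q * w' q * \<rho> q"]])
      (use assms gen_smooth_id[OF gen_mulop[OF assms(1,2)]] gen_smooth_id[OF gen_mulop[OF assms(3,4)]] in
        \<open>simp_all add: i_commutator_def weight_mult weight_rho\<close>)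
  ultimately show ?thesis unfolding bracket_def by blast
qed

text \<open>With \<open>g = w e\<close>, the operator \<open>\<i> [V, g]\<close> is multiplication
  by \<open>\<i> V g\<close>. In a chart \<open>V g\<close> is a sum of scaled derivatives; division
  by \<open>w \<rho>\<close> leaves logarithmic derivatives of \<open>w\<close>, derivatives of
  \<open>e\<close> and quotients of scales by \<open>\<rho>\<close>, all uniform.\<close>

lemma bracket_vec_mul:
  assumes V: "V \<in> op_lie_algebra M B" and w: "weight M B w" and e: "e \<in> C_uni M B"
  shows "bracket (\<lambda>q. 1) (vecop V) (vecsym V) w (mulop w e) (mulsym w e) 0"
proof -
  obtain v where v: "vrep V v" using V op_lie_iff by blast
  define g where "g = (\<lambda>q. cor (w q) * e q)"
  have g: "smooth_fun M g" unfolding g_def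
    by (rule smooth_fun_mult[OF smooth_fun_of_real[OF weightD(3)[OF w]] smooth_fun_C_uni[OF e]])
  have Vg: "V g (\<psi> \<alpha> x) = (\<Sum>i\<in>UNIV. cor (v \<alpha> x $ i * scl B \<alpha> $ i) * pd i (g \<circ> \<psi> \<alpha>) x)" if "\<alpha> \<in> I" "x \<in> cube 2" for \<alpha> x
    using v g that unfolding vrep_def by blast
  define h where "h = (\<lambda>q. \<i> * (V g q * inverse (cor (w q * \<rho> q))))"
  have ec: "cfam (\<lambda>\<alpha> x. e (\<psi> \<alpha> x))" using e by (simp add: C_uni_iff)
  have h: "h \<in> C_uni M B"
    unfolding C_uni_iff
  proof (rule c_fam_cong)
    show "cfam (\<lambda>\<alpha> x. \<i> * (\<Sum>i\<in>UNIV. cor (v \<alpha> x $ i) *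
        (cor (scl B \<alpha> $ i * inverse (\<rho> (\<psi> \<alpha> x))) * (cor (logd w i \<alpha> x) * e (\<psi> \<alpha> x) + pd i (\<lambda>y. e (\<psi> \<alpha> y)) x))))"
      by (intro c_fam_mult c_fam_sum c_fam_add c_fam_of_real c_fam_const' c_fam_scl_rho weightD(4)[OF w] ec c_fam_pd) (use v in \<open>auto simp: vrep_def\<close>)
    fix \<alpha> and x :: "real^'n" assume x: "\<alpha> \<in> I" "x \<in> cube 2"
    have dw: "(\<lambda>y. w (\<psi> \<alpha> y)) differentiable (at x)" by (rule weight_differentiable[OF w x])
    have dwc: "(\<lambda>y. cor (w (\<psi> \<alpha> y))) differentiable (at x)" by (rule differentiable_cor[OF dw])
    have de: "(\<lambda>y. e (\<psi> \<alpha> y)) differentiable (at x)" by (rule c_fam_differentiable[OF ec x])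
    have ge: "g \<circ> \<psi> \<alpha> = (\<lambda>y. cor (w (\<psi> \<alpha> y)) * e (\<psi> \<alpha> y))" by (simp add: g_def fun_eq_iff)
    have "pd i (g \<circ> \<psi> \<alpha>) x = cor (w (\<psi> \<alpha> x)) * (cor (logd w i \<alpha> x) * e (\<psi> \<alpha> x) + pd i (\<lambda>y. e (\<psi> \<alpha> y)) x)" for i
      unfolding ge pd_mult[OF dwc de] pd_of_real[OF dw] using weightD(2)[OF w, of "\<psi> \<alpha> x"] by (simp add: logd_def field_simps)
    then have "V g (\<psi> \<alpha> x) = cor (w (\<psi> \<alpha> x)) * (\<Sum>i\<in>UNIV. cor (v \<alpha> x $ i * scl B \<alpha> $ i) *
        (cor (logd w i \<alpha> x) * e (\<psi> \<alpha> x) + pd i (\<lambda>y. e (\<psi> \<alpha> y)) x))"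
      unfolding Vg[OF x] sum_distrib_left by (intro sum.cong refl) (simp only: mult_ac)
    moreover have "(\<Sum>i\<in>UNIV. cor (v \<alpha> x $ i) * (cor (scl B \<alpha> $ i * inverse (\<rho> (\<psi> \<alpha> x))) * E i))
        = inverse (cor (\<rho> (\<psi> \<alpha> x))) * (\<Sum>i\<in>UNIV. cor (v \<alpha> x $ i * scl B \<alpha> $ i) * E i)" for E
      by (simp add: sum_distrib_left mult_ac)
    moreover have "\<i> * (inverse (cor r) * S) = \<i> * (cor t * S * inverse (cor (t * r)))" if "t \<noteq> 0" "r \<noteq> 0" for t r S
      using that by (simp add: field_simps)
    ultimately show "\<i> * (\<Sum>i\<in>UNIV. cor (v \<alpha> x $ i) *
        (cor (scl B \<alpha> $ i * inverse (\<rho> (\<psi> \<alpha> x))) * (cor (logd w i \<alpha> x) * e (\<psi> \<alpha> x) + pd i (\<lambda>y. e (\<psi> \<alpha> y)) x)))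
       = h (\<psi> \<alpha> x)"
      using weightD(2)[OF w, of "\<psi> \<alpha> x"] weightD(2)[OF weight_rho, of "\<psi> \<alpha> x"]
      unfolding h_def by (simp only:)
  qed simp
  define c where "c = mulsym (\<lambda>q. w q * \<rho> q) h"
  have wr: "weight M B (\<lambda>q. w q * \<rho> q)" by (rule weight_mult_rho[OF w])
  have wh: "cor (w q * \<rho> q) * h q = \<i> * V g q" for q
    using weightD(2)[OF w, of q] weightD(2)[OF weight_rho, of q] by (simp add: h_def field_simps)
  have "gn (\<lambda>q. 1 * w q * \<rho> q) 0 (i_commutator (vecop V) (mulop w e)) c"
  proof (rule gen_cong[OF gen_mulop[OF wr h]])
    fix u q
    define s where "s = smooth_id M u"
    have s: "smooth_fun M s" by (simp add: s_def smooth_id_def)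
    have 1: "mulop w e u = (\<lambda>q. g q * s q)" by (simp add: g_def s_def fun_eq_iff mult.assoc)
    have 2: "smooth_id M (\<lambda>q. g q * s q) = (\<lambda>q. g q * s q)" using smooth_fun_mult[OF g s] by (simp add: smooth_id_def)
    have 3: "smooth_id M (V s) = V s" using vrep_smooth[OF v s] by (simp add: smooth_id_def)
    have "i_commutator (vecop V) (mulop w e) u q = \<i> * (V (\<lambda>q. g q * s q) q - g q * V s q)"
      unfolding i_commutator_def 1 2 s_def[symmetric] 3 using 2 by (simp add: g_def mult.assoc)
    also have "\<dots> = (\<i> * V g q) * s q" unfolding vrep_mult[OF v g s] by (simp add: algebra_simps)
    finally show "mulop (\<lambda>q. w q * \<rho> q) h u q = i_commutator (vecop V) (mulop w e) u q"
      by (simp only: wh[symmetric] s_def mult.assoc)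
  qed (simp_all add: c_def)
  moreover have "is_poisson (vecsym V) (mulsym w e) c"
    unfolding is_poisson_def
  proof (intro conjI allI impI ballI)
    fix \<alpha> and x \<xi> :: "real^'n" assume x: "\<alpha> \<in> I" "x \<in> cube 2"
    have m: "pd i (\<lambda>y. push M B \<alpha> (mulsym w e) y \<xi>) x = pd i (g \<circ> \<psi> \<alpha>) x" for i
      by (rule pd_local_cong[OF open_cube x(2)]) (simp add: push_mulsym[OF x(1)] g_def)
    have "push M B \<alpha> c x \<xi> = cor (w (\<psi> \<alpha> x) * \<rho> (\<psi> \<alpha> x)) * h (\<psi> \<alpha> x)"
      unfolding c_def by (rule push_mulsym[OF x])
    also have "\<dots> = \<i> * V g (\<psi> \<alpha> x)" by (rule wh)
    also have "\<dots> = local_poisson (scl B \<alpha>) (push M B \<alpha> (vecsym V)) (push M B \<alpha> (mulsym w e)) x \<xi>"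
      unfolding local_poisson_def pd_push_mulsym[OF x] pd_push_vecsym[OF v x] m Vg[OF x] sum_distrib_left
      by (intro sum.cong refl) (simp add: mult_ac)
    finally show "push M B \<alpha> c x \<xi> = local_poisson (scl B \<alpha>) (push M B \<alpha> (vecsym V)) (push M B \<alpha> (mulsym w e)) x \<xi>" .
  qed (simp add: c_def)
  ultimately show ?thesis unfolding bracket_def by blast
qed

lemma vrep_twice:
  assumes V: "vrep V v" and W: "vrep W w" and u: "smooth_fun M u" and x: "\<alpha> \<in> I" "x \<in> cube 2"
  shows "V (W u) (\<psi> \<alpha> x) = (\<Sum>i\<in>UNIV. cor (v \<alpha> x $ i * scl B \<alpha> $ i) *
    (\<Sum>j\<in>UNIV. cor (w \<alpha> x $ j * scl B \<alpha> $ j) * pd i (pd j (u \<circ> \<psi> \<alpha>)) x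
       + cor (pd i (\<lambda>y. w \<alpha> y $ j) x * scl B \<alpha> $ j) * pd j (u \<circ> \<psi> \<alpha>) x))"
proof -
  have dw: "(\<lambda>y. w \<alpha> y $ j) differentiable (at x)" for j
    by (rule c_fam_differentiable[of True I "\<lambda>_. cube 2"]) (use W x in \<open>auto simp: vrep_def\<close>)
  have dws: "(\<lambda>y. w \<alpha> y $ j * scl B \<alpha> $ j) differentiable (at x)" for j by (rule differentiable_mult[OF dw differentiable_const])
  have dwc: "(\<lambda>y. cor (w \<alpha> y $ j * scl B \<alpha> $ j)) differentiable (at x)" for j by (rule differentiable_cor[OF dws])
  have du: "pd j (u \<circ> \<psi> \<alpha>) differentiable (at x)" for j
    by (rule smooth_on_differentiable[OF smooth_on_pd[OF smooth_chart[OF u x(1)]] x(2)])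
  have "pd i (W u \<circ> \<psi> \<alpha>) x = pd i (\<lambda>y. \<Sum>j\<in>UNIV. cor (w \<alpha> y $ j * scl B \<alpha> $ j) * pd j (u \<circ> \<psi> \<alpha>) y) x" for i
    by (rule pd_local_cong[OF open_cube x(2)]) (use W u x in \<open>simp add: vrep_def\<close>)
  also have "pd i (\<lambda>y. \<Sum>j\<in>UNIV. cor (w \<alpha> y $ j * scl B \<alpha> $ j) * pd j (u \<circ> \<psi> \<alpha>) y) x
      = (\<Sum>j\<in>UNIV. cor (w \<alpha> x $ j * scl B \<alpha> $ j) * pd i (pd j (u \<circ> \<psi> \<alpha>)) x
       + cor (pd i (\<lambda>y. w \<alpha> y $ j) x * scl B \<alpha> $ j) * pd j (u \<circ> \<psi> \<alpha>) x)" for i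
    by (subst pd_sum[OF differentiable_mult[OF dwc du]])
      (simp only: pd_mult[OF dwc du] pd_of_real[OF dws] pd_mult[OF dw differentiable_const], simp)
  finally have pdW: "pd i (W u \<circ> \<psi> \<alpha>) x = (\<Sum>j\<in>UNIV. cor (w \<alpha> x $ j * scl B \<alpha> $ j) * pd i (pd j (u \<circ> \<psi> \<alpha>)) x
       + cor (pd i (\<lambda>y. w \<alpha> y $ j) x * scl B \<alpha> $ j) * pd j (u \<circ> \<psi> \<alpha>) x)" for i .
  have "V (W u) (\<psi> \<alpha> x) = (\<Sum>i\<in>UNIV. cor (v \<alpha> x $ i * scl B \<alpha> $ i) * pd i (W u \<circ> \<psi> \<alpha>) x)"
    using V vrep_smooth[OF W u] x unfolding vrep_def by blast
  then show ?thesis unfolding pdW .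
qed

text \<open>Second derivatives cancel, and each remaining term contains the scale of the
  differentiating field in addition to the scale of the frame. Hence \<open>[V, W]\<close> is
  \<open>\<rho>\<close> times a field \<open>X\<close> of the operator Lie algebra.\<close>

lemma bracket_vec_vec:
  assumes V: "V \<in> op_lie_algebra M B" and W: "W \<in> op_lie_algebra M B"
  shows "bracket (\<lambda>q. 1) (vecop V) (vecsym V) (\<lambda>q. 1) (vecop W) (vecsym W) 1"
proof -
  obtain v where v: "vrep V v" using V op_lie_iff by blast
  obtain w where w: "vrep W w" using W op_lie_iff by blast
  define X where "X = (\<lambda>u q. inverse (cor (\<rho> q)) * (V (W u) q - W (V u) q))"
  \<comment> \<open>The components of the Lie bracket in the scaled frame, with
    \<open>\<rho>\<close> divided out.\<close>
  define k where "k = (\<lambda>j \<alpha> x. \<Sum>i\<in>UNIV. v \<alpha> x $ i * (scl B \<alpha> $ i * inverse (\<rho> (\<psi> \<alpha> x))) * pd i (\<lambda>y. w \<alpha> y $ j) x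
      - w \<alpha> x $ i * (scl B \<alpha> $ i * inverse (\<rho> (\<psi> \<alpha> x))) * pd i (\<lambda>y. v \<alpha> y $ j) x)"
  define xx where "xx = (\<lambda>\<alpha> x. \<chi> j. k j \<alpha> x)"
  have vc: "cfam (\<lambda>\<alpha> x. v \<alpha> x $ i)" and wc: "cfam (\<lambda>\<alpha> x. w \<alpha> x $ i)" for i
    using v w by (auto simp: vrep_def)
  have rk: "\<rho> (\<psi> \<alpha> x) * k j \<alpha> x = (\<Sum>i\<in>UNIV. v \<alpha> x $ i * scl B \<alpha> $ i * pd i (\<lambda>y. w \<alpha> y $ j) x - w \<alpha> x $ i * scl B \<alpha> $ i * pd i (\<lambda>y. v \<alpha> y $ j) x)" for \<alpha> x j
    unfolding k_def sum_distrib_left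
    by (intro sum.cong refl) (use weightD(2)[OF weight_rho, of "\<psi> \<alpha> x"] in \<open>simp add: field_simps\<close>)
  have vX: "vrep X xx"
    unfolding vrep_def
  proof (intro conjI allI impI ballI)
    have z: "V (\<lambda>q. 0) = (\<lambda>q. 0)" "W (\<lambda>q. 0) = (\<lambda>q. 0)"
      using vrep_linear[OF v, of "\<lambda>q. 0" "\<lambda>q. 0" 0 0] vrep_linear[OF w, of "\<lambda>q. 0" "\<lambda>q. 0" 0 0] by simp_all
    show "X u = (\<lambda>q. 0)" if "\<not> smooth_fun M u" for u
    proof -
      have "V u = (\<lambda>q. 0)" "W u = (\<lambda>q. 0)" using v w that unfolding vrep_def by blast+
      then show ?thesis by (simp add: X_def z)
    qed
    show "cfam (\<lambda>\<alpha> x. xx \<alpha> x $ j)" for j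
      unfolding xx_def vec_lambda_beta k_def
      by (intro c_fam_sum c_fam_diff c_fam_mult c_fam_scl_rho c_fam_pd vc wc) simp_all
    fix u :: "'a => complex" and \<alpha> and x :: "real^'n" assume u: "smooth_fun M u" and x: "\<alpha> \<in> I" "x \<in> cube 2"
    have sym: "pd i (pd j (u \<circ> \<psi> \<alpha>)) x = pd j (pd i (u \<circ> \<psi> \<alpha>)) x" for i j
      unfolding pd_dird by (rule dird_commute[OF open_cube x(2) smooth_chart[OF u x(1)]])
    have r: "cor (\<rho> (\<psi> \<alpha> x)) \<noteq> 0" using weightD(2)[OF weight_rho] by simp
    have "V (W u) (\<psi> \<alpha> x) - W (V u) (\<psi> \<alpha> x) = (\<Sum>j\<in>UNIV. (\<Sum>i\<in>UNIV.
        cor (v \<alpha> x $ i * scl B \<alpha> $ i) * cor (pd i (\<lambda>y. w \<alpha> y $ j) x * scl B \<alpha> $ j)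
      - cor (w \<alpha> x $ i * scl B \<alpha> $ i) * cor (pd i (\<lambda>y. v \<alpha> y $ j) x * scl B \<alpha> $ j)) * pd j (u \<circ> \<psi> \<alpha>) x)"
      unfolding vrep_twice[OF v w u x] vrep_twice[OF w v u x] by (rule bracket_algebra[OF sym])
    also have "\<dots> = (\<Sum>j\<in>UNIV. cor (\<rho> (\<psi> \<alpha> x)) * (cor (xx \<alpha> x $ j * scl B \<alpha> $ j) * pd j (u \<circ> \<psi> \<alpha>) x))"
    proof (rule sum.cong[OF refl])
      fix j
      have "(\<Sum>i\<in>UNIV. cor (v \<alpha> x $ i * scl B \<alpha> $ i) * cor (pd i (\<lambda>y. w \<alpha> y $ j) x * scl B \<alpha> $ j)
          - cor (w \<alpha> x $ i * scl B \<alpha> $ i) * cor (pd i (\<lambda>y. v \<alpha> y $ j) x * scl B \<alpha> $ j))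
        = cor ((\<rho> (\<psi> \<alpha> x) * k j \<alpha> x) * scl B \<alpha> $ j)"
        unfolding rk sum_distrib_right of_real_sum by (intro sum.cong refl) (simp add: algebra_simps)
      then show "(\<Sum>i\<in>UNIV. cor (v \<alpha> x $ i * scl B \<alpha> $ i) * cor (pd i (\<lambda>y. w \<alpha> y $ j) x * scl B \<alpha> $ j)
          - cor (w \<alpha> x $ i * scl B \<alpha> $ i) * cor (pd i (\<lambda>y. v \<alpha> y $ j) x * scl B \<alpha> $ j)) * pd j (u \<circ> \<psi> \<alpha>) x
        = cor (\<rho> (\<psi> \<alpha> x)) * (cor (xx \<alpha> x $ j * scl B \<alpha> $ j) * pd j (u \<circ> \<psi> \<alpha>) x)"
        by (simp only: xx_def vec_lambda_beta of_real_mult mult_ac)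
    qed
    finally have fin: "V (W u) (\<psi> \<alpha> x) - W (V u) (\<psi> \<alpha> x) = (\<Sum>j\<in>UNIV. cor (\<rho> (\<psi> \<alpha> x)) * (cor (xx \<alpha> x $ j * scl B \<alpha> $ j) * pd j (u \<circ> \<psi> \<alpha>) x))" .
    show "X u (\<psi> \<alpha> x) = (\<Sum>j\<in>UNIV. cor (xx \<alpha> x $ j * scl B \<alpha> $ j) * pd j (u \<circ> \<psi> \<alpha>) x)"
      unfolding X_def fin sum_distrib_left[symmetric] by (simp only: mult.assoc[symmetric] left_inverse[OF r] mult_1_left)
  qed
  then have X: "X \<in> op_lie_algebra M B" using op_lie_iff by blast
  have "\<rho> \<in> Wt" using weight_rho by simp
  from gen.wmult[OF this gen_scale[OF gen_vecop[OF X], of \<i>]]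
  have "gn (\<lambda>q. 1 * 1 * \<rho> q) 1 (i_commutator (vecop V) (vecop W)) (\<lambda>z. cor (\<rho> (fst z)) * (\<i> * vecsym X z))"
  proof (rule gen_cong)
    fix u q
    define s where "s = smooth_id M u"
    have s: "smooth_fun M s" by (simp add: s_def smooth_id_def)
    have "smooth_id M (V s) = V s" "smooth_id M (W s) = W s"
      using vrep_smooth[OF v s] vrep_smooth[OF w s] by (simp_all add: smooth_id_def)
    then show "cor (\<rho> q) * (\<i> * vecop X u q) = i_commutator (vecop V) (vecop W) u q"
      unfolding i_commutator_def s_def[symmetric] X_def using weightD(2)[OF weight_rho, of q] by simp
  qed simp_all
  moreover have "is_poisson (vecsym V) (vecsym W) (\<lambda>z. cor (\<rho> (fst z)) * (\<i> * vecsym X z))"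
    unfolding is_poisson_def
  proof (intro conjI allI impI ballI)
    fix \<alpha> and x \<xi> :: "real^'n" assume x: "\<alpha> \<in> I" "x \<in> cube 2"
    have pv: "pd i (\<lambda>y. push M B \<alpha> (vecsym Y) y \<xi>) x = \<i> * (\<Sum>j\<in>UNIV. cor (pd i (\<lambda>y. f \<alpha> y $ j) x) * cor (\<xi> $ j))"
      if Y: "vrep Y f" for Y f i
    proof -
      have df: "(\<lambda>y. f \<alpha> y $ j) differentiable (at x)" for j
        by (rule c_fam_differentiable[of True I "\<lambda>_. cube 2"]) (use Y x in \<open>auto simp: vrep_def\<close>)
      have dfc: "(\<lambda>y. cor (f \<alpha> y $ j)) differentiable (at x)" for j by (rule differentiable_cor[OF df])
      have d1: "(\<lambda>y. cor (f \<alpha> y $ j) * cor (\<xi> $ j)) differentiable (at x)" for j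
        by (rule differentiable_mult[OF dfc differentiable_const])
      have d2: "(\<lambda>y. \<Sum>j\<in>UNIV. cor (f \<alpha> y $ j) * cor (\<xi> $ j)) differentiable (at x)"
        by (rule differentiable_sum) (use d1 in auto)
      have "pd i (\<lambda>y. push M B \<alpha> (vecsym Y) y \<xi>) x = pd i (\<lambda>y. \<i> * (\<Sum>j\<in>UNIV. cor (f \<alpha> y $ j) * cor (\<xi> $ j))) x"
        by (rule pd_local_cong[OF open_cube x(2)]) (rule push_vecsym[OF Y x(1)])
      also have "\<dots> = \<i> * pd i (\<lambda>y. \<Sum>j\<in>UNIV. cor (f \<alpha> y $ j) * cor (\<xi> $ j)) x"
        by (simp add: pd_mult[OF differentiable_const d2])
      also have "pd i (\<lambda>y. \<Sum>j\<in>UNIV. cor (f \<alpha> y $ j) * cor (\<xi> $ j)) x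
          = (\<Sum>j\<in>UNIV. cor (pd i (\<lambda>y. f \<alpha> y $ j) x) * cor (\<xi> $ j))"
        by (subst pd_sum[OF d1]) (simp add: pd_mult[OF dfc differentiable_const] pd_of_real[OF df])
      finally show ?thesis .
    qed
    have "push M B \<alpha> (\<lambda>z. cor (\<rho> (fst z)) * (\<i> * vecsym X z)) x \<xi> = cor (\<rho> (\<psi> \<alpha> x)) * (\<i> * push M B \<alpha> (vecsym X) x \<xi>)"
      by (simp add: push_def)
    also have "\<dots> = \<i> * (\<i> * (\<Sum>j\<in>UNIV. cor (\<rho> (\<psi> \<alpha> x) * k j \<alpha> x) * cor (\<xi> $ j)))"
      unfolding push_vecsym[OF vX x] by (simp add: sum_distrib_left xx_def mult_ac)
    also have "(\<Sum>j\<in>UNIV. cor (\<rho> (\<psi> \<alpha> x) * k j \<alpha> x) * cor (\<xi> $ j))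
       = (\<Sum>j\<in>UNIV. \<Sum>i\<in>UNIV. cor (v \<alpha> x $ i * scl B \<alpha> $ i * pd i (\<lambda>y. w \<alpha> y $ j) x - w \<alpha> x $ i * scl B \<alpha> $ i * pd i (\<lambda>y. v \<alpha> y $ j) x) * cor (\<xi> $ j))"
      unfolding rk of_real_sum sum_distrib_right ..
    also have "\<dots> = (\<Sum>i\<in>UNIV. \<Sum>j\<in>UNIV. cor (v \<alpha> x $ i * scl B \<alpha> $ i * pd i (\<lambda>y. w \<alpha> y $ j) x - w \<alpha> x $ i * scl B \<alpha> $ i * pd i (\<lambda>y. v \<alpha> y $ j) x) * cor (\<xi> $ j))"
      by (rule sum.swap)
    also have "\<i> * (\<i> * \<dots>) = local_poisson (scl B \<alpha>) (push M B \<alpha> (vecsym V)) (push M B \<alpha> (vecsym W)) x \<xi>"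
      unfolding local_poisson_def pd_push_vecsym[OF v x] pd_push_vecsym[OF w x] pv[OF v] pv[OF w] sum_distrib_left
      by (intro sum.cong refl) (simp add: sum_distrib_left sum_distrib_right sum_subtractf[symmetric] algebra_simps)
    finally show "push M B \<alpha> (\<lambda>z. cor (\<rho> (fst z)) * (\<i> * vecsym X z)) x \<xi> = local_poisson (scl B \<alpha>) (push M B \<alpha> (vecsym V)) (push M B \<alpha> (vecsym W)) x \<xi>" .
  qed simp
  ultimately show ?thesis unfolding bracket_def by blast
qed

text \<open>\<open>bracket_gen\<close> reduces the first argument only. It is used once for each
  kind of letter in the second place and, after exchanging the arguments by antisymmetry, once more
  for \<open>Q\<close>.\<close>

lemma bracket_all:
  assumes P: "gn w m P a" and Q: "gn v k Q b"
  shows "bracket w P a v Q b (m + k - 1)"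
proof -
  have 1: "bracket y R c w' (mulop w' e) (mulsym w' e) (l - 1)" if "weight M B w'" "e \<in> C_uni M B" "gn y l R c" for y l R c w' e
    using bracket_gen[OF gen_mulop[OF that(1,2)] bracket_mul_mul[OF _ _ that(1,2)] bracket_vec_mul[OF _ that(1,2)] that(3)] by simp
  have 2: "bracket y R c (\<lambda>q. 1) (vecop V) (vecsym V) l" if V: "V \<in> op_lie_algebra M B" and R: "gn y l R c" for y l R c V
    using bracket_gen[OF gen_vecop[OF V] _ bracket_vec_vec[OF _ V] R] bracket_antisym[OF bracket_vec_mul[OF V]] by simp
  show ?thesis
    by (rule bracket_gen[OF Q bracket_antisym[OF 1[OF _ _ Q]] bracket_antisym[OF 2[OF _ Q]] P])
qed

text \<open>The representatives differ from the generated symbols by \<open>d1\<close> and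
  \<open>d2\<close>, which are symbols of lower operators. Bilinearity gives
  \<open>{p1, p2} = {a1, a2} + {d1, a2} + {p1, d2}\<close>, and the last two brackets carry one more
  factor \<open>\<rho>\<close> and one order less.\<close>

lemma commutator_symbol:
  assumes P1: "gn w1 m1 P1 a1" and P2: "gn w2 m2 P2 a2"
    and p1: "p1 \<in> symbol_class M B \<rho> w1 m1 a1" and p2: "p2 \<in> symbol_class M B \<rho> w2 m2 a2"
  shows "i_commutator P1 P2 \<in> wDiff M B (\<lambda>q. w1 q * w2 q * \<rho> q) (m1 + m2 - 1)"
    and "poisson M B p1 p2 \<in> wpoly_symbols M B (\<lambda>q. w1 q * w2 q * \<rho> q) (m1 + m2 - 1)"
    and "weighted_principal_symbol M B \<kappa> \<rho> (\<lambda>q. w1 q * w2 q * \<rho> q) (m1 + m2 - 1) (i_commutator P1 P2)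
      = symbol_class M B \<rho> (\<lambda>q. w1 q * w2 q * \<rho> q) (m1 + m2 - 1) (poisson M B p1 p2)"
proof -
  let ?w = "\<lambda>q. w1 q * w2 q * \<rho> q" and ?k = "m1 + m2 - 1"
  have w: "weight M B ?w" by (rule weight_mult_rho[OF weight_mult[OF gen_weight[OF P1] gen_weight[OF P2]]])
  have wr: "weight M B (\<lambda>q. ?w q * \<rho> q)" by (rule weight_mult_rho[OF w])
  obtain d1 where d1: "d1 \<in> wpoly_symbols M B (\<lambda>q. w1 q * \<rho> q) (m1 - 1)" "p1 = d1 + a1" using p1 unfolding symbol_class_eq by blast
  obtain d2 where d2: "d2 \<in> wpoly_symbols M B (\<lambda>q. w2 q * \<rho> q) (m2 - 1)" "p2 = d2 + a2" using p2 unfolding symbol_class_eq by blast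
  obtain D1 where D1: "gn (\<lambda>q. w1 q * \<rho> q) (m1 - 1) D1 d1" using d1(1) wpoly_iff[OF weight_mult_rho[OF gen_weight[OF P1]]] by blast
  obtain D2 where D2: "gn (\<lambda>q. w2 q * \<rho> q) (m2 - 1) D2 d2" using d2(1) wpoly_iff[OF weight_mult_rho[OF gen_weight[OF P2]]] by blast
  have G1: "gn w1 m1 (\<lambda>u q. D1 u q + P1 u q) p1" using gen.add[OF gen_lower[OF D1] P1] by (simp add: d1(2) plus_fun_def)
  obtain c0 where c0: "is_poisson a1 a2 c0" "gn ?w ?k (i_commutator P1 P2) c0"
    using bracket_all[OF P1 P2] unfolding bracket_def by blast
  obtain c1 where c1: "is_poisson d1 a2 c1" "gn (\<lambda>q. w1 q * \<rho> q * w2 q * \<rho> q) (m1 - 1 + m2 - 1) (i_commutator D1 P2) c1"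
    using bracket_all[OF D1 P2] unfolding bracket_def by blast
  obtain c2 where c2: "is_poisson p1 d2 c2" "gn (\<lambda>q. w1 q * (w2 q * \<rho> q) * \<rho> q) (m1 + (m2 - 1) - 1) (i_commutator (\<lambda>u q. D1 u q + P1 u q) D2) c2"
    using bracket_all[OF G1 D2] unfolding bracket_def by blast
  have "is_poisson p1 a2 (\<lambda>z. c1 z + c0 z)"
    using is_poisson_add[OF gen_dsym[OF D1] gen_dsym[OF P1] c1(1) c0(1)] by (simp add: d1(2) plus_fun_def)
  from is_poisson_antisym[OF is_poisson_add[OF gen_dsym[OF D2] gen_dsym[OF P2] is_poisson_antisym[OF c2(1)] is_poisson_antisym[OF this]]]
  have "is_poisson p1 (\<lambda>z. d2 z + a2 z) (\<lambda>z. - 1 * (- 1 * c2 z + - 1 * (c1 z + c0 z)))" .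
  moreover have "(\<lambda>z. - 1 * (- 1 * c2 z + - 1 * (c1 z + c0 z))) = (c2 + c1) + c0" by (simp add: fun_eq_iff)
  moreover have "(\<lambda>z. d2 z + a2 z) = p2" by (simp add: d2(2) fun_eq_iff)
  ultimately have "is_poisson p1 p2 ((c2 + c1) + c0)" by (simp only:)
  then have pc: "poisson M B p1 p2 = (c2 + c1) + c0" by (rule is_poisson_unique)
  have "gn (\<lambda>q. ?w q * \<rho> q) (?k - 1) (i_commutator D1 P2) c1" by (rule gen_cong[OF c1(2)]) (simp_all add: mult_ac)
  moreover have "gn (\<lambda>q. ?w q * \<rho> q) (?k - 1) (i_commutator (\<lambda>u q. D1 u q + P1 u q) D2) c2" by (rule gen_cong[OF c2(2)]) (simp_all add: mult_ac)
  ultimately have c12: "c2 + c1 \<in> wpoly_symbols M B (\<lambda>q. ?w q * \<rho> q) (?k - 1)"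
    using wpoly_iff[OF wr] wpoly_group(2)[OF wr] by blast
  show "i_commutator P1 P2 \<in> wDiff M B ?w ?k" using c0(2) wDiff_iff[OF w] by blast
  show "poisson M B p1 p2 \<in> wpoly_symbols M B ?w ?k"
    unfolding pc by (rule wpoly_group(2)[OF w]) (use c12 wpoly_lower(1)[OF w] c0(2) wpoly_iff[OF w] in blast)+
  show "weighted_principal_symbol M B \<kappa> \<rho> ?w ?k (i_commutator P1 P2) = symbol_class M B \<rho> ?w ?k (poisson M B p1 p2)"
    unfolding principal_symbol_eq[OF c0(2)] pc symbol_class_shift[OF w c12] ..
qed

end

section \<open>Compatible structures\<close>

lemma pd_change:
  fixes f :: "'a::t2_space => 'b::real_normed_vector"
  assumes B: "scaled_bg M B" and B': "scaled_bg M B'"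
    and ab: "\<alpha> \<in> indices B" "\<beta> \<in> indices B'" and q: "q \<in> nbhd B \<alpha>" "q \<in> nbhd B' \<beta>"
    and f: "(f \<circ> param B' \<beta>) differentiable (at (coord B' \<beta> q))"
  shows "pd i (f \<circ> param B \<alpha>) (coord B \<alpha> q) =
    (\<Sum>j\<in>UNIV. pd i (\<lambda>z. (coord B' \<beta> \<circ> param B \<alpha>) z $ j) (coord B \<alpha> q) *\<^sub>R pd j (f \<circ> param B' \<beta>) (coord B' \<beta> q))"
  using scaled_bg.pd_chart_change[OF B scaled_bg.diffeo[OF B ab(1)] scaled_bg.diffeo[OF B' ab(2)]
    scaled_bg.open_U[OF B ab(1)] scaled_bg.open_U[OF B' ab(2)] open_cube q, of f i] f
  unfolding param_def by blast

context scaled_bg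
begin

lemma inner_subset: "inner B \<alpha> \<subseteq> U \<alpha>"
  by (auto simp: inner_def)

lemma open_inner:
  assumes "\<alpha> \<in> I"
  shows "open (inner B \<alpha>)"
proof -
  have c: "cube (3/2) \<subseteq> (cube 2 :: (real^'n) set)" by (rule cube_mono) simp
  have "inner B \<alpha> = \<psi> \<alpha> ` cube (3/2)" by (simp add: inner_def param_image[OF assms c])
  then show ?thesis using open_param_image[OF assms open_cube c] by simp
qed

lemma in_inner:
  obtains \<alpha> where "\<alpha> \<in> I" "q \<in> inner B \<alpha>"
proof -
  obtain \<alpha> where "\<alpha> \<in> I" "q \<in> U \<alpha>" "\<phi> \<alpha> q \<in> cube 1" by (rule covered)
  then show ?thesis using that cube_mono[of 1 "3/2"] by (auto simp: inner_def)
qed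

end

lemma compatible_sym: "compatible B B' ==> compatible B' B"
  unfolding compatible_def by (simp add: Int_commute)

locale compatible_bg = L: scaled_bg M B + R: scaled_bg M B'
  for M :: "('a::t2_space, 'n::finite) atlas" and B :: "('i, 'a, 'n) scaled_bg_data"
    and B' :: "('j, 'a, 'n) scaled_bg_data" +
  assumes compat: "compatible B B'"
begin

lemma sym: "compatible_bg M B' B"
  by (intro compatible_bg.intro compatible_bg_axioms.intro L.scaled_bg_axioms R.scaled_bg_axioms compatible_sym[OF compat])

definition iov :: "'j \<times> 'i => (real^'n) set" where
  "iov k = coord B' (fst k) ` (inner B (snd k) \<inter> inner B' (fst k))"

definition itr :: "'j \<times> 'i => real^'n => real^'n" where
  "itr k = coord B (snd k) \<circ> param B' (fst k)"

lemma open_iov: "k \<in> R.I \<times> L.I ==> open (iov k)"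
proof -
  assume "k \<in> R.I \<times> L.I"
  then have k: "fst k \<in> R.I" "snd k \<in> L.I" by auto
  have "iov k = coord B' (fst k) ` (nbhd B' (fst k) \<inter> (inner B (snd k) \<inter> inner B' (fst k)))"
    using R.inner_subset[of "fst k"] by (auto simp: iov_def)
  then show ?thesis
    using R.open_coord_image[OF k(1) open_Int[OF L.open_inner[OF k(2)] R.open_inner[OF k(1)]]] by simp
qed

lemma smooth_itr:
  assumes "k \<in> R.I \<times> L.I"
  shows "smooth_on (iov k) (itr k)"
proof -
  have k: "fst k \<in> R.I" "snd k \<in> L.I" using assms by auto
  have "smooth_on (coord B' (fst k) ` (nbhd B' (fst k) \<inter> nbhd B (snd k))) (itr k)"
    using L.smooth_charts[OF R.diffeo[OF k(1)] L.diffeo[OF k(2)] R.open_U[OF k(1)] L.open_U[OF k(2)] open_cube]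
    by (simp add: itr_def param_def)
  then show ?thesis
    by (rule smooth_on_subset) (use R.inner_subset[of "fst k"] L.inner_subset[of "snd k"] in \<open>auto simp: iov_def\<close>)
qed

lemma c_fam_itr: "c_fam True (R.I \<times> L.I) iov itr"
proof -
  have e: "(\<lambda>(\<beta>, \<alpha>). coord B' \<beta> ` (inner B \<alpha> \<inter> inner B' \<beta>)) = iov" "(\<lambda>(\<beta>, \<alpha>). transition B' B \<beta> \<alpha>) = itr"
    by (auto simp: fun_eq_iff iov_def itr_def transition_def)
  have "unif_bounded_derivs (R.I \<times> L.I) iov itr"
    using compat unfolding compatible_def e by simp
  then show ?thesis by (subst c_fam_True) (auto intro: open_iov smooth_itr)
qed

lemma c_fam_itr_scale:
  "c_fam True (R.I \<times> L.I) iov (\<lambda>k y. scl B' (fst k) $ i * pd i (\<lambda>z. itr k z $ j) y / scl B (snd k) $ j)"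
proof (rule c_fam_quotient[OF open_iov])
  show "c_fam True (R.I \<times> L.I) iov (\<lambda>k y. scl B' (fst k) $ i * pd i (\<lambda>z. itr k z $ j) y)"
    by (intro c_fam_mult open_iov c_fam_pd c_fam_component c_fam_itr c_fam_const)
      (auto intro!: exI[of _ 1] simp: less_imp_le R.scl_pos R.scl_le_1)
  show "0 < scl B (snd k) $ j" if "k \<in> R.I \<times> L.I" for k using that L.scl_pos by auto
  fix \<gamma> :: "'n => nat"
  have "scale_bounds B' B (\<lambda>\<beta> \<alpha>. inner B \<alpha> \<inter> inner B' \<beta>)" using compat by (simp add: compatible_def)
  then obtain C where C: "\<forall>\<beta>\<in>R.I. \<forall>\<alpha>\<in>L.I. \<forall>x\<in>coord B' \<beta> ` (inner B \<alpha> \<inter> inner B' \<beta>). \<forall>i j.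
      \<bar>mpd \<gamma> (\<lambda>y. scl B' \<beta> $ i * pd i (\<lambda>z. transition B' B \<beta> \<alpha> z $ j) y) x\<bar> \<le> C * scl B \<alpha> $ j"
    unfolding scale_bounds_def by blast
  show "\<exists>C. \<forall>k\<in>R.I \<times> L.I. \<forall>x\<in>iov k. \<bar>mpd \<gamma> (\<lambda>y. scl B' (fst k) $ i * pd i (\<lambda>z. itr k z $ j) y) x\<bar> \<le> C * scl B (snd k) $ j"
  proof (intro exI ballI)
    fix k x assume k: "k \<in> R.I \<times> L.I" and x: "x \<in> iov k"
    have k': "fst k \<in> R.I" "snd k \<in> L.I" using k by auto
    show "\<bar>mpd \<gamma> (\<lambda>y. scl B' (fst k) $ i * pd i (\<lambda>z. itr k z $ j) y) x\<bar> \<le> C * scl B (snd k) $ j"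
      using C[rule_format, OF k' x[unfolded iov_def], of i j] by (simp add: itr_def transition_def)
  qed
qed

text \<open>
  Compatibility controls the transition maps only between the inner charts. A full chart \<open>\<beta>\<close> of
  \<open>B'\<close> is therefore compared with a chart \<open>\<alpha>\<close> of \<open>B\<close> through an intermediate chart \<open>\<beta>\<^sub>0\<close> of \<open>B'\<close>.
\<close>

definition J :: "('j \<times> 'j \<times> 'i) set" where
  "J = R.I \<times> R.I \<times> L.I"

definition E :: "'j \<times> 'j \<times> 'i => (real^'n) set" where
  "E k = coord B' (fst k) ` (nbhd B' (fst k) \<inter> (inner B (snd (snd k)) \<inter> inner B' (fst (snd k))))"

text \<open>The coordinate change from the full chart to the chart of \<open>B\<close>. By
  \<open>E_facts\<close> it is \<open>itr\<close> after \<open>T0\<close>, the former bounded by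
  compatibility and the latter by the structure \<open>B'\<close> itself.\<close>

definition T :: "'j \<times> 'j \<times> 'i => real^'n => real^'n" where
  "T k x = coord B (snd (snd k)) (param B' (fst k) x)"

definition T0 :: "'j \<times> 'j \<times> 'i => real^'n => real^'n" where
  "T0 k = R.trans (fst k, fst (snd k))"

lemma J_D: "k \<in> J ==> fst k \<in> R.I \<and> fst (snd k) \<in> R.I \<and> snd (snd k) \<in> L.I"
  by (auto simp: J_def)

lemma E_iff: "k \<in> J ==> x \<in> E k \<longleftrightarrow> x \<in> cube 2 \<and> param B' (fst k) x \<in> inner B (snd (snd k)) \<and> param B' (fst k) x \<in> inner B' (fst (snd k))"
  using J_D[of k] unfolding E_def by (simp add: R.coord_image)

lemma open_E: "k \<in> J ==> open (E k)"
  using J_D[of k] unfolding E_def by (intro R.open_coord_image open_Int L.open_inner R.open_inner) auto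

lemma E_cover: "\<beta> \<in> R.I ==> x \<in> cube 2 ==> \<exists>j. (\<beta>, j) \<in> J \<and> x \<in> E (\<beta>, j)"
proof -
  assume \<beta>: "\<beta> \<in> R.I" and x: "x \<in> cube 2"
  obtain \<alpha> where \<alpha>: "\<alpha> \<in> L.I" "param B' \<beta> x \<in> inner B \<alpha>" by (rule L.in_inner)
  obtain \<beta>0 where \<beta>0: "\<beta>0 \<in> R.I" "param B' \<beta> x \<in> inner B' \<beta>0" by (rule R.in_inner)
  have "(\<beta>, (\<beta>0, \<alpha>)) \<in> J" using \<alpha> \<beta> \<beta>0 by (simp add: J_def)
  moreover from this have "x \<in> E (\<beta>, (\<beta>0, \<alpha>))" using \<alpha> \<beta>0 x by (simp add: E_iff)
  ultimately show ?thesis by blast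
qed

lemma E_facts:
  assumes k: "k \<in> J" and x: "x \<in> E k"
  shows "T k x \<in> cube 2" "param B (snd (snd k)) (T k x) = param B' (fst k) x"
    "x \<in> R.ov (fst k, fst (snd k))" "T0 k x = coord B' (fst (snd k)) (param B' (fst k) x)"
    "T0 k x \<in> R.ov (fst (snd k), fst k)" "T0 k x \<in> iov (snd k)" "itr (snd k) (T0 k x) = T k x"
    "T k x \<in> coord B (snd (snd k)) ` (inner B' (fst (snd k)) \<inter> inner B (snd (snd k)))"
    "param B' (fst k) x \<in> nbhd B (snd (snd k))" "param B' (fst k) x \<in> nbhd B' (fst (snd k))" "param B' (fst k) x \<in> nbhd B' (fst k)"
    "coord B' (fst k) (param B' (fst k) x) = x" "x \<in> cube 2"
proof -
  define q where "q = param B' (fst k) x"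
  have I: "fst k \<in> R.I" "fst (snd k) \<in> R.I" "snd (snd k) \<in> L.I" using J_D[OF k] by auto
  have x2: "x \<in> cube 2" and q: "q \<in> inner B (snd (snd k))" "q \<in> inner B' (fst (snd k))" using x E_iff[OF k] by (auto simp: q_def)
  have qU: "q \<in> nbhd B (snd (snd k))" "q \<in> nbhd B' (fst (snd k))" using q L.inner_subset R.inner_subset by blast+
  show "T k x \<in> cube 2" "param B (snd (snd k)) (T k x) = param B' (fst k) x"
    using L.coord_in[OF I(3) qU(1)] L.param_coord[OF I(3) qU(1)] by (simp_all add: T_def q_def)
  show ov: "x \<in> R.ov (fst k, fst (snd k))" using x2 qU I by (simp add: R.ov_eq q_def)
  show t0: "T0 k x = coord B' (fst (snd k)) (param B' (fst k) x)" by (simp add: T0_def R.trans_eq)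
  show "T0 k x \<in> R.ov (fst (snd k), fst k)" unfolding T0_def by (rule R.trans_in[OF I(1,2) ov])
  show "T0 k x \<in> iov (snd k)" using q by (auto simp: t0 iov_def q_def)
  show "itr (snd k) (T0 k x) = T k x" using R.param_coord[OF I(2) qU(2)] by (simp add: itr_def t0 T_def q_def)
  show "T k x \<in> coord B (snd (snd k)) ` (inner B' (fst (snd k)) \<inter> inner B (snd (snd k)))" using q by (auto simp: T_def q_def)
  show "param B' (fst k) x \<in> nbhd B (snd (snd k))" "param B' (fst k) x \<in> nbhd B' (fst (snd k))" using qU by (simp_all add: q_def)
  show "param B' (fst k) x \<in> nbhd B' (fst k)" "coord B' (fst k) (param B' (fst k) x) = x" "x \<in> cube 2"
    using R.param_in[OF I(1) x2] R.coord_param[OF I(1) x2] x2 by simp_all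
qed

lemma c_fam_T0: "c_fam True J E T0"
  unfolding T0_def
proof (rule c_fam_reindex[where s = "\<lambda>k. (fst k, fst (snd k))" and J = "R.I \<times> R.I" and E = R.ov and F = R.trans])
  show "(fst k, fst (snd k)) \<in> R.I \<times> R.I" if "k \<in> J" for k using J_D[OF that] by simp
qed (rule E_facts(3) R.c_fam_trans; assumption?)+

lemma c_fam_T: "c_fam True J E T"
proof (rule c_fam_cong[OF open_E])
  show "c_fam True J E (\<lambda>k x. itr (snd k) (T0 k x))"
  proof (rule c_fam_compose[where s = snd and E = iov and J = "R.I \<times> L.I" and G = T0 and F = itr])
    show "snd k \<in> R.I \<times> L.I" if "k \<in> J" for k using that by (auto simp: J_def)
  qed (rule open_E E_facts(6) c_fam_T0 c_fam_itr; assumption?)+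
  show "itr (snd k) (T0 k x) = T k x" if "k \<in> J" "x \<in> E k" for k x by (rule E_facts(7)[OF that])
qed

lemma c_fam_compose_T:
  assumes "c_fam True L.I (\<lambda>_. cube 2) F"
  shows "c_fam True J E (\<lambda>k x. F (snd (snd k)) (T k x))"
proof (rule c_fam_compose[where s = "\<lambda>k. snd (snd k)" and E = "\<lambda>_. cube 2" and J = L.I and G = T])
  show "snd (snd k) \<in> L.I" if "k \<in> J" for k using J_D[OF that] by simp
qed (rule open_E E_facts(1) c_fam_T assms; assumption?)+

lemma c_fam_from_E:
  fixes F :: "'j => real^'n => 'b::real_normed_vector"
  assumes "\<And>k x. k \<in> J ==> x \<in> E k ==> G k x = F (fst k) x" "c_fam True J E G"
  shows "c_fam True R.I (\<lambda>_. cube 2) F"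
proof (rule c_fam_cover[OF E_cover])
  show "c_fam True J E (\<lambda>(\<beta>, j). F \<beta>)"
    by (rule c_fam_cong[OF open_E _ assms(2)]) (use assms(1) in \<open>auto simp: case_prod_beta\<close>)
qed

lemma C_uni_transfer:
  fixes f :: "'a => 'b::euclidean_space"
  assumes "f \<in> C_uni M B"
  shows "f \<in> C_uni M B'"
  unfolding R.C_uni_iff
proof (rule c_fam_from_E)
  have f: "c_fam True L.I (\<lambda>_. cube 2) (\<lambda>\<alpha> x. f (param B \<alpha> x))" using assms by (simp add: L.C_uni_iff)
  show "c_fam True J E (\<lambda>k x. f (param B (snd (snd k)) (T k x)))"
    by (rule c_fam_compose_T[OF f])
  show "f (param B (snd (snd k)) (T k x)) = f (param B' (fst k) x)" if "k \<in> J" "x \<in> E k" for k x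
    using E_facts(2)[OF that] by simp
qed

text \<open>The gradient of \<open>log w\<close> transforms by the Jacobian of \<open>T\<close>,
  which is uniform.\<close>

lemma weight_transfer:
  assumes c: "scaled_bg_cutoff M B \<kappa>" "scaled_bg_cutoff M B' \<kappa>" and w: "weight M B w"
  shows "weight M B' w"
proof -
  have w': "\<And>q. 0 < w q" "smooth_fun M w" "\<And>i. c_fam True L.I (\<lambda>_. cube 2) (L.logd w i)"
    using w scaled_bg_cutoff.weight_iff[OF c(1)] by auto
  have "c_fam True R.I (\<lambda>_. cube 2) (R.logd w i)" for i
  proof (rule c_fam_from_E)
    show "c_fam True J E (\<lambda>k x. \<Sum>j\<in>UNIV. pd i (\<lambda>z. T k z $ j) x * L.logd w j (snd (snd k)) (T k x))"
    proof (intro c_fam_sum[OF open_E] c_fam_mult[OF open_E] c_fam_pd[OF open_E] c_fam_component[OF open_E] c_fam_T)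
      show "c_fam True J E (\<lambda>k x. L.logd w j (snd (snd k)) (T k x))" for j
        by (rule c_fam_compose_T[OF w'(3)])
    qed
    fix k x assume k: "k \<in> J" and x: "x \<in> E k"
    note e = E_facts[OF k x]
    have I: "fst k \<in> R.I" "snd (snd k) \<in> L.I" using J_D[OF k] by auto
    have t: "coord B (snd (snd k)) (param B' (fst k) x) = T k x" by (simp add: T_def)
    have "(w \<circ> param B (snd (snd k))) differentiable (at (T k x))"
      by (rule smooth_on_differentiable[OF L.smooth_chart[OF w'(2) I(2)] e(1)])
    from pd_change[OF R.scaled_bg_axioms L.scaled_bg_axioms I e(11) e(9), of w i, unfolded t e(12), OF this]
    have "pd i (\<lambda>y. w (param B' (fst k) y)) x = (\<Sum>j\<in>UNIV. pd i (\<lambda>z. T k z $ j) x * pd j (\<lambda>y. w (param B (snd (snd k)) y)) (T k x))"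
      by (simp add: T_def o_def)
    then show "(\<Sum>j\<in>UNIV. pd i (\<lambda>z. T k z $ j) x * L.logd w j (snd (snd k)) (T k x)) = R.logd w i (fst k) x"
      by (simp add: L.logd_def R.logd_def e(2) sum_divide_distrib)
  qed
  then show ?thesis using w'(1,2) scaled_bg_cutoff.weight_iff[OF c(2)] by blast
qed

lemma vector_field_transfer:
  assumes c: "cutoff (\<kappa> :: real^'n => real)" and V: "V \<in> op_lie_algebra M B"
  shows "V \<in> op_lie_algebra M B'"
proof -
  interpret S: compatible_bg M B' B by (rule sym)
  obtain v where v: "L.vrep V v" using V L.op_lie_iff by blast
  define s1 where "s1 = (\<lambda>i l k y. scl B (fst k) $ i * pd i (\<lambda>z. S.itr k z $ l) y / scl B' (snd k) $ l)"
  define s2 where "s2 = (\<lambda>l j k y. scl B' (fst k) $ l * pd l (\<lambda>z. R.trans k z $ j) y / scl B' (snd k) $ j)"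
  \<comment> \<open>Components of \<open>V\<close> in the full chart of \<open>B'\<close>, obtained
    from those in \<open>B\<close> by two scaled Jacobians through the intermediate chart:
    \<open>s1\<close> is controlled by compatibility, \<open>s2\<close> by the scale condition of
    \<open>B'\<close>.\<close>
  define F where "F = (\<lambda>j k x. \<Sum>i\<in>UNIV. v (snd (snd k)) (T k x) $ i *
      (\<Sum>l\<in>UNIV. s1 i l (snd (snd k), fst (snd k)) (T k x) * s2 l j (fst (snd k), fst k) (T0 k x)))"
  have F: "c_fam True J E (F j)" for j
    unfolding F_def
  proof (intro c_fam_sum[OF open_E] c_fam_mult[OF open_E])
    show "c_fam True J E (\<lambda>k x. v (snd (snd k)) (T k x) $ i)" for i
    proof (rule c_fam_compose_T[where F = "\<lambda>\<alpha> x. v \<alpha> x $ i"])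
      show "c_fam True L.I (\<lambda>_. cube 2) (\<lambda>\<alpha> x. v \<alpha> x $ i)" using v unfolding L.vrep_def by blast
    qed
    show "c_fam True J E (\<lambda>k x. s1 i l (snd (snd k), fst (snd k)) (T k x))" for i l
    proof (rule c_fam_compose[where s = "\<lambda>k. (snd (snd k), fst (snd k))" and E = S.iov and J = "L.I \<times> R.I" and G = T and F = "s1 i l"])
      show "c_fam True (L.I \<times> R.I) S.iov (s1 i l)" unfolding s1_def by (rule S.c_fam_itr_scale)
      show "T k x \<in> S.iov (snd (snd k), fst (snd k))" if "k \<in> J" "x \<in> E k" for k x
        using E_facts(8)[OF that] by (simp add: S.iov_def)
      show "(snd (snd k), fst (snd k)) \<in> L.I \<times> R.I" if "k \<in> J" for k using J_D[OF that] by simp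
    qed (rule open_E c_fam_T; assumption?)+
    show "c_fam True J E (\<lambda>k x. s2 l j (fst (snd k), fst k) (T0 k x))" for l
    proof (rule c_fam_compose[where s = "\<lambda>k. (fst (snd k), fst k)" and E = R.ov and J = "R.I \<times> R.I" and G = T0 and F = "s2 l j"])
      show "c_fam True (R.I \<times> R.I) R.ov (s2 l j)" unfolding s2_def by (rule R.c_fam_scale)
      show "(fst (snd k), fst k) \<in> R.I \<times> R.I" if "k \<in> J" for k using J_D[OF that] by simp
    qed (rule open_E E_facts(5) c_fam_T0; assumption?)+
  qed
  have VF: "V u (param B' (fst k) x) = (\<Sum>j\<in>UNIV. cor (F j k x * scl B' (fst k) $ j) * pd j (u \<circ> param B' (fst k)) x)"
    if k: "k \<in> J" and x: "x \<in> E k" and u: "smooth_fun M u" for k x and u :: "'a => complex"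
  proof -
    note e = E_facts[OF k x]
    have I: "fst k \<in> R.I" "fst (snd k) \<in> R.I" "snd (snd k) \<in> L.I" using J_D[OF k] by auto
    define P where "P = (\<lambda>i l. pd i (\<lambda>z. S.itr (snd (snd k), fst (snd k)) z $ l) (T k x))"
    define Q where "Q = (\<lambda>l j. pd l (\<lambda>z. R.trans (fst (snd k), fst k) z $ j) (T0 k x))"
    define p where "p = (\<lambda>j. pd j (u \<circ> param B' (fst k)) x)"
    have t: "coord B (snd (snd k)) (param B' (fst k) x) = T k x" by (simp add: T_def)
    have T02: "T0 k x \<in> cube 2" using e(5) I by (simp add: R.ov_eq)
    have d0: "(u \<circ> param B' (fst (snd k))) differentiable (at (T0 k x))"
      by (rule smooth_on_differentiable[OF R.smooth_chart[OF u I(2)] T02])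
    have dx: "(u \<circ> param B' (fst k)) differentiable (at x)"
      by (rule smooth_on_differentiable[OF R.smooth_chart[OF u I(1)] e(13)])
    have 1: "pd i (u \<circ> param B (snd (snd k))) (T k x) = (\<Sum>l\<in>UNIV. P i l *\<^sub>R pd l (u \<circ> param B' (fst (snd k))) (T0 k x))" for i
      using pd_change[OF L.scaled_bg_axioms R.scaled_bg_axioms I(3,2) e(9,10), of u i, unfolded t e(4)[symmetric], OF d0]
      by (simp add: P_def S.itr_def)
    have 2: "pd l (u \<circ> param B' (fst (snd k))) (T0 k x) = (\<Sum>j\<in>UNIV. Q l j *\<^sub>R p j)" for l
      using pd_change[OF R.scaled_bg_axioms R.scaled_bg_axioms I(2,1) e(10,11), of u l, unfolded e(12) e(4)[symmetric], OF dx]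
      by (simp add: Q_def p_def R.trans_def transition_def)
    have Fs: "F j k x * scl B' (fst k) $ j = (\<Sum>i\<in>UNIV. \<Sum>l\<in>UNIV. v (snd (snd k)) (T k x) $ i * scl B (snd (snd k)) $ i * P i l * Q l j)" for j
      unfolding F_def sum_distrib_left sum_distrib_right
      by (intro sum.cong refl)
        (use R.scl_pos[OF I(1), of j] R.scl_pos[OF I(2)] in \<open>simp add: s1_def s2_def P_def Q_def field_simps less_imp_neq[THEN not_sym] order_less_imp_not_eq2\<close>)
    have "V u (param B' (fst k) x) = V u (param B (snd (snd k)) (T k x))" by (simp add: e(2))
    also have "\<dots> = (\<Sum>i\<in>UNIV. cor (v (snd (snd k)) (T k x) $ i * scl B (snd (snd k)) $ i) * pd i (u \<circ> param B (snd (snd k))) (T k x))"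
      using v u e(1) I(3) unfolding L.vrep_def by blast
    also have "\<dots> = (\<Sum>i\<in>UNIV. \<Sum>l\<in>UNIV. \<Sum>j\<in>UNIV. cor (v (snd (snd k)) (T k x) $ i * scl B (snd (snd k)) $ i * P i l * Q l j) * p j)"
      unfolding 1 2 by (simp add: sum_distrib_left scaleR_conv_of_real scaleR_sum_right mult.assoc)
    also have "\<dots> = (\<Sum>i\<in>UNIV. \<Sum>j\<in>UNIV. \<Sum>l\<in>UNIV. cor (v (snd (snd k)) (T k x) $ i * scl B (snd (snd k)) $ i * P i l * Q l j) * p j)"
      by (rule sum.cong[OF refl], rule sum.swap)
    also have "\<dots> = (\<Sum>j\<in>UNIV. \<Sum>i\<in>UNIV. \<Sum>l\<in>UNIV. cor (v (snd (snd k)) (T k x) $ i * scl B (snd (snd k)) $ i * P i l * Q l j) * p j)"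
      by (rule sum.swap)
    also have "\<dots> = (\<Sum>j\<in>UNIV. cor (F j k x * scl B' (fst k) $ j) * p j)"
      unfolding Fs of_real_sum sum_distrib_right ..
    finally show ?thesis unfolding p_def .
  qed
  \<comment> \<open>The components \<open>F\<close> are attached to triples of charts. Evaluating
    \<open>V\<close> on functions whose gradient at the point is a unit vector shows that they
    depend only on the full chart and the point, so they define \<open>v'\<close>.\<close>
  have "\<exists>g. smooth_fun M g \<and> (\<beta> \<in> R.I \<longrightarrow> x \<in> cube 2 \<longrightarrow> (\<forall>m. pd m (g \<circ> param B' \<beta>) x = (if m = j then 1 else 0 :: complex)))" for \<beta> x j
  proof (cases "\<beta> \<in> R.I \<and> x \<in> cube 2")
    case True
    have sm: "smooth_on UNIV (\<lambda>y :: real^'n. cor (y $ j))"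
    proof -
      have "c_fam False {()} (\<lambda>_. UNIV) (\<lambda>_ y :: real^'n. cor (y $ j))"
        by (intro c_fam_of_real c_fam_component c_fam_id) auto
      then show ?thesis by (simp add: c_fam_single)
    qed
    obtain g :: "'a => complex" and N where g: "smooth_fun M g" "open N" "x \<in> N" "N \<subseteq> cube 2" "\<And>y. y \<in> N ==> g (param B' \<beta> y) = cor (y $ j)"
      using R.test_function[OF c _ _ sm, of \<beta> x] True by blast
    have dj: "(\<lambda>y :: real^'n. y $ j) differentiable (at x)"
      by (rule differentiableI[OF bounded_linear_imp_has_derivative[OF bounded_linear_vec_nth]])
    have "pd m (g \<circ> param B' \<beta>) x = (if m = j then 1 else 0)" for m
    proof -
      have "pd m (g \<circ> param B' \<beta>) x = pd m (\<lambda>y. cor (y $ j)) x"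
        by (rule pd_local_cong[OF g(2,3)]) (simp add: g(5))
      then show ?thesis by (simp add: pd_of_real[OF dj] pd_component)
    qed
    then show ?thesis using g(1) by blast
  qed (use R.smooth_fun_const in blast)
  then obtain g where g: "\<And>\<beta> x j. smooth_fun M (g \<beta> x j)"
    "\<And>\<beta> x j m. \<beta> \<in> R.I ==> x \<in> cube 2 ==> pd m (g \<beta> x j \<circ> param B' \<beta>) x = (if m = j then 1 else 0 :: complex)"
    by metis
  define v' where "v' = (\<lambda>\<beta> x. \<chi> j. Re (V (g \<beta> x j) (param B' \<beta> x)) / scl B' \<beta> $ j)"
  have v': "F j k x = v' (fst k) x $ j" if k: "k \<in> J" and x: "x \<in> E k" for k x j
  proof -
    have I: "fst k \<in> R.I" using J_D[OF k] by auto
    have "V (g (fst k) x j) (param B' (fst k) x) = (\<Sum>m\<in>UNIV. if m = j then cor (F j k x * scl B' (fst k) $ j) else 0)"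
      unfolding VF[OF k x g(1)] g(2)[OF I E_facts(13)[OF k x]] by (rule sum.cong) auto
    then show ?thesis using R.scl_pos[OF I, of j] by (simp add: v'_def)
  qed
  have "R.vrep V v'"
    unfolding R.vrep_def
  proof (intro conjI allI impI ballI)
    show "V u = (\<lambda>q. 0)" if "\<not> smooth_fun M u" for u using v that unfolding L.vrep_def by blast
    show "c_fam True R.I (\<lambda>_. cube 2) (\<lambda>\<beta> x. v' \<beta> x $ j)" for j by (rule c_fam_from_E[OF v' F])
    fix u :: "'a => complex" and \<beta> and x :: "real^'n" assume u: "smooth_fun M u" and \<beta>: "\<beta> \<in> R.I" and x: "x \<in> cube 2"
    obtain j where j: "(\<beta>, j) \<in> J" "x \<in> E (\<beta>, j)" using E_cover[OF \<beta> x] by blast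
    show "V u (param B' \<beta> x) = (\<Sum>i\<in>UNIV. cor (v' \<beta> x $ i * scl B' \<beta> $ i) * pd i (u \<circ> param B' \<beta>) x)"
      using VF[OF j u] v'[OF j] by simp
  qed
  then show ?thesis using R.op_lie_iff by blast
qed

text \<open>Differentiating the i-th coordinate of the chart of \<open>B'\<close> by way of the
  chart of \<open>B\<close> gives the identity that \<open>scale_compare\<close> needs.\<close>

lemma scale_bound:
  "\<exists>D>0. \<forall>\<alpha>\<in>L.I. \<forall>\<beta>\<in>R.I. \<forall>q i. q \<in> inner B \<alpha> \<longrightarrow> q \<in> inner B' \<beta> \<longrightarrow>
    scl B' \<beta> $ i \<le> D * Max (range (\<lambda>i. scl B \<alpha> $ i))"
proof -
  interpret S: compatible_bg M B' B by (rule sym)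
  obtain A where A: "A > 0" "\<And>i j k y. k \<in> R.I \<times> L.I ==> y \<in> iov k ==>
      \<bar>scl B' (fst k) $ i * pd i (\<lambda>z. itr k z $ j) y / scl B (snd k) $ j\<bar> \<le> A"
    using c_fam_bounds[of "R.I \<times> L.I" iov "\<lambda>i j k y. scl B' (fst k) $ i * pd i (\<lambda>z. itr k z $ j) y / scl B (snd k) $ j"]
      c_fam_itr_scale by blast
  have pdS: "c_fam True (L.I \<times> R.I) S.iov (\<lambda>k. pd i (\<lambda>z. S.itr k z $ j))" for i j
    by (intro c_fam_pd c_fam_component S.open_iov S.c_fam_itr)
  obtain A' where A': "A' > 0" "\<And>i j k y. k \<in> L.I \<times> R.I ==> y \<in> S.iov k ==> \<bar>pd i (\<lambda>z. S.itr k z $ j) y\<bar> \<le> A'"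
    using c_fam_bounds[of "L.I \<times> R.I" S.iov "\<lambda>i j k. pd i (\<lambda>z. S.itr k z $ j)"] pdS by blast
  show ?thesis
  proof (intro exI[of _ "real CARD('n) * (A * A')"] conjI ballI allI impI)
    show "real CARD('n) * (A * A') > 0" using A(1) A'(1) by simp
    fix \<alpha> \<beta> q i assume \<alpha>: "\<alpha> \<in> L.I" and \<beta>: "\<beta> \<in> R.I" and q: "q \<in> inner B \<alpha>" "q \<in> inner B' \<beta>"
    have qU: "q \<in> nbhd B \<alpha>" "q \<in> nbhd B' \<beta>" using q L.inner_subset R.inner_subset by blast+
    have k: "(\<beta>, \<alpha>) \<in> R.I \<times> L.I" "(\<alpha>, \<beta>) \<in> L.I \<times> R.I" using \<alpha> \<beta> by auto
    have x: "coord B' \<beta> q \<in> iov (\<beta>, \<alpha>)" "coord B \<alpha> q \<in> S.iov (\<alpha>, \<beta>)" using q by (auto simp: iov_def S.iov_def)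
    have pc: "pd i ((\<lambda>p. coord B' \<beta> p $ i) \<circ> param B' \<beta>) (coord B' \<beta> q) = 1"
    proof -
      have "pd i ((\<lambda>p. coord B' \<beta> p $ i) \<circ> param B' \<beta>) (coord B' \<beta> q) = pd i (\<lambda>z. z $ i) (coord B' \<beta> q)"
        by (rule pd_local_cong[OF open_cube R.coord_in[OF \<beta> qU(2)]]) (simp add: R.coord_param[OF \<beta>])
      then show ?thesis by (simp add: pd_component)
    qed
    have e: "(\<lambda>p. coord B' \<beta> p $ i) \<circ> param B \<alpha> = (\<lambda>z. S.itr (\<alpha>, \<beta>) z $ i)" by (simp add: S.itr_def fun_eq_iff)
    have "(\<lambda>z. S.itr (\<alpha>, \<beta>) z $ i) differentiable (at (coord B \<alpha> q))"
      by (rule c_fam_differentiable[OF c_fam_component[OF S.open_iov S.c_fam_itr] k(2) x(2)])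
    from pd_change[OF R.scaled_bg_axioms L.scaled_bg_axioms \<beta> \<alpha> qU(2,1), of "\<lambda>p. coord B' \<beta> p $ i" i, unfolded e, OF this]
    have J1: "(\<Sum>j\<in>UNIV. pd i (\<lambda>z. itr (\<beta>, \<alpha>) z $ j) (coord B' \<beta> q) * pd j (\<lambda>z. S.itr (\<alpha>, \<beta>) z $ i) (coord B \<alpha> q)) = 1"
      by (simp add: pc itr_def)
    show "scl B' \<beta> $ i \<le> real CARD('n) * (A * A') * Max (range (\<lambda>i. scl B \<alpha> $ i))"
    proof (rule scale_compare[OF J1])
      show "\<bar>scl B' \<beta> $ i * pd i (\<lambda>z. itr (\<beta>, \<alpha>) z $ j) (coord B' \<beta> q)\<bar> \<le> A * scl B \<alpha> $ j" for j
        using A(2)[OF k(1) x(1), of i j] L.scl_pos[OF \<alpha>, of j] by (simp add: abs_mult field_simps)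
      show "\<bar>pd j (\<lambda>z. S.itr (\<alpha>, \<beta>) z $ i) (coord B \<alpha> q)\<bar> \<le> A'" for j by (rule A'(2)[OF k(2) x(2)])
    qed (use A A' in auto)
  qed
qed

text \<open>The maximal scales of the two structures are comparable in both directions, and each
  direction yields one of the two inequalities; \<open>C * (D + D')\<close> serves for both.\<close>

lemma scaling_weight_transfer:
  assumes c: "scaled_bg_cutoff M B \<kappa>" "scaled_bg_cutoff M B' \<kappa>" and \<rho>: "scaling_weight M B \<rho>"
  shows "scaling_weight M B' \<rho>"
proof -
  obtain C where C: "C > 0" "\<And>\<alpha> q. \<alpha> \<in> L.I ==> q \<in> inner B \<alpha> ==>
      Max (range (\<lambda>i. scl B \<alpha> $ i)) / C \<le> \<rho> q \<and> \<rho> q \<le> C * Max (range (\<lambda>i. scl B \<alpha> $ i))"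
    using \<rho> unfolding scaling_weight_def by blast
  obtain D where D: "D > 0" "\<forall>\<alpha>\<in>L.I. \<forall>\<beta>\<in>R.I. \<forall>q i. q \<in> inner B \<alpha> \<longrightarrow> q \<in> inner B' \<beta> \<longrightarrow>
    scl B' \<beta> $ i \<le> D * Max (range (\<lambda>i. scl B \<alpha> $ i))" using scale_bound by (elim exE conjE) (rule that)
  obtain D' where D': "D' > 0" "\<forall>\<beta>\<in>R.I. \<forall>\<alpha>\<in>L.I. \<forall>q i. q \<in> inner B' \<beta> \<longrightarrow> q \<in> inner B \<alpha> \<longrightarrow>
    scl B \<alpha> $ i \<le> D' * Max (range (\<lambda>i. scl B' \<beta> $ i))" using compatible_bg.scale_bound[OF sym] by (elim exE conjE) (rule that)
  define m where "m = (\<lambda>\<alpha>. Max (range (\<lambda>i. scl B \<alpha> $ i)))"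
  define m' where "m' = (\<lambda>\<beta>. Max (range (\<lambda>i. scl B' \<beta> $ i)))"
  have "m' \<beta> / (C * (D + D')) \<le> \<rho> q \<and> \<rho> q \<le> C * (D + D') * m' \<beta>" if \<beta>: "\<beta> \<in> R.I" and q: "q \<in> inner B' \<beta>" for \<beta> q
  proof -
    obtain \<alpha> where \<alpha>: "\<alpha> \<in> L.I" "q \<in> inner B \<alpha>" by (rule L.in_inner)
    have 1: "m' \<beta> \<le> D * m \<alpha>" unfolding m'_def using D(2)[rule_format, OF \<alpha>(1) \<beta> \<alpha>(2) q] by (simp add: m_def Max_le_iff)
    have 2: "m \<alpha> \<le> D' * m' \<beta>" unfolding m_def using D'(2)[rule_format, OF \<beta> \<alpha>(1) q \<alpha>(2)] by (simp add: m'_def Max_le_iff)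
    have 3: "m \<alpha> \<le> C * \<rho> q" "\<rho> q \<le> C * m \<alpha>" using C(2)[OF \<alpha>] C(1) by (simp_all add: m_def field_simps)
    have pos: "0 < \<rho> q" using \<rho> by (simp add: scaling_weight_def weight_def)
    then have mp: "0 < m \<alpha>" using 3(2) C(1) by (meson less_le_trans zero_less_mult_pos)
    have m'p: "0 < m' \<beta>" using 2 mp D'(1) by (meson less_le_trans zero_less_mult_pos)
    have "m' \<beta> \<le> D * (C * \<rho> q)" using 1 mult_left_mono[OF 3(1), of D] D(1) by linarith
    also have "\<dots> \<le> (D + D') * (C * \<rho> q)" using D'(1) C(1) pos by (intro mult_right_mono) auto
    finally have "m' \<beta> \<le> \<rho> q * (C * (D + D'))" by (simp add: mult_ac)
    moreover have "\<rho> q \<le> C * (D' * m' \<beta>)" using 3(2) mult_left_mono[OF 2, of C] C(1) by linarith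
    moreover have "C * (D' * m' \<beta>) \<le> C * ((D + D') * m' \<beta>)" using C(1) D(1) m'p by (intro mult_left_mono mult_right_mono) auto
    ultimately have "m' \<beta> \<le> \<rho> q * (C * (D + D')) \<and> \<rho> q \<le> C * ((D + D') * m' \<beta>)" by (blast intro: order_trans)
    moreover have "0 < C * (D + D')" using C(1) D(1) D'(1) by simp
    ultimately show ?thesis by (simp only: pos_divide_le_eq mult.assoc)
  qed
  moreover have "C * (D + D') > 0" using C(1) D(1) D'(1) by simp
  moreover have "weight M B' \<rho>" by (rule weight_transfer[OF c]) (use \<rho> in \<open>simp add: scaling_weight_def\<close>)
  ultimately show ?thesis unfolding scaling_weight_def m'_def by blast
qed

end

section \<open>Independence of weight, cutoff and structure, and the final assembly\<close>

context scaled_bg_weight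
begin

lemma wpoly_equivalent:
  assumes w: "weight M B w" and w': "weight M B w'"
    and "(\<lambda>q. cor (w q * inverse (w' q))) \<in> C_uni M B" "(\<lambda>q. cor (w' q * inverse (w q))) \<in> C_uni M B"
  shows "wpoly_symbols M B w m = wpoly_symbols M B w' m" "wDiff M B w m = wDiff M B w' m"
proof -
  have eq: "gn w m P a \<longleftrightarrow> gn w' m P a" for P a using gen_equivalent assms by blast
  show "wpoly_symbols M B w m = wpoly_symbols M B w' m" by (simp add: Set.set_eq_iff wpoly_iff[OF w] wpoly_iff[OF w'] eq)
  show "wDiff M B w m = wDiff M B w' m" by (simp add: Set.set_eq_iff wDiff_iff[OF w] wDiff_iff[OF w'] eq)
qed

text \<open>For equivalent weights \<open>gen\<close> contains the same pairs. The same holds after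
  multiplying both by \<open>\<rho>\<close>, since the quotient is unchanged.\<close>

lemma equivalent_weights_symbol:
  assumes w: "weight M B w" and w': "weight M B w'" and eq: "equivalent_weights M B w w'"
  shows "wpoly_symbols M B w' m = wpoly_symbols M B w m"
    and "P \<in> wDiff M B w m ==> P \<in> wDiff M B w' m"
    and "P \<in> wDiff M B w m ==> weighted_principal_symbol M B \<kappa> \<rho> w' m P = weighted_principal_symbol M B \<kappa> \<rho> w m P"
proof -
  have re: "(\<lambda>q. cor (f q)) \<in> C_uni M B" if "f \<in> C_uni M B" for f
    using that unfolding C_uni_iff by (intro c_fam_of_real) auto
  have "(\<lambda>q. w q * inverse (w' q)) \<in> C_uni M B" "(\<lambda>q. w' q * inverse (w q)) \<in> C_uni M B"
    using eq by (simp_all add: equivalent_weights_def divide_inverse)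
  note c = this[THEN re]
  show "wpoly_symbols M B w' m = wpoly_symbols M B w m" by (rule wpoly_equivalent(1)[OF w' w c(2,1)])
  show "P \<in> wDiff M B w' m" if "P \<in> wDiff M B w m" using that wpoly_equivalent(2)[OF w w' c] by simp
  have r: "(w q * \<rho> q) * inverse (w' q * \<rho> q) = w q * inverse (w' q)" "(w' q * \<rho> q) * inverse (w q * \<rho> q) = w' q * inverse (w q)" for q
    using weightD(2)[OF weight_rho, of q] by simp_all
  have wr: "wpoly_symbols M B (\<lambda>q. w' q * \<rho> q) k = wpoly_symbols M B (\<lambda>q. w q * \<rho> q) k" for k
    by (rule wpoly_equivalent(1)[OF weight_mult_rho[OF w'] weight_mult_rho[OF w]]) (use c in \<open>simp_all only: r\<close>)
  show "weighted_principal_symbol M B \<kappa> \<rho> w' m P = weighted_principal_symbol M B \<kappa> \<rho> w m P" if P: "P \<in> wDiff M B w m"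
  proof -
    obtain a where a: "gn w m P a" using P wDiff_iff[OF w] by blast
    show ?thesis
      unfolding principal_symbol_eq[OF a] principal_symbol_eq[OF gen_equivalent[OF a w' c(1)]] symbol_class_eq wr ..
  qed
qed

text \<open>The pair found for \<open>P\<close> does not involve the cutoff, so
  \<open>principal_symbol_eq\<close> applies to it with either one.\<close>

lemma cutoff_independent:
  assumes \<kappa>': "cutoff \<kappa>'" and P: "P \<in> Diff M B m"
  shows "full_symbol M B \<kappa> m P \<in> poly_symbols M B m"
    and "principal_symbol M B \<kappa>' \<rho> m P = principal_symbol M B \<kappa> \<rho> m P"
proof -
  interpret K: scaled_bg_weight M B \<kappa>' \<rho> by unfold_locales (rule \<kappa>', rule scaling)
  obtain a where a: "gn (\<lambda>q. 1) m P a" using Diff_gen[OF P] by blast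
  obtain d where d: "d \<in> wpoly_symbols M B (\<lambda>q. 1 * \<rho> q) (m - 1)" "full_symbol M B \<kappa> m P = d + a" using gen_full_symbol[OF a] by blast
  have "d \<in> wpoly_symbols M B (\<lambda>q. 1) m" using d(1) wpoly_lower(1)[OF weight_1] by blast
  moreover have "a \<in> wpoly_symbols M B (\<lambda>q. 1) m" using a wpoly_iff[OF weight_1] by blast
  ultimately have "d + a \<in> wpoly_symbols M B (\<lambda>q. 1) m" by (rule wpoly_group(2)[OF weight_1])
  then show "full_symbol M B \<kappa> m P \<in> poly_symbols M B m" by (simp add: d(2))
  show "principal_symbol M B \<kappa>' \<rho> m P = principal_symbol M B \<kappa> \<rho> m P"
    using principal_symbol_eq[OF a] K.principal_symbol_eq[OF a] by simp
qed

text \<open>\<open>gen\<close> refers to a structure only through the three sets compared in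
  \<open>sets\<close>. Once these agree, a pair for \<open>B\<close> is a pair for
  \<open>B'\<close>, and \<open>principal_symbol_eq\<close> applies on both sides.\<close>

lemma compatible_symbol:
  fixes B' :: "('j, 'a, 'n) scaled_bg_data"
  assumes B': "scaled_bg_structure M B'" and compat: "compatible B B'"
  shows "scaling_weight M B' \<rho>" "poly_symbols M B' m = poly_symbols M B m"
    and "P \<in> Diff M B m ==> P \<in> Diff M B' m"
    and "P \<in> Diff M B m ==> scaling_weight M B' \<rho>' ==> cutoff \<kappa>' ==>
      principal_symbol M B' \<kappa>' \<rho>' m P = principal_symbol M B \<kappa> \<rho> m P"
proof -
  have cB: "scaled_bg_cutoff M B \<kappa>" by (rule scaled_bg_cutoff_axioms)
  have cB': "scaled_bg_cutoff M B' \<kappa>"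
    by (intro scaled_bg_cutoff.intro scaled_bg.intro scaled_bg_cutoff_axioms.intro atlas B' cutoff)
  interpret R: scaled_bg_cutoff M B' \<kappa> by (rule cB')
  interpret K: compatible_bg M B B' by unfold_locales (rule compat)
  interpret S: compatible_bg M B' B by (rule K.sym)
  show sw: "scaling_weight M B' \<rho>" by (rule K.scaling_weight_transfer[OF cB cB' scaling])
  have sets: "C_uni M B' = (C_uni M B :: ('a => complex) set)" "{w. weight M B' w} = Wt" "op_lie_algebra M B' = op_lie_algebra M B"
  proof -
    show "C_uni M B' = (C_uni M B :: ('a => complex) set)"
      by (intro subset_antisym subsetI) (rule S.C_uni_transfer K.C_uni_transfer; assumption)+
    show "{w. weight M B' w} = Wt"
      by (intro Collect_cong iffI) (rule S.weight_transfer[OF cB' cB] K.weight_transfer[OF cB cB']; assumption)+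
    show "op_lie_algebra M B' = op_lie_algebra M B"
      by (intro subset_antisym subsetI) (rule S.vector_field_transfer[OF cutoff] K.vector_field_transfer[OF cutoff]; assumption)+
  qed
  have poly: "wpoly_symbols M B' w k = wpoly_symbols M B w k" if w: "weight M B w" for w k
  proof -
    interpret R': scaled_bg_weight M B' \<kappa> \<rho> by unfold_locales (rule sw)
    have "a \<in> wpoly_symbols M B' w k \<longleftrightarrow> (\<exists>P. gn w k P a)" for a
      using R'.wpoly_iff[OF K.weight_transfer[OF cB cB' w], of a k] unfolding sets .
    then show ?thesis by (simp add: Set.set_eq_iff wpoly_iff[OF w])
  qed
  show "poly_symbols M B' m = poly_symbols M B m" using poly[OF weight_1] by simp
  show "P \<in> Diff M B' m" if "P \<in> Diff M B m"
  proof -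
    interpret R': scaled_bg_weight M B' \<kappa> \<rho> by unfold_locales (rule sw)
    show ?thesis using R'.wDiff_iff[OF R.weight_1, of P m] Diff_gen[OF that] unfolding sets by simp
  qed
  show "principal_symbol M B' \<kappa>' \<rho>' m P = principal_symbol M B \<kappa> \<rho> m P"
    if P: "P \<in> Diff M B m" and \<rho>': "scaling_weight M B' \<rho>'" and \<kappa>': "cutoff \<kappa>'"
  proof -
    interpret R': scaled_bg_weight M B' \<kappa>' \<rho>' by unfold_locales (rule \<kappa>', rule \<rho>')
    \<comment> \<open>A scaling weight for \<open>B'\<close> is one for \<open>B\<close> too, and
      there any two of them define the same lower order symbols.\<close>
    have sB: "scaling_weight M B \<rho>'" by (rule S.scaling_weight_transfer[OF cB' cB \<rho>'])
    interpret L': scaled_bg_weight M B \<kappa> \<rho>' by unfold_locales (rule sB)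
    obtain a where a: "gn (\<lambda>q. 1) m P a" using Diff_gen[OF P] by blast
    have "principal_symbol M B' \<kappa>' \<rho>' m P = symbol_class M B' \<rho>' (\<lambda>q. 1) m a"
      using R'.principal_symbol_eq[of "\<lambda>q. 1" m P a] a unfolding sets by simp
    also have "\<dots> = symbol_class M B \<rho> (\<lambda>q. 1) m a"
    proof -
      have "wpoly_symbols M B' (\<lambda>q. 1 * \<rho>' q) (m - 1) = wpoly_symbols M B (\<lambda>q. 1 * \<rho>' q) (m - 1)"
        by (rule poly) (use L'.weight_rho in simp)
      also have "\<dots> = wpoly_symbols M B (\<lambda>q. 1 * \<rho> q) (m - 1)"
        using wpoly_equivalent(1)[OF L'.weight_rho weight_rho scaling_quotient[OF sB] L'.scaling_quotient[OF scaling]] by simp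
      finally show ?thesis unfolding symbol_class_eq R'.symbol_class_eq by simp
    qed
    also have "\<dots> = principal_symbol M B \<kappa> \<rho> m P" using principal_symbol_eq[OF a] by simp
    finally show ?thesis .
  qed
qed

lemma commutator_class:
  assumes w: "weight M B w1" "weight M B w2" and P: "P1 \<in> wDiff M B w1 m1" "P2 \<in> wDiff M B w2 m2"
  shows "i_commutator P1 P2 \<in> wDiff M B (\<lambda>q. w1 q * w2 q * \<rho> q) (m1 + m2 - 1)"
    and "p1 \<in> weighted_principal_symbol M B \<kappa> \<rho> w1 m1 P1 ==> p2 \<in> weighted_principal_symbol M B \<kappa> \<rho> w2 m2 P2 ==>
      poisson M B p1 p2 \<in> wpoly_symbols M B (\<lambda>q. w1 q * w2 q * \<rho> q) (m1 + m2 - 1) \<and>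
      weighted_principal_symbol M B \<kappa> \<rho> (\<lambda>q. w1 q * w2 q * \<rho> q) (m1 + m2 - 1) (i_commutator P1 P2)
        = symbol_class M B \<rho> (\<lambda>q. w1 q * w2 q * \<rho> q) (m1 + m2 - 1) (poisson M B p1 p2)"
proof -
  obtain a1 where a1: "gn w1 m1 P1 a1" using P(1) wDiff_iff[OF w(1)] by blast
  obtain a2 where a2: "gn w2 m2 P2 a2" using P(2) wDiff_iff[OF w(2)] by blast
  have "a \<in> symbol_class M B \<rho> w m a" if "weight M B w" for w m a
    unfolding symbol_class_eq using wpoly_group(1)[OF weight_mult_rho[OF that], of "m - 1"] by force
  from commutator_symbol(1)[OF a1 a2 this[OF w(1)] this[OF w(2)]]
  show "i_commutator P1 P2 \<in> wDiff M B (\<lambda>q. w1 q * w2 q * \<rho> q) (m1 + m2 - 1)" .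
  show "poisson M B p1 p2 \<in> wpoly_symbols M B (\<lambda>q. w1 q * w2 q * \<rho> q) (m1 + m2 - 1) \<and>
      weighted_principal_symbol M B \<kappa> \<rho> (\<lambda>q. w1 q * w2 q * \<rho> q) (m1 + m2 - 1) (i_commutator P1 P2)
        = symbol_class M B \<rho> (\<lambda>q. w1 q * w2 q * \<rho> q) (m1 + m2 - 1) (poisson M B p1 p2)"
    if "p1 \<in> weighted_principal_symbol M B \<kappa> \<rho> w1 m1 P1" "p2 \<in> weighted_principal_symbol M B \<kappa> \<rho> w2 m2 P2"
    using that unfolding principal_symbol_eq[OF a1] principal_symbol_eq[OF a2]
    by (intro conjI commutator_symbol(2,3)[OF a1 a2])
qed

lemma short_exact_unweighted:
  "symbol_short_exact (wDiff M B \<rho> (m - 1)) (Diff M B m) (principal_symbol M B \<kappa> \<rho> m)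
    (poly_symbols M B m) (wpoly_symbols M B \<rho> (m - 1))"
proof -
  have "weighted_principal_symbol M B \<kappa> \<rho> (\<lambda>q. 1) m = principal_symbol M B \<kappa> \<rho> m" by (rule ext) simp
  then show ?thesis using short_exact[OF weight_1, of m] by simp
qed

end

theorem theorem3p10:
  fixes M :: "('a::{t2_space, second_countable_topology}, 'n::finite) atlas"
    and B :: "('i, 'a, 'n) scaled_bg_data"
    and \<rho> :: "'a \<Rightarrow> real"
    and \<kappa> :: "real^'n \<Rightarrow> real"
  assumes "smooth_atlas M"
    and "scaled_bg_structure M B"
    and "scaling_weight M B \<rho>"
    and "cutoff \<kappa>"
  shows
    "\<comment> \<open>independence of the cutoff\<close>
     (\<forall>m::nat. \<forall>P\<in>Diff M B (int m).
       full_symbol M B \<kappa> (int m) P \<in> poly_symbols M B (int m) \<and>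
       (\<forall>\<kappa>'. cutoff \<kappa>' \<longrightarrow>
          principal_symbol M B \<kappa>' \<rho> (int m) P = principal_symbol M B \<kappa> \<rho> (int m) P)) \<and>
     \<comment> \<open>independence of the choice of compatible structure\<close>
     (\<forall>B' :: ('j, 'a, 'n) scaled_bg_data. scaled_bg_structure M B' \<and> compatible B B' \<longrightarrow>
       scaling_weight M B' \<rho> \<and>
       (\<forall>m::nat.
          poly_symbols M B' (int m) = poly_symbols M B (int m) \<and>
          (\<forall>P\<in>Diff M B (int m). P \<in> Diff M B' (int m) \<and>
             (\<forall>\<rho>' \<kappa>'. scaling_weight M B' \<rho>' \<and> cutoff \<kappa>' \<longrightarrow>
                principal_symbol M B' \<kappa>' \<rho>' (int m) P = principal_symbol M B \<kappa> \<rho> (int m) P)))) \<and>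
     \<comment> \<open>short exact sequence\<close>
     (\<forall>m::nat. symbol_short_exact
       (wDiff M B \<rho> (int m - 1)) (Diff M B (int m)) (principal_symbol M B \<kappa> \<rho> (int m))
       (poly_symbols M B (int m)) (wpoly_symbols M B \<rho> (int m - 1))) \<and>
     \<comment> \<open>weighted symbol: independence of the representative weight\<close>
     (\<forall>m::nat. \<forall>w w'. weight M B w \<and> weight M B w' \<and> equivalent_weights M B w w' \<longrightarrow>
       wpoly_symbols M B w' (int m) = wpoly_symbols M B w (int m) \<and>
       (\<forall>P\<in>wDiff M B w (int m). P \<in> wDiff M B w' (int m) \<and>
          weighted_principal_symbol M B \<kappa> \<rho> w' (int m) P
            = weighted_principal_symbol M B \<kappa> \<rho> w (int m) P)) \<and>
     \<comment> \<open>weighted short exact sequence\<close>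
     (\<forall>m::nat. \<forall>w. weight M B w \<longrightarrow> symbol_short_exact
       (wDiff M B (\<lambda>q. w q * \<rho> q) (int m - 1)) (wDiff M B w (int m))
       (weighted_principal_symbol M B \<kappa> \<rho> w (int m))
       (wpoly_symbols M B w (int m)) (wpoly_symbols M B (\<lambda>q. w q * \<rho> q) (int m - 1))) \<and>
     \<comment> \<open>commutators; the class of the bracket does not depend on the representatives\<close>
     (\<forall>m1 m2 :: nat. \<forall>w1 w2. weight M B w1 \<and> weight M B w2 \<longrightarrow>
       (\<forall>P1\<in>wDiff M B w1 (int m1). \<forall>P2\<in>wDiff M B w2 (int m2).
          i_commutator P1 P2 \<in> wDiff M B (\<lambda>q. w1 q * w2 q * \<rho> q) (int m1 + int m2 - 1) \<and>
          (\<forall>p1\<in>weighted_principal_symbol M B \<kappa> \<rho> w1 (int m1) P1.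
           \<forall>p2\<in>weighted_principal_symbol M B \<kappa> \<rho> w2 (int m2) P2.
             poisson M B p1 p2
               \<in> wpoly_symbols M B (\<lambda>q. w1 q * w2 q * \<rho> q) (int m1 + int m2 - 1) \<and>
             weighted_principal_symbol M B \<kappa> \<rho> (\<lambda>q. w1 q * w2 q * \<rho> q) (int m1 + int m2 - 1)
                 (i_commutator P1 P2)
               = symbol_class M B \<rho> (\<lambda>q. w1 q * w2 q * \<rho> q) (int m1 + int m2 - 1)
                   (poisson M B p1 p2))))"
proof -
  interpret scaled_bg_weight M B \<kappa> \<rho>
    by (intro scaled_bg_weight.intro scaled_bg_cutoff.intro scaled_bg.intro scaled_bg_cutoff_axioms.intro
      scaled_bg_weight_axioms.intro) (rule assms)+
  show ?thesis
    by (intro conjI allI impI ballI; (elim conjE)?;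
      rule cutoff_independent(1)[OF cutoff] cutoff_independent(2) compatible_symbol short_exact_unweighted
        short_exact equivalent_weights_symbol commutator_class(1) commutator_class(2)[THEN conjunct1]
        commutator_class(2)[THEN conjunct2]; assumption)
qed

end
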